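(* Let $\Gamma$ be a discrete group. Let $B=\bigoplus_{\alpha=1}^c M_{n_\alpha}(\mathbb{C})$ be a finite dimensional C*-algebra with a faithful state $\psi=\bigoplus_{\alpha=1}^c\mathrm{Tr}(Q_\alpha\,\cdot)$ on it. The state $\psi$ restricted to every summand $M_{n_\alpha}(\mathbb{C})$ (and normalized) is a $\delta$-form with $\delta=\mathrm{Tr}(Q_\alpha^{-1})$. Consider the decomposition $B=\bigoplus_{i=1}^d B_i$ where every $B_i$ is the direct sum of all the $M_{n_\alpha}(\mathbb{C})$ such that $\mathrm{Tr}(Q_\alpha^{-1})$ is a constant value denoted $\delta_i$ (the $\delta_i$ being the distinct values of $\mathrm{Tr}(Q_\alpha^{-1})$). Let $\psi_i$ be the state on $B_i$ which is obtained by normalizing $\psi|_{B_i}$. Then $$\widehat{\Gamma}\wr_*\mathbb{G}^{aut}(B,\psi)\cong\hat{\ast}_{i=1}^d\big(\widehat{\Gamma}\wr_*\mathbb{G}^{aut}(B_i,\psi_i)\big)$$ is a $*$-isomorphism which intertwines the comultiplications, i.e. there is a $*$-isomorphism between the C*-algebra $C(\widehat{\Gamma}\wr_*\mathbb{G}^{aut}(B,\psi))$ and the free product $\ast_{i=1}^d C(\widehat{\Gamma}\wr_*\mathbb{G}^{aut}(B_i,\psi_i))$ which intertwines the comultiplications.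
   Context: Here $Q_\alpha\in M_{n_\alpha}(\mathbb{C})$, $Q_\alpha>0$, $\sum_\alpha\mathrm{Tr}(Q_\alpha)=1$. A finite dimensional C*-algebra $B$ with multiplication $m:B\otimes B\to B$, unit map $\eta:\mathbb{C}\to B$, $\eta(1)=1_B$, and a faithful state $\psi$ is a Hilbert space for $\langle x,y\rangle=\psi(y^*x)$; a faithful state $\psi$ is a $\delta$-form ($\delta>0$) if $mm^*=\delta\cdot\mathrm{id}_B$ for the resulting adjoint. **Free wreath product.** $C(\widehat{\Gamma}\wr_*\mathbb{G}^{aut}(B,\psi))$ is the universal unital C*-algebra generated by the coefficients of elements $a(g)\in\mathcal{L}(B)\otimes C(\widehat{\Gamma}\wr_*\mathbb{G}^{aut}(B,\psi))$, $g\in\Gamma$, subject to: each $a(g)$ is unitary; $m\in\mathrm{Hom}(a(g)\otimes a(h),a(gh))$ for all $g,h\in\Gamma$; $\eta\in\mathrm{Hom}(1,a(e))$, with $e$ the unit of $\Gamma$. It is a compact quantum group, denoted $\widehat{\Gamma}\wr_*\mathbb{G}^{aut}(B,\psi)$, with the comultiplication $\Delta$ such that $(\mathrm{id}\otimes\Delta)(a(g))=a(g)_{12}a(g)_{13}$ for all $g$. Here for $v\in\mathcal{L}(H)\otimes A$, $w\in\mathcal{L}(K)\otimes A$, $\mathrm{Hom}(v,w)=\{T\in\mathcal{L}(H,K):(T\otimes 1)v=w(T\otimes 1)\}$ and $v\otimes w=v_{13}w_{23}$. **Free product.** $\hat{\ast}_i\mathbb{G}_i$ denotes Wang's free product of compact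 quantum groups: its C*-algebra is the full unital free product (amalgamated over $\mathbb{C}1$) $\ast_i C(\mathbb{G}_i)$, with the unique comultiplication extending those of the $C(\mathbb{G}_i)$.
   Formalization: The restriction of ψ to a summand satisfies mm* = Tr(Q_α^{-1})·id before normalizing; the normalized restriction is a δ-form with δ = Tr(Q_α)Tr(Q_α^{-1}), not Tr(Q_α^{-1}) (B = C⊕C, Q_1 = Q_2 = 1/2 gives δ = 1, not 2). *)

theory Defs
  imports
    "HOL-Algebra.Group"
    "HOL-Algebra.Module"
    "HOL-Library.FuncSet"
    "Jordan_Normal_Form.Schur_Decomposition"
    "Jordan_Normal_Form.Gauss_Jordan_Elimination"
begin

section \<open>Complex unital *-algebras and C*-algebras\<close>

record 'a star_alg = "(complex, 'a) module" +
  star :: "'a \<Rightarrow> 'a"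

record 'a cstar = "'a star_alg" +
  nrm :: "'a \<Rightarrow> real"

definition star_hom ::
  "('a, 'm) star_alg_scheme \<Rightarrow> ('b, 'n) star_alg_scheme \<Rightarrow> ('a \<Rightarrow> 'b) \<Rightarrow> bool" where
  "star_hom A B f \<longleftrightarrow> f \<in> Ring.ring_hom A B
     \<and> (\<forall>c. \<forall>x\<in>carrier A. f (c \<odot>\<^bsub>A\<^esub> x) = c \<odot>\<^bsub>B\<^esub> f x)
     \<and> (\<forall>x\<in>carrier A. f (star A x) = star B (f x))"

text \<open>For C*-algebras, isometry of a bijective *-homomorphism is automatic.\<close>

definition star_iso :: "'a cstar \<Rightarrow> 'b cstar \<Rightarrow> ('a \<Rightarrow> 'b) \<Rightarrow> bool" where
  "star_iso A B f \<longleftrightarrow> star_hom A B f \<and> bij_betw f (carrier A) (carrier B)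
     \<and> (\<forall>x\<in>carrier A. nrm B (f x) = nrm A x)"

definition cstar_seminorm :: "('a, 'm) star_alg_scheme \<Rightarrow> ('a \<Rightarrow> real) \<Rightarrow> bool" where
  "cstar_seminorm P p \<longleftrightarrow>
     (\<forall>x\<in>carrier P. 0 \<le> p x)
     \<and> (\<forall>x\<in>carrier P. \<forall>y\<in>carrier P. p (x \<oplus>\<^bsub>P\<^esub> y) \<le> p x + p y)
     \<and> (\<forall>c. \<forall>x\<in>carrier P. p (c \<odot>\<^bsub>P\<^esub> x) = cmod c * p x)
     \<and> (\<forall>x\<in>carrier P. \<forall>y\<in>carrier P. p (x \<otimes>\<^bsub>P\<^esub> y) \<le> p x * p y)
     \<and> (\<forall>x\<in>carrier P. p (star P x \<otimes>\<^bsub>P\<^esub> x) = (p x)\<^sup>2)"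


subsection \<open>Separation and completion\<close>

definition cauchy_seqs :: "('a, 'm) star_alg_scheme \<Rightarrow> ('a \<Rightarrow> real) \<Rightarrow> (nat \<Rightarrow> 'a) set" where
  "cauchy_seqs P p = {x. (\<forall>n. x n \<in> carrier P) \<and>
     (\<forall>e>0. \<exists>N. \<forall>m\<ge>N. \<forall>n\<ge>N. p (x m \<ominus>\<^bsub>P\<^esub> x n) < e)}"

definition cauchy_class ::
  "('a, 'm) star_alg_scheme \<Rightarrow> ('a \<Rightarrow> real) \<Rightarrow> (nat \<Rightarrow> 'a) \<Rightarrow> (nat \<Rightarrow> 'a) set" where
  "cauchy_class P p x =
     {y \<in> cauchy_seqs P p. (\<lambda>n. p (x n \<ominus>\<^bsub>P\<^esub> y n)) \<longlonglongrightarrow> 0}"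

definition completion ::
  "('a, 'm) star_alg_scheme \<Rightarrow> ('a \<Rightarrow> real) \<Rightarrow> (nat \<Rightarrow> 'a) set cstar" where
  "completion P p = \<lparr>
     carrier = cauchy_class P p ` cauchy_seqs P p,
     monoid.mult = (\<lambda>X Y. \<Union>x\<in>X. \<Union>y\<in>Y. cauchy_class P p (\<lambda>n. x n \<otimes>\<^bsub>P\<^esub> y n)),
     one = cauchy_class P p (\<lambda>_. \<one>\<^bsub>P\<^esub>),
     zero = cauchy_class P p (\<lambda>_. \<zero>\<^bsub>P\<^esub>),
     add = (\<lambda>X Y. \<Union>x\<in>X. \<Union>y\<in>Y. cauchy_class P p (\<lambda>n. x n \<oplus>\<^bsub>P\<^esub> y n)),
     module.smult = (\<lambda>c X. \<Union>x\<in>X. cauchy_class P p (\<lambda>n. c \<odot>\<^bsub>P\<^esub> x n)),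
     star = (\<lambda>X. \<Union>x\<in>X. cauchy_class P p (\<lambda>n. star P (x n))),
     nrm = (\<lambda>X. THE r. \<forall>x\<in>X. (\<lambda>n. p (x n)) \<longlonglongrightarrow> r) \<rparr>"

definition to_completion ::
  "('a, 'm) star_alg_scheme \<Rightarrow> ('a \<Rightarrow> real) \<Rightarrow> 'a \<Rightarrow> (nat \<Rightarrow> 'a) set" where
  "to_completion P p x = cauchy_class P p (\<lambda>_. x)"


subsection \<open>The *-algebra of a monoid with involution\<close>

text \<open>The algebra \<open>\<complex>[M]\<close> of finitely supported functions with convolution as product. It is used
  both for noncommutative *-polynomials and for formal sums of elementary tensors.\<close>

record 'w star_monoid = "'w monoid" +
  inv_op :: "'w \<Rightarrow> 'w"

definition monoid_star_alg :: "'w star_monoid \<Rightarrow> ('w \<Rightarrow> complex) star_alg" where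
  "monoid_star_alg M = \<lparr>
     carrier = {f. finite {w. f w \<noteq> 0} \<and> {w. f w \<noteq> 0} \<subseteq> carrier M},
     monoid.mult = (\<lambda>f g w. \<Sum>(u, v) \<in> {(u, v). f u \<noteq> 0 \<and> g v \<noteq> 0 \<and> u \<otimes>\<^bsub>M\<^esub> v = w}. f u * g v),
     one = (\<lambda>w. if w = \<one>\<^bsub>M\<^esub> then 1 else 0),
     zero = (\<lambda>_. 0),
     add = (\<lambda>f g w. f w + g w),
     module.smult = (\<lambda>c f w. c * f w),
     star = (\<lambda>f w. if w \<in> carrier M then cnj (f (inv_op M w)) else 0) \<rparr>"

definition single :: "'w \<Rightarrow> 'w \<Rightarrow> complex" where
  "single u = (\<lambda>w. if w = u then 1 else 0)"


subsection \<open>Universal unital C*-algebras\<close>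

text \<open>A word is a list of letters \<open>(x, b)\<close>, where \<open>(x, False)\<close> stands for the generator \<open>x\<close>
  and \<open>(x, True)\<close> for its adjoint.\<close>

type_synonym 'x star_poly = "('x \<times> bool) list \<Rightarrow> complex"

definition word_monoid :: "'x set \<Rightarrow> ('x \<times> bool) list star_monoid" where
  "word_monoid X = \<lparr> carrier = lists (X \<times> UNIV), monoid.mult = (@), one = [],
     inv_op = (\<lambda>w. rev (map (\<lambda>(x, b). (x, \<not> b)) w)) \<rparr>"

definition free_star_alg :: "'x set \<Rightarrow> 'x star_poly star_alg" where
  "free_star_alg X = monoid_star_alg (word_monoid X)"

definition gen :: "'x \<Rightarrow> 'x star_poly" where
  "gen x = single [(x, False)]"

text \<open>The universal unital C*-algebra with generators \<open>X\<close> and relations \<open>r = 0\<close>, \<open>r \<in> R\<close>, is the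
  separated completion of the free unital *-algebra on \<open>X\<close> for the largest C*-seminorm vanishing
  on \<open>R\<close>. The supremum is that of a set containing 0 (zero seminorm); its boundedness above is the
  usual existence condition for universal C*-algebras.\<close>

definition univ_seminorm :: "'x set \<Rightarrow> 'x star_poly set \<Rightarrow> 'x star_poly \<Rightarrow> real" where
  "univ_seminorm X R x =
     Sup {p x | p. cstar_seminorm (free_star_alg X) p \<and> (\<forall>r\<in>R. p r = 0)}"

definition univ_cstar :: "'x set \<Rightarrow> 'x star_poly set \<Rightarrow> (nat \<Rightarrow> 'x star_poly) set cstar" where
  "univ_cstar X R = completion (free_star_alg X) (univ_seminorm X R)"

definition univ_gen ::
  "'x set \<Rightarrow> 'x star_poly set \<Rightarrow> 'x \<Rightarrow> (nat \<Rightarrow> 'x star_poly) set" where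
  "univ_gen X R x = to_completion (free_star_alg X) (univ_seminorm X R) (gen x)"


subsection \<open>Full unital free products\<close>

text \<open>Generated by letters \<open>(i, a)\<close> with \<open>a \<in> A i\<close>, subject to \<open>a \<mapsto> (i, a)\<close> being a unital
  *-homomorphism for every \<open>i\<close>; the units of all factors are thereby identified.\<close>

definition free_prod_gens :: "'i set \<Rightarrow> ('i \<Rightarrow> 'a cstar) \<Rightarrow> ('i \<times> 'a) set" where
  "free_prod_gens I A = Sigma I (\<lambda>i. carrier (A i))"

definition free_prod_rels :: "'i set \<Rightarrow> ('i \<Rightarrow> 'a cstar) \<Rightarrow> ('i \<times> 'a) star_poly set" where
  "free_prod_rels I A =
    (let P = free_star_alg (free_prod_gens I A) in
     (\<Union>i\<in>I.
       {gen (i, a \<oplus>\<^bsub>A i\<^esub> b) \<ominus>\<^bsub>P\<^esub> (gen (i, a) \<oplus>\<^bsub>P\<^esub> gen (i, b)) | a b.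
          a \<in> carrier (A i) \<and> b \<in> carrier (A i)}
     \<union> {gen (i, c \<odot>\<^bsub>A i\<^esub> a) \<ominus>\<^bsub>P\<^esub> (c \<odot>\<^bsub>P\<^esub> gen (i, a)) | c a. a \<in> carrier (A i)}
     \<union> {gen (i, a \<otimes>\<^bsub>A i\<^esub> b) \<ominus>\<^bsub>P\<^esub> (gen (i, a) \<otimes>\<^bsub>P\<^esub> gen (i, b)) | a b.
          a \<in> carrier (A i) \<and> b \<in> carrier (A i)}
     \<union> {gen (i, star (A i) a) \<ominus>\<^bsub>P\<^esub> star P (gen (i, a)) | a. a \<in> carrier (A i)}
     \<union> {gen (i, \<one>\<^bsub>A i\<^esub>) \<ominus>\<^bsub>P\<^esub> \<one>\<^bsub>P\<^esub>}))"

type_synonym ('i, 'a) free_prod_elem = "(nat \<Rightarrow> ('i \<times> 'a) star_poly) set"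

definition free_prod ::
  "'i set \<Rightarrow> ('i \<Rightarrow> 'a cstar) \<Rightarrow> ('i, 'a) free_prod_elem cstar" where
  "free_prod I A = univ_cstar (free_prod_gens I A) (free_prod_rels I A)"

definition free_prod_incl ::
  "'i set \<Rightarrow> ('i \<Rightarrow> 'a cstar) \<Rightarrow> 'i \<Rightarrow> 'a \<Rightarrow> ('i, 'a) free_prod_elem" where
  "free_prod_incl I A i a = univ_gen (free_prod_gens I A) (free_prod_rels I A) (i, a)"


subsection \<open>Minimal tensor products\<close>

definition states :: "('a, 'm) star_alg_scheme \<Rightarrow> ('a \<Rightarrow> complex) set" where
  "states A = {\<phi>.
     (\<forall>x\<in>carrier A. \<forall>y\<in>carrier A. \<phi> (x \<oplus>\<^bsub>A\<^esub> y) = \<phi> x + \<phi> y)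
     \<and> (\<forall>c. \<forall>x\<in>carrier A. \<phi> (c \<odot>\<^bsub>A\<^esub> x) = c * \<phi> x)
     \<and> (\<forall>x\<in>carrier A. 0 \<le> \<phi> (star A x \<otimes>\<^bsub>A\<^esub> x))
     \<and> \<phi> \<one>\<^bsub>A\<^esub> = 1}"

text \<open>\<open>pair_alg A B\<close> is the *-algebra of formal sums of elementary tensors. The algebraic tensor
  product is its quotient by the bilinearity relations; these are exactly the elements of spatial
  seminorm 0, so they need not be divided out before completing.\<close>

definition pair_alg ::
  "('a, 'm) star_alg_scheme \<Rightarrow> ('b, 'n) star_alg_scheme \<Rightarrow> ('a \<times> 'b \<Rightarrow> complex) star_alg" where
  "pair_alg A B = monoid_star_alg \<lparr> carrier = carrier A \<times> carrier B,
     monoid.mult = (\<lambda>(a, b) (a', b'). (a \<otimes>\<^bsub>A\<^esub> a', b \<otimes>\<^bsub>B\<^esub> b')),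
     one = (\<one>\<^bsub>A\<^esub>, \<one>\<^bsub>B\<^esub>),
     inv_op = (\<lambda>(a, b). (star A a, star B b)) \<rparr>"

definition tensor_fun ::
  "('a \<Rightarrow> complex) \<Rightarrow> ('b \<Rightarrow> complex) \<Rightarrow> ('a \<times> 'b \<Rightarrow> complex) \<Rightarrow> complex" where
  "tensor_fun \<phi> \<chi> x = (\<Sum>(a, b) \<in> {ab. x ab \<noteq> 0}. x (a, b) * \<phi> a * \<chi> b)"

text \<open>The supremum, over all states \<open>\<phi>\<close>, \<open>\<chi>\<close>, of the operator norm of \<open>x\<close> in the tensor product
  \<open>\<pi>\<^sub>\<phi> \<otimes> \<pi>\<^sub>\<chi>\<close> of the GNS representations, computed on the dense set of vectors
  \<open>y (\<xi>\<^sub>\<phi> \<otimes> \<xi>\<^sub>\<chi>)\<close>: the quotient below is the square of the norm of \<open>x y (\<xi>\<^sub>\<phi> \<otimes> \<xi>\<^sub>\<chi>)\<close> divided by that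
  of \<open>y (\<xi>\<^sub>\<phi> \<otimes> \<xi>\<^sub>\<chi>)\<close>. Thus this is the norm in the tensor product of the universal
  representations. The element 0 is inserted only for algebras without states.\<close>

definition spatial_norm ::
  "('a, 'm) star_alg_scheme \<Rightarrow> ('b, 'n) star_alg_scheme \<Rightarrow> ('a \<times> 'b \<Rightarrow> complex) \<Rightarrow> real" where
  "spatial_norm A B x =
    (let P = pair_alg A B;
         sq = (\<lambda>\<phi> \<chi> z. Re (tensor_fun \<phi> \<chi> (star P z \<otimes>\<^bsub>P\<^esub> z)))
     in Sup (insert 0 {sqrt (sq \<phi> \<chi> (x \<otimes>\<^bsub>P\<^esub> y) / sq \<phi> \<chi> y) | \<phi> \<chi> y.
          \<phi> \<in> states A \<and> \<chi> \<in> states B \<and> y \<in> carrier P \<and> sq \<phi> \<chi> y \<noteq> 0}))"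

type_synonym ('a, 'b) tensor_elem = "(nat \<Rightarrow> ('a \<times> 'b \<Rightarrow> complex)) set"

definition min_tensor :: "'a cstar \<Rightarrow> 'b cstar \<Rightarrow> ('a, 'b) tensor_elem cstar" where
  "min_tensor A B = completion (pair_alg A B) (spatial_norm A B)"

definition elem_tensor :: "'a cstar \<Rightarrow> 'b cstar \<Rightarrow> 'a \<Rightarrow> 'b \<Rightarrow> ('a, 'b) tensor_elem" where
  "elem_tensor A B a b = to_completion (pair_alg A B) (spatial_norm A B) (single (a, b))"

text \<open>The unique *-homomorphism \<open>f \<otimes> g\<close>, for *-homomorphisms \<open>f : A \<rightarrow> C\<close> and \<open>g : B \<rightarrow> D\<close>.\<close>

definition tensor_hom ::
  "'a cstar \<Rightarrow> 'b cstar \<Rightarrow> 'c cstar \<Rightarrow> 'd cstar \<Rightarrow> ('a \<Rightarrow> 'c) \<Rightarrow> ('b \<Rightarrow> 'd)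
     \<Rightarrow> ('a, 'b) tensor_elem \<Rightarrow> ('c, 'd) tensor_elem" where
  "tensor_hom A B C D f g = (THE h.
     h \<in> extensional (carrier (min_tensor A B))
     \<and> star_hom (min_tensor A B) (min_tensor C D) h
     \<and> (\<forall>a\<in>carrier A. \<forall>b\<in>carrier B.
          h (elem_tensor A B a b) = elem_tensor C D (f a) (g b)))"


section \<open>Compact quantum groups and their free products\<close>

record 'a cqg =
  cqg_alg :: "'a cstar"
  comult :: "'a \<Rightarrow> ('a, 'a) tensor_elem"

definition cqg_iso :: "'a cqg \<Rightarrow> 'b cqg \<Rightarrow> ('a \<Rightarrow> 'b) \<Rightarrow> bool" where
  "cqg_iso G H \<Phi> \<longleftrightarrow>
     (let A = cqg_alg G; B = cqg_alg H in
      star_iso A B \<Phi> \<and>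
      (\<forall>x\<in>carrier A. comult H (\<Phi> x) = tensor_hom A A B B \<Phi> \<Phi> (comult G x)))"

definition free_prod_comult :: "'i set \<Rightarrow> ('i \<Rightarrow> 'a cqg)
    \<Rightarrow> ('i, 'a) free_prod_elem \<Rightarrow> (('i, 'a) free_prod_elem, ('i, 'a) free_prod_elem) tensor_elem"
  where
  "free_prod_comult I G =
    (let A = (\<lambda>i. cqg_alg (G i)); F = free_prod I A; \<iota> = free_prod_incl I A in
     THE \<Delta>. \<Delta> \<in> extensional (carrier F)
       \<and> star_hom F (min_tensor F F) \<Delta>
       \<and> (\<forall>i\<in>I. \<forall>a\<in>carrier (A i).
            \<Delta> (\<iota> i a) = tensor_hom (A i) (A i) F F (\<iota> i) (\<iota> i) (comult (G i) a)))"

definition cqg_free_prod :: "'i set \<Rightarrow> ('i \<Rightarrow> 'a cqg) \<Rightarrow> ('i, 'a) free_prod_elem cqg" where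
  "cqg_free_prod I G =
     \<lparr> cqg_alg = free_prod I (\<lambda>i. cqg_alg (G i)), comult = free_prod_comult I G \<rparr>"


section \<open>Finite-dimensional Hilbert spaces\<close>

text \<open>The space \<open>\<complex>\<^sup>J\<close> with the inner product for which \<open>\<langle>e\<^sub>p, e\<^sub>q\<rangle> = gram p q\<close>; the basis need not be
  orthonormal. Inner products are linear in the first argument. A linear map is given by its matrix
  \<open>T\<close>, where \<open>T k j\<close> is the coefficient of \<open>e\<^sub>k\<close> in the image of \<open>e\<^sub>j\<close>.\<close>

record 'j fhilb =
  idx :: "'j set"
  gram :: "'j \<Rightarrow> 'j \<Rightarrow> complex"

definition inner_h :: "'j fhilb \<Rightarrow> ('j \<Rightarrow> complex) \<Rightarrow> ('j \<Rightarrow> complex) \<Rightarrow> complex" where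
  "inner_h H x y = (\<Sum>p\<in>idx H. \<Sum>q\<in>idx H. x p * cnj (y q) * gram H p q)"

definition tensor_h :: "'j fhilb \<Rightarrow> 'k fhilb \<Rightarrow> ('j \<times> 'k) fhilb" where
  "tensor_h H K = \<lparr> idx = idx H \<times> idx K,
     gram = (\<lambda>(p, p') (q, q'). gram H p q * gram K p' q') \<rparr>"

definition apply_h ::
  "'j fhilb \<Rightarrow> ('k \<Rightarrow> 'j \<Rightarrow> complex) \<Rightarrow> ('j \<Rightarrow> complex) \<Rightarrow> 'k \<Rightarrow> complex" where
  "apply_h H T x k = (\<Sum>j\<in>idx H. T k j * x j)"

definition adjoint_h ::
  "'j fhilb \<Rightarrow> 'k fhilb \<Rightarrow> ('k \<Rightarrow> 'j \<Rightarrow> complex) \<Rightarrow> 'j \<Rightarrow> 'k \<Rightarrow> complex" where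
  "adjoint_h H K T = (THE S.
     (\<forall>j k. \<not> (j \<in> idx H \<and> k \<in> idx K) \<longrightarrow> S j k = 0)
     \<and> (\<forall>x y. inner_h K (apply_h H T x) y = inner_h H x (apply_h K S y)))"

definition mat_unit_h :: "'j \<Rightarrow> 'j \<Rightarrow> 'j \<Rightarrow> 'j \<Rightarrow> complex" where
  "mat_unit_h p q = (\<lambda>r s. if r = p \<and> s = q then 1 else 0)"


subsection \<open>Elements of L(H) tensored with a *-algebra\<close>

text \<open>An element \<open>u = \<Sum> E\<^sub>p\<^sub>q \<otimes> u p q\<close> of \<open>L(H) \<otimes> P\<close> is given by its coefficients with respect to
  the matrix units of the basis \<open>(e\<^sub>p)\<close>. As that basis need not be orthonormal, the
  adjoints of the matrix units enter the involution.\<close>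

definition lmult :: "('a, 'm) star_alg_scheme \<Rightarrow> 'l set
    \<Rightarrow> ('k \<Rightarrow> 'l \<Rightarrow> 'a) \<Rightarrow> ('l \<Rightarrow> 'j \<Rightarrow> 'a) \<Rightarrow> 'k \<Rightarrow> 'j \<Rightarrow> 'a" where
  "lmult P L u v = (\<lambda>k j. \<Oplus>\<^bsub>P\<^esub>l\<in>L. u k l \<otimes>\<^bsub>P\<^esub> v l j)"

definition lstar ::
  "('a, 'm) star_alg_scheme \<Rightarrow> 'j fhilb \<Rightarrow> ('j \<Rightarrow> 'j \<Rightarrow> 'a) \<Rightarrow> 'j \<Rightarrow> 'j \<Rightarrow> 'a" where
  "lstar P H u = (\<lambda>r s. \<Oplus>\<^bsub>P\<^esub>pq\<in>idx H \<times> idx H.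
     adjoint_h H H (mat_unit_h (fst pq) (snd pq)) r s \<odot>\<^bsub>P\<^esub> star P (u (fst pq) (snd pq)))"

definition lscal :: "('a, 'm) star_alg_scheme \<Rightarrow> ('k \<Rightarrow> 'j \<Rightarrow> complex) \<Rightarrow> 'k \<Rightarrow> 'j \<Rightarrow> 'a" where
  "lscal P T = (\<lambda>k j. T k j \<odot>\<^bsub>P\<^esub> \<one>\<^bsub>P\<^esub>)"

definition lone :: "('a, 'm) star_alg_scheme \<Rightarrow> 'j \<Rightarrow> 'j \<Rightarrow> 'a" where
  "lone P = (\<lambda>p q. if p = q then \<one>\<^bsub>P\<^esub> else \<zero>\<^bsub>P\<^esub>)"

text \<open>The coefficients of \<open>v \<otimes> w = v\<^sub>1\<^sub>3 w\<^sub>2\<^sub>3\<close>.\<close>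

definition ltensor :: "('a, 'm) star_alg_scheme
    \<Rightarrow> ('j \<Rightarrow> 'j \<Rightarrow> 'a) \<Rightarrow> ('k \<Rightarrow> 'k \<Rightarrow> 'a) \<Rightarrow> 'j \<times> 'k \<Rightarrow> 'j \<times> 'k \<Rightarrow> 'a" where
  "ltensor P v w = (\<lambda>(p, p') (q, q'). v p q \<otimes>\<^bsub>P\<^esub> w p' q')"

definition coeff_diffs :: "('a, 'm) star_alg_scheme \<Rightarrow> 'k set \<Rightarrow> 'j set
    \<Rightarrow> ('k \<Rightarrow> 'j \<Rightarrow> 'a) \<Rightarrow> ('k \<Rightarrow> 'j \<Rightarrow> 'a) \<Rightarrow> 'a set" where
  "coeff_diffs P K J u v = {u k j \<ominus>\<^bsub>P\<^esub> v k j | k j. k \<in> K \<and> j \<in> J}"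

text \<open>Relators expressing that \<open>u\<close> is unitary, respectively that \<open>T \<in> Hom(v, w)\<close>, where \<open>v\<close> and \<open>w\<close>
  are indexed by \<open>J\<close> and \<open>K\<close>.\<close>

definition unitary_rels ::
  "('a, 'm) star_alg_scheme \<Rightarrow> 'j fhilb \<Rightarrow> ('j \<Rightarrow> 'j \<Rightarrow> 'a) \<Rightarrow> 'a set" where
  "unitary_rels P H u =
     coeff_diffs P (idx H) (idx H) (lmult P (idx H) (lstar P H u) u) (lone P)
     \<union> coeff_diffs P (idx H) (idx H) (lmult P (idx H) u (lstar P H u)) (lone P)"

definition hom_rels :: "('a, 'm) star_alg_scheme \<Rightarrow> 'j set \<Rightarrow> 'k set
    \<Rightarrow> ('j \<Rightarrow> 'j \<Rightarrow> 'a) \<Rightarrow> ('k \<Rightarrow> 'k \<Rightarrow> 'a) \<Rightarrow> ('k \<Rightarrow> 'j \<Rightarrow> complex) \<Rightarrow> 'a set" where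
  "hom_rels P J K v w T =
     coeff_diffs P K J (lmult P J (lscal P T) v) (lmult P K w (lscal P T))"


section \<open>Finite-dimensional C*-algebras with a state\<close>

definition mtrace :: "complex mat \<Rightarrow> complex" where
  "mtrace M = (\<Sum>i<dim_row M. M $$ (i, i))"

definition mat_inv :: "complex mat \<Rightarrow> complex mat" where
  "mat_inv M = the (mat_inverse M)"

text \<open>The inequality is that of \<open>Complex_Order\<close>, so its left-hand side is real; hence \<open>M\<close> is
  automatically self-adjoint.\<close>

definition pos_def :: "nat \<Rightarrow> complex mat \<Rightarrow> bool" where
  "pos_def k M \<longleftrightarrow> M \<in> carrier_mat k k \<and>
     (\<forall>v\<in>carrier_vec k. v \<noteq> 0\<^sub>v k \<longrightarrow> 0 < (M *\<^sub>v v) \<bullet>c v)"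

text \<open>The algebra \<open>\<Oplus>\<^bsub>\<alpha> \<in> blocks\<^esub> M\<^bsub>dims \<alpha>\<^esub>(\<complex>)\<close> with the functional \<open>\<Oplus>\<^sub>\<alpha> Tr(dens \<alpha> \<cdot>)\<close>. Its elements are
  families of matrices, whose members outside \<open>blocks\<close> are irrelevant.\<close>

record fd_alg =
  blocks :: "nat set"
  dims :: "nat \<Rightarrow> nat"
  dens :: "nat \<Rightarrow> complex mat"

definition fd_mult :: "(nat \<Rightarrow> complex mat) \<Rightarrow> (nat \<Rightarrow> complex mat) \<Rightarrow> nat \<Rightarrow> complex mat" where
  "fd_mult x y = (\<lambda>\<alpha>. x \<alpha> * y \<alpha>)"

definition fd_star :: "(nat \<Rightarrow> complex mat) \<Rightarrow> nat \<Rightarrow> complex mat" where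
  "fd_star x = (\<lambda>\<alpha>. mat_adjoint (x \<alpha>))"

definition fd_one :: "fd_alg \<Rightarrow> nat \<Rightarrow> complex mat" where
  "fd_one B = (\<lambda>\<alpha>. 1\<^sub>m (dims B \<alpha>))"

definition fd_state :: "fd_alg \<Rightarrow> (nat \<Rightarrow> complex mat) \<Rightarrow> complex" where
  "fd_state B x = (\<Sum>\<alpha>\<in>blocks B. mtrace (dens B \<alpha> * x \<alpha>))"

definition faithful_state :: "fd_alg \<Rightarrow> bool" where
  "faithful_state B \<longleftrightarrow> finite (blocks B)
     \<and> (\<forall>\<alpha>\<in>blocks B. 0 < dims B \<alpha> \<and> pos_def (dims B \<alpha>) (dens B \<alpha>))
     \<and> (\<Sum>\<alpha>\<in>blocks B. mtrace (dens B \<alpha>)) = 1"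

text \<open>The index \<open>(\<alpha>, i, j)\<close> stands for the matrix unit \<open>e\<^sub>i\<^sub>j\<close> of the summand \<open>\<alpha>\<close>.\<close>

type_synonym fd_idx = "nat \<times> nat \<times> nat"

definition fd_basis_idx :: "fd_alg \<Rightarrow> fd_idx set" where
  "fd_basis_idx B = {(\<alpha>, i, j). \<alpha> \<in> blocks B \<and> i < dims B \<alpha> \<and> j < dims B \<alpha>}"

definition fd_basis :: "fd_alg \<Rightarrow> fd_idx \<Rightarrow> nat \<Rightarrow> complex mat" where
  "fd_basis B p = (\<lambda>\<alpha>. mat (dims B \<alpha>) (dims B \<alpha>)
     (\<lambda>(i, j). if (\<alpha>, i, j) = p then 1 else 0))"

definition fd_coord :: "(nat \<Rightarrow> complex mat) \<Rightarrow> fd_idx \<Rightarrow> complex" where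
  "fd_coord x = (\<lambda>(\<alpha>, i, j). x \<alpha> $$ (i, j))"

text \<open>\<open>B\<close> as a Hilbert space for \<open>\<langle>x, y\<rangle> = \<psi>(y\<^sup>* x)\<close>.\<close>

definition fd_hilb :: "fd_alg \<Rightarrow> fd_idx fhilb" where
  "fd_hilb B = \<lparr> idx = fd_basis_idx B,
     gram = (\<lambda>p q. fd_state B (fd_mult (fd_star (fd_basis B q)) (fd_basis B p))) \<rparr>"

text \<open>The matrices of the multiplication \<open>B \<otimes> B \<rightarrow> B\<close> and of the unit map \<open>\<complex> \<rightarrow> B\<close>.\<close>

definition fd_mult_map :: "fd_alg \<Rightarrow> fd_idx \<Rightarrow> fd_idx \<times> fd_idx \<Rightarrow> complex" where
  "fd_mult_map B = (\<lambda>r (p, q). fd_coord (fd_mult (fd_basis B p) (fd_basis B q)) r)"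

definition fd_unit_map :: "fd_alg \<Rightarrow> fd_idx \<Rightarrow> unit \<Rightarrow> complex" where
  "fd_unit_map B = (\<lambda>r _. fd_coord (fd_one B) r)"

text \<open>\<open>m m\<^sup>* = z id\<close>.\<close>

definition mult_coisometry_upto :: "fd_alg \<Rightarrow> complex \<Rightarrow> bool" where
  "mult_coisometry_upto B z \<longleftrightarrow>
    (let H = fd_hilb B; m = fd_mult_map B; m' = adjoint_h (tensor_h H H) H m in
     \<forall>r\<in>idx H. \<forall>s\<in>idx H.
       (\<Sum>t\<in>idx (tensor_h H H). m r t * m' t s) = (if r = s then z else 0))"

definition delta_form :: "fd_alg \<Rightarrow> complex \<Rightarrow> bool" where
  "delta_form B \<delta> \<longleftrightarrow> faithful_state B \<and> 0 < \<delta> \<and> mult_coisometry_upto B \<delta>"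

definition restrict_blocks :: "fd_alg \<Rightarrow> nat set \<Rightarrow> fd_alg" where
  "restrict_blocks B S = B \<lparr> blocks := S \<rparr>"

text \<open>Division of the functional by its value at the unit.\<close>

definition normalize_state :: "fd_alg \<Rightarrow> fd_alg" where
  "normalize_state B = B \<lparr> dens := (\<lambda>\<alpha>. (1 / fd_state B (fd_one B)) \<cdot>\<^sub>m dens B \<alpha>) \<rparr>"


section \<open>Free wreath products\<close>

text \<open>The generator \<open>(g, p, q)\<close> is the coefficient of \<open>a(g)\<close> at the matrix unit \<open>E\<^sub>p\<^sub>q\<close> of \<open>L(B)\<close>.\<close>

definition fw_gens :: "('g, 'm) monoid_scheme \<Rightarrow> fd_alg \<Rightarrow> ('g \<times> fd_idx \<times> fd_idx) set" where
  "fw_gens \<Gamma> B = carrier \<Gamma> \<times> fd_basis_idx B \<times> fd_basis_idx B"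

definition fw_rels ::
  "('g, 'm) monoid_scheme \<Rightarrow> fd_alg \<Rightarrow> ('g \<times> fd_idx \<times> fd_idx) star_poly set" where
  "fw_rels \<Gamma> B =
    (let P = free_star_alg (fw_gens \<Gamma> B); a = (\<lambda>g p q. gen (g, p, q));
         H = fd_hilb B; J = idx H in
     (\<Union>g\<in>carrier \<Gamma>. unitary_rels P H (a g))
     \<union> (\<Union>g\<in>carrier \<Gamma>. \<Union>h\<in>carrier \<Gamma>.
          hom_rels P (J \<times> J) J (ltensor P (a g) (a h)) (a (g \<otimes>\<^bsub>\<Gamma>\<^esub> h)) (fd_mult_map B))
     \<union> hom_rels P {()} J (lone P) (a \<one>\<^bsub>\<Gamma>\<^esub>) (fd_unit_map B))"

type_synonym 'g fw_elem = "(nat \<Rightarrow> ('g \<times> fd_idx \<times> fd_idx) star_poly) set"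

definition fw_alg :: "('g, 'm) monoid_scheme \<Rightarrow> fd_alg \<Rightarrow> 'g fw_elem cstar" where
  "fw_alg \<Gamma> B = univ_cstar (fw_gens \<Gamma> B) (fw_rels \<Gamma> B)"

definition fw_coeff ::
  "('g, 'm) monoid_scheme \<Rightarrow> fd_alg \<Rightarrow> 'g \<Rightarrow> fd_idx \<Rightarrow> fd_idx \<Rightarrow> 'g fw_elem" where
  "fw_coeff \<Gamma> B g p q = univ_gen (fw_gens \<Gamma> B) (fw_rels \<Gamma> B) (g, p, q)"

text \<open>\<open>(id \<otimes> \<Delta>)(a(g)) = a(g)\<^sub>1\<^sub>2 a(g)\<^sub>1\<^sub>3\<close>, written in coefficients.\<close>

definition fw_comult ::
  "('g, 'm) monoid_scheme \<Rightarrow> fd_alg \<Rightarrow> 'g fw_elem \<Rightarrow> ('g fw_elem, 'g fw_elem) tensor_elem" where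
  "fw_comult \<Gamma> B =
    (let A = fw_alg \<Gamma> B; a = fw_coeff \<Gamma> B; J = fd_basis_idx B in
     THE \<Delta>. \<Delta> \<in> extensional (carrier A)
       \<and> star_hom A (min_tensor A A) \<Delta>
       \<and> (\<forall>g\<in>carrier \<Gamma>. \<forall>p\<in>J. \<forall>q\<in>J.
            \<Delta> (a g p q) =
              (\<Oplus>\<^bsub>min_tensor A A\<^esub>r\<in>J. elem_tensor A A (a g p r) (a g r q))))"

definition free_wreath :: "('g, 'm) monoid_scheme \<Rightarrow> fd_alg \<Rightarrow> 'g fw_elem cqg" where
  "free_wreath \<Gamma> B = \<lparr> cqg_alg = fw_alg \<Gamma> B, comult = fw_comult \<Gamma> B \<rparr>"

end

theory Submission
  imports Defs
begin

text \<open>If \<open>a\<close> satisfies the relations of the free wreath product, then \<open>m\<^sup>*\<close> intertwines \<open>a(g)\<close> and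
  \<open>a(e) \<otimes> a(g)\<close> because \<open>m\<close> intertwines these unitaries in the other direction. Hence \<open>m m\<^sup>*\<close>, which is
  multiplication by the scalar \<open>Tr(Q\<^sub>\<alpha>\<^sup>-\<^sup>1)\<close> on the summand \<open>\<alpha>\<close>, commutes with \<open>a(g)\<close>, so \<open>a(g)\<close> is block
  diagonal for the decomposition of \<open>B\<close> into the \<open>B\<^sub>i\<close>. Since the Gram matrix, the multiplication and
  the unit are block diagonal too, the relations for \<open>B\<close> amount to those for all the \<open>B\<^sub>i\<close>, up to a
  rescaling of the Gram matrix that leaves unitarity unchanged. The universal properties then give
  mutually inverse *-homomorphisms, which are isometric since *-homomorphisms are contractive.\<close>

section \<open>*-algebras and C*-seminorms\<close>

text \<open>The norms and comultiplications of the statement are given by \<open>Sup\<close> and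
  \<open>THE\<close>, so before any isomorphism makes sense the seminorms must be bounded on the
  generators and the comultiplications must exist. One analytic tool serves for all of this, in
  place of spectral theory: the square root of 1 - h for self-adjoint h of norm below 1. It makes
  such an h the real part of a unitary, so every C*-seminorm on a C*-algebra is at most its norm;
  this bounds the generators of a free product and makes *-homomorphisms contractive. It also shows
  that self-adjoint elements whose squares sum to c have norm at most the square root of c, which
  bounds the coefficients of a unitary although the basis of matrix units is not orthonormal.
  Finally it bounds the action on GNS vectors, so the minimal tensor product can be treated with
  positive functionals alone. The delicate point there is that f tensor g is contractive for
  *-homomorphisms that need not be injective, which follows from an estimate along powers of a
  self-adjoint element.\<close>

locale star_algebra = ring A for A :: "('a, 'm) star_alg_scheme" (structure) +
  assumes smult_closed [simp, intro]: "x \<in> carrier A \<Longrightarrow> c \<odot> x \<in> carrier A"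
    and smult_l_distr: "x \<in> carrier A \<Longrightarrow> (c + d) \<odot> x = c \<odot> x \<oplus> d \<odot> x"
    and smult_r_distr: "\<lbrakk>x \<in> carrier A; y \<in> carrier A\<rbrakk> \<Longrightarrow> c \<odot> (x \<oplus> y) = c \<odot> x \<oplus> c \<odot> y"
    and smult_smult [simp]: "x \<in> carrier A \<Longrightarrow> c \<odot> (d \<odot> x) = (c * d) \<odot> x"
    and smult_one [simp]: "x \<in> carrier A \<Longrightarrow> 1 \<odot> x = x"
    and smult_mult [simp]: "\<lbrakk>x \<in> carrier A; y \<in> carrier A\<rbrakk> \<Longrightarrow> (c \<odot> x) \<otimes> y = c \<odot> (x \<otimes> y)"
    and mult_smult [simp]: "\<lbrakk>x \<in> carrier A; y \<in> carrier A\<rbrakk> \<Longrightarrow> x \<otimes> (c \<odot> y) = c \<odot> (x \<otimes> y)"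
    and star_closed [simp, intro]: "x \<in> carrier A \<Longrightarrow> star A x \<in> carrier A"
    and star_star [simp]: "x \<in> carrier A \<Longrightarrow> star A (star A x) = x"
    and star_add [simp]: "\<lbrakk>x \<in> carrier A; y \<in> carrier A\<rbrakk> \<Longrightarrow> star A (x \<oplus> y) = star A x \<oplus> star A y"
    and star_smult [simp]: "x \<in> carrier A \<Longrightarrow> star A (c \<odot> x) = cnj c \<odot> star A x"
    and star_mult [simp]: "\<lbrakk>x \<in> carrier A; y \<in> carrier A\<rbrakk> \<Longrightarrow> star A (x \<otimes> y) = star A y \<otimes> star A x"
begin

lemma smult_0 [simp]: "x \<in> carrier A \<Longrightarrow> 0 \<odot> x = \<zero>"
proof -
  assume x: "x \<in> carrier A"
  have "0 \<odot> x \<oplus> 0 \<odot> x = 0 \<odot> x" using smult_l_distr[OF x, of 0 0] by simp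
  then show ?thesis using x add.l_cancel_one[of "0 \<odot> x" "0 \<odot> x"] by simp
qed

lemma smult_zero [simp]: "c \<odot> \<zero> = \<zero>"
  using smult_smult[of \<zero> c 0] by simp

lemma a_inv_eq: "x \<in> carrier A \<Longrightarrow> \<ominus> x = (- 1) \<odot> x"
proof -
  assume x: "x \<in> carrier A"
  have "(-1) \<odot> x \<oplus> x = \<zero>" using smult_l_distr[OF x, of "-1" 1] x by simp
  then show ?thesis using x by (metis minus_equality smult_closed)
qed

lemma a_minus_eq: "\<lbrakk>x \<in> carrier A; y \<in> carrier A\<rbrakk> \<Longrightarrow> x \<ominus> y = x \<oplus> (- 1) \<odot> y"
  by (simp add: a_minus_def a_inv_eq)

lemma diff_self [simp]: "x \<in> carrier A \<Longrightarrow> x \<ominus> x = \<zero>"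
  by (simp add: a_minus_def r_neg)

lemma diff_zero [simp]: "x \<in> carrier A \<Longrightarrow> x \<ominus> \<zero> = x"
  by (simp add: a_minus_eq)

lemma diff_eq_zero_iff [simp]: "\<lbrakk>x \<in> carrier A; y \<in> carrier A\<rbrakk> \<Longrightarrow> x \<ominus> y = \<zero> \<longleftrightarrow> x = y"
  using minus_equality[of x "\<ominus> y"] by (auto simp: a_minus_def r_neg)

lemma diff_diff_telescope:
  "\<lbrakk>x \<in> carrier A; y \<in> carrier A; z \<in> carrier A\<rbrakk> \<Longrightarrow> (x \<ominus> y) \<oplus> (y \<ominus> z) = x \<ominus> z"
  by (simp add: a_minus_def a_assoc) (metis a_assoc add.inv_closed l_neg l_zero)

lemma add_diff_add: "\<lbrakk>x \<in> carrier A; y \<in> carrier A; x' \<in> carrier A; y' \<in> carrier A\<rbrakk>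
   \<Longrightarrow> (x \<oplus> y) \<ominus> (x' \<oplus> y') = (x \<ominus> x') \<oplus> (y \<ominus> y')"
  by (simp add: a_minus_eq smult_r_distr a_ac)

lemma smult_diff: "\<lbrakk>x \<in> carrier A; y \<in> carrier A\<rbrakk> \<Longrightarrow> c \<odot> (x \<ominus> y) = c \<odot> x \<ominus> c \<odot> y"
  by (simp add: a_minus_eq smult_r_distr mult.commute)

lemma star_zero [simp]: "star A \<zero> = \<zero>"
  using star_smult[of \<zero> 0] by simp

lemma star_one [simp]: "star A \<one> = \<one>"
  by (metis one_closed r_one star_closed star_mult star_star)

lemma star_diff [simp]:
  "\<lbrakk>x \<in> carrier A; y \<in> carrier A\<rbrakk> \<Longrightarrow> star A (x \<ominus> y) = star A x \<ominus> star A y"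
  by (simp add: a_minus_eq)

lemma mult_diff_mult: "\<lbrakk>x \<in> carrier A; y \<in> carrier A; x' \<in> carrier A; y' \<in> carrier A\<rbrakk>
   \<Longrightarrow> (x \<otimes> y) \<ominus> (x' \<otimes> y') = (x \<ominus> x') \<otimes> y \<oplus> x' \<otimes> (y \<ominus> y')"
proof -
  assume c: "x \<in> carrier A" "y \<in> carrier A" "x' \<in> carrier A" "y' \<in> carrier A"
  have "(x \<ominus> x') \<otimes> y = x \<otimes> y \<ominus> x' \<otimes> y" "x' \<otimes> (y \<ominus> y') = x' \<otimes> y \<ominus> x' \<otimes> y'"
    using c by (simp_all add: a_minus_eq l_distr r_distr)
  then show ?thesis using c by (simp add: diff_diff_telescope)
qed

lemma smult_finsum:
  "f \<in> S \<rightarrow> carrier A \<Longrightarrow> c \<odot> (\<Oplus>i\<in>S. f i) = (\<Oplus>i\<in>S. c \<odot> f i)"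
  by (induction S rule: infinite_finite_induct)
    (auto simp: finsum_insert smult_r_distr Pi_def finsum_infinite finsum_closed)

lemma star_finsum:
  "f \<in> S \<rightarrow> carrier A \<Longrightarrow> star A (\<Oplus>i\<in>S. f i) = (\<Oplus>i\<in>S. star A (f i))"
  by (induction S rule: infinite_finite_induct)
    (auto simp: finsum_insert Pi_def finsum_infinite finsum_closed)

lemma finsum_smult:
  "x \<in> carrier A \<Longrightarrow> (\<Sum>i\<in>S. c i) \<odot> x = (\<Oplus>i\<in>S. c i \<odot> x)"
  by (induction S rule: infinite_finite_induct)
    (auto simp: finsum_insert smult_l_distr Pi_def finsum_infinite finsum_closed)

end

section \<open>Homomorphisms of star-algebras\<close>

locale star_morphism = A: star_algebra A + B: star_algebra B
  for A :: "('a, 'm) star_alg_scheme" and B :: "('b, 'n) star_alg_scheme" and f :: "'a \<Rightarrow> 'b" +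
  assumes hom: "star_hom A B f"
begin

lemma closed [simp, intro]: "x \<in> carrier A \<Longrightarrow> f x \<in> carrier B"
  and map_add [simp]: "\<lbrakk>x \<in> carrier A; y \<in> carrier A\<rbrakk> \<Longrightarrow> f (x \<oplus>\<^bsub>A\<^esub> y) = f x \<oplus>\<^bsub>B\<^esub> f y"
  and map_mult [simp]: "\<lbrakk>x \<in> carrier A; y \<in> carrier A\<rbrakk> \<Longrightarrow> f (x \<otimes>\<^bsub>A\<^esub> y) = f x \<otimes>\<^bsub>B\<^esub> f y"
  and map_one [simp]: "f \<one>\<^bsub>A\<^esub> = \<one>\<^bsub>B\<^esub>"
  and map_smult [simp]: "x \<in> carrier A \<Longrightarrow> f (c \<odot>\<^bsub>A\<^esub> x) = c \<odot>\<^bsub>B\<^esub> f x"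
  and map_star [simp]: "x \<in> carrier A \<Longrightarrow> f (star A x) = star B (f x)"
  using hom unfolding star_hom_def
  by (auto dest: ring_hom_closed ring_hom_add ring_hom_mult ring_hom_one)

lemma map_zero [simp]: "f \<zero>\<^bsub>A\<^esub> = \<zero>\<^bsub>B\<^esub>"
  using map_smult[of "\<zero>\<^bsub>A\<^esub>" 0] by simp

lemma map_minus [simp]:
  "\<lbrakk>x \<in> carrier A; y \<in> carrier A\<rbrakk> \<Longrightarrow> f (x \<ominus>\<^bsub>A\<^esub> y) = f x \<ominus>\<^bsub>B\<^esub> f y"
  by (simp add: A.a_minus_eq B.a_minus_eq)

lemma map_finsum:
  "g \<in> S \<rightarrow> carrier A \<Longrightarrow> f (\<Oplus>\<^bsub>A\<^esub>i\<in>S. g i) = (\<Oplus>\<^bsub>B\<^esub>i\<in>S. f (g i))"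
  by (induction S rule: infinite_finite_induct)
    (auto simp: A.finsum_insert B.finsum_insert Pi_def A.finsum_infinite B.finsum_infinite
      A.finsum_closed)

end

lemma star_homI:
  assumes "\<And>x. x \<in> carrier A \<Longrightarrow> f x \<in> carrier B"
    and "\<And>x y. \<lbrakk>x \<in> carrier A; y \<in> carrier A\<rbrakk> \<Longrightarrow> f (x \<oplus>\<^bsub>A\<^esub> y) = f x \<oplus>\<^bsub>B\<^esub> f y"
    and "\<And>x y. \<lbrakk>x \<in> carrier A; y \<in> carrier A\<rbrakk> \<Longrightarrow> f (x \<otimes>\<^bsub>A\<^esub> y) = f x \<otimes>\<^bsub>B\<^esub> f y"
    and "f \<one>\<^bsub>A\<^esub> = \<one>\<^bsub>B\<^esub>"
    and "\<And>c x. x \<in> carrier A \<Longrightarrow> f (c \<odot>\<^bsub>A\<^esub> x) = c \<odot>\<^bsub>B\<^esub> f x"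
    and "\<And>x. x \<in> carrier A \<Longrightarrow> f (star A x) = star B (f x)"
  shows "star_hom A B f"
  using assms unfolding star_hom_def by (auto intro!: ring_hom_memI)

lemma star_hom_comp:
  assumes f: "star_hom A B f" and g: "star_hom B C g"
  shows "star_hom A C (\<lambda>x. g (f x))"
  using ring_hom_trans[of f A B g C] f g ring_hom_closed[of f A B]
  unfolding star_hom_def by (auto simp: comp_def)

lemma star_hom_cong:
  assumes "star_algebra A" "star_hom A B f" "\<And>x. x \<in> carrier A \<Longrightarrow> f x = g x"
  shows "star_hom A B g"
proof -
  interpret star_algebra A by fact
  have hom: "f \<in> Ring.ring_hom A B" using assms(2) by (simp add: star_hom_def)
  have "g \<in> Ring.ring_hom A B"
    using ring_hom_closed[OF hom] ring_hom_mult[OF hom] ring_hom_add[OF hom] ring_hom_one[OF hom]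
    by (auto intro!: ring_hom_memI simp flip: assms(3))
  then show ?thesis using assms(2) unfolding star_hom_def
    by (simp flip: assms(3))
qed

section \<open>C*-seminorms\<close>

locale seminormed_star_algebra = star_algebra P
  for P :: "('a, 'm) star_alg_scheme" (structure) and p :: "'a \<Rightarrow> real" +
  assumes seminorm: "cstar_seminorm P p"
begin

lemma p_nonneg [simp]: "x \<in> carrier P \<Longrightarrow> 0 \<le> p x"
  and p_triangle: "\<lbrakk>x \<in> carrier P; y \<in> carrier P\<rbrakk> \<Longrightarrow> p (x \<oplus> y) \<le> p x + p y"
  and p_smult [simp]: "x \<in> carrier P \<Longrightarrow> p (c \<odot> x) = cmod c * p x"
  and p_mult: "\<lbrakk>x \<in> carrier P; y \<in> carrier P\<rbrakk> \<Longrightarrow> p (x \<otimes> y) \<le> p x * p y"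
  and p_cstar: "x \<in> carrier P \<Longrightarrow> p (star P x \<otimes> x) = (p x)\<^sup>2"
  using seminorm unfolding cstar_seminorm_def by auto

lemma p_zero [simp]: "p \<zero> = 0"
  using p_smult[of \<zero> 0] by simp

lemma p_diff_commute: "\<lbrakk>x \<in> carrier P; y \<in> carrier P\<rbrakk> \<Longrightarrow> p (x \<ominus> y) = p (y \<ominus> x)"
proof -
  assume c: "x \<in> carrier P" "y \<in> carrier P"
  have "x \<ominus> y = (-1) \<odot> (y \<ominus> x)" using c by (simp add: a_minus_eq smult_r_distr a_ac)
  then show ?thesis using c by simp
qed

lemma p_triangle_diff:
  "\<lbrakk>x \<in> carrier P; y \<in> carrier P; z \<in> carrier P\<rbrakk> \<Longrightarrow> p (x \<ominus> z) \<le> p (x \<ominus> y) + p (y \<ominus> z)"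
  by (metis diff_diff_telescope minus_closed p_triangle)

lemma p_abs_diff: "\<lbrakk>x \<in> carrier P; y \<in> carrier P\<rbrakk> \<Longrightarrow> \<bar>p x - p y\<bar> \<le> p (x \<ominus> y)"
  using p_triangle_diff[of x y \<zero>] p_triangle_diff[of y x \<zero>] p_diff_commute[of x y] by simp

text \<open>The C*-identity bounds the square of p x by the product of p x with the seminorm of the
  adjoint, and a nonzero factor p x cancels. So the involution is isometric although
  \<open>cstar_seminorm\<close> does not ask for it.\<close>

lemma p_star_le: "x \<in> carrier P \<Longrightarrow> p x \<le> p (star P x)"
proof -
  assume x: "x \<in> carrier P"
  have "p x * p x \<le> p (star P x) * p x" using p_cstar[OF x] p_mult[of "star P x" x] x
    by (simp add: power2_eq_square)
  then show ?thesis using x p_nonneg[OF x] p_nonneg[of "star P x"]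
    by (cases "p x = 0") (auto simp: mult_le_cancel_right)
qed

lemma p_star [simp]: "x \<in> carrier P \<Longrightarrow> p (star P x) = p x"
  using p_star_le[of x] p_star_le[of "star P x"] by simp

text \<open>By the C*-identity \<open>p \<one>\<close> is idempotent, hence 0 or 1. The value 0
  occurs for the zero seminorm, so only an inequality is available.\<close>

lemma p_one: "p \<one> \<le> 1"
proof -
  have "p \<one> = p \<one> * p \<one>" using p_cstar[of \<one>] by (simp add: power2_eq_square)
  then have "p \<one> = 0 \<or> p \<one> = 1" by simp
  then show ?thesis by auto
qed

lemma p_mult_diff: "\<lbrakk>x \<in> carrier P; y \<in> carrier P; x' \<in> carrier P; y' \<in> carrier P\<rbrakk>
   \<Longrightarrow> p (x \<otimes> y \<ominus> x' \<otimes> y') \<le> p (x \<ominus> x') * p y + p x' * p (y \<ominus> y')"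
proof -
  assume c: "x \<in> carrier P" "y \<in> carrier P" "x' \<in> carrier P" "y' \<in> carrier P"
  show ?thesis using p_triangle[of "(x \<ominus> x') \<otimes> y" "x' \<otimes> (y \<ominus> y')"]
      p_mult[of "x \<ominus> x'" y] p_mult[of x' "y \<ominus> y'"] c by (simp add: mult_diff_mult)
qed

text \<open>Meant for relators x - y: where p vanishes on one of them, p x may be replaced by p
  y.\<close>

lemma p_eq_of_diff: "\<lbrakk>x \<in> carrier P; y \<in> carrier P; p (x \<ominus> y) = 0\<rbrakk> \<Longrightarrow> p x = p y"
  using p_abs_diff[of x y] by simp

lemma p_finsum_le:
  "\<lbrakk>finite S; f \<in> S \<rightarrow> carrier P\<rbrakk> \<Longrightarrow> p (\<Oplus>i\<in>S. f i) \<le> (\<Sum>i\<in>S. p (f i))"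
proof (induction S rule: finite_induct)
  case (insert i S)
  then show ?case using p_triangle[of "f i" "\<Oplus>i\<in>S. f i"]
    by (simp add: finsum_insert Pi_def finsum_closed)
qed auto

end

section \<open>Completions\<close>

context seminormed_star_algebra
begin

abbreviation "CS \<equiv> cauchy_seqs P p"
abbreviation "cls \<equiv> cauchy_class P p"
abbreviation "C \<equiv> completion P p"

lemma CS_carrier [simp]: "x \<in> CS \<Longrightarrow> x n \<in> carrier P"
  by (simp add: cauchy_seqs_def)

lemma CS_D: "\<lbrakk>x \<in> CS; 0 < e\<rbrakk> \<Longrightarrow> \<exists>N. \<forall>m\<ge>N. \<forall>n\<ge>N. p (x m \<ominus> x n) < e"
  unfolding cauchy_seqs_def by blast

lemma CS_Cauchy: "x \<in> CS \<Longrightarrow> Cauchy (\<lambda>n. p (x n))"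
proof (rule metric_CauchyI)
  fix e :: real assume x: "x \<in> CS" and "0 < e"
  then obtain N where N: "\<forall>m\<ge>N. \<forall>n\<ge>N. p (x m \<ominus> x n) < e" using CS_D by blast
  have "dist (p (x m)) (p (x n)) < e" if "m \<ge> N" "n \<ge> N" for m n
    using N that p_abs_diff[of "x m" "x n"] x by (auto simp: dist_real_def intro: le_less_trans)
  then show "\<exists>N. \<forall>m\<ge>N. \<forall>n\<ge>N. dist (p (x m)) (p (x n)) < e" by blast
qed

lemma CS_bounded: "x \<in> CS \<Longrightarrow> \<exists>M>0. \<forall>n. p (x n) \<le> M"
  using Cauchy_Bseq[OF CS_Cauchy[of x]] unfolding Bseq_def by auto

text \<open>A Lipschitz criterion common to all operations on Cauchy sequences; unary operations use
  it with y = x.\<close>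

lemma CS_I:
  assumes "\<And>n. z n \<in> carrier P" "x \<in> CS" "y \<in> CS" "0 < L"
    and "\<And>m n. p (z m \<ominus> z n) \<le> L * (p (x m \<ominus> x n) + p (y m \<ominus> y n))"
  shows "z \<in> CS"
  unfolding cauchy_seqs_def
proof (intro CollectI conjI allI impI)
  fix e :: real assume "e > 0"
  then have e: "e / (2 * L) > 0" using assms by simp
  obtain M where M: "\<forall>m\<ge>M. \<forall>n\<ge>M. p (x m \<ominus> x n) < e / (2 * L)"
    using CS_D[OF assms(2) e] by blast
  obtain N where N: "\<forall>m\<ge>N. \<forall>n\<ge>N. p (y m \<ominus> y n) < e / (2 * L)"
    using CS_D[OF assms(3) e] by blast
  show "\<exists>N. \<forall>m\<ge>N. \<forall>n\<ge>N. p (z m \<ominus> z n) < e"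
  proof (intro exI allI impI)
    fix m n assume mn: "m \<ge> max M N" "n \<ge> max M N"
    have "p (z m \<ominus> z n) \<le> L * (p (x m \<ominus> x n) + p (y m \<ominus> y n))" by (rule assms)
    also have "\<dots> < L * (e / (2 * L) + e / (2 * L))"
      using mn assms(4) M N by (intro mult_strict_left_mono add_strict_mono) auto
    also have "\<dots> = e" using assms(4) by simp
    finally show "p (z m \<ominus> z n) < e" .
  qed
qed (use assms in auto)

lemma CS_const [simp]: "a \<in> carrier P \<Longrightarrow> (\<lambda>_. a) \<in> CS"
  by (simp add: cauchy_seqs_def del: CS_carrier)

lemma CS_add [simp]: "\<lbrakk>x \<in> CS; y \<in> CS\<rbrakk> \<Longrightarrow> (\<lambda>n. x n \<oplus> y n) \<in> CS"
  by (rule CS_I[of _ x y 1]) (auto simp: add_diff_add intro!: p_triangle)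

lemma CS_smult [simp]: "x \<in> CS \<Longrightarrow> (\<lambda>n. c \<odot> x n) \<in> CS"
  by (rule CS_I[of _ x x "cmod c + 1"]) (auto simp flip: smult_diff intro!: mult_mono add_nonneg_pos)

lemma CS_star [simp]: "x \<in> CS \<Longrightarrow> (\<lambda>n. star P (x n)) \<in> CS"
  by (rule CS_I[of _ x x 1]) (auto simp flip: star_diff)

lemma CS_mult [simp]: "\<lbrakk>x \<in> CS; y \<in> CS\<rbrakk> \<Longrightarrow> (\<lambda>n. x n \<otimes> y n) \<in> CS"
proof -
  assume x: "x \<in> CS" and y: "y \<in> CS"
  obtain M where M: "M > 0" "\<And>n. p (x n) \<le> M" using CS_bounded[OF x] by blast
  obtain N where N: "N > 0" "\<And>n. p (y n) \<le> N" using CS_bounded[OF y] by blast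
  show ?thesis
  proof (rule CS_I[OF _ x y, of _ "M + N"])
    fix m n
    have "p (x m \<otimes> y m \<ominus> x n \<otimes> y n) \<le> p (x m \<ominus> x n) * p (y m) + p (x n) * p (y m \<ominus> y n)"
      using x y by (simp add: p_mult_diff)
    also have "\<dots> \<le> p (x m \<ominus> x n) * (M + N) + (M + N) * p (y m \<ominus> y n)"
      using x y M(1) N(1) M(2)[of n] N(2)[of m] by (intro add_mono mult_mono) auto
    finally show "p (x m \<otimes> y m \<ominus> x n \<otimes> y n) \<le> (M + N) * (p (x m \<ominus> x n) + p (y m \<ominus> y n))"
      by (simp add: algebra_simps)
  qed (use x y M N in auto)
qed

text \<open>The equivalence of Cauchy sequences whose classes are the points of the
  completion.\<close>

definition nul :: "(nat \<Rightarrow> 'a) \<Rightarrow> (nat \<Rightarrow> 'a) \<Rightarrow> bool" where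
  "nul x y \<longleftrightarrow> (\<lambda>n. p (x n \<ominus> y n)) \<longlonglongrightarrow> 0"

lemma nulI:
  assumes "\<And>n. z n \<in> carrier P" "\<And>n. z' n \<in> carrier P" "g \<longlonglongrightarrow> 0"
    and "\<And>n. p (z n \<ominus> z' n) \<le> g n"
  shows "nul z z'"
  unfolding nul_def
  by (rule tendsto_sandwich[OF _ _ tendsto_const assms(3)]) (use assms in auto)

lemma nul_refl [simp]: "x \<in> CS \<Longrightarrow> nul x x"
  by (simp add: nul_def)

lemma nul_sym: "\<lbrakk>x \<in> CS; y \<in> CS; nul x y\<rbrakk> \<Longrightarrow> nul y x"
  by (simp add: nul_def p_diff_commute[of "y _"])

lemma nul_trans: "\<lbrakk>x \<in> CS; y \<in> CS; z \<in> CS; nul x y; nul y z\<rbrakk> \<Longrightarrow> nul x z"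
  unfolding nul_def
  by (rule nulI[unfolded nul_def, of _ _ "\<lambda>n. p (x n \<ominus> y n) + p (y n \<ominus> z n)"])
    (auto intro: p_triangle_diff tendsto_add_zero)

lemma nul_add: "\<lbrakk>x \<in> CS; y \<in> CS; x' \<in> CS; y' \<in> CS; nul x x'; nul y y'\<rbrakk>
    \<Longrightarrow> nul (\<lambda>n. x n \<oplus> y n) (\<lambda>n. x' n \<oplus> y' n)"
  by (rule nulI[of _ _ "\<lambda>n. p (x n \<ominus> x' n) + p (y n \<ominus> y' n)"])
    (auto simp: add_diff_add nul_def intro!: p_triangle tendsto_add_zero)

lemma nul_smult: "\<lbrakk>x \<in> CS; x' \<in> CS; nul x x'\<rbrakk> \<Longrightarrow> nul (\<lambda>n. c \<odot> x n) (\<lambda>n. c \<odot> x' n)"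
  unfolding nul_def by (simp flip: smult_diff add: tendsto_mult_right_zero)

lemma nul_star: "\<lbrakk>x \<in> CS; x' \<in> CS; nul x x'\<rbrakk> \<Longrightarrow> nul (\<lambda>n. star P (x n)) (\<lambda>n. star P (x' n))"
  unfolding nul_def by (simp flip: star_diff)

lemma nul_mult:
  assumes "x \<in> CS" "y \<in> CS" "x' \<in> CS" "y' \<in> CS" "nul x x'" "nul y y'"
  shows "nul (\<lambda>n. x n \<otimes> y n) (\<lambda>n. x' n \<otimes> y' n)"
proof -
  obtain M where M: "M > 0" "\<And>n. p (x' n) \<le> M" using CS_bounded[OF assms(3)] by blast
  obtain N where N: "N > 0" "\<And>n. p (y n) \<le> N" using CS_bounded[OF assms(2)] by blast
  show ?thesis
  proof (rule nulI[of _ _ "\<lambda>n. p (x n \<ominus> x' n) * N + M * p (y n \<ominus> y' n)"])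
    show "(\<lambda>n. p (x n \<ominus> x' n) * N + M * p (y n \<ominus> y' n)) \<longlonglongrightarrow> 0"
      using assms(5,6) unfolding nul_def
      by (intro tendsto_add_zero tendsto_mult_right_zero tendsto_mult_left_zero)
    fix n
    have "p (x n \<otimes> y n \<ominus> x' n \<otimes> y' n) \<le> p (x n \<ominus> x' n) * p (y n) + p (x' n) * p (y n \<ominus> y' n)"
      using assms by (simp add: p_mult_diff)
    also have "\<dots> \<le> p (x n \<ominus> x' n) * N + M * p (y n \<ominus> y' n)"
      using assms M(1) N(1) M(2)[of n] N(2)[of n] by (intro add_mono mult_mono) auto
    finally show "p (x n \<otimes> y n \<ominus> x' n \<otimes> y' n) \<le> p (x n \<ominus> x' n) * N + M * p (y n \<ominus> y' n)" .
  qed (use assms in auto)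
qed

lemma mem_cls: "y \<in> cls x \<longleftrightarrow> y \<in> CS \<and> nul x y"
  by (simp add: cauchy_class_def nul_def)

lemma cls_eq_iff: "\<lbrakk>x \<in> CS; y \<in> CS\<rbrakk> \<Longrightarrow> cls x = cls y \<longleftrightarrow> nul x y"
  by (auto simp: set_eq_iff mem_cls intro: nul_trans nul_sym)

lemma cls_self [simp]: "x \<in> CS \<Longrightarrow> x \<in> cls x"
  by (simp add: mem_cls)

lemma C_carrier: "X \<in> carrier C \<longleftrightarrow> (\<exists>x\<in>CS. X = cls x)"
  by (auto simp: completion_def)

lemma cls_closed [simp, intro]: "x \<in> CS \<Longrightarrow> cls x \<in> carrier C"
  by (auto simp: C_carrier)

text \<open>\<open>completion\<close> forms each operation as the union of the result classes over
  all representatives. Once the result class does not depend on the representative, this is a union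
  of equal sets.\<close>

lemma UN_cls:
  assumes "x \<in> CS" "F x \<in> CS" "\<And>x'. \<lbrakk>x' \<in> CS; nul x x'\<rbrakk> \<Longrightarrow> F x' \<in> CS \<and> nul (F x) (F x')"
  shows "(\<Union>x'\<in>cls x. cls (F x')) = cls (F x)"
proof (rule SUP_eq_const)
  fix x' assume "x' \<in> cls x"
  then have "F x' \<in> CS" "nul (F x) (F x')" using assms(3) by (auto simp: mem_cls)
  then show "cls (F x') = cls (F x)" using assms(2) cls_eq_iff by metis
qed (use assms(1) cls_self in blast)

lemma UN_cls2:
  assumes "x \<in> CS" "y \<in> CS" "F x y \<in> CS"
    and "\<And>x' y'. \<lbrakk>x' \<in> CS; nul x x'; y' \<in> CS; nul y y'\<rbrakk> \<Longrightarrow> F x' y' \<in> CS \<and> nul (F x y) (F x' y')"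
  shows "(\<Union>x'\<in>cls x. \<Union>y'\<in>cls y. cls (F x' y')) = cls (F x y)"
proof (rule SUP_eq_const)
  fix x' assume "x' \<in> cls x"
  then have x': "x' \<in> CS" "nul x x'" by (auto simp: mem_cls)
  show "(\<Union>y'\<in>cls y. cls (F x' y')) = cls (F x y)"
  proof (rule SUP_eq_const)
    fix y' assume "y' \<in> cls y"
    then have "F x' y' \<in> CS" "nul (F x y) (F x' y')" using assms(4) x' by (auto simp: mem_cls)
    then show "cls (F x' y') = cls (F x y)" using assms(3) cls_eq_iff by metis
  qed (use assms(2) cls_self in blast)
qed (use assms(1) cls_self in blast)

lemma C_add [simp]: "\<lbrakk>x \<in> CS; y \<in> CS\<rbrakk> \<Longrightarrow> cls x \<oplus>\<^bsub>C\<^esub> cls y = cls (\<lambda>n. x n \<oplus> y n)"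
  using UN_cls2[of x y "\<lambda>x y n. x n \<oplus> y n"] by (simp add: completion_def nul_add)

lemma C_mult [simp]: "\<lbrakk>x \<in> CS; y \<in> CS\<rbrakk> \<Longrightarrow> cls x \<otimes>\<^bsub>C\<^esub> cls y = cls (\<lambda>n. x n \<otimes> y n)"
  using UN_cls2[of x y "\<lambda>x y n. x n \<otimes> y n"] by (simp add: completion_def nul_mult)

lemma C_smult [simp]: "x \<in> CS \<Longrightarrow> c \<odot>\<^bsub>C\<^esub> cls x = cls (\<lambda>n. c \<odot> x n)"
  unfolding completion_def by (simp, rule UN_cls) (auto intro: nul_smult)

lemma C_star [simp]: "x \<in> CS \<Longrightarrow> star C (cls x) = cls (\<lambda>n. star P (x n))"
  unfolding completion_def by (simp, rule UN_cls) (auto intro: nul_star)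

lemma C_one: "\<one>\<^bsub>C\<^esub> = cls (\<lambda>_. \<one>)"
  by (simp add: completion_def)

lemma C_zero: "\<zero>\<^bsub>C\<^esub> = cls (\<lambda>_. \<zero>)"
  by (simp add: completion_def)

lemma C_nrm: "x \<in> CS \<Longrightarrow> (\<lambda>n. p (x n)) \<longlonglongrightarrow> nrm C (cls x)"
proof -
  assume x: "x \<in> CS"
  obtain r where r: "(\<lambda>n. p (x n)) \<longlonglongrightarrow> r"
    using CS_Cauchy[OF x] Cauchy_convergent_iff convergentD by blast
  \<comment> \<open>The \<open>THE\<close> in \<open>nrm\<close> quantifies over all
    representatives, so each of them must be shown to have the same limit.\<close>
  have conv: "(\<lambda>n. p (y n)) \<longlonglongrightarrow> r" if "y \<in> cls x" for y
  proof -
    from that have y: "y \<in> CS" "nul x y" by (auto simp: mem_cls)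
    have "(\<lambda>n. p (x n) - p (y n)) \<longlonglongrightarrow> 0"
      by (rule tendsto_rabs_zero_cancel, rule tendsto_sandwich[OF _ _ tendsto_const y(2)[unfolded nul_def]])
        (use x y p_abs_diff in auto)
    from Lim_transform2[OF r this] show ?thesis .
  qed
  have "(THE r. \<forall>y\<in>cls x. (\<lambda>n. p (y n)) \<longlonglongrightarrow> r) = r"
  proof (rule the_equality)
    fix s assume "\<forall>y\<in>cls x. (\<lambda>n. p (y n)) \<longlonglongrightarrow> s"
    with cls_self[OF x] have "(\<lambda>n. p (x n)) \<longlonglongrightarrow> s" by blast
    then show "s = r" using r by (rule LIMSEQ_unique)
  qed (use conv in blast)
  then show ?thesis using r by (simp add: completion_def)
qed

lemma C_nrm_eq: "\<lbrakk>x \<in> CS; (\<lambda>n. p (x n)) \<longlonglongrightarrow> r\<rbrakk> \<Longrightarrow> nrm C (cls x) = r"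
  by (rule LIMSEQ_unique[OF C_nrm])

lemma C_cases:
  assumes "X \<in> carrier C" obtains x where "x \<in> CS" "X = cls x"
  using assms C_carrier by blast

lemma star_algebra_completion: "star_algebra C"
proof -
  have inv: "\<exists>Y\<in>carrier C. Y \<oplus>\<^bsub>C\<^esub> X = \<zero>\<^bsub>C\<^esub>" if X: "X \<in> carrier C" for X
  proof -
    obtain x where x: "x \<in> CS" "X = cls x" using X by (rule C_cases)
    have eq: "(\<lambda>n. (-1) \<odot> x n \<oplus> x n) = (\<lambda>n. \<zero>)"
      using x smult_l_distr[of "x _" "-1" 1] by auto
    have "cls (\<lambda>n. (-1) \<odot> x n) \<oplus>\<^bsub>C\<^esub> X = \<zero>\<^bsub>C\<^esub>"
      using x eq by (simp add: C_zero)
    then show ?thesis using x by (metis CS_smult cls_closed)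
  qed
  have "abelian_group C"
  proof (rule abelian_groupI)
    show "\<And>X Y. \<lbrakk>X \<in> carrier C; Y \<in> carrier C\<rbrakk> \<Longrightarrow> X \<oplus>\<^bsub>C\<^esub> Y \<in> carrier C"
      by (erule C_cases, erule C_cases) simp
    show "\<zero>\<^bsub>C\<^esub> \<in> carrier C" by (simp add: C_zero)
    show "\<And>X Y Z. \<lbrakk>X \<in> carrier C; Y \<in> carrier C; Z \<in> carrier C\<rbrakk>
        \<Longrightarrow> X \<oplus>\<^bsub>C\<^esub> Y \<oplus>\<^bsub>C\<^esub> Z = X \<oplus>\<^bsub>C\<^esub> (Y \<oplus>\<^bsub>C\<^esub> Z)"
      by (erule C_cases, erule C_cases, erule C_cases) (simp add: a_assoc)
    show "\<And>X Y. \<lbrakk>X \<in> carrier C; Y \<in> carrier C\<rbrakk> \<Longrightarrow> X \<oplus>\<^bsub>C\<^esub> Y = Y \<oplus>\<^bsub>C\<^esub> X"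
      by (erule C_cases, erule C_cases) (simp add: a_comm)
    show "\<And>X. X \<in> carrier C \<Longrightarrow> \<zero>\<^bsub>C\<^esub> \<oplus>\<^bsub>C\<^esub> X = X"
      by (erule C_cases) (simp add: C_zero)
  qed (rule inv)
  moreover have "Group.monoid C"
  proof (rule monoidI)
    show "\<And>X Y. \<lbrakk>X \<in> carrier C; Y \<in> carrier C\<rbrakk> \<Longrightarrow> X \<otimes>\<^bsub>C\<^esub> Y \<in> carrier C"
      by (erule C_cases, erule C_cases) simp
    show "\<one>\<^bsub>C\<^esub> \<in> carrier C" by (simp add: C_one)
    show "\<And>X Y Z. \<lbrakk>X \<in> carrier C; Y \<in> carrier C; Z \<in> carrier C\<rbrakk>
        \<Longrightarrow> X \<otimes>\<^bsub>C\<^esub> Y \<otimes>\<^bsub>C\<^esub> Z = X \<otimes>\<^bsub>C\<^esub> (Y \<otimes>\<^bsub>C\<^esub> Z)"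
      by (erule C_cases, erule C_cases, erule C_cases) (simp add: m_assoc)
    show "\<And>X. X \<in> carrier C \<Longrightarrow> \<one>\<^bsub>C\<^esub> \<otimes>\<^bsub>C\<^esub> X = X" "\<And>X. X \<in> carrier C \<Longrightarrow> X \<otimes>\<^bsub>C\<^esub> \<one>\<^bsub>C\<^esub> = X"
      by (erule C_cases, simp add: C_one)+
  qed
  ultimately have "ring C"
  proof (rule ringI)
    fix X Y Z assume "X \<in> carrier C" "Y \<in> carrier C" "Z \<in> carrier C"
    then show "(X \<oplus>\<^bsub>C\<^esub> Y) \<otimes>\<^bsub>C\<^esub> Z = X \<otimes>\<^bsub>C\<^esub> Z \<oplus>\<^bsub>C\<^esub> Y \<otimes>\<^bsub>C\<^esub> Z"
      and "Z \<otimes>\<^bsub>C\<^esub> (X \<oplus>\<^bsub>C\<^esub> Y) = Z \<otimes>\<^bsub>C\<^esub> X \<oplus>\<^bsub>C\<^esub> Z \<otimes>\<^bsub>C\<^esub> Y"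
      by (erule_tac C_cases, erule_tac C_cases, erule_tac C_cases, simp add: l_distr r_distr)+
  qed
  then show ?thesis
  proof (rule star_algebra.intro, unfold_locales)
    fix X Y c d assume XY: "X \<in> carrier C" "Y \<in> carrier C"
    obtain x y where x: "x \<in> CS" "X = cls x" and y: "y \<in> CS" "Y = cls y"
      using XY by (meson C_cases)
    show "c \<odot>\<^bsub>C\<^esub> (X \<oplus>\<^bsub>C\<^esub> Y) = c \<odot>\<^bsub>C\<^esub> X \<oplus>\<^bsub>C\<^esub> c \<odot>\<^bsub>C\<^esub> Y"
      and "(c \<odot>\<^bsub>C\<^esub> X) \<otimes>\<^bsub>C\<^esub> Y = c \<odot>\<^bsub>C\<^esub> (X \<otimes>\<^bsub>C\<^esub> Y)" and "X \<otimes>\<^bsub>C\<^esub> (c \<odot>\<^bsub>C\<^esub> Y) = c \<odot>\<^bsub>C\<^esub> (X \<otimes>\<^bsub>C\<^esub> Y)"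
      and "star C (X \<oplus>\<^bsub>C\<^esub> Y) = star C X \<oplus>\<^bsub>C\<^esub> star C Y" and "star C (X \<otimes>\<^bsub>C\<^esub> Y) = star C Y \<otimes>\<^bsub>C\<^esub> star C X"
      using x y by (simp_all add: smult_r_distr)
  next
    fix X c d assume "X \<in> carrier C"
    then obtain x where x: "x \<in> CS" "X = cls x" by (rule C_cases)
    show "c \<odot>\<^bsub>C\<^esub> X \<in> carrier C" "(c + d) \<odot>\<^bsub>C\<^esub> X = c \<odot>\<^bsub>C\<^esub> X \<oplus>\<^bsub>C\<^esub> d \<odot>\<^bsub>C\<^esub> X"
      "c \<odot>\<^bsub>C\<^esub> (d \<odot>\<^bsub>C\<^esub> X) = (c * d) \<odot>\<^bsub>C\<^esub> X" "1 \<odot>\<^bsub>C\<^esub> X = X"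
      "star C X \<in> carrier C" "star C (star C X) = X" "star C (c \<odot>\<^bsub>C\<^esub> X) = cnj c \<odot>\<^bsub>C\<^esub> star C X"
      using x by (simp_all add: smult_l_distr)
  qed
qed

end

declare seminormed_star_algebra.CS_carrier [simp del]

section \<open>C*-algebras, and the completion as one of them\<close>

lemma LIMSEQ_0_bound:
  fixes f :: "nat \<Rightarrow> real"
  assumes "f \<longlonglongrightarrow> 0" "e > 0"
  shows "\<exists>N. \<forall>n\<ge>N. f n < e"
  using order_tendstoD(2)[OF assms] by (simp add: eventually_sequentially)

locale cstar_algebra = star_algebra A for A :: "'a cstar" (structure) +
  assumes seminorm_nrm: "cstar_seminorm A (nrm A)"
    and nrm_eq_zero: "\<lbrakk>x \<in> carrier A; nrm A x = 0\<rbrakk> \<Longrightarrow> x = \<zero>"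
    and complete: "s \<in> cauchy_seqs A (nrm A) \<Longrightarrow>
      \<exists>l\<in>carrier A. (\<lambda>n. nrm A (s n \<ominus> l)) \<longlonglongrightarrow> 0"

sublocale cstar_algebra \<subseteq> seminormed_star_algebra A "nrm A"
  by unfold_locales (rule seminorm_nrm)

context seminormed_star_algebra
begin

lemma CS_diff [simp]: "\<lbrakk>x \<in> CS; y \<in> CS\<rbrakk> \<Longrightarrow> (\<lambda>n. x n \<ominus> y n) \<in> CS"
  using CS_add[OF _ CS_smult[of y "-1"], of x] by (simp add: a_minus_eq CS_carrier)

lemma C_diff [simp]: "\<lbrakk>x \<in> CS; y \<in> CS\<rbrakk> \<Longrightarrow> cls x \<ominus>\<^bsub>C\<^esub> cls y = cls (\<lambda>n. x n \<ominus> y n)"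
  using star_algebra.a_minus_eq[OF star_algebra_completion, of "cls x" "cls y"]
  by (simp add: a_minus_eq CS_carrier)

lemma to_completion_eq: "to_completion P p a = cls (\<lambda>_. a)"
  by (simp add: to_completion_def)

lemma to_completion_closed [simp, intro]: "a \<in> carrier P \<Longrightarrow> to_completion P p a \<in> carrier C"
  by (simp add: to_completion_eq)

lemma star_hom_to_completion: "star_hom P C (to_completion P p)"
  by (rule star_homI) (simp_all add: to_completion_eq C_one)

lemma nrm_to_completion [simp]: "a \<in> carrier P \<Longrightarrow> nrm C (to_completion P p a) = p a"
  by (simp add: to_completion_eq C_nrm_eq)

lemma seminorm_completion: "cstar_seminorm C (nrm C)"
  unfolding cstar_seminorm_def
proof (intro conjI ballI allI)
  fix X assume "X \<in> carrier C"
  then obtain x where x: "x \<in> CS" "X = cls x" by (rule C_cases)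
  have l: "(\<lambda>n. p (x n)) \<longlonglongrightarrow> nrm C X" using C_nrm x by simp
  show "0 \<le> nrm C X" by (rule LIMSEQ_le_const[OF l]) (use x CS_carrier in auto)
  show "nrm C (c \<odot>\<^bsub>C\<^esub> X) = cmod c * nrm C X" for c
    using x tendsto_mult_left[OF l, of "cmod c"] by (simp add: C_nrm_eq CS_carrier)
  show "nrm C (star C X \<otimes>\<^bsub>C\<^esub> X) = (nrm C X)\<^sup>2"
    using x tendsto_power[OF l, of 2] by (simp add: C_nrm_eq CS_carrier p_cstar)
  fix Y assume "Y \<in> carrier C"
  then obtain y where y: "y \<in> CS" "Y = cls y" by (rule C_cases)
  have l': "(\<lambda>n. p (y n)) \<longlonglongrightarrow> nrm C Y" using C_nrm y by simp
  have "(\<lambda>n. p (x n \<oplus> y n)) \<longlonglongrightarrow> nrm C (X \<oplus>\<^bsub>C\<^esub> Y)" using x y by (simp add: C_nrm)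
  then show "nrm C (X \<oplus>\<^bsub>C\<^esub> Y) \<le> nrm C X + nrm C Y"
    by (rule LIMSEQ_le[OF _ tendsto_add[OF l l']]) (use x y CS_carrier p_triangle in blast)
  have "(\<lambda>n. p (x n \<otimes> y n)) \<longlonglongrightarrow> nrm C (X \<otimes>\<^bsub>C\<^esub> Y)" using x y by (simp add: C_nrm)
  then show "nrm C (X \<otimes>\<^bsub>C\<^esub> Y) \<le> nrm C X * nrm C Y"
    by (rule LIMSEQ_le[OF _ tendsto_mult[OF l l']]) (use x y CS_carrier p_mult in blast)
qed

lemma completion_dense:
  assumes "X \<in> carrier C" "e > 0"
  obtains a where "a \<in> carrier P" "nrm C (to_completion P p a \<ominus>\<^bsub>C\<^esub> X) < e"
proof -
  obtain x where x: "x \<in> CS" "X = cls x" using assms by (meson C_cases)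
  then obtain N where N: "\<forall>m\<ge>N. \<forall>n\<ge>N. p (x m \<ominus> x n) < e / 2"
    using CS_D[of x "e/2"] assms by auto
  have xN: "x N \<in> carrier P" using x CS_carrier by blast
  have "(\<lambda>n. p (x N \<ominus> x n)) \<longlonglongrightarrow> nrm C (to_completion P p (x N) \<ominus>\<^bsub>C\<^esub> X)"
    using x xN by (simp add: C_nrm to_completion_eq)
  then have "nrm C (to_completion P p (x N) \<ominus>\<^bsub>C\<^esub> X) \<le> e / 2"
    by (rule LIMSEQ_le_const2) (use N less_imp_le in blast)
  then show thesis using that[OF xN] assms by auto
qed

lemma cstar_algebra_completion: "cstar_algebra C"
proof -
  interpret C: star_algebra C by (rule star_algebra_completion)
  interpret C: seminormed_star_algebra C "nrm C"
    by unfold_locales (rule seminorm_completion)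
  show ?thesis
  proof (unfold_locales)
    show "cstar_seminorm C (nrm C)" by (rule seminorm_completion)
    fix X assume X: "X \<in> carrier C" "nrm C X = 0"
    then obtain x where x: "x \<in> CS" "X = cls x" by (meson C_cases)
    then have "(\<lambda>n. p (x n)) \<longlonglongrightarrow> 0" using C_nrm X by metis
    then have "nul x (\<lambda>_. \<zero>)" using x by (simp add: nul_def CS_carrier)
    then show "X = \<zero>\<^bsub>C\<^esub>" using x by (simp add: C_zero cls_eq_iff)
  next
    fix X assume X: "X \<in> cauchy_seqs C (nrm C)"
    have Xc: "X n \<in> carrier C" for n using X C.CS_carrier by blast
    \<comment> \<open>Each X n is replaced by a point z n of P at distance below 1/(n+1). The
      sequence z is then Cauchy in P, and its class is the limit of X.\<close>
    have "\<exists>a. a \<in> carrier P \<and> nrm C (to_completion P p a \<ominus>\<^bsub>C\<^esub> X n) < 1 / real (Suc n)" for n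
      using completion_dense[OF Xc[of n], of "1 / real (Suc n)"] by auto
    then obtain z where z: "\<And>n. z n \<in> carrier P"
      "\<And>n. nrm C (to_completion P p (z n) \<ominus>\<^bsub>C\<^esub> X n) < 1 / real (Suc n)" by metis
    interpret T: star_morphism P C "to_completion P p"
      by unfold_locales (rule star_hom_to_completion)
    have zX: "(\<lambda>n. nrm C (to_completion P p (z n) \<ominus>\<^bsub>C\<^esub> X n)) \<longlonglongrightarrow> 0"
      by (rule tendsto_sandwich[OF _ _ tendsto_const LIMSEQ_inverse_real_of_nat])
        (use z Xc in \<open>auto simp: inverse_eq_divide intro!: always_eventually less_imp_le\<close>)
    have dist: "p (z m \<ominus> z n) \<le> nrm C (to_completion P p (z m) \<ominus>\<^bsub>C\<^esub> X m) + nrm C (X m \<ominus>\<^bsub>C\<^esub> X n)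
        + nrm C (to_completion P p (z n) \<ominus>\<^bsub>C\<^esub> X n)" for m n
    proof -
      have "p (z m \<ominus> z n) = nrm C (to_completion P p (z m) \<ominus>\<^bsub>C\<^esub> to_completion P p (z n))"
        using z by (simp flip: T.map_minus)
      also have "\<dots> \<le> nrm C (to_completion P p (z m) \<ominus>\<^bsub>C\<^esub> X m) + nrm C (X m \<ominus>\<^bsub>C\<^esub> to_completion P p (z n))"
        using z Xc by (intro C.p_triangle_diff) auto
      also have "nrm C (X m \<ominus>\<^bsub>C\<^esub> to_completion P p (z n)) \<le> nrm C (X m \<ominus>\<^bsub>C\<^esub> X n) + nrm C (X n \<ominus>\<^bsub>C\<^esub> to_completion P p (z n))"
        using z Xc by (intro C.p_triangle_diff) auto
      finally show ?thesis using z Xc C.p_diff_commute[of "X n" "to_completion P p (z n)"] by simp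
    qed
    have zCS: "z \<in> CS"
      unfolding cauchy_seqs_def
    proof (intro CollectI conjI allI impI)
      fix e :: real assume e: "e > 0"
      obtain M where M: "\<forall>m\<ge>M. \<forall>n\<ge>M. nrm C (X m \<ominus>\<^bsub>C\<^esub> X n) < e / 3"
        using C.CS_D[OF X, of "e/3"] e by auto
      obtain N where N: "\<forall>n\<ge>N. nrm C (to_completion P p (z n) \<ominus>\<^bsub>C\<^esub> X n) < e / 3"
        using LIMSEQ_0_bound[OF zX, of "e / 3"] e by auto
      show "\<exists>N. \<forall>m\<ge>N. \<forall>n\<ge>N. p (z m \<ominus> z n) < e"
      proof (intro exI allI impI)
        fix m n assume mn: "m \<ge> max M N" "n \<ge> max M N"
        then have "nrm C (X m \<ominus>\<^bsub>C\<^esub> X n) < e / 3" "nrm C (to_completion P p (z m) \<ominus>\<^bsub>C\<^esub> X m) < e / 3"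
          "nrm C (to_completion P p (z n) \<ominus>\<^bsub>C\<^esub> X n) < e / 3" using M N by auto
        then show "p (z m \<ominus> z n) < e" using dist[of m n] by linarith
      qed
    qed (rule z)
    have "(\<lambda>n. nrm C (X n \<ominus>\<^bsub>C\<^esub> cls z)) \<longlonglongrightarrow> 0"
    proof (rule LIMSEQ_I)
      fix e :: real assume e: "e > 0"
      obtain M where M: "\<forall>m\<ge>M. \<forall>n\<ge>M. p (z m \<ominus> z n) < e / 3" using CS_D[OF zCS, of "e/3"] e by auto
      obtain N where N: "\<forall>n\<ge>N. nrm C (to_completion P p (z n) \<ominus>\<^bsub>C\<^esub> X n) < e / 3"
        using LIMSEQ_0_bound[OF zX, of "e / 3"] e by auto
      have "nrm C (X n \<ominus>\<^bsub>C\<^esub> cls z) < e" if n: "n \<ge> max M N" for n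
      proof -
        have "(\<lambda>m. p (z n \<ominus> z m)) \<longlonglongrightarrow> nrm C (to_completion P p (z n) \<ominus>\<^bsub>C\<^esub> cls z)"
          using zCS z by (simp add: C_nrm to_completion_eq)
        then have "nrm C (to_completion P p (z n) \<ominus>\<^bsub>C\<^esub> cls z) \<le> e / 3"
          by (rule LIMSEQ_le_const2) (use M n less_imp_le in \<open>meson max.boundedE\<close>)
        moreover have "nrm C (X n \<ominus>\<^bsub>C\<^esub> cls z) \<le> nrm C (X n \<ominus>\<^bsub>C\<^esub> to_completion P p (z n))
            + nrm C (to_completion P p (z n) \<ominus>\<^bsub>C\<^esub> cls z)"
          using z zCS Xc by (intro C.p_triangle_diff) auto
        moreover have "nrm C (X n \<ominus>\<^bsub>C\<^esub> to_completion P p (z n)) < e / 3"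
          using N n C.p_diff_commute[of "X n" "to_completion P p (z n)"] z Xc by auto
        ultimately show ?thesis using e by linarith
      qed
      then show "\<exists>N. \<forall>n\<ge>N. norm (nrm C (X n \<ominus>\<^bsub>C\<^esub> cls z) - 0) < e"
        using C.p_nonneg[OF C.minus_closed[OF Xc cls_closed[OF zCS]]] by (intro exI[of _ "max M N"]) auto
    qed
    then show "\<exists>l\<in>carrier C. (\<lambda>n. nrm C (X n \<ominus>\<^bsub>C\<^esub> l)) \<longlonglongrightarrow> 0" using zCS by blast
  qed
qed

end

section \<open>Limits in a C*-algebra and extension of homomorphisms to completions\<close>

context cstar_algebra
begin

definition converges :: "(nat \<Rightarrow> 'a) \<Rightarrow> 'a \<Rightarrow> bool" where
  "converges x l \<longleftrightarrow> (\<forall>n. x n \<in> carrier A) \<and> l \<in> carrier A \<and> (\<lambda>n. nrm A (x n \<ominus> l)) \<longlonglongrightarrow> 0"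

text \<open>Convergence is rephrased as equivalence to a constant sequence, so that the limit laws
  become the well-definedness facts \<open>nul_add\<close>, \<open>nul_mult\<close> and so
  on.\<close>

lemma converges_iff: "converges x l \<longleftrightarrow> x \<in> CS \<and> l \<in> carrier A \<and> nul x (\<lambda>_. l)"
proof
  assume c: "converges x l"
  have "x \<in> CS"
    unfolding cauchy_seqs_def
  proof (intro CollectI conjI allI impI)
    fix e :: real assume e: "e > 0"
    obtain N where N: "\<forall>n\<ge>N. nrm A (x n \<ominus> l) < e / 2"
      using LIMSEQ_0_bound[of "\<lambda>n. nrm A (x n \<ominus> l)" "e / 2"] c e by (auto simp: converges_def)
    have "nrm A (x m \<ominus> x n) < e" if mn: "m \<ge> N" "n \<ge> N" for m n
    proof -
      have "nrm A (x m \<ominus> l) < e / 2" "nrm A (x n \<ominus> l) < e / 2" using N mn by auto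
      then show ?thesis
        using p_triangle_diff[of "x m" l "x n"] p_diff_commute[of l "x n"] c
        by (auto simp: converges_def)
    qed
    then show "\<exists>N. \<forall>m\<ge>N. \<forall>n\<ge>N. nrm A (x m \<ominus> x n) < e" by blast
  qed (use c in \<open>auto simp: converges_def\<close>)
  then show "x \<in> CS \<and> l \<in> carrier A \<and> nul x (\<lambda>_. l)" using c by (simp add: converges_def nul_def)
qed (auto simp: converges_def nul_def CS_carrier)

lemma converges_unique: "\<lbrakk>converges x l; converges x l'\<rbrakk> \<Longrightarrow> l = l'"
proof -
  assume a: "converges x l" "converges x l'"
  then have "nul (\<lambda>_. l) (\<lambda>_. l')" unfolding converges_iff
    using nul_trans[of "\<lambda>_. l" x "\<lambda>_. l'"] nul_sym[of x "\<lambda>_. l"] by simp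
  then have "nrm A (l \<ominus> l') = 0" by (auto simp: nul_def LIMSEQ_const_iff)
  then show ?thesis using a nrm_eq_zero[of "l \<ominus> l'"] by (auto simp: converges_def)
qed

lemma converges_const: "l \<in> carrier A \<Longrightarrow> converges (\<lambda>_. l) l"
  by (simp add: converges_iff)

lemma converges_add: "\<lbrakk>converges x l; converges y m\<rbrakk> \<Longrightarrow> converges (\<lambda>n. x n \<oplus> y n) (l \<oplus> m)"
  by (auto simp: converges_iff intro: nul_add)

lemma converges_mult: "\<lbrakk>converges x l; converges y m\<rbrakk> \<Longrightarrow> converges (\<lambda>n. x n \<otimes> y n) (l \<otimes> m)"
  by (auto simp: converges_iff intro: nul_mult)

lemma converges_smult: "converges x l \<Longrightarrow> converges (\<lambda>n. c \<odot> x n) (c \<odot> l)"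
  by (auto simp: converges_iff intro: nul_smult)

lemma converges_star: "converges x l \<Longrightarrow> converges (\<lambda>n. star A (x n)) (star A l)"
  by (auto simp: converges_iff intro: nul_star)

lemma converges_ex: "x \<in> CS \<Longrightarrow> \<exists>l. converges x l"
  using complete[of x] by (auto simp: converges_def CS_carrier)

end

text \<open>The bound by p makes f carry Cauchy sequences to Cauchy sequences and equivalent ones to
  equivalent ones, so the limit of the images depends on the class alone and can serve as the value
  of the extension.\<close>

lemma (in seminormed_star_algebra) completion_extend:
  fixes D :: "'d cstar"
  assumes D: "cstar_algebra D" and f: "star_hom P D f"
    and le: "\<And>x. x \<in> carrier P \<Longrightarrow> nrm D (f x) \<le> p x"
  shows "\<exists>F. star_hom C D F \<and> (\<forall>x\<in>carrier P. F (to_completion P p x) = f x)"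
proof -
  interpret D: cstar_algebra D by (rule D)
  interpret f: star_morphism P D f by unfold_locales (rule f)
  have nul: "D.nul (\<lambda>n. f (x n)) (\<lambda>n. f (y n))" if "x \<in> CS" "y \<in> CS" "nul x y" for x y
    by (rule D.nulI[of _ _ "\<lambda>n. p (x n \<ominus> y n)"])
      (use that le[of "x _ \<ominus> y _"] in \<open>auto simp: CS_carrier nul_def\<close>)
  have fCS: "(\<lambda>n. f (x n)) \<in> D.CS" if x: "x \<in> CS" for x
    unfolding cauchy_seqs_def
  proof (intro CollectI conjI allI impI)
    fix e :: real assume "e > 0"
    then obtain N where N: "\<forall>m\<ge>N. \<forall>n\<ge>N. p (x m \<ominus> x n) < e" using CS_D x by blast
    have "nrm D (f (x m) \<ominus>\<^bsub>D\<^esub> f (x n)) \<le> p (x m \<ominus> x n)" for m n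
      using le[of "x m \<ominus> x n"] x by (simp add: CS_carrier)
    with N show "\<exists>N. \<forall>m\<ge>N. \<forall>n\<ge>N. nrm D (f (x m) \<ominus>\<^bsub>D\<^esub> f (x n)) < e" by (meson le_less_trans)
  qed (use x in \<open>auto simp: CS_carrier\<close>)
  define F where "F X = (THE l. \<forall>x\<in>X. D.converges (\<lambda>n. f (x n)) l)" for X
  have F: "F (cls x) = l" if x: "x \<in> CS" and l: "D.converges (\<lambda>n. f (x n)) l" for x l
    unfolding F_def
  proof (rule the_equality)
    show "\<forall>y\<in>cls x. D.converges (\<lambda>n. f (y n)) l"
    proof
      fix y assume "y \<in> cls x"
      then have y: "y \<in> CS" "nul y x" using x nul_sym by (auto simp: mem_cls)
      show "D.converges (\<lambda>n. f (y n)) l" using l fCS[OF x] fCS[OF y(1)] nul[OF y(1) x y(2)]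
        by (auto simp: D.converges_iff intro: D.nul_trans)
    qed
  next
    fix l' assume "\<forall>y\<in>cls x. D.converges (\<lambda>n. f (y n)) l'"
    then show "l' = l" using l cls_self[OF x] D.converges_unique by blast
  qed
  have conv: "D.converges (\<lambda>n. f (x n)) (F (cls x))" if x: "x \<in> CS" for x
    using D.converges_ex[OF fCS[OF x]] F[OF x] by auto
  have "star_hom C D F"
  proof (rule star_homI)
    fix X assume "X \<in> carrier C"
    then obtain x where x: "x \<in> CS" "X = cls x" by (rule C_cases)
    show "F X \<in> carrier D" using conv[OF x(1)] x by (simp add: D.converges_def)
    show "F (c \<odot>\<^bsub>C\<^esub> X) = c \<odot>\<^bsub>D\<^esub> F X" for c
      using D.converges_smult[OF conv[OF x(1)], of c] x by (simp add: F CS_carrier)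
    show "F (star C X) = star D (F X)"
      using D.converges_star[OF conv[OF x(1)]] x by (simp add: F CS_carrier)
    fix Y assume "Y \<in> carrier C"
    then obtain y where y: "y \<in> CS" "Y = cls y" by (rule C_cases)
    show "F (X \<oplus>\<^bsub>C\<^esub> Y) = F X \<oplus>\<^bsub>D\<^esub> F Y"
      using D.converges_add[OF conv[OF x(1)] conv[OF y(1)]] x y by (simp add: F CS_carrier)
    show "F (X \<otimes>\<^bsub>C\<^esub> Y) = F X \<otimes>\<^bsub>D\<^esub> F Y"
      using D.converges_mult[OF conv[OF x(1)] conv[OF y(1)]] x y by (simp add: F CS_carrier)
  next
    show "F \<one>\<^bsub>C\<^esub> = \<one>\<^bsub>D\<^esub>" using D.converges_const[of "\<one>\<^bsub>D\<^esub>"] by (simp add: F C_one)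
  qed
  moreover have "F (to_completion P p x) = f x" if "x \<in> carrier P" for x
    using that D.converges_const[of "f x"] by (simp add: F to_completion_eq)
  ultimately show ?thesis by (intro exI[of _ F]) simp
qed

section \<open>Square roots, contractivity and sums of squares\<close>

lemma (in star_algebra) add_add_swap:
  "\<lbrakk>a \<in> carrier A; b \<in> carrier A; c \<in> carrier A; d \<in> carrier A\<rbrakk>
    \<Longrightarrow> (a \<oplus> b) \<oplus> (c \<oplus> d) = (a \<oplus> c) \<oplus> (b \<oplus> d)"
  by (simp add: a_ac)

lemma (in star_algebra) finsum_diff:
  assumes "f \<in> S \<rightarrow> carrier A" "g \<in> S \<rightarrow> carrier A"
  shows "(\<Oplus>i\<in>S. f i \<ominus> g i) = (\<Oplus>i\<in>S. f i) \<ominus> (\<Oplus>i\<in>S. g i)"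
  using assms by (induction S rule: infinite_finite_induct)
    (auto simp: finsum_insert Pi_def finsum_closed add_diff_add)

lemma (in star_algebra) eq_diffI:
  assumes "s \<oplus> r = c" "s \<in> carrier A" "r \<in> carrier A"
  shows "r = c \<ominus> s"
proof -
  have "c = r \<oplus> s" using assms(1) a_comm[OF assms(2,3)] by simp
  then show ?thesis using assms(2,3) by (simp add: a_minus_def a_assoc r_neg)
qed

context cstar_algebra
begin

text \<open>Distances between the y n are dominated by differences of partial sums of the geometric
  series.\<close>

lemma CS_of_geometric:
  assumes "\<And>n. y n \<in> carrier A" "0 \<le> r" "r < 1" "\<And>n. nrm A (y (Suc n) \<ominus> y n) \<le> r ^ n"
  shows "y \<in> CS"
proof -
  define s where "s n = (\<Sum>k<n. r ^ k)" for n
  have le: "nrm A (y m \<ominus> y n) \<le> s m - s n" if "n \<le> m" for m n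
    using that
  proof (induction m rule: dec_induct)
    case (step m)
    have "nrm A (y (Suc m) \<ominus> y n) \<le> nrm A (y (Suc m) \<ominus> y m) + nrm A (y m \<ominus> y n)"
      using assms by (intro p_triangle_diff) auto
    then show ?case using step assms(4)[of m] by (simp add: s_def)
  qed (use assms in auto)
  have sym: "nrm A (y m \<ominus> y n) \<le> \<bar>s m - s n\<bar>" for m n
    using le[of n m] le[of m n] p_diff_commute[of "y m" "y n"] assms(1) by (cases "n \<le> m") auto
  have "summable (\<lambda>k. r ^ k)" using assms by (intro summable_geometric) auto
  then have "Cauchy s" unfolding s_def
    by (simp add: summable_iff_convergent Cauchy_convergent_iff)
  show ?thesis unfolding cauchy_seqs_def
  proof (intro CollectI conjI allI impI)
    fix e :: real assume "e > 0"
    with \<open>Cauchy s\<close> obtain N where N: "\<forall>m\<ge>N. \<forall>n\<ge>N. \<bar>s m - s n\<bar> < e"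
      unfolding Cauchy_def dist_real_def by blast
    show "\<exists>N. \<forall>m\<ge>N. \<forall>n\<ge>N. nrm A (y m \<ominus> y n) < e"
      by (rule exI[of _ N]) (use N sym le_less_trans in blast)
  qed (rule assms)
qed

text \<open>The square root is \<open>1 - l\<close>, where \<open>l\<close> is the fixed point of the contraction
  \<open>y \<mapsto> (h + y\<^sup>2) / 2\<close>.\<close>

lemma sqrt_one_minus:
  assumes h: "h \<in> carrier A" "star A h = h" "nrm A h < 1"
  obtains k where "k \<in> carrier A" "star A k = k" "k \<otimes> k = \<one> \<ominus> h"
    "\<forall>g\<in>carrier A. g \<otimes> h = h \<otimes> g \<longrightarrow> g \<otimes> k = k \<otimes> g"
proof -
  define y where "y = rec_nat \<zero> (\<lambda>_ z. (1/2) \<odot> (h \<oplus> z \<otimes> z))"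
  have y0: "y 0 = \<zero>" and yS: "y (Suc n) = (1/2) \<odot> (h \<oplus> y n \<otimes> y n)" for n
    by (simp_all add: y_def)
  \<comment> \<open>The scalar fixed point of the iteration, that is, the smaller root of t^2 - 2 t
    + |h| = 0. It is below 1 because |h| < 1; it bounds the norms of all y n and is also the
    contraction rate.\<close>
  define r where "r = 1 - sqrt (1 - nrm A h)"
  have r: "0 \<le> r" "r < 1" "nrm A h + r * r = 2 * r"
    using h p_nonneg[of h] by (auto simp: r_def algebra_simps)
  have yc [simp]: "y n \<in> carrier A" for n by (induction n) (use h in \<open>auto simp: y0 yS\<close>)
  have ystar: "star A (y n) = y n" for n by (induction n) (use h in \<open>auto simp: y0 yS\<close>)
  have ynrm: "nrm A (y n) \<le> r" for n
  proof (induction n)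
    case (Suc n)
    have "nrm A (y (Suc n)) = nrm A (h \<oplus> y n \<otimes> y n) / 2" using h by (simp add: yS)
    also have "\<dots> \<le> (nrm A h + nrm A (y n) * nrm A (y n)) / 2"
      using p_triangle[of h "y n \<otimes> y n"] p_mult[of "y n" "y n"] h by simp
    also have "\<dots> \<le> (nrm A h + r * r) / 2"
      using mult_mono[OF Suc Suc r(1) p_nonneg[OF yc]] by simp
    finally show ?case using r by simp
  qed (use r in \<open>simp add: y0\<close>)
  have step: "nrm A (y (Suc n) \<ominus> y n) \<le> r ^ n" for n
  proof (induction n)
    case 0
    then show ?case using ynrm[of 1] r by (simp add: y0)
  next
    case (Suc n)
    have eq: "y (Suc (Suc n)) \<ominus> y (Suc n) = (1/2) \<odot> ((y (Suc n) \<ominus> y n) \<otimes> y (Suc n) \<oplus> y n \<otimes> (y (Suc n) \<ominus> y n))"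
      unfolding yS[of "Suc n"]
      using h by (subst yS[of n]) (simp add: add_diff_add mult_diff_mult[of "y (Suc n)" "y (Suc n)" "y n" "y n"] flip: smult_diff)
    have "nrm A (y (Suc (Suc n)) \<ominus> y (Suc n))
        = nrm A ((y (Suc n) \<ominus> y n) \<otimes> y (Suc n) \<oplus> y n \<otimes> (y (Suc n) \<ominus> y n)) / 2"
      unfolding eq by (subst p_smult) auto
    also have "\<dots> \<le> (nrm A (y (Suc n) \<ominus> y n) * nrm A (y (Suc n)) + nrm A (y n) * nrm A (y (Suc n) \<ominus> y n)) / 2"
      using p_triangle[of "(y (Suc n) \<ominus> y n) \<otimes> y (Suc n)" "y n \<otimes> (y (Suc n) \<ominus> y n)"]
        p_mult[of "y (Suc n) \<ominus> y n" "y (Suc n)"] p_mult[of "y n" "y (Suc n) \<ominus> y n"] by simp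
    also have "\<dots> \<le> (r ^ n * r + r * r ^ n) / 2"
      using Suc ynrm r by (intro divide_right_mono add_mono mult_mono) auto
    finally show ?case by simp
  qed
  obtain l where l: "converges y l"
    using converges_ex[OF CS_of_geometric[OF yc r(1,2) step]] by blast
  then have lc [simp]: "l \<in> carrier A" by (simp add: converges_def)
  have "converges (\<lambda>n. y (Suc n)) l"
    using l LIMSEQ_Suc[of "\<lambda>n. nrm A (y n \<ominus> l)" 0] by (simp add: converges_def)
  moreover have "converges (\<lambda>n. y (Suc n)) ((1/2) \<odot> (h \<oplus> l \<otimes> l))"
    unfolding yS by (intro converges_smult converges_add converges_const converges_mult l h)
  ultimately have leq: "l = (1/2) \<odot> (h \<oplus> l \<otimes> l)" by (rule converges_unique)
  have ll: "l \<otimes> l = (2 \<odot> l) \<ominus> h"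
  proof -
    have "2 \<odot> ((1/2) \<odot> (h \<oplus> l \<otimes> l)) = l \<otimes> l \<oplus> h" using h by (simp add: a_comm)
    then have "2 \<odot> l = l \<otimes> l \<oplus> h" unfolding leq[symmetric] .
    then show ?thesis using h by (simp add: a_minus_def a_assoc r_neg)
  qed
  have ls: "star A l = l" using converges_star[OF l] l converges_unique by (simp add: ystar)
  \<comment> \<open>An element commuting with h commutes with every y n, hence with the limit. This
    is needed for the square root of 1 - h^2, which has to commute with h.\<close>
  have lcomm: "g \<otimes> l = l \<otimes> g" if g: "g \<in> carrier A" "g \<otimes> h = h \<otimes> g" for g
  proof -
    have gy: "g \<otimes> y n = y n \<otimes> g" for n
    proof (induction n)
      case (Suc n)
      have "g \<otimes> (y n \<otimes> y n) = (y n \<otimes> y n) \<otimes> g" using Suc g yc by (metis m_assoc)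
      then show ?case using g h by (simp add: yS r_distr l_distr)
    qed (use g in \<open>simp add: y0\<close>)
    have "converges (\<lambda>n. g \<otimes> y n) (g \<otimes> l)" by (intro converges_mult converges_const l g)
    moreover have "converges (\<lambda>n. g \<otimes> y n) (l \<otimes> g)" unfolding gy
      by (intro converges_mult converges_const l g)
    ultimately show ?thesis by (rule converges_unique)
  qed
  have kk: "(\<one> \<ominus> l) \<otimes> (\<one> \<ominus> l) = \<one> \<ominus> h"
  proof -
    have "(\<one> \<ominus> l) \<otimes> (\<one> \<ominus> l) = (\<one> \<oplus> (-1) \<odot> l) \<oplus> ((-1) \<odot> l \<oplus> l \<otimes> l)"
      by (simp add: a_minus_eq l_distr r_distr smult_r_distr)
    also have "\<dots> = \<one> \<oplus> (((-1) \<odot> l \<oplus> (-1) \<odot> l) \<oplus> (2 \<odot> l \<oplus> (-1) \<odot> h))"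
      using h by (simp add: ll a_minus_eq a_assoc)
    also have "(-1) \<odot> l \<oplus> (-1) \<odot> l = (-2) \<odot> l" using smult_l_distr[of l "-1" "-1"] by simp
    also have "(-2) \<odot> l \<oplus> (2 \<odot> l \<oplus> (-1) \<odot> h) = (-1) \<odot> h"
      using h smult_l_distr[of l "-2" 2] by (simp flip: a_assoc)
    finally show ?thesis using h by (simp add: a_minus_eq)
  qed
  show thesis
  proof (rule that)
    show "\<one> \<ominus> l \<in> carrier A" by simp
    show "star A (\<one> \<ominus> l) = \<one> \<ominus> l" by (simp add: ls)
    show "(\<one> \<ominus> l) \<otimes> (\<one> \<ominus> l) = \<one> \<ominus> h" by (rule kk)
    show "\<forall>g\<in>carrier A. g \<otimes> h = h \<otimes> g \<longrightarrow> g \<otimes> (\<one> \<ominus> l) = (\<one> \<ominus> l) \<otimes> g"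
    proof (intro ballI impI)
      fix g assume g: "g \<in> carrier A" "g \<otimes> h = h \<otimes> g"
      show "g \<otimes> (\<one> \<ominus> l) = (\<one> \<ominus> l) \<otimes> g"
        using g(1) lcomm[OF g] by (simp add: a_minus_eq l_distr r_distr)
    qed
  qed
qed

text \<open>Take u = h + i k, where k is the square root of 1 - h^2, so that h plays the role of a
  cosine. The last identity is then cos^2 t = 1/2 + (e^(2it) + e^(-2it))/4, which compares h^2 with
  the scalar 1/2.\<close>

lemma unitary_of_selfadjoint:
  assumes h: "h \<in> carrier A" "star A h = h" "nrm A h < 1"
  obtains u where "u \<in> carrier A" "star A u \<otimes> u = \<one>" "h = (1/2) \<odot> (u \<oplus> star A u)"
    "h \<otimes> h = (1/2) \<odot> \<one> \<oplus> (1/4) \<odot> (u \<otimes> u \<oplus> star A u \<otimes> star A u)"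
proof -
  have "nrm A (h \<otimes> h) < 1" using p_cstar[of h] h p_nonneg[of h] by (simp add: power_less_one_iff)
  moreover have "h \<otimes> h \<in> carrier A" "star A (h \<otimes> h) = h \<otimes> h" using h by auto
  ultimately obtain k where k: "k \<in> carrier A" "star A k = k" "k \<otimes> k = \<one> \<ominus> h \<otimes> h"
    and comm: "\<forall>g\<in>carrier A. g \<otimes> (h \<otimes> h) = (h \<otimes> h) \<otimes> g \<longrightarrow> g \<otimes> k = k \<otimes> g"
    using sqrt_one_minus by metis
  have hk: "h \<otimes> k = k \<otimes> h" using h comm by (simp add: m_assoc)
  define u where "u = h \<oplus> \<i> \<odot> k"
  have us: "star A u = h \<oplus> (-\<i>) \<odot> k" and uc: "u \<in> carrier A" using h k by (simp_all add: u_def)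
  have hhkk: "h \<otimes> h \<oplus> k \<otimes> k = \<one>"
    unfolding k(3) a_minus_def using h by (subst a_lcomm) (auto simp: r_neg)
  have c0: "c \<odot> (h \<otimes> k) \<oplus> (- c) \<odot> (h \<otimes> k) = \<zero>" for c
    using smult_l_distr[of "h \<otimes> k" c "-c"] h k by simp
  have "star A u \<otimes> u = (h \<otimes> h \<oplus> \<i> \<odot> (h \<otimes> k)) \<oplus> ((-\<i>) \<odot> (h \<otimes> k) \<oplus> k \<otimes> k)"
    unfolding u_def using h k(1,2) by (simp add: l_distr r_distr hk smult_r_distr a_ac)
  also have "\<dots> = (h \<otimes> h \<oplus> k \<otimes> k) \<oplus> (\<i> \<odot> (h \<otimes> k) \<oplus> (-\<i>) \<odot> (h \<otimes> k))"
    using h k(1) by (simp add: a_ac)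
  finally have uu: "star A u \<otimes> u = \<one>" using c0[of \<i>] hhkk by simp
  have "u \<oplus> star A u = (h \<oplus> h) \<oplus> (\<i> \<odot> k \<oplus> (-\<i>) \<odot> k)"
    unfolding u_def using h k(1,2) by (simp add: a_ac)
  also have "\<dots> = 2 \<odot> h" using h k(1) smult_l_distr[of k \<i> "-\<i>"] smult_l_distr[of h 1 1] by simp
  finally have hu: "h = (1/2) \<odot> (u \<oplus> star A u)" using h by simp
  have "u \<otimes> u \<oplus> star A u \<otimes> star A u = ((h \<otimes> h \<oplus> \<i> \<odot> (h \<otimes> k)) \<oplus> (\<i> \<odot> (h \<otimes> k) \<oplus> (-1) \<odot> (k \<otimes> k)))
      \<oplus> ((h \<otimes> h \<oplus> (-\<i>) \<odot> (h \<otimes> k)) \<oplus> ((-\<i>) \<odot> (h \<otimes> k) \<oplus> (-1) \<odot> (k \<otimes> k)))"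
    unfolding u_def using h k(1,2) by (simp add: l_distr r_distr hk smult_r_distr a_ac)
  also have "\<dots> = ((h \<otimes> h \<oplus> h \<otimes> h) \<oplus> ((-1) \<odot> (k \<otimes> k) \<oplus> (-1) \<odot> (k \<otimes> k)))
      \<oplus> ((\<i> \<odot> (h \<otimes> k) \<oplus> (-\<i>) \<odot> (h \<otimes> k)) \<oplus> (\<i> \<odot> (h \<otimes> k) \<oplus> (-\<i>) \<odot> (h \<otimes> k)))"
    using h k(1) by (simp add: a_ac)
  also have "\<dots> = 2 \<odot> (h \<otimes> h) \<oplus> (-2) \<odot> (k \<otimes> k)"
    using h k(1) c0[of \<i>] smult_l_distr[of "h \<otimes> h" 1 1] smult_l_distr[of "k \<otimes> k" "-1" "-1"] by simp
  also have "\<dots> = 4 \<odot> (h \<otimes> h) \<oplus> (-2) \<odot> \<one>"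
    using h k smult_l_distr[of "h \<otimes> h" 2 2] by (simp add: a_minus_eq smult_r_distr a_ac)
  finally have sq: "u \<otimes> u \<oplus> star A u \<otimes> star A u = 4 \<odot> (h \<otimes> h) \<oplus> (-2) \<odot> \<one>" .
  have "(1/2) \<odot> \<one> \<oplus> (1/4) \<odot> (u \<otimes> u \<oplus> star A u \<otimes> star A u) = h \<otimes> h \<oplus> ((1/2) \<odot> \<one> \<oplus> (-1/2) \<odot> \<one>)"
    unfolding sq using h by (simp add: smult_r_distr a_ac)
  also have "\<dots> = h \<otimes> h" using smult_l_distr[of \<one> "1/2" "-1/2"] h by simp
  finally show thesis using that[OF uc uu hu] by simp
qed

text \<open>A self-adjoint h of norm below 1 is the average of some u and its adjoint, where u is
  isometric, so the C*-identity and q 1 <= 1 give q u <= 1 and hence q h <= 1. The general case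
  follows by applying this to the product of the adjoint of x with x and by rescaling.\<close>

theorem seminorm_le_nrm:
  assumes q: "cstar_seminorm A q" and x: "x \<in> carrier A"
  shows "q x \<le> nrm A x"
proof -
  interpret q: seminormed_star_algebra A q by unfold_locales (rule q)
  have sa: "q h \<le> 1" if h: "h \<in> carrier A" "star A h = h" "nrm A h < 1" for h
  proof -
    obtain u where u: "u \<in> carrier A" "star A u \<otimes> u = \<one>" "h = (1/2) \<odot> (u \<oplus> star A u)"
      using unitary_of_selfadjoint[OF h] by metis
    have "(q u)\<^sup>2 \<le> 1" using q.p_cstar[OF u(1)] u q.p_one by simp
    then have "q u \<le> 1" using u(1) by (simp add: power_le_one_iff)
    moreover have "q h \<le> (q u + q (star A u)) / 2"
      using u q.p_triangle[of u "star A u"] by simp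
    ultimately show ?thesis using u by simp
  qed
  have le1: "q x \<le> 1" if x: "x \<in> carrier A" "nrm A x < 1" for x
  proof -
    have "q (star A x \<otimes> x) \<le> 1"
      by (rule sa) (use x p_nonneg[of x] in \<open>auto simp: p_cstar power_less_one_iff\<close>)
    then show ?thesis using x by (simp add: q.p_cstar power_le_one_iff)
  qed
  show ?thesis
  proof (rule dense_ge)
    fix t assume t: "nrm A x < t"
    then have "0 < t" using p_nonneg[OF x] by linarith
    have "q (complex_of_real (1/t) \<odot> x) \<le> 1"
      by (rule le1) (use x t \<open>0 < t\<close> in \<open>auto simp: norm_divide\<close>)
    then show "q x \<le> t" using x \<open>0 < t\<close> by (simp add: norm_divide field_simps)
  qed
qed

text \<open>This is the operator inequality 0 <= h^2 <= t in norm form: the distance of h^2 from the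
  midpoint t/2 is at most t/2. The double-angle identity writes 1/2 - h^2 as -1/4 times a sum of two
  elements of norm at most 1.\<close>

lemma square_positive:
  assumes h: "h \<in> carrier A" "star A h = h" and t: "(nrm A h)\<^sup>2 \<le> t"
  shows "nrm A (complex_of_real (t / 2) \<odot> \<one> \<ominus> h \<otimes> h) \<le> t / 2"
proof -
  have one: "nrm A (complex_of_real (1/2) \<odot> \<one> \<ominus> h \<otimes> h) \<le> 1/2"
    if h: "h \<in> carrier A" "star A h = h" "nrm A h < 1" for h
  proof -
    obtain u where u: "u \<in> carrier A" "star A u \<otimes> u = \<one>"
        "h \<otimes> h = (1/2) \<odot> \<one> \<oplus> (1/4) \<odot> (u \<otimes> u \<oplus> star A u \<otimes> star A u)"
      using unitary_of_selfadjoint[OF h] by metis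
    have "(nrm A u)\<^sup>2 \<le> 1" using p_cstar[OF u(1)] u p_one by simp
    then have nu: "nrm A u \<le> 1" using u(1) by (simp add: power_le_one_iff)
    have "nrm A (u \<otimes> u) \<le> 1" "nrm A (star A u \<otimes> star A u) \<le> 1"
      using p_mult[of u u] p_mult[of "star A u" "star A u"] mult_mono[OF nu nu] u(1) by auto
    then have le: "nrm A (u \<otimes> u \<oplus> star A u \<otimes> star A u) \<le> 2"
      using p_triangle[of "u \<otimes> u" "star A u \<otimes> star A u"] u(1) by simp
    have "(1/2) \<odot> \<one> \<ominus> h \<otimes> h = ((1/2) \<odot> \<one> \<oplus> (-1/2) \<odot> \<one>) \<oplus> (-1/4) \<odot> (u \<otimes> u \<oplus> star A u \<otimes> star A u)"
      unfolding u(3) using u(1) by (simp add: a_minus_eq smult_r_distr a_assoc)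
    also have "\<dots> = (-1/4) \<odot> (u \<otimes> u \<oplus> star A u \<otimes> star A u)"
      using smult_l_distr[of \<one> "1/2" "-1/2"] u(1) by simp
    finally show ?thesis using u(1) le by simp
  qed
  show ?thesis
  proof (rule field_le_epsilon)
    fix e :: real assume e: "e > 0"
    \<comment> \<open>The enlargement by e makes the norm of h divided by the square root of s
      strictly less than 1, as the square root construction requires.\<close>
    define s where "s = t + e"
    have "(nrm A h)\<^sup>2 < s" using t e by (simp add: s_def)
    then have s: "0 < s" "nrm A h < sqrt s"
      using zero_le_power2[of "nrm A h"] by (linarith, simp add: real_less_rsqrt)
    define g where "g = complex_of_real (1 / sqrt s) \<odot> h"
    have g: "g \<in> carrier A" "star A g = g" "nrm A g < 1"
      using h s by (simp_all add: g_def norm_divide)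
    have gg: "complex_of_real s \<odot> (g \<otimes> g) = h \<otimes> h"
      using h s by (simp add: g_def flip: of_real_mult)
    have "complex_of_real (s / 2) \<odot> \<one> \<ominus> h \<otimes> h = complex_of_real s \<odot> (complex_of_real (1/2) \<odot> \<one> \<ominus> g \<otimes> g)"
      using g h by (subst smult_diff) (auto simp: gg)
    then have "nrm A (complex_of_real (s / 2) \<odot> \<one> \<ominus> h \<otimes> h) \<le> s * (1/2)"
      using one[OF g] s g by (simp add: mult_left_mono del: of_real_divide)
    moreover have "complex_of_real (t / 2) \<odot> \<one> \<ominus> h \<otimes> h
        = (complex_of_real (s / 2) \<odot> \<one> \<ominus> h \<otimes> h) \<oplus> complex_of_real (- e / 2) \<odot> \<one>"
    proof -
      have "complex_of_real (t / 2) \<odot> \<one> = complex_of_real (s / 2) \<odot> \<one> \<oplus> complex_of_real (- e / 2) \<odot> \<one>"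
        using smult_l_distr[of \<one> "complex_of_real (s / 2)" "complex_of_real (- e / 2)"]
        by (simp add: s_def add_divide_distrib)
      then show ?thesis using h by (simp add: a_minus_eq a_ac)
    qed
    moreover have "nrm A (complex_of_real (- e / 2) \<odot> \<one>) \<le> e / 2"
      using p_one e mult_left_mono[OF p_one, of "e/2"] by simp
    ultimately show "nrm A (complex_of_real (t / 2) \<odot> \<one> \<ominus> h \<otimes> h) \<le> t / 2 + e"
      using p_triangle[of "complex_of_real (s / 2) \<odot> \<one> \<ominus> h \<otimes> h" "complex_of_real (- e / 2) \<odot> \<one>"] h
      by (simp add: s_def)
  qed
qed

text \<open>With \<open>s = h\<^sub>j\<^sup>2\<close> for an \<open>h\<^sub>j\<close> of maximal norm and \<open>M\<close> the norm of \<open>s\<close>, the norms of \<open>s - M/2\<close>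
  and \<open>T + s\<close> are at most \<open>M/2\<close> and \<open>T + c\<close>; the bound \<open>M \<le> c\<close> follows since \<open>s\<close> is a convex
  combination of these two elements.\<close>

theorem nrm_le_of_sum_squares:
  assumes S: "finite S" and h: "\<And>k. k \<in> S \<Longrightarrow> h k \<in> carrier A" "\<And>k. k \<in> S \<Longrightarrow> star A (h k) = h k"
    and c: "0 \<le> c" and sum: "(\<Oplus>k\<in>S. h k \<otimes> h k) = complex_of_real c \<odot> \<one>" and k: "k \<in> S"
  shows "(nrm A (h k))\<^sup>2 \<le> c"
proof -
  define f where "f k = (nrm A (h k))\<^sup>2" for k
  define M where "M = Max (f ` S)"
  have "M \<in> f ` S" unfolding M_def using S k by (intro Max_in) auto
  then obtain j where j: "j \<in> S" "f j = M" by blast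
  have fM: "f k \<le> M" if "k \<in> S" for k unfolding M_def using S that by simp
  have "M \<le> c"
  proof (rule ccontr)
    assume "\<not> M \<le> c"
    then have M: "c < M" "0 < M" using c by auto
    define s where "s = h j \<otimes> h j"
    have sc [simp]: "s \<in> carrier A" using h j by (simp add: s_def)
    have sM: "nrm A s = M" using p_cstar[of "h j"] h j by (simp add: s_def f_def)
    define R where "R = S - {j}"
    \<comment> \<open>The sum of the midpoints M/2 over the remaining indices: by
      \<open>square_positive\<close> each remaining square lies within M/2 of its midpoint.\<close>
    define T where "T = real (card R) * (M / 2)"
    have R: "finite R" "j \<notin> R" "S = insert j R" using S j by (auto simp: R_def)
    have hR: "h k \<in> carrier A" "star A (h k) = h k" if "k \<in> R" for k using h that R by auto
    have sumR: "(\<Oplus>k\<in>R. h k \<otimes> h k) = complex_of_real c \<odot> \<one> \<ominus> s"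
    proof -
      have "s \<oplus> (\<Oplus>k\<in>R. h k \<otimes> h k) = complex_of_real c \<odot> \<one>"
        using sum R h j by (simp add: finsum_insert Pi_def s_def)
      moreover have "(\<Oplus>k\<in>R. h k \<otimes> h k) \<in> carrier A" using hR by (intro finsum_closed) auto
      ultimately show ?thesis
        by (intro eq_diffI) auto
    qed
    have "nrm A (\<Oplus>k\<in>R. complex_of_real (M/2) \<odot> \<one> \<ominus> h k \<otimes> h k) \<le> (\<Sum>k\<in>R. M / 2)"
    proof (rule order.trans[OF p_finsum_le sum_mono])
      show "nrm A (complex_of_real (M/2) \<odot> \<one> \<ominus> h k \<otimes> h k) \<le> M / 2" if "k \<in> R" for k
        using fM[of k] hR[OF that] that R by (intro square_positive) (auto simp: f_def)
    qed (use R hR in auto)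
    also have "(\<Sum>k\<in>R. M / 2) = T" by (simp add: T_def)
    also have "(\<Oplus>k\<in>R. complex_of_real (M/2) \<odot> \<one> \<ominus> h k \<otimes> h k)
        = complex_of_real T \<odot> \<one> \<oplus> (-1) \<odot> (complex_of_real c \<odot> \<one> \<ominus> s)"
    proof -
      have "(\<Oplus>k\<in>R. complex_of_real (M/2) \<odot> \<one> \<ominus> h k \<otimes> h k)
          = (\<Oplus>k\<in>R. complex_of_real (M/2) \<odot> \<one>) \<ominus> (\<Oplus>k\<in>R. h k \<otimes> h k)"
        using hR by (intro finsum_diff) auto
      also have "(\<Oplus>k\<in>R. complex_of_real (M/2) \<odot> \<one>) = complex_of_real T \<odot> \<one>"
        using finsum_smult[of \<one> "\<lambda>_. complex_of_real (M/2)" R] by (simp add: T_def)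
      also have "complex_of_real T \<odot> \<one> \<ominus> (\<Oplus>k\<in>R. h k \<otimes> h k)
          = complex_of_real T \<odot> \<one> \<oplus> (-1) \<odot> (complex_of_real c \<odot> \<one> \<ominus> s)"
        unfolding sumR by (intro a_minus_eq) auto
      finally show ?thesis .
    qed
    finally have le1: "nrm A (complex_of_real T \<odot> \<one> \<oplus> (-1) \<odot> (complex_of_real c \<odot> \<one> \<ominus> s)) \<le> T" .
    have "complex_of_real T \<odot> \<one> \<oplus> s
        = (complex_of_real T \<odot> \<one> \<oplus> (-1) \<odot> (complex_of_real c \<odot> \<one> \<ominus> s)) \<oplus> complex_of_real c \<odot> \<one>"
    proof -
      have "(-1) \<odot> (complex_of_real c \<odot> \<one> \<ominus> s) \<oplus> complex_of_real c \<odot> \<one>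
          = s \<oplus> ((- complex_of_real c) \<odot> \<one> \<oplus> complex_of_real c \<odot> \<one>)"
        by (simp add: a_minus_eq smult_r_distr a_ac)
      also have "\<dots> = s" using smult_l_distr[of \<one> "- complex_of_real c" "complex_of_real c"] by simp
      finally show ?thesis by (simp add: a_assoc)
    qed
    then have "nrm A (complex_of_real T \<odot> \<one> \<oplus> s)
        \<le> nrm A (complex_of_real T \<odot> \<one> \<oplus> (-1) \<odot> (complex_of_real c \<odot> \<one> \<ominus> s)) + nrm A (complex_of_real c \<odot> \<one>)"
      using p_triangle[of "complex_of_real T \<odot> \<one> \<oplus> (-1) \<odot> (complex_of_real c \<odot> \<one> \<ominus> s)" "complex_of_real c \<odot> \<one>"]
      by simp
    also have "\<dots> \<le> T + c" using le1 c mult_left_mono[OF p_one c] by simp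
    finally have le2: "nrm A (complex_of_real T \<odot> \<one> \<oplus> s) \<le> T + c" .
    have le3: "nrm A (s \<ominus> complex_of_real (M/2) \<odot> \<one>) \<le> M / 2"
      using square_positive[of "h j" M] h j p_diff_commute[of s "complex_of_real (M/2) \<odot> \<one>"]
      by (simp add: f_def s_def)
    \<comment> \<open>The weight for which the scalar parts of the convex combination cancel: a T =
      (1 - a) M / 2.\<close>
    define a where "a = M / (2 * T + M)"
    have T0: "0 \<le> T" using M by (simp add: T_def)
    have a: "0 < a" "a \<le> 1" "a * (2 * T + M) = M" using M T0 by (auto simp: a_def)
    have eq: "s = complex_of_real a \<odot> (complex_of_real T \<odot> \<one> \<oplus> s)
        \<oplus> complex_of_real (1 - a) \<odot> (s \<ominus> complex_of_real (M/2) \<odot> \<one>)"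
    proof -
      have "complex_of_real a \<odot> (complex_of_real T \<odot> \<one> \<oplus> s)
        \<oplus> complex_of_real (1 - a) \<odot> (s \<ominus> complex_of_real (M/2) \<odot> \<one>)
        = (complex_of_real (a * T) \<odot> \<one> \<oplus> complex_of_real a \<odot> s)
          \<oplus> (complex_of_real (- (1 - a) * (M / 2)) \<odot> \<one> \<oplus> complex_of_real (1 - a) \<odot> s)"
      proof -
        have cf: "- ((1 - complex_of_real a) * complex_of_real M / 2) = (complex_of_real a - 1) * complex_of_real M / 2"
          by (metis minus_diff_eq minus_divide_left minus_mult_left)
        show ?thesis by (simp add: a_minus_eq smult_r_distr a_comm cf)
      qed
      also have "\<dots> = (complex_of_real (a * T) \<odot> \<one> \<oplus> complex_of_real (- (1 - a) * (M / 2)) \<odot> \<one>)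
          \<oplus> (complex_of_real a \<odot> s \<oplus> complex_of_real (1 - a) \<odot> s)"
        by (rule add_add_swap) auto
      also have "complex_of_real (a * T) \<odot> \<one> \<oplus> complex_of_real (- (1 - a) * (M / 2)) \<odot> \<one>
          = complex_of_real (a * T + - (1 - a) * (M / 2)) \<odot> \<one>"
        unfolding of_real_add by (rule smult_l_distr[symmetric]) simp
      also have "a * T + - (1 - a) * (M / 2) = (a * (2 * T + M) - M) / 2" by (simp add: field_simps)
      also have "\<dots> = 0" using a(3) by simp
      also have "complex_of_real a \<odot> s \<oplus> complex_of_real (1 - a) \<odot> s = complex_of_real (a + (1 - a)) \<odot> s"
        unfolding of_real_add by (rule smult_l_distr[symmetric]) simp
      finally show ?thesis by simp
    qed
    have "M = nrm A (complex_of_real a \<odot> (complex_of_real T \<odot> \<one> \<oplus> s)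
        \<oplus> complex_of_real (1 - a) \<odot> (s \<ominus> complex_of_real (M/2) \<odot> \<one>))"
      using arg_cong[OF eq, of "nrm A"] sM by simp
    also have "\<dots> \<le> nrm A (complex_of_real a \<odot> (complex_of_real T \<odot> \<one> \<oplus> s))
        + nrm A (complex_of_real (1 - a) \<odot> (s \<ominus> complex_of_real (M/2) \<odot> \<one>))"
      by (intro p_triangle) auto
    also have "\<dots> = a * nrm A (complex_of_real T \<odot> \<one> \<oplus> s) + (1 - a) * nrm A (s \<ominus> complex_of_real (M/2) \<odot> \<one>)"
      using a by (subst (1 2) p_smult) (auto simp del: of_real_diff of_real_divide)
    also have "\<dots> \<le> a * (T + c) + (1 - a) * (M / 2)"
      using le2 le3 a by (intro add_mono mult_left_mono) auto
    also have "\<dots> = M / 2 + a * (2 * T + M) / 2 + a * (c - M)" by (simp add: field_simps)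
    also have "\<dots> = M + a * (c - M)" unfolding a(3) by simp
    also have "\<dots> < M" using a M by (simp add: mult_pos_neg)
    finally show False by simp
  qed
  then show ?thesis using fM[OF k] by (simp add: f_def)
qed

end

text \<open>The pulled-back norm is a C*-seminorm on A, and C*-seminorms on a C*-algebra are at most
  its norm.\<close>

lemma star_hom_contractive:
  assumes A: "cstar_algebra A" and B: "cstar_algebra B" and f: "star_hom A B f" and x: "x \<in> carrier A"
  shows "nrm B (f x) \<le> nrm A x"
proof -
  interpret A: cstar_algebra A by fact
  interpret B: cstar_algebra B by fact
  interpret f: star_morphism A B f by unfold_locales fact
  have "cstar_seminorm A (\<lambda>x. nrm B (f x))" unfolding cstar_seminorm_def
    by (auto simp: B.p_triangle B.p_mult B.p_cstar)
  then show ?thesis using A.seminorm_le_nrm x by blast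
qed

lemma (in seminormed_star_algebra) completion_hom_eqI:
  assumes D: "cstar_algebra D" and F: "star_hom C D F" and G: "star_hom C D G"
    and eq: "\<And>x. x \<in> carrier P \<Longrightarrow> F (to_completion P p x) = G (to_completion P p x)"
    and X: "X \<in> carrier C"
  shows "F X = G X"
proof -
  interpret C: cstar_algebra C by (rule cstar_algebra_completion)
  interpret D: cstar_algebra D by (rule D)
  interpret F: star_morphism C D F by unfold_locales (rule F)
  interpret G: star_morphism C D G by unfold_locales (rule G)
  have "nrm D (F X \<ominus>\<^bsub>D\<^esub> G X) \<le> 0"
  proof (rule field_le_epsilon)
    fix e :: real assume "e > 0"
    then obtain a where a: "a \<in> carrier P" "nrm C (to_completion P p a \<ominus>\<^bsub>C\<^esub> X) < e / 2"
      using completion_dense[OF X, of "e/2"] by auto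
    let ?a = "to_completion P p a"
    have "nrm D (F X \<ominus>\<^bsub>D\<^esub> G X) \<le> nrm D (F X \<ominus>\<^bsub>D\<^esub> F ?a) + nrm D (F ?a \<ominus>\<^bsub>D\<^esub> G X)"
      using X a by (intro D.p_triangle_diff) auto
    also have "nrm D (F X \<ominus>\<^bsub>D\<^esub> F ?a) \<le> nrm C (X \<ominus>\<^bsub>C\<^esub> ?a)"
      using star_hom_contractive[OF C.cstar_algebra_axioms D F, of "X \<ominus>\<^bsub>C\<^esub> ?a"] X a by simp
    also have "nrm C (X \<ominus>\<^bsub>C\<^esub> ?a) = nrm C (?a \<ominus>\<^bsub>C\<^esub> X)" using X a by (intro C.p_diff_commute) auto
    also have "nrm D (F ?a \<ominus>\<^bsub>D\<^esub> G X) \<le> nrm C (?a \<ominus>\<^bsub>C\<^esub> X)"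
      using star_hom_contractive[OF C.cstar_algebra_axioms D G, of "?a \<ominus>\<^bsub>C\<^esub> X"] X a eq by simp
    finally show "nrm D (F X \<ominus>\<^bsub>D\<^esub> G X) \<le> 0 + e" using a by simp
  qed
  moreover have c: "F X \<ominus>\<^bsub>D\<^esub> G X \<in> carrier D" using X by simp
  ultimately have "nrm D (F X \<ominus>\<^bsub>D\<^esub> G X) = 0" using D.p_nonneg[OF c] by linarith
  then have "F X \<ominus>\<^bsub>D\<^esub> G X = \<zero>\<^bsub>D\<^esub>" by (rule D.nrm_eq_zero[OF c])
  then show ?thesis using X by simp
qed

section \<open>Monoid algebras and universal C*-algebras\<close>

abbreviation supp :: "('w \<Rightarrow> complex) \<Rightarrow> 'w set" where
  "supp f \<equiv> {w. f w \<noteq> 0}"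

text \<open>The linear extension of \<open>\<phi>\<close> to formal sums. Such functionals separate
  formal sums, so the laws of the convolution algebra are verified after applying \<open>lin\<close>
  instead of on convolution sums.\<close>

definition lin :: "('w \<Rightarrow> complex) \<Rightarrow> ('w \<Rightarrow> complex) \<Rightarrow> complex" where
  "lin \<phi> f = (\<Sum>w\<in>supp f. f w * \<phi> w)"

lemma lin_superset: "\<lbrakk>finite S; supp f \<subseteq> S\<rbrakk> \<Longrightarrow> lin \<phi> f = (\<Sum>w\<in>S. f w * \<phi> w)"
  unfolding lin_def by (rule sum.mono_neutral_left) auto

lemma lin_cong: "(\<And>w. f w \<noteq> 0 \<Longrightarrow> \<phi> w = \<psi> w) \<Longrightarrow> lin \<phi> f = lin \<psi> f"
  by (simp add: lin_def)

lemma lin_add: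
  assumes "finite (supp f)" "finite (supp g)"
  shows "lin \<phi> (\<lambda>w. f w + g w) = lin \<phi> f + lin \<phi> g"
proof -
  have S: "finite (supp f \<union> supp g)" using assms by simp
  show ?thesis
    by (subst (1 2 3) lin_superset[OF S]) (auto simp: sum.distrib distrib_right)
qed

lemma lin_smult: "lin \<phi> (\<lambda>w. c * f w) = c * lin \<phi> f"
  by (cases "c = 0") (simp_all add: lin_def sum_distrib_left mult.assoc)

lemma lin_fun_add: "lin (\<lambda>w. \<phi> w + \<psi> w) f = lin \<phi> f + lin \<psi> f"
  by (simp add: lin_def distrib_left sum.distrib)

lemma lin_fun_smult: "lin (\<lambda>w. c * \<phi> w) f = c * lin \<phi> f"
  by (simp add: lin_def sum_distrib_left mult.left_commute)

lemma supp_single: "supp (single u) = {u}"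
  by (auto simp: single_def)

lemma lin_single [simp]: "lin \<phi> (single u) = \<phi> u"
  unfolding lin_def supp_single by (simp add: single_def)

lemma lin_zero [simp]: "lin \<phi> (\<lambda>_. 0) = 0"
  by (simp add: lin_def)

lemma lin_swap: "lin (\<lambda>u. lin (\<lambda>v. F u v) g) f = lin (\<lambda>v. lin (\<lambda>u. F u v) f) g"
  unfolding lin_def sum_distrib_left
  by (subst sum.swap) (simp add: mult.left_commute)

lemma lin_indicator: "finite (supp f) \<Longrightarrow> lin (\<lambda>w. if w = u then 1 else 0) f = f u"
  unfolding lin_def by (simp add: if_distrib[of "(*) _"] sum.delta cong: if_cong)

lemma fun_eq_linI:
  assumes "finite (supp f)" "finite (supp g)" "\<And>\<phi>. lin \<phi> f = lin \<phi> g"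
  shows "f = g"
proof
  fix u show "f u = g u"
    using assms(3)[of "\<lambda>w. if w = u then 1 else 0"] assms(1,2) by (simp add: lin_indicator)
qed

locale inv_monoid = Group.monoid M for M :: "'w star_monoid" (structure) +
  assumes inv_op_closed [simp]: "u \<in> carrier M \<Longrightarrow> inv_op M u \<in> carrier M"
    and inv_op_inv_op [simp]: "u \<in> carrier M \<Longrightarrow> inv_op M (inv_op M u) = u"
    and inv_op_mult [simp]:
      "\<lbrakk>u \<in> carrier M; v \<in> carrier M\<rbrakk> \<Longrightarrow> inv_op M (u \<otimes> v) = inv_op M v \<otimes> inv_op M u"
begin

abbreviation "Q \<equiv> monoid_star_alg M"

lemma Q_carrier: "f \<in> carrier Q \<longleftrightarrow> finite (supp f) \<and> supp f \<subseteq> carrier M"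
  by (simp add: monoid_star_alg_def)

lemma Q_finite: "f \<in> carrier Q \<Longrightarrow> finite (supp f)"
  and Q_supp: "\<lbrakk>f \<in> carrier Q; f w \<noteq> 0\<rbrakk> \<Longrightarrow> w \<in> carrier M"
  by (auto simp: Q_carrier)

lemma single_closed [simp, intro]: "w \<in> carrier M \<Longrightarrow> single w \<in> carrier Q"
  by (simp add: Q_carrier supp_single)

lemma Q_add: "f \<oplus>\<^bsub>Q\<^esub> g = (\<lambda>w. f w + g w)"
  and Q_smult: "c \<odot>\<^bsub>Q\<^esub> f = (\<lambda>w. c * f w)"
  and Q_zero: "\<zero>\<^bsub>Q\<^esub> = (\<lambda>_. 0)"
  and Q_one: "\<one>\<^bsub>Q\<^esub> = single \<one>"
  by (simp_all add: monoid_star_alg_def single_def)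

lemma Q_add_closed: "\<lbrakk>f \<in> carrier Q; g \<in> carrier Q\<rbrakk> \<Longrightarrow> f \<oplus>\<^bsub>Q\<^esub> g \<in> carrier Q"
proof -
  assume "f \<in> carrier Q" "g \<in> carrier Q"
  moreover have "supp (\<lambda>w. f w + g w) \<subseteq> supp f \<union> supp g" by auto
  ultimately show ?thesis unfolding Q_carrier Q_add by (meson finite_UnI finite_subset le_sup_iff subset_trans)
qed

lemma Q_smult_closed: "f \<in> carrier Q \<Longrightarrow> c \<odot>\<^bsub>Q\<^esub> f \<in> carrier Q"
  unfolding Q_carrier Q_smult by (auto intro: finite_subset[of _ "supp f"])

lemma Q_zero_closed: "\<zero>\<^bsub>Q\<^esub> \<in> carrier Q"
  by (simp add: Q_carrier Q_zero)

lemma Q_mult_supp: "supp (f \<otimes>\<^bsub>Q\<^esub> g) \<subseteq> (\<lambda>(u, v). u \<otimes> v) ` (supp f \<times> supp g)"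
proof
  fix w assume "w \<in> supp (f \<otimes>\<^bsub>Q\<^esub> g)"
  then have "(\<Sum>(u, v) \<in> {(u, v). f u \<noteq> 0 \<and> g v \<noteq> 0 \<and> u \<otimes> v = w}. f u * g v) \<noteq> 0"
    by (simp add: monoid_star_alg_def)
  then obtain z where "z \<in> {(u, v). f u \<noteq> 0 \<and> g v \<noteq> 0 \<and> u \<otimes> v = w}"
    by (metis (no_types, lifting) sum.not_neutral_contains_not_neutral)
  then show "w \<in> (\<lambda>(u, v). u \<otimes> v) ` (supp f \<times> supp g)" by (auto intro!: image_eqI[of _ _ z])
qed

lemma Q_mult_closed: "\<lbrakk>f \<in> carrier Q; g \<in> carrier Q\<rbrakk> \<Longrightarrow> f \<otimes>\<^bsub>Q\<^esub> g \<in> carrier Q"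
proof -
  assume f: "f \<in> carrier Q" and g: "g \<in> carrier Q"
  have "finite ((\<lambda>(u, v). u \<otimes> v) ` (supp f \<times> supp g))" using f g by (simp add: Q_carrier)
  moreover have "(\<lambda>(u, v). u \<otimes> v) ` (supp f \<times> supp g) \<subseteq> carrier M"
    using Q_supp[OF f] Q_supp[OF g] by auto
  ultimately show ?thesis unfolding Q_carrier
    by (intro conjI finite_subset[OF Q_mult_supp] subset_trans[OF Q_mult_supp])
qed

text \<open>The double sum over pairs (u, v) is regrouped according to the value of the product of u
  and v. With this, laws of the convolution reduce to laws of the monoid.\<close>

lemma lin_mult:
  assumes f: "f \<in> carrier Q" and g: "g \<in> carrier Q"
  shows "lin \<phi> (f \<otimes>\<^bsub>Q\<^esub> g) = lin (\<lambda>u. lin (\<lambda>v. \<phi> (u \<otimes> v)) g) f"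
proof -
  let ?A = "supp f \<times> supp g" and ?m = "\<lambda>(u, v). u \<otimes> v" and ?h = "\<lambda>(u, v). f u * g v"
  have A: "finite ?A" using f g by (simp add: Q_carrier)
  have "lin \<phi> (f \<otimes>\<^bsub>Q\<^esub> g) = (\<Sum>w\<in>?m ` ?A. (f \<otimes>\<^bsub>Q\<^esub> g) w * \<phi> w)"
    by (rule lin_superset[OF finite_imageI[OF A] Q_mult_supp])
  also have "\<dots> = (\<Sum>w\<in>?m ` ?A. \<Sum>z\<in>{z \<in> ?A. ?m z = w}. ?h z * \<phi> (?m z))"
  proof (rule sum.cong[OF refl])
    fix w
    have eq: "{(u, v). f u \<noteq> 0 \<and> g v \<noteq> 0 \<and> u \<otimes> v = w} = {z \<in> ?A. ?m z = w}" by auto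
    have "(f \<otimes>\<^bsub>Q\<^esub> g) w = (\<Sum>z\<in>{z \<in> ?A. ?m z = w}. ?h z)"
      by (simp add: monoid_star_alg_def eq)
    then show "(f \<otimes>\<^bsub>Q\<^esub> g) w * \<phi> w = (\<Sum>z\<in>{z \<in> ?A. ?m z = w}. ?h z * \<phi> (?m z))"
      by (simp add: sum_distrib_right)
  qed
  also have "\<dots> = (\<Sum>z\<in>?A. ?h z * \<phi> (?m z))" by (rule sum.image_gen[OF A, symmetric])
  also have "\<dots> = lin (\<lambda>u. lin (\<lambda>v. \<phi> (u \<otimes> v)) g) f"
    by (simp add: lin_def sum_distrib_left sum.cartesian_product case_prod_beta mult.assoc)
  finally show ?thesis .
qed

lemma Q_star: "star Q f = (\<lambda>w. if w \<in> carrier M then cnj (f (inv_op M w)) else 0)"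
  by (simp add: monoid_star_alg_def)

lemma Q_star_supp: "f \<in> carrier Q \<Longrightarrow> supp (star Q f) = inv_op M ` supp f"
proof -
  assume f: "f \<in> carrier Q"
  have "w \<in> inv_op M ` supp f" if "w \<in> supp (star Q f)" for w
    using that by (intro image_eqI[of _ _ "inv_op M w"]) (auto simp: Q_star split: if_splits)
  then show ?thesis using Q_supp[OF f] by (auto simp: Q_star)
qed

lemma Q_star_closed: "f \<in> carrier Q \<Longrightarrow> star Q f \<in> carrier Q"
  using Q_supp[of f] by (auto simp: Q_carrier[of "star Q f"] Q_star_supp Q_finite)

lemma lin_star:
  assumes f: "f \<in> carrier Q"
  shows "lin \<phi> (star Q f) = cnj (lin (\<lambda>w. cnj (\<phi> (inv_op M w))) f)"
proof -
  have inj: "inj_on (inv_op M) (supp f)"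
    using Q_supp[OF f] by (intro inj_on_inverseI[of _ "inv_op M"]) auto
  show ?thesis unfolding lin_def Q_star_supp[OF f] cnj_sum
    by (subst sum.reindex[OF inj]) (auto simp: Q_star intro!: sum.cong dest: Q_supp[OF f])
qed

lemma Q_eqI: "\<lbrakk>f \<in> carrier Q; g \<in> carrier Q; \<And>\<phi>. lin \<phi> f = lin \<phi> g\<rbrakk> \<Longrightarrow> f = g"
  by (intro fun_eq_linI Q_finite)

lemma star_algebra_Q: "star_algebra Q"
proof -
  have "abelian_group Q"
  proof (rule abelian_groupI)
    fix f assume f: "f \<in> carrier Q"
    show "\<exists>g\<in>carrier Q. g \<oplus>\<^bsub>Q\<^esub> f = \<zero>\<^bsub>Q\<^esub>"
      by (rule bexI[OF _ Q_smult_closed[OF f, of "-1"]]) (simp add: Q_add Q_smult Q_zero)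
  qed (auto simp: Q_add_closed[unfolded Q_add] Q_zero_closed[unfolded Q_zero] Q_add Q_zero add_ac)
  moreover have "Group.monoid Q"
  proof (rule monoidI)
    have c: "\<one>\<^bsub>Q\<^esub> \<in> carrier Q" by (simp add: Q_one)
    then show "\<one>\<^bsub>Q\<^esub> \<in> carrier Q" .
    fix f assume f: "f \<in> carrier Q"
    show "\<one>\<^bsub>Q\<^esub> \<otimes>\<^bsub>Q\<^esub> f = f" "f \<otimes>\<^bsub>Q\<^esub> \<one>\<^bsub>Q\<^esub> = f"
      using f c Q_supp[OF f]
      by (auto intro!: Q_eqI Q_mult_closed lin_cong simp: lin_mult Q_one)
    fix g assume g: "g \<in> carrier Q"
    show "f \<otimes>\<^bsub>Q\<^esub> g \<in> carrier Q" using f g by (rule Q_mult_closed)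
    fix h assume h: "h \<in> carrier Q"
    show "f \<otimes>\<^bsub>Q\<^esub> g \<otimes>\<^bsub>Q\<^esub> h = f \<otimes>\<^bsub>Q\<^esub> (g \<otimes>\<^bsub>Q\<^esub> h)"
    proof (rule Q_eqI)
      fix \<phi>
      show "lin \<phi> (f \<otimes>\<^bsub>Q\<^esub> g \<otimes>\<^bsub>Q\<^esub> h) = lin \<phi> (f \<otimes>\<^bsub>Q\<^esub> (g \<otimes>\<^bsub>Q\<^esub> h))"
        using f g h by (simp add: lin_mult Q_mult_closed)
          (intro lin_cong, simp add: m_assoc Q_supp[OF f] Q_supp[OF g] Q_supp[OF h])
    qed (use f g h in \<open>auto intro!: Q_mult_closed\<close>)
  qed
  ultimately have "ring Q"
  proof (rule ringI)
    fix f g h assume c: "f \<in> carrier Q" "g \<in> carrier Q" "h \<in> carrier Q"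
    show "(f \<oplus>\<^bsub>Q\<^esub> g) \<otimes>\<^bsub>Q\<^esub> h = f \<otimes>\<^bsub>Q\<^esub> h \<oplus>\<^bsub>Q\<^esub> g \<otimes>\<^bsub>Q\<^esub> h"
    proof (rule Q_eqI)
      fix \<phi> show "lin \<phi> ((f \<oplus>\<^bsub>Q\<^esub> g) \<otimes>\<^bsub>Q\<^esub> h) = lin \<phi> (f \<otimes>\<^bsub>Q\<^esub> h \<oplus>\<^bsub>Q\<^esub> g \<otimes>\<^bsub>Q\<^esub> h)"
        using c by (simp add: lin_mult Q_add_closed)
          (simp add: Q_add lin_add lin_mult Q_finite Q_mult_closed)
    qed (use c in \<open>auto intro!: Q_mult_closed Q_add_closed\<close>)
    show "h \<otimes>\<^bsub>Q\<^esub> (f \<oplus>\<^bsub>Q\<^esub> g) = h \<otimes>\<^bsub>Q\<^esub> f \<oplus>\<^bsub>Q\<^esub> h \<otimes>\<^bsub>Q\<^esub> g"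
    proof (rule Q_eqI)
      fix \<phi> show "lin \<phi> (h \<otimes>\<^bsub>Q\<^esub> (f \<oplus>\<^bsub>Q\<^esub> g)) = lin \<phi> (h \<otimes>\<^bsub>Q\<^esub> f \<oplus>\<^bsub>Q\<^esub> h \<otimes>\<^bsub>Q\<^esub> g)"
        using c by (simp add: lin_mult Q_add_closed)
          (simp add: Q_add lin_add lin_mult Q_finite Q_mult_closed lin_fun_add)
    qed (use c in \<open>auto intro!: Q_mult_closed Q_add_closed\<close>)
  qed
  then show ?thesis
  proof (rule star_algebra.intro, unfold_locales)
    fix f c d assume f: "f \<in> carrier Q"
    show "c \<odot>\<^bsub>Q\<^esub> f \<in> carrier Q" "star Q f \<in> carrier Q"
      using f by (auto intro: Q_smult_closed Q_star_closed)
    show "(c + d) \<odot>\<^bsub>Q\<^esub> f = c \<odot>\<^bsub>Q\<^esub> f \<oplus>\<^bsub>Q\<^esub> d \<odot>\<^bsub>Q\<^esub> f" "c \<odot>\<^bsub>Q\<^esub> (d \<odot>\<^bsub>Q\<^esub> f) = (c * d) \<odot>\<^bsub>Q\<^esub> f" "1 \<odot>\<^bsub>Q\<^esub> f = f"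
      "star Q (c \<odot>\<^bsub>Q\<^esub> f) = cnj c \<odot>\<^bsub>Q\<^esub> star Q f"
      by (auto simp: Q_add Q_smult Q_star algebra_simps)
    show "star Q (star Q f) = f"
    proof
      fix w show "star Q (star Q f) w = f w"
        using Q_supp[OF f, of w] by (auto simp: Q_star)
    qed
    fix g assume g: "g \<in> carrier Q"
    show "c \<odot>\<^bsub>Q\<^esub> (f \<oplus>\<^bsub>Q\<^esub> g) = c \<odot>\<^bsub>Q\<^esub> f \<oplus>\<^bsub>Q\<^esub> c \<odot>\<^bsub>Q\<^esub> g" "star Q (f \<oplus>\<^bsub>Q\<^esub> g) = star Q f \<oplus>\<^bsub>Q\<^esub> star Q g"
      by (auto simp: Q_add Q_smult Q_star algebra_simps)
    show "(c \<odot>\<^bsub>Q\<^esub> f) \<otimes>\<^bsub>Q\<^esub> g = c \<odot>\<^bsub>Q\<^esub> (f \<otimes>\<^bsub>Q\<^esub> g)" "f \<otimes>\<^bsub>Q\<^esub> (c \<odot>\<^bsub>Q\<^esub> g) = c \<odot>\<^bsub>Q\<^esub> (f \<otimes>\<^bsub>Q\<^esub> g)"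
      using f g
      by (auto intro!: Q_eqI Q_mult_closed Q_smult_closed simp: lin_mult Q_smult_closed)
        (simp_all add: Q_smult lin_smult lin_mult lin_fun_smult)
    show "star Q (f \<otimes>\<^bsub>Q\<^esub> g) = star Q g \<otimes>\<^bsub>Q\<^esub> star Q f"
    proof (rule Q_eqI)
      fix \<phi>
      have "lin \<phi> (star Q (f \<otimes>\<^bsub>Q\<^esub> g)) = cnj (lin (\<lambda>u. lin (\<lambda>v. cnj (\<phi> (inv_op M (u \<otimes> v)))) g) f)"
        using f g by (simp add: lin_star lin_mult Q_mult_closed)
      also have "lin (\<lambda>u. lin (\<lambda>v. cnj (\<phi> (inv_op M (u \<otimes> v)))) g) f
          = lin (\<lambda>u. lin (\<lambda>v. cnj (\<phi> (inv_op M v \<otimes> inv_op M u))) g) f"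
        by (intro lin_cong) (simp add: Q_supp[OF f] Q_supp[OF g])
      also have "cnj \<dots> = lin \<phi> (star Q g \<otimes>\<^bsub>Q\<^esub> star Q f)"
        using f g by (subst lin_swap) (simp add: lin_mult lin_star Q_star_closed)
      finally show "lin \<phi> (star Q (f \<otimes>\<^bsub>Q\<^esub> g)) = lin \<phi> (star Q g \<otimes>\<^bsub>Q\<^esub> star Q f)" .
    qed (use f g in \<open>auto intro!: Q_mult_closed Q_star_closed\<close>)
  qed
qed

lemma Q_induct [consumes 1, case_names zero add]:
  assumes f: "f \<in> carrier Q" and 0: "P \<zero>\<^bsub>Q\<^esub>"
    and add: "\<And>f c w. \<lbrakk>f \<in> carrier Q; P f; w \<in> carrier M\<rbrakk> \<Longrightarrow> P (f \<oplus>\<^bsub>Q\<^esub> c \<odot>\<^bsub>Q\<^esub> single w)"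
  shows "P f"
proof -
  have "\<forall>f. supp f \<subseteq> S \<longrightarrow> P f" if "finite S" "S \<subseteq> carrier M" for S
    using that
  proof (induction S rule: finite_induct)
    case empty
    then show ?case using 0 by (auto simp: Q_zero fun_eq_iff)
  next
    case (insert w S)
    show ?case
    proof (intro allI impI)
      fix f :: "'w \<Rightarrow> complex" assume f: "supp f \<subseteq> insert w S"
      define g where "g = f(w := 0)"
      have g: "supp g \<subseteq> S" using f by (auto simp: g_def)
      then have "g \<in> carrier Q" using insert finite_subset[OF g] by (auto simp: Q_carrier)
      moreover have "f = g \<oplus>\<^bsub>Q\<^esub> f w \<odot>\<^bsub>Q\<^esub> single w"
        by (auto simp: Q_add Q_smult g_def single_def)
      ultimately show "P f" using add[of g w "f w"] g insert by auto
    qed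
  qed
  from this[of "supp f"] f show ?thesis by (auto simp: Q_carrier)
qed

lemma single_mult: "\<lbrakk>u \<in> carrier M; v \<in> carrier M\<rbrakk> \<Longrightarrow> single u \<otimes>\<^bsub>Q\<^esub> single v = single (u \<otimes> v)"
  by (rule Q_eqI) (auto simp: lin_mult intro!: Q_mult_closed)

lemma single_star: "u \<in> carrier M \<Longrightarrow> star Q (single u) = single (inv_op M u)"
  by (rule Q_eqI) (auto simp: lin_star intro!: Q_star_closed)

lemma Q_hom_eqI:
  assumes D: "star_algebra D" and F: "star_hom Q D F" and G: "star_hom Q D G"
    and eq: "\<And>w. w \<in> carrier M \<Longrightarrow> F (single w) = G (single w)" and f: "f \<in> carrier Q"
  shows "F f = G f"
proof -
  interpret Q: star_algebra Q by (rule star_algebra_Q)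
  interpret D: star_algebra D by (rule D)
  interpret F: star_morphism Q D F by unfold_locales (rule F)
  interpret G: star_morphism Q D G by unfold_locales (rule G)
  show ?thesis using f by (induction rule: Q_induct) (simp_all add: eq)
qed

lemma Q_hom_ex:
  assumes D: "star_algebra D" and \<phi>: "\<And>w. w \<in> carrier M \<Longrightarrow> \<phi> w \<in> carrier D"
    and one: "\<phi> \<one> = \<one>\<^bsub>D\<^esub>"
    and mult: "\<And>u v. \<lbrakk>u \<in> carrier M; v \<in> carrier M\<rbrakk> \<Longrightarrow> \<phi> (u \<otimes> v) = \<phi> u \<otimes>\<^bsub>D\<^esub> \<phi> v"
    and inv: "\<And>u. u \<in> carrier M \<Longrightarrow> \<phi> (inv_op M u) = star D (\<phi> u)"
  shows "\<exists>F. star_hom Q D F \<and> (\<forall>w\<in>carrier M. F (single w) = \<phi> w)"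
proof -
  interpret Q: star_algebra Q by (rule star_algebra_Q)
  interpret D: star_algebra D by (rule D)
  define F where "F f = (\<Oplus>\<^bsub>D\<^esub>w\<in>supp f. f w \<odot>\<^bsub>D\<^esub> \<phi> w)" for f
  have F_superset: "F f = (\<Oplus>\<^bsub>D\<^esub>w\<in>S. f w \<odot>\<^bsub>D\<^esub> \<phi> w)"
    if "finite S" "supp f \<subseteq> S" "S \<subseteq> carrier M" for f S
    unfolding F_def using that \<phi>
    by (intro D.add.finprod_mono_neutral_cong_left) auto
  have F_closed: "F f \<in> carrier D" if "f \<in> carrier Q" for f
    unfolding F_def using \<phi> Q_supp[OF that] by (intro D.finsum_closed) auto
  have F_add: "F (f \<oplus>\<^bsub>Q\<^esub> g) = F f \<oplus>\<^bsub>D\<^esub> F g" if f: "f \<in> carrier Q" and g: "g \<in> carrier Q" for f g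
  proof -
    have S: "finite (supp f \<union> supp g)" "supp f \<union> supp g \<subseteq> carrier M" using f g by (auto simp: Q_carrier)
    have "supp (f \<oplus>\<^bsub>Q\<^esub> g) \<subseteq> supp f \<union> supp g" by (auto simp: Q_add)
    then have "F (f \<oplus>\<^bsub>Q\<^esub> g) = (\<Oplus>\<^bsub>D\<^esub>w\<in>supp f \<union> supp g. (f w \<odot>\<^bsub>D\<^esub> \<phi> w) \<oplus>\<^bsub>D\<^esub> (g w \<odot>\<^bsub>D\<^esub> \<phi> w))"
      using S \<phi> by (subst F_superset[OF S(1) _ S(2)])
        (auto simp: Q_add D.smult_l_distr intro!: D.finsum_cong')
    also have "\<dots> = F f \<oplus>\<^bsub>D\<^esub> F g"
      using S \<phi> by (subst D.finsum_addf) (auto simp: F_superset[OF S(1) _ S(2)])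
    finally show ?thesis .
  qed
  have F_smult: "F (c \<odot>\<^bsub>Q\<^esub> f) = c \<odot>\<^bsub>D\<^esub> F f" if f: "f \<in> carrier Q" for c f
  proof -
    have S: "finite (supp f)" "supp f \<subseteq> carrier M" using f by (auto simp: Q_carrier)
    have "supp (c \<odot>\<^bsub>Q\<^esub> f) \<subseteq> supp f" by (auto simp: Q_smult)
    then show ?thesis using S \<phi>
      by (subst (1 2) F_superset[OF S(1) _ S(2)], auto simp: Q_smult)
        (subst D.smult_finsum, auto intro!: D.finsum_cong')
  qed
  have F_single: "F (single w) = \<phi> w" if "w \<in> carrier M" for w
    using \<phi>[OF that] that F_superset[of "{w}" "single w"]
    by (simp add: supp_single D.finsum_insert) (simp add: single_def)
  have F_zero: "F \<zero>\<^bsub>Q\<^esub> = \<zero>\<^bsub>D\<^esub>" by (simp add: F_def Q_zero)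
  \<comment> \<open>Multiplicativity is first shown with a single monoid element on the right, by
    induction on the left factor, and then extended by induction on the right factor.\<close>
  have F_mult_single: "F (f \<otimes>\<^bsub>Q\<^esub> single v) = F f \<otimes>\<^bsub>D\<^esub> \<phi> v" if f: "f \<in> carrier Q" and v: "v \<in> carrier M" for f v
    using f
  proof (induction rule: Q_induct)
    case (add f c w)
    then show ?case using v \<phi>
      by (simp add: Q.l_distr D.l_distr F_add F_smult F_single single_mult mult F_closed)
  qed (use v \<phi> in \<open>simp add: F_zero\<close>)
  have F_mult: "F (f \<otimes>\<^bsub>Q\<^esub> g) = F f \<otimes>\<^bsub>D\<^esub> F g" if f: "f \<in> carrier Q" and g: "g \<in> carrier Q" for f g
    using g
  proof (induction rule: Q_induct)
    case (add g c w)
    then show ?case using f \<phi>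
      by (simp add: Q.r_distr D.r_distr F_add F_smult F_single F_mult_single F_closed)
  qed (use f F_closed in \<open>simp add: F_zero\<close>)
  have F_star: "F (star Q f) = star D (F f)" if f: "f \<in> carrier Q" for f
    using f
  proof (induction rule: Q_induct)
    case (add f c w)
    then show ?case using \<phi> by (simp add: F_add F_smult F_single single_star inv F_closed)
  qed (simp add: F_zero)
  have "star_hom Q D F"
    by (rule star_homI) (simp_all add: F_closed F_add F_mult F_smult F_star Q_one F_single one)
  then show ?thesis using F_single by blast
qed

end

section \<open>Free star-algebras\<close>

lemma inv_monoid_word: "inv_monoid (word_monoid X)"
proof -
  have "Group.monoid (word_monoid X)"
    by (rule monoidI) (auto simp: word_monoid_def)
  then show ?thesis
    by (rule inv_monoid.intro, unfold_locales)
      (auto simp: word_monoid_def lists_eq_set rev_map comp_def case_prod_beta)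
qed

lemma star_algebra_free: "star_algebra (free_star_alg X)"
  unfolding free_star_alg_def by (rule inv_monoid.star_algebra_Q[OF inv_monoid_word])

lemma gen_closed [simp, intro]: "x \<in> X \<Longrightarrow> gen x \<in> carrier (free_star_alg X)"
  unfolding free_star_alg_def gen_def
  by (rule inv_monoid.single_closed[OF inv_monoid_word]) (simp add: word_monoid_def)

lemma free_word_induct:
  assumes w: "w \<in> lists (X \<times> UNIV)" and 1: "P \<one>\<^bsub>free_star_alg X\<^esub>"
    and gen: "\<And>x f. \<lbrakk>x \<in> X; f \<in> carrier (free_star_alg X); P f\<rbrakk> \<Longrightarrow> P (gen x \<otimes>\<^bsub>free_star_alg X\<^esub> f)"
    and star: "\<And>x f. \<lbrakk>x \<in> X; f \<in> carrier (free_star_alg X); P f\<rbrakk>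
      \<Longrightarrow> P (star (free_star_alg X) (gen x) \<otimes>\<^bsub>free_star_alg X\<^esub> f)"
  shows "P (single w)"
proof -
  interpret M: inv_monoid "word_monoid X" by (rule inv_monoid_word)
  show ?thesis using w
  proof (induction w)
    case Nil
    then show ?case using 1 M.Q_one by (simp add: free_star_alg_def word_monoid_def)
  next
    case (Cons l w)
    obtain x b where l: "l = (x, b)" "x \<in> X" using Cons by auto
    have w: "single w \<in> carrier (free_star_alg X)"
      using Cons M.single_closed[of w] by (auto simp: free_star_alg_def word_monoid_def)
    have "single [l] \<otimes>\<^bsub>free_star_alg X\<^esub> single w = single (l # w)"
      using M.single_mult[of "[l]" w] Cons l by (auto simp: free_star_alg_def word_monoid_def)
    moreover have "single [l] = (if b then star (free_star_alg X) (gen x) else gen x)"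
      using M.single_star[of "[(x, False)]"] l by (auto simp: free_star_alg_def word_monoid_def gen_def)
    ultimately show ?case using gen[OF l(2) w] star[OF l(2) w] Cons by (auto split: if_splits)
  qed
qed

lemma free_hom_eqI:
  assumes D: "star_algebra D" and F: "star_hom (free_star_alg X) D F" and G: "star_hom (free_star_alg X) D G"
    and eq: "\<And>x. x \<in> X \<Longrightarrow> F (gen x) = G (gen x)" and f: "f \<in> carrier (free_star_alg X)"
  shows "F f = G f"
proof -
  interpret M: inv_monoid "word_monoid X" by (rule inv_monoid_word)
  interpret P: star_algebra "free_star_alg X" by (rule star_algebra_free)
  interpret D: star_algebra D by (rule D)
  interpret F: star_morphism "free_star_alg X" D F by unfold_locales (rule F)
  interpret G: star_morphism "free_star_alg X" D G by unfold_locales (rule G)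
  show ?thesis
  proof (rule M.Q_hom_eqI[OF D F[unfolded free_star_alg_def] G[unfolded free_star_alg_def] _ f[unfolded free_star_alg_def]])
    fix w assume "w \<in> carrier (word_monoid X)"
    then have "w \<in> lists (X \<times> UNIV)" by (simp add: word_monoid_def)
    then show "F (single w) = G (single w)"
      by (rule free_word_induct[where P = "\<lambda>f. F f = G f"]) (simp_all add: eq)
  qed
qed

lemma free_hom_ex:
  assumes D: "star_algebra D" and b: "\<And>x. x \<in> X \<Longrightarrow> b x \<in> carrier D"
  shows "\<exists>F. star_hom (free_star_alg X) D F \<and> (\<forall>x\<in>X. F (gen x) = b x)"
proof -
  interpret M: inv_monoid "word_monoid X" by (rule inv_monoid_word)
  interpret D: star_algebra D by (rule D)
  define l where "l = (\<lambda>(x, s). if s then star D (b x) else b x)"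
  define \<phi> where "\<phi> w = foldr (\<lambda>z a. l z \<otimes>\<^bsub>D\<^esub> a) w \<one>\<^bsub>D\<^esub>" for w
  have lc: "l z \<in> carrier D" if "z \<in> X \<times> UNIV" for z using that b by (auto simp: l_def)
  have \<phi>c: "\<phi> w \<in> carrier D" if "w \<in> lists (X \<times> UNIV)" for w
    using that by (induction w) (auto simp: \<phi>_def lc)
  have mult: "\<phi> (u @ v) = \<phi> u \<otimes>\<^bsub>D\<^esub> \<phi> v" if u: "u \<in> lists (X \<times> UNIV)" and v: "v \<in> lists (X \<times> UNIV)" for u v
    using u
  proof (induction u)
    case (Cons z u)
    then have "\<phi> (z # u) = l z \<otimes>\<^bsub>D\<^esub> \<phi> u" "\<phi> ((z # u) @ v) = l z \<otimes>\<^bsub>D\<^esub> \<phi> (u @ v)" by (simp_all add: \<phi>_def)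
    then show ?case using Cons lc[of z] \<phi>c[of u] \<phi>c[OF v] by (simp add: D.m_assoc)
  qed (use \<phi>c[OF v] in \<open>simp add: \<phi>_def\<close>)
  have inv: "\<phi> (rev (map (\<lambda>(x, b). (x, \<not> b)) w)) = star D (\<phi> w)" if "w \<in> lists (X \<times> UNIV)" for w
    using that
  proof (induction w)
    case (Cons z w)
    have z: "z \<in> X \<times> UNIV" using Cons by auto
    have "\<phi> [case z of (x, b) \<Rightarrow> (x, \<not> b)] = star D (l z)"
      using z b by (auto simp: \<phi>_def l_def)
    moreover have "\<phi> (z # w) = l z \<otimes>\<^bsub>D\<^esub> \<phi> w" by (simp add: \<phi>_def)
    moreover have "rev (map (\<lambda>(x, b). (x, \<not> b)) w) \<in> lists (X \<times> UNIV)"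
      "[case z of (x, b) \<Rightarrow> (x, \<not> b)] \<in> lists (X \<times> UNIV)" using Cons z by auto
    note mult[OF this]
    ultimately show ?case using Cons z lc[OF z] \<phi>c[of w] by simp
  qed (simp add: \<phi>_def)
  have "\<exists>F. star_hom M.Q D F \<and> (\<forall>w\<in>carrier (word_monoid X). F (single w) = \<phi> w)"
    by (rule M.Q_hom_ex[OF D]) (use \<phi>c mult inv in \<open>auto simp: word_monoid_def \<phi>_def[of "[]"]\<close>)
  then obtain F where F: "star_hom M.Q D F" "\<And>w. w \<in> carrier (word_monoid X) \<Longrightarrow> F (single w) = \<phi> w"
    by blast
  have "F (gen x) = b x" if "x \<in> X" for x
    using F(2)[of "[(x, False)]"] that b[OF that] by (simp add: gen_def word_monoid_def \<phi>_def l_def)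
  then show ?thesis using F(1) by (auto simp: free_star_alg_def)
qed

section \<open>Universal C*-algebras of presentations by bounded generators\<close>

locale presentation =
  fixes X :: "'x set" and R :: "'x star_poly set"
  assumes rels: "R \<subseteq> carrier (free_star_alg X)"
    and bounded: "x \<in> X \<Longrightarrow> \<exists>b. \<forall>p. cstar_seminorm (free_star_alg X) p \<longrightarrow> (\<forall>r\<in>R. p r = 0) \<longrightarrow> p (gen x) \<le> b"
begin

abbreviation "P \<equiv> free_star_alg X"
abbreviation "u \<equiv> univ_seminorm X R"

definition admissible :: "('x star_poly \<Rightarrow> real) \<Rightarrow> bool" where
  "admissible p \<longleftrightarrow> cstar_seminorm P p \<and> (\<forall>r\<in>R. p r = 0)"

text \<open>The bound on the generators passes to words by submultiplicativity and to all elements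
  by linearity. Without it the supremum defining \<open>univ_seminorm\<close> would be taken over
  unbounded sets.\<close>

lemma bounded_all:
  assumes f: "f \<in> carrier P"
  shows "\<exists>b. \<forall>p. admissible p \<longrightarrow> p f \<le> b"
proof -
  interpret M: inv_monoid "word_monoid X" by (rule inv_monoid_word)
  interpret P: star_algebra P by (rule star_algebra_free)
  have sn: "seminormed_star_algebra P p" if "admissible p" for p
    using that by unfold_locales (simp add: admissible_def)
  have mult: "\<exists>b. \<forall>p. admissible p \<longrightarrow> p (f \<otimes>\<^bsub>P\<^esub> g) \<le> b"
    if f: "f \<in> carrier P" "\<exists>b. \<forall>p. admissible p \<longrightarrow> p f \<le> b"
      and g: "g \<in> carrier P" "\<exists>b. \<forall>p. admissible p \<longrightarrow> p g \<le> b" for f g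
  proof -
    obtain b c where b: "\<And>p. admissible p \<Longrightarrow> p f \<le> b" and c: "\<And>p. admissible p \<Longrightarrow> p g \<le> c"
      using f g by blast
    have "p (f \<otimes>\<^bsub>P\<^esub> g) \<le> b * c" if p: "admissible p" for p
    proof -
      interpret seminormed_star_algebra P p by (rule sn[OF p])
      have "p (f \<otimes>\<^bsub>P\<^esub> g) \<le> p f * p g" using f g by (intro p_mult)
      also have "\<dots> \<le> b * c"
        using b[OF p] c[OF p] f(1) g(1) p_nonneg[of f] p_nonneg[of g] by (intro mult_mono) linarith+
      finally show ?thesis .
    qed
    then show ?thesis by blast
  qed
  have word: "\<exists>b. \<forall>p. admissible p \<longrightarrow> p (single w) \<le> b" if "w \<in> lists (X \<times> UNIV)" for w
    using that
  proof (rule free_word_induct[where P = "\<lambda>f. \<exists>b. \<forall>p. admissible p \<longrightarrow> p f \<le> b"])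
    show "\<exists>b. \<forall>p. admissible p \<longrightarrow> p \<one>\<^bsub>P\<^esub> \<le> b"
      using seminormed_star_algebra.p_one[OF sn] by blast
    fix x f assume x: "x \<in> X" and f: "f \<in> carrier P" "\<exists>b. \<forall>p. admissible p \<longrightarrow> p f \<le> b"
    have g: "\<exists>b. \<forall>p. admissible p \<longrightarrow> p (gen x) \<le> b"
      using bounded[OF x] unfolding admissible_def by blast
    then show "\<exists>b. \<forall>p. admissible p \<longrightarrow> p (gen x \<otimes>\<^bsub>P\<^esub> f) \<le> b"
      using x f by (intro mult) auto
    have "\<exists>b. \<forall>p. admissible p \<longrightarrow> p (star P (gen x)) \<le> b"
      using g seminormed_star_algebra.p_star[OF sn gen_closed[OF x]] by metis
    then show "\<exists>b. \<forall>p. admissible p \<longrightarrow> p (star P (gen x) \<otimes>\<^bsub>P\<^esub> f) \<le> b"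
      using x f by (intro mult) auto
  qed
  show ?thesis using f unfolding free_star_alg_def
  proof (induction rule: M.Q_induct)
    case zero
    then show ?case using seminormed_star_algebra.p_zero[OF sn] unfolding free_star_alg_def by force
  next
    case (add f c w)
    obtain b where b: "\<And>p. admissible p \<Longrightarrow> p f \<le> b" using add by blast
    have "w \<in> lists (X \<times> UNIV)" using add by (simp add: word_monoid_def)
    then obtain d where d: "\<And>p. admissible p \<Longrightarrow> p (single w) \<le> d" using word by blast
    have f: "f \<in> carrier P" and w: "single w \<in> carrier P" using add unfolding free_star_alg_def by auto
    have "p (f \<oplus>\<^bsub>P\<^esub> c \<odot>\<^bsub>P\<^esub> single w) \<le> b + cmod c * d" if p: "admissible p" for p
    proof -
      interpret seminormed_star_algebra P p by (rule sn[OF p])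
      have "p (f \<oplus>\<^bsub>P\<^esub> c \<odot>\<^bsub>P\<^esub> single w) \<le> p f + cmod c * p (single w)"
        using f w p_triangle[of f "c \<odot>\<^bsub>P\<^esub> single w"] by simp
      also have "\<dots> \<le> b + cmod c * d" using b[OF p] d[OF p] by (intro add_mono mult_left_mono) auto
      finally show ?thesis .
    qed
    then show ?case unfolding free_star_alg_def by blast
  qed
qed

lemma admissible_zero: "admissible (\<lambda>_. 0)"
  by (simp add: admissible_def cstar_seminorm_def)

lemma u_eq: "u x = Sup {p x |p. admissible p}"
  by (simp add: univ_seminorm_def admissible_def)

lemma u_upper: "\<lbrakk>admissible p; x \<in> carrier P\<rbrakk> \<Longrightarrow> p x \<le> u x"
  unfolding u_eq using bounded_all[of x] by (intro cSup_upper) (auto simp: bdd_above_def)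

lemma u_least: "(\<And>p. admissible p \<Longrightarrow> p x \<le> b) \<Longrightarrow> u x \<le> b"
  unfolding u_eq using admissible_zero by (intro cSup_least) auto

lemma seminorm_u: "cstar_seminorm P u"
  unfolding cstar_seminorm_def
proof (intro conjI ballI allI)
  interpret P: star_algebra P by (rule star_algebra_free)
  have sn: "seminormed_star_algebra P p" if "admissible p" for p
    using that by unfold_locales (simp add: admissible_def)
  fix x assume x: "x \<in> carrier P"
  show u0: "0 \<le> u x" using u_upper[OF admissible_zero x] .
  show "u (star P x \<otimes>\<^bsub>P\<^esub> x) = (u x)\<^sup>2"
  proof (rule antisym)
    show "u (star P x \<otimes>\<^bsub>P\<^esub> x) \<le> (u x)\<^sup>2"
    proof (rule u_least)
      fix p assume p: "admissible p"
      interpret seminormed_star_algebra P p by (rule sn[OF p])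
      show "p (star P x \<otimes>\<^bsub>P\<^esub> x) \<le> (u x)\<^sup>2" using x u_upper[OF p x] by (simp add: p_cstar power_mono)
    qed
    \<comment> \<open>The square root on the right turns the C*-identity of each single p into a
      bound on p x, so that \<open>u_least\<close> applies.\<close>
    have "u x \<le> sqrt (u (star P x \<otimes>\<^bsub>P\<^esub> x))"
    proof (rule u_least)
      fix p assume p: "admissible p"
      interpret seminormed_star_algebra P p by (rule sn[OF p])
      show "p x \<le> sqrt (u (star P x \<otimes>\<^bsub>P\<^esub> x))"
        using x u_upper[OF p, of "star P x \<otimes>\<^bsub>P\<^esub> x"] by (intro real_le_rsqrt) (simp add: p_cstar)
    qed
    then have "(u x)\<^sup>2 \<le> (sqrt (u (star P x \<otimes>\<^bsub>P\<^esub> x)))\<^sup>2" using u0 by (rule power_mono)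
    also have "\<dots> = u (star P x \<otimes>\<^bsub>P\<^esub> x)"
      using u_upper[OF admissible_zero, of "star P x \<otimes>\<^bsub>P\<^esub> x"] x by simp
    finally show "(u x)\<^sup>2 \<le> u (star P x \<otimes>\<^bsub>P\<^esub> x)" .
  qed
  have le: "u (c \<odot>\<^bsub>P\<^esub> x) \<le> cmod c * u x" if x: "x \<in> carrier P" for c x
  proof (rule u_least)
    fix p assume p: "admissible p"
    interpret seminormed_star_algebra P p by (rule sn[OF p])
    show "p (c \<odot>\<^bsub>P\<^esub> x) \<le> cmod c * u x" using x u_upper[OF p x] by (simp add: mult_left_mono)
  qed
  show "u (c \<odot>\<^bsub>P\<^esub> x) = cmod c * u x" for c
  proof (cases "c = 0")
    case True
    have "0 \<le> u \<zero>\<^bsub>P\<^esub>" using u_upper[OF admissible_zero] by simp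
    then show ?thesis using le[OF x, of c] True x by simp
  next
    case False
    \<comment> \<open>The inequality \<open>le\<close> for the inverse scalar yields the reverse
      inequality.\<close>
    have "u x \<le> cmod (inverse c) * u (c \<odot>\<^bsub>P\<^esub> x)" using le[of "c \<odot>\<^bsub>P\<^esub> x" "inverse c"] x False by simp
    then have "cmod c * u x \<le> u (c \<odot>\<^bsub>P\<^esub> x)" using False by (simp add: norm_divide field_simps)
    then show ?thesis using le[OF x, of c] by simp
  qed
  fix y assume y: "y \<in> carrier P"
  show "u (x \<oplus>\<^bsub>P\<^esub> y) \<le> u x + u y"
  proof (rule u_least)
    fix p assume p: "admissible p"
    interpret seminormed_star_algebra P p by (rule sn[OF p])
    show "p (x \<oplus>\<^bsub>P\<^esub> y) \<le> u x + u y"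
      using p_triangle[OF x y] u_upper[OF p x] u_upper[OF p y] by linarith
  qed
  show "u (x \<otimes>\<^bsub>P\<^esub> y) \<le> u x * u y"
  proof (rule u_least)
    fix p assume p: "admissible p"
    interpret seminormed_star_algebra P p by (rule sn[OF p])
    show "p (x \<otimes>\<^bsub>P\<^esub> y) \<le> u x * u y"
      using p_mult[OF x y] mult_mono[OF u_upper[OF p x] u_upper[OF p y] u0 p_nonneg[OF y]] by linarith
  qed
qed

sublocale U: seminormed_star_algebra P u
  by (rule seminormed_star_algebra.intro[OF star_algebra_free]) (unfold_locales, rule seminorm_u)

lemma cstar_algebra_univ: "cstar_algebra (univ_cstar X R)"
  unfolding univ_cstar_def by (rule U.cstar_algebra_completion)

lemma univ_gen_closed [simp, intro]: "x \<in> X \<Longrightarrow> univ_gen X R x \<in> carrier (univ_cstar X R)"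
  unfolding univ_gen_def univ_cstar_def by auto

lemma u_rel: "r \<in> R \<Longrightarrow> u r = 0"
proof (rule antisym)
  assume r: "r \<in> R"
  show "u r \<le> 0" by (rule u_least) (use r in \<open>simp add: admissible_def\<close>)
  show "0 \<le> u r" using u_upper[OF admissible_zero] r rels by blast
qed

lemma star_hom_to_univ: "star_hom P (univ_cstar X R) (to_completion P u)"
  unfolding univ_cstar_def by (rule U.star_hom_to_completion)

lemma to_univ_rel: "r \<in> R \<Longrightarrow> to_completion P u r = \<zero>\<^bsub>univ_cstar X R\<^esub>"
proof -
  assume r: "r \<in> R"
  then have P: "r \<in> carrier P" using rels by blast
  have "to_completion P u r \<in> carrier (univ_cstar X R)" "nrm (univ_cstar X R) (to_completion P u r) = 0"
    using U.to_completion_closed[OF P] U.nrm_to_completion[OF P] u_rel[OF r] by (simp_all add: univ_cstar_def)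
  then show ?thesis by (rule cstar_algebra.nrm_eq_zero[OF cstar_algebra_univ])
qed

text \<open>The norm pulled back along f is one of the seminorms in the supremum, so f is bounded by
  it and extends to the completion. The assumption \<open>rel\<close> quantifies over f because the
  homomorphism on the free algebra is only produced inside the proof.\<close>

lemma univ_hom_ex:
  assumes D: "cstar_algebra D" and b: "\<And>x. x \<in> X \<Longrightarrow> b x \<in> carrier D"
    and rel: "\<And>f r. \<lbrakk>star_hom P D f; \<And>x. x \<in> X \<Longrightarrow> f (gen x) = b x; r \<in> R\<rbrakk> \<Longrightarrow> f r = \<zero>\<^bsub>D\<^esub>"
  shows "\<exists>F. star_hom (univ_cstar X R) D F \<and> (\<forall>x\<in>X. F (univ_gen X R x) = b x)"
proof -
  interpret D: cstar_algebra D by (rule D)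
  obtain f where f: "star_hom P D f" "\<And>x. x \<in> X \<Longrightarrow> f (gen x) = b x"
    using free_hom_ex[of D X b, OF D.star_algebra_axioms b] by blast
  interpret f: star_morphism P D f
    by (rule star_morphism.intro[OF star_algebra_free D.star_algebra_axioms]) (unfold_locales, rule f)
  have "cstar_seminorm P (\<lambda>x. nrm D (f x))"
    unfolding cstar_seminorm_def by (simp add: D.p_triangle D.p_mult D.p_cstar)
  then have adm: "admissible (\<lambda>x. nrm D (f x))" by (simp add: admissible_def rel[OF f])
  have "\<exists>F. star_hom U.C D F \<and> (\<forall>x\<in>carrier P. F (to_completion P u x) = f x)"
    by (rule U.completion_extend[OF D f(1)]) (rule u_upper[OF adm])
  then obtain F where F: "star_hom U.C D F" "\<And>x. x \<in> carrier P \<Longrightarrow> F (to_completion P u x) = f x" by blast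
  have "F (univ_gen X R x) = b x" if "x \<in> X" for x
    using F(2)[of "gen x"] f(2) that by (simp add: univ_gen_def gen_closed)
  then show ?thesis using F(1) unfolding univ_cstar_def by blast
qed

lemma univ_hom_eqI:
  assumes D: "cstar_algebra D" and F: "star_hom (univ_cstar X R) D F" and G: "star_hom (univ_cstar X R) D G"
    and eq: "\<And>x. x \<in> X \<Longrightarrow> F (univ_gen X R x) = G (univ_gen X R x)"
    and a: "a \<in> carrier (univ_cstar X R)"
  shows "F a = G a"
proof (rule U.completion_hom_eqI[OF D F[unfolded univ_cstar_def] G[unfolded univ_cstar_def] _ a[unfolded univ_cstar_def]])
  have D': "star_algebra D" using D by (simp add: cstar_algebra_def)
  fix x assume x: "x \<in> carrier P"
  show "F (to_completion P u x) = G (to_completion P u x)"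
    by (rule free_hom_eqI[OF D' star_hom_comp[OF star_hom_to_univ F] star_hom_comp[OF star_hom_to_univ G] _ x])
      (use eq in \<open>simp add: univ_gen_def\<close>)
qed

end

section \<open>Free products\<close>

lemma free_prod_rels_iff:
  "r \<in> free_prod_rels I A \<longleftrightarrow> (\<exists>i\<in>I.
    (\<exists>a\<in>carrier (A i). \<exists>b\<in>carrier (A i). r = gen (i, a \<oplus>\<^bsub>A i\<^esub> b)
        \<ominus>\<^bsub>free_star_alg (free_prod_gens I A)\<^esub> (gen (i, a) \<oplus>\<^bsub>free_star_alg (free_prod_gens I A)\<^esub> gen (i, b)))
    \<or> (\<exists>c. \<exists>a\<in>carrier (A i). r = gen (i, c \<odot>\<^bsub>A i\<^esub> a)
        \<ominus>\<^bsub>free_star_alg (free_prod_gens I A)\<^esub> (c \<odot>\<^bsub>free_star_alg (free_prod_gens I A)\<^esub> gen (i, a)))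
    \<or> (\<exists>a\<in>carrier (A i). \<exists>b\<in>carrier (A i). r = gen (i, a \<otimes>\<^bsub>A i\<^esub> b)
        \<ominus>\<^bsub>free_star_alg (free_prod_gens I A)\<^esub> (gen (i, a) \<otimes>\<^bsub>free_star_alg (free_prod_gens I A)\<^esub> gen (i, b)))
    \<or> (\<exists>a\<in>carrier (A i). r = gen (i, star (A i) a)
        \<ominus>\<^bsub>free_star_alg (free_prod_gens I A)\<^esub> star (free_star_alg (free_prod_gens I A)) (gen (i, a)))
    \<or> r = gen (i, \<one>\<^bsub>A i\<^esub>) \<ominus>\<^bsub>free_star_alg (free_prod_gens I A)\<^esub> \<one>\<^bsub>free_star_alg (free_prod_gens I A)\<^esub>)"
  unfolding free_prod_rels_def Let_def UN_iff Un_iff mem_Collect_eq singleton_iff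
  by (rule bex_cong[OF refl]) blast

locale free_product =
  fixes I :: "'i set" and A :: "'i \<Rightarrow> 'a cstar"
  assumes cstar_factor: "i \<in> I \<Longrightarrow> cstar_algebra (A i)"
begin

abbreviation "X \<equiv> free_prod_gens I A"
abbreviation "R \<equiv> free_prod_rels I A"
abbreviation "P \<equiv> free_star_alg X"
abbreviation "F \<equiv> free_prod I A"
abbreviation "\<iota> \<equiv> free_prod_incl I A"

lemma star_factor: "i \<in> I \<Longrightarrow> star_algebra (A i)"
  using cstar_factor by (simp add: cstar_algebra_def)

lemma gen_in_X: "\<lbrakk>i \<in> I; a \<in> carrier (A i)\<rbrakk> \<Longrightarrow> (i, a) \<in> X"
  by (simp add: free_prod_gens_def)

lemma gen_in_P: "\<lbrakk>i \<in> I; a \<in> carrier (A i)\<rbrakk> \<Longrightarrow> gen (i, a) \<in> carrier P"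
  by (simp add: gen_in_X gen_closed)

lemma rel_add: "\<lbrakk>i \<in> I; a \<in> carrier (A i); b \<in> carrier (A i)\<rbrakk>
    \<Longrightarrow> gen (i, a \<oplus>\<^bsub>A i\<^esub> b) \<ominus>\<^bsub>P\<^esub> (gen (i, a) \<oplus>\<^bsub>P\<^esub> gen (i, b)) \<in> R"
  and rel_smult: "\<lbrakk>i \<in> I; a \<in> carrier (A i)\<rbrakk>
    \<Longrightarrow> gen (i, c \<odot>\<^bsub>A i\<^esub> a) \<ominus>\<^bsub>P\<^esub> (c \<odot>\<^bsub>P\<^esub> gen (i, a)) \<in> R"
  and rel_mult: "\<lbrakk>i \<in> I; a \<in> carrier (A i); b \<in> carrier (A i)\<rbrakk>
    \<Longrightarrow> gen (i, a \<otimes>\<^bsub>A i\<^esub> b) \<ominus>\<^bsub>P\<^esub> (gen (i, a) \<otimes>\<^bsub>P\<^esub> gen (i, b)) \<in> R"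
  and rel_star: "\<lbrakk>i \<in> I; a \<in> carrier (A i)\<rbrakk>
    \<Longrightarrow> gen (i, star (A i) a) \<ominus>\<^bsub>P\<^esub> star P (gen (i, a)) \<in> R"
  and rel_one: "i \<in> I \<Longrightarrow> gen (i, \<one>\<^bsub>A i\<^esub>) \<ominus>\<^bsub>P\<^esub> \<one>\<^bsub>P\<^esub> \<in> R"
  unfolding free_prod_rels_iff by blast+

lemma rels_closed: "R \<subseteq> carrier P"
proof
  interpret P: star_algebra P by (rule star_algebra_free)
  fix r assume "r \<in> R"
  then show "r \<in> carrier P"
    unfolding free_prod_rels_iff
    by (elim bexE disjE exE)
      (simp_all add: gen_in_P P.minus_closed star_algebra.star_closed[OF star_factor]
        star_algebra.smult_closed[OF star_factor] ring.ring_simprules[OF star_algebra.axioms(1)[OF star_factor]])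
qed

sublocale pres: presentation X R
proof
  show "R \<subseteq> carrier P" by (rule rels_closed)
  fix x assume "x \<in> X"
  then obtain i a where x: "x = (i, a)" "i \<in> I" "a \<in> carrier (A i)" by (auto simp: free_prod_gens_def)
  interpret A: cstar_algebra "A i" by (rule cstar_factor[OF x(2)])
  have "p (gen x) \<le> nrm (A i) a" if p: "cstar_seminorm P p" and R: "\<forall>r\<in>R. p r = 0" for p
  proof -
    interpret p: seminormed_star_algebra P p
      by (rule seminormed_star_algebra.intro[OF star_algebra_free]) (unfold_locales, rule p)
    \<comment> \<open>The values of p on the letters of the i-th factor form a C*-seminorm on
      \<open>A i\<close>, because p vanishes on the relators. As \<open>A i\<close> is complete, its
      norm bounds q and so bounds the generator uniformly in p.\<close>
    define q where "q b = p (gen (i, b))" for b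
    note g = gen_in_P[OF x(2)]
    have add: "q (b \<oplus>\<^bsub>A i\<^esub> c) = p (gen (i, b) \<oplus>\<^bsub>P\<^esub> gen (i, c))" if "b \<in> carrier (A i)" "c \<in> carrier (A i)" for b c
      unfolding q_def by (rule p.p_eq_of_diff) (use that g x(2) R rel_add[OF x(2)] in auto)
    have mult: "q (b \<otimes>\<^bsub>A i\<^esub> c) = p (gen (i, b) \<otimes>\<^bsub>P\<^esub> gen (i, c))" if "b \<in> carrier (A i)" "c \<in> carrier (A i)" for b c
      unfolding q_def by (rule p.p_eq_of_diff) (use that g x(2) R rel_mult[OF x(2)] in auto)
    have smult: "q (c \<odot>\<^bsub>A i\<^esub> b) = p (c \<odot>\<^bsub>P\<^esub> gen (i, b))" if "b \<in> carrier (A i)" for b c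
      unfolding q_def by (rule p.p_eq_of_diff) (use that g x(2) R rel_smult[OF x(2)] in auto)
    have star: "p (gen (i, star (A i) b) \<ominus>\<^bsub>P\<^esub> star P (gen (i, b))) = 0" if "b \<in> carrier (A i)" for b
      using that R rel_star[OF x(2)] by blast
    have cstar: "q (star (A i) b \<otimes>\<^bsub>A i\<^esub> b) = (q b)\<^sup>2" if b: "b \<in> carrier (A i)" for b
    proof -
      have gs: "gen (i, star (A i) b) \<in> carrier P" "gen (i, b) \<in> carrier P" using g b by auto
      \<comment> \<open>The letter of the adjoint agrees with the adjoint of the letter only up to
        p-distance 0; \<open>p_mult_diff\<close> carries the replacement through the
        product.\<close>
      have "p (gen (i, star (A i) b) \<otimes>\<^bsub>P\<^esub> gen (i, b) \<ominus>\<^bsub>P\<^esub> star P (gen (i, b)) \<otimes>\<^bsub>P\<^esub> gen (i, b))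
          \<le> p (gen (i, star (A i) b) \<ominus>\<^bsub>P\<^esub> star P (gen (i, b))) * p (gen (i, b))
            + p (star P (gen (i, b))) * p (gen (i, b) \<ominus>\<^bsub>P\<^esub> gen (i, b))"
        using gs by (intro p.p_mult_diff) auto
      also have "\<dots> = 0" using star[OF b] gs by simp
      finally have "p (gen (i, star (A i) b) \<otimes>\<^bsub>P\<^esub> gen (i, b) \<ominus>\<^bsub>P\<^esub> star P (gen (i, b)) \<otimes>\<^bsub>P\<^esub> gen (i, b)) = 0"
        using gs by (intro antisym) auto
      then have "p (gen (i, star (A i) b) \<otimes>\<^bsub>P\<^esub> gen (i, b)) = p (star P (gen (i, b)) \<otimes>\<^bsub>P\<^esub> gen (i, b))"
        using gs by (intro p.p_eq_of_diff) auto
      then show ?thesis using b gs by (simp add: mult p.p_cstar) (simp add: q_def)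
    qed
    have "cstar_seminorm (A i) q"
      unfolding cstar_seminorm_def
    proof (intro conjI ballI allI)
      fix b assume b: "b \<in> carrier (A i)"
      show "0 \<le> q b" using g[OF b] by (simp add: q_def)
      show "q (c \<odot>\<^bsub>A i\<^esub> b) = cmod c * q b" for c unfolding smult[OF b] using g[OF b] by (simp add: q_def)
      show "q (star (A i) b \<otimes>\<^bsub>A i\<^esub> b) = (q b)\<^sup>2" by (rule cstar[OF b])
      fix c assume c: "c \<in> carrier (A i)"
      show "q (b \<oplus>\<^bsub>A i\<^esub> c) \<le> q b + q c"
        unfolding add[OF b c] unfolding q_def by (rule p.p_triangle[OF g[OF b] g[OF c]])
      show "q (b \<otimes>\<^bsub>A i\<^esub> c) \<le> q b * q c"
        unfolding mult[OF b c] unfolding q_def by (rule p.p_mult[OF g[OF b] g[OF c]])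
    qed
    then have "q a \<le> nrm (A i) a" using x by (intro A.seminorm_le_nrm)
    then show ?thesis by (simp add: q_def x)
  qed
  then show "\<exists>b. \<forall>p. cstar_seminorm P p \<longrightarrow> (\<forall>r\<in>R. p r = 0) \<longrightarrow> p (gen x) \<le> b" by blast
qed

lemma cstar_algebra_free_prod: "cstar_algebra F"
  unfolding free_prod_def by (rule pres.cstar_algebra_univ)

lemma star_hom_incl: "i \<in> I \<Longrightarrow> star_hom (A i) F (\<iota> i)"
proof -
  assume i: "i \<in> I"
  interpret A: cstar_algebra "A i" by (rule cstar_factor[OF i])
  interpret F: cstar_algebra F by (rule cstar_algebra_free_prod)
  interpret j: star_morphism P F "to_completion P pres.u"
    by (rule star_morphism.intro[OF star_algebra_free F.star_algebra_axioms])
      (unfold_locales, simp add: free_prod_def pres.star_hom_to_univ)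
  have eq: "\<iota> i a = to_completion P pres.u (gen (i, a))" for a
    by (simp add: free_prod_incl_def univ_gen_def)
  note g = gen_in_P[OF i]
  have rel: "to_completion P pres.u x = to_completion P pres.u y"
    if "x \<ominus>\<^bsub>P\<^esub> y \<in> R" "x \<in> carrier P" "y \<in> carrier P" for x y
  proof -
    have "to_completion P pres.u x \<ominus>\<^bsub>F\<^esub> to_completion P pres.u y = \<zero>\<^bsub>F\<^esub>"
      unfolding j.map_minus[OF that(2,3), symmetric] unfolding free_prod_def by (rule pres.to_univ_rel[OF that(1)])
    then show ?thesis using that by simp
  qed
  show ?thesis
  proof (rule star_homI)
    fix a assume a: "a \<in> carrier (A i)"
    show "\<iota> i a \<in> carrier F" using a g by (simp add: eq)
    show "\<iota> i (c \<odot>\<^bsub>A i\<^esub> a) = c \<odot>\<^bsub>F\<^esub> \<iota> i a" for c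
      using rel_smult[OF i, of a c] rel[of "gen (i, c \<odot>\<^bsub>A i\<^esub> a)" "c \<odot>\<^bsub>P\<^esub> gen (i, a)"] a g i
      by (auto simp: eq)
    show "\<iota> i (star (A i) a) = star F (\<iota> i a)"
      using rel_star[OF i, of a] rel[of "gen (i, star (A i) a)" "star P (gen (i, a))"] a g i
      by (auto simp: eq)
    fix b assume b: "b \<in> carrier (A i)"
    show "\<iota> i (a \<oplus>\<^bsub>A i\<^esub> b) = \<iota> i a \<oplus>\<^bsub>F\<^esub> \<iota> i b"
      using rel_add[OF i, of a b] rel[of "gen (i, a \<oplus>\<^bsub>A i\<^esub> b)" "gen (i, a) \<oplus>\<^bsub>P\<^esub> gen (i, b)"] a b g i
      by (auto simp: eq)
    show "\<iota> i (a \<otimes>\<^bsub>A i\<^esub> b) = \<iota> i a \<otimes>\<^bsub>F\<^esub> \<iota> i b"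
      using rel_mult[OF i, of a b] rel[of "gen (i, a \<otimes>\<^bsub>A i\<^esub> b)" "gen (i, a) \<otimes>\<^bsub>P\<^esub> gen (i, b)"] a b g i
      by (auto simp: eq)
  next
    show "\<iota> i \<one>\<^bsub>A i\<^esub> = \<one>\<^bsub>F\<^esub>"
      using rel_one[OF i] rel[of "gen (i, \<one>\<^bsub>A i\<^esub>)" "\<one>\<^bsub>P\<^esub>"] g i by (auto simp: eq)
  qed
qed

lemma free_prod_hom_ex:
  assumes D: "cstar_algebra D" and f: "\<And>i. i \<in> I \<Longrightarrow> star_hom (A i) D (f i)"
  shows "\<exists>h. star_hom F D h \<and> (\<forall>i\<in>I. \<forall>a\<in>carrier (A i). h (\<iota> i a) = f i a)"
proof -
  interpret D: cstar_algebra D by (rule D)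
  have fm: "star_morphism (A i) D (f i)" if "i \<in> I" for i
    using star_factor[OF that] D.star_algebra_axioms f[OF that]
    by (simp add: star_morphism_def star_morphism_axioms_def)
  have "\<exists>h. star_hom (univ_cstar X R) D h \<and> (\<forall>x\<in>X. h (univ_gen X R x) = (case x of (i, a) \<Rightarrow> f i a))"
  proof (rule pres.univ_hom_ex[OF D])
    fix x assume "x \<in> X"
    then show "(case x of (i, a) \<Rightarrow> f i a) \<in> carrier D"
      using star_morphism.closed[OF fm] by (auto simp: free_prod_gens_def)
  next
    fix h r assume h: "star_hom P D h" "\<And>x. x \<in> X \<Longrightarrow> h (gen x) = (case x of (i, a) \<Rightarrow> f i a)" and r: "r \<in> R"
    interpret h: star_morphism P D h
      by (rule star_morphism.intro[OF star_algebra_free D.star_algebra_axioms]) (unfold_locales, rule h)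
    have hg: "h (gen (i, a)) = f i a" if "i \<in> I" "a \<in> carrier (A i)" for i a
      using h(2)[OF gen_in_X[OF that]] by simp
    from r show "h r = \<zero>\<^bsub>D\<^esub>"
      unfolding free_prod_rels_iff
    proof (elim bexE)
      fix i assume i: "i \<in> I"
      interpret fi: star_morphism "A i" D "f i" by (rule fm[OF i])
      note s = hg[OF i] gen_in_P[OF i]
      assume "(\<exists>a\<in>carrier (A i). \<exists>b\<in>carrier (A i). r = gen (i, a \<oplus>\<^bsub>A i\<^esub> b) \<ominus>\<^bsub>P\<^esub> (gen (i, a) \<oplus>\<^bsub>P\<^esub> gen (i, b)))
        \<or> (\<exists>c. \<exists>a\<in>carrier (A i). r = gen (i, c \<odot>\<^bsub>A i\<^esub> a) \<ominus>\<^bsub>P\<^esub> (c \<odot>\<^bsub>P\<^esub> gen (i, a)))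
        \<or> (\<exists>a\<in>carrier (A i). \<exists>b\<in>carrier (A i). r = gen (i, a \<otimes>\<^bsub>A i\<^esub> b) \<ominus>\<^bsub>P\<^esub> (gen (i, a) \<otimes>\<^bsub>P\<^esub> gen (i, b)))
        \<or> (\<exists>a\<in>carrier (A i). r = gen (i, star (A i) a) \<ominus>\<^bsub>P\<^esub> star P (gen (i, a)))
        \<or> r = gen (i, \<one>\<^bsub>A i\<^esub>) \<ominus>\<^bsub>P\<^esub> \<one>\<^bsub>P\<^esub>"
      then show "h r = \<zero>\<^bsub>D\<^esub>"
        by (elim disjE bexE exE) (simp_all add: s)
    qed
  qed
  then obtain h where h: "star_hom F D h" "\<And>x. x \<in> X \<Longrightarrow> h (univ_gen X R x) = (case x of (i, a) \<Rightarrow> f i a)"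
    unfolding free_prod_def by blast
  have "h (\<iota> i a) = f i a" if "i \<in> I" "a \<in> carrier (A i)" for i a
    using h(2)[OF gen_in_X[OF that]] by (simp add: free_prod_incl_def)
  then show ?thesis using h(1) by blast
qed

lemma free_prod_hom_eqI:
  assumes D: "cstar_algebra D" and f: "star_hom F D f" and g: "star_hom F D g"
    and eq: "\<And>i a. \<lbrakk>i \<in> I; a \<in> carrier (A i)\<rbrakk> \<Longrightarrow> f (\<iota> i a) = g (\<iota> i a)" and x: "x \<in> carrier F"
  shows "f x = g x"
  by (rule pres.univ_hom_eqI[OF D f[unfolded free_prod_def] g[unfolded free_prod_def] _ x[unfolded free_prod_def]])
    (use eq in \<open>auto simp: free_prod_gens_def free_prod_incl_def\<close>)

end

section \<open>Positive semidefinite matrices and positive functionals\<close>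

text \<open>The inequality is that of the complex order, so the form is real-valued and Hermitian
  symmetry comes out as a consequence.\<close>

definition psd_on :: "'k set \<Rightarrow> ('k \<Rightarrow> 'k \<Rightarrow> complex) \<Rightarrow> bool" where
  "psd_on S X \<longleftrightarrow> (\<forall>z. 0 \<le> (\<Sum>u\<in>S. \<Sum>v\<in>S. cnj (z u) * z v * X u v))"

lemma psd_onD: "psd_on S X \<Longrightarrow> 0 \<le> (\<Sum>u\<in>S. \<Sum>v\<in>S. cnj (z u) * z v * X u v)"
  by (simp add: psd_on_def)

lemma psd_on_subset:
  assumes "psd_on S X" "T \<subseteq> S" "finite S"
  shows "psd_on T X"
  unfolding psd_on_def
proof
  fix z :: "'a \<Rightarrow> complex"
  let ?z = "\<lambda>u. if u \<in> T then z u else 0"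
  have "(\<Sum>u\<in>T. \<Sum>v\<in>T. cnj (z u) * z v * X u v) = (\<Sum>u\<in>T. \<Sum>v\<in>T. cnj (?z u) * ?z v * X u v)"
    by (intro sum.cong refl) auto
  also have "\<dots> = (\<Sum>u\<in>T. \<Sum>v\<in>S. cnj (?z u) * ?z v * X u v)"
    by (intro sum.cong refl sum.mono_neutral_left) (use assms in auto)
  also have "\<dots> = (\<Sum>u\<in>S. \<Sum>v\<in>S. cnj (?z u) * ?z v * X u v)"
    by (intro sum.mono_neutral_left) (use assms in auto)
  finally show "0 \<le> (\<Sum>u\<in>T. \<Sum>v\<in>T. cnj (z u) * z v * X u v)"
    using psd_onD[OF assms(1), of ?z] by simp
qed

lemma psd_on_diag:
  assumes "psd_on S X" "u \<in> S" "finite S"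
  shows "0 \<le> X u u"
  using psd_onD[OF psd_on_subset[OF assms(1), of "{u}"], of "\<lambda>_. 1"] assms by simp

lemma psd_on_two:
  assumes "psd_on S X" "u \<in> S" "v \<in> S" "u \<noteq> v" "finite S"
  shows "0 \<le> cnj a * a * X u u + cnj a * b * X u v + cnj b * a * X v u + cnj b * b * X v v"
  using psd_onD[OF psd_on_subset[OF assms(1), of "{u, v}"], of "\<lambda>w. if w = u then a else b"] assms
  by (simp add: add_ac)

text \<open>The form is real at the vectors (1, 1) and (1, i), which controls the imaginary and the
  real part of the off-diagonal entries.\<close>

lemma psd_on_hermitian:
  assumes "psd_on S X" "u \<in> S" "v \<in> S" "finite S"
  shows "X v u = cnj (X u v)"
proof (cases "u = v")
  case True
  then show ?thesis using psd_on_diag[OF assms(1,2,4)] by (simp add: complex_eq_iff less_eq_complex_def)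
next
  case False
  have d: "Im (X u u) = 0" "Im (X v v) = 0"
    using psd_on_diag[OF assms(1,2,4)] psd_on_diag[OF assms(1,3,4)] by (simp_all add: less_eq_complex_def)
  have "Im (X u v) + Im (X v u) = 0"
    using psd_on_two[OF assms(1-3) False assms(4), of 1 1] d by (simp add: less_eq_complex_def)
  moreover have "Re (X u v) - Re (X v u) = 0"
    using psd_on_two[OF assms(1-3) False assms(4), of 1 \<i>] d by (simp add: less_eq_complex_def)
  ultimately show ?thesis by (simp add: complex_eq_iff)
qed

lemma psd_on_zero_diag:
  assumes X: "psd_on S X" "u \<in> S" "v \<in> S" "finite S" and 0: "X u u = 0"
  shows "X u v = 0"
proof (cases "u = v")
  case False
  define h where "h = X u v"
  define r where "r = Re (X v v)"
  have r: "X v v = complex_of_real r" "0 \<le> r"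
    using psd_on_diag[OF X(1,3,4)] by (simp_all add: r_def less_eq_complex_def complex_eq_iff)
  have hv: "X v u = cnj h" using psd_on_hermitian[OF X] by (simp add: h_def)
  have "2 * t * (cmod h)\<^sup>2 \<le> r" for t :: real
  proof -
    let ?a = "complex_of_real (- t) * h"
    have "0 \<le> cnj ?a * 1 * h + cnj 1 * ?a * cnj h + complex_of_real r"
      using psd_on_two[OF X(1-3) False X(4), of ?a 1] 0 r hv by (simp add: h_def)
    also have "cnj ?a * 1 * h + cnj 1 * ?a * cnj h + complex_of_real r
        = complex_of_real (r - 2 * t * (cmod h)\<^sup>2)"
      using complex_norm_square[of h] by (simp add: algebra_simps)
    finally show ?thesis by (simp add: less_eq_complex_def)
  qed
  \<comment> \<open>With h nonzero this t would give r + 1 <= r.\<close>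
  from this[of "(r + 1) / (2 * (cmod h)\<^sup>2)"] have "h = 0" by (cases "h = 0") auto
  then show ?thesis by (simp add: h_def)
qed (use 0 in simp)

text \<open>A Cholesky decomposition; if \<open>X s s = 0\<close> then the row of \<open>s\<close> is 0 and so is the one of \<open>V\<close>,
  thanks to \<open>x / 0 = 0\<close>.\<close>

lemma psd_on_decomp:
  assumes "finite S" "psd_on S X"
  shows "\<exists>V. \<forall>u\<in>S. \<forall>v\<in>S. X u v = (\<Sum>k\<in>S. cnj (V k u) * V k v)"
  using assms
proof (induction S arbitrary: X rule: finite_induct)
  case (insert s S)
  note X = insert.prems
  have fin: "finite (insert s S)" using insert by simp
  define d where "d = Re (X s s)"
  have d: "X s s = complex_of_real d" "0 \<le> d"
    using psd_on_diag[OF X _ fin, of s] by (simp_all add: d_def less_eq_complex_def complex_eq_iff)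
  have herm: "X u s = cnj (X s u)" if "u \<in> S" for u using psd_on_hermitian[OF X _ _ fin, of s u] that by simp
  have zero: "X s v = 0" if "d = 0" "v \<in> S" for v
    using psd_on_zero_diag[OF X _ _ fin, of s v] d that by simp
  \<comment> \<open>The Schur complement of the entry X s s.\<close>
  define X' where "X' u v = X u v - cnj (X s u) * X s v / complex_of_real d" for u v
  have "psd_on S X'" unfolding psd_on_def
  proof
    fix z :: "'a \<Rightarrow> complex"
    define w where "w = (\<Sum>v\<in>S. z v * X s v)"
    define q where "q = (\<Sum>u\<in>S. \<Sum>v\<in>S. cnj (z u) * z v * X u v)"
    \<comment> \<open>The value of the coordinate at s that minimises the form when d is positive.
      Completing the square then leaves the form of the Schur complement at z.\<close>
    define a where "a = - w / complex_of_real d"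
    let ?z = "\<lambda>u. if u = s then a else z u"
    have z: "?z u = z u" if "u \<in> S" for u using that insert by auto
    have cw: "(\<Sum>u\<in>S. cnj (z u) * X u s) = cnj w"
      by (simp add: w_def herm)
    have "0 \<le> (\<Sum>u\<in>insert s S. \<Sum>v\<in>insert s S. cnj (?z u) * ?z v * X u v)" using X by (rule psd_onD)
    also have "\<dots> = (\<Sum>v\<in>insert s S. cnj a * ?z v * X s v) + (\<Sum>u\<in>S. \<Sum>v\<in>insert s S. cnj (z u) * ?z v * X u v)"
      using insert(1,2) z by (simp add: sum.insert)
    also have "(\<Sum>v\<in>insert s S. cnj a * ?z v * X s v) = cnj a * a * complex_of_real d + cnj a * w"
    proof -
      have "(\<Sum>v\<in>S. cnj a * ?z v * X s v) = cnj a * w"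
        unfolding w_def sum_distrib_left by (intro sum.cong refl) (use z in auto)
      then show ?thesis using insert(1,2) by (simp add: d)
    qed
    also have "(\<Sum>u\<in>S. \<Sum>v\<in>insert s S. cnj (z u) * ?z v * X u v) = a * cnj w + q"
    proof -
      have "(\<Sum>v\<in>insert s S. cnj (z u) * ?z v * X u v) = a * (cnj (z u) * X u s) + (\<Sum>v\<in>S. cnj (z u) * z v * X u v)" for u
        using insert(1,2) z by (simp add: sum.insert)
      then show ?thesis unfolding q_def cw[symmetric] by (simp only: sum.distrib sum_distrib_left)
    qed
    also have "cnj a * a * complex_of_real d + cnj a * w + (a * cnj w + q) = q - cnj w * w / complex_of_real d"
      by (cases "d = 0") (simp_all add: a_def field_simps)
    also have "\<dots> = (\<Sum>u\<in>S. \<Sum>v\<in>S. cnj (z u) * z v * X' u v)"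
    proof -
      have "cnj w * w / complex_of_real d = (\<Sum>u\<in>S. \<Sum>v\<in>S. cnj (z u) * z v * (cnj (X s u) * X s v / complex_of_real d))"
        unfolding w_def cnj_sum sum_product sum_divide_distrib by (intro sum.cong refl) simp
      then show ?thesis by (simp add: X'_def q_def right_diff_distrib sum_subtractf)
    qed
    finally show "0 \<le> (\<Sum>u\<in>S. \<Sum>v\<in>S. cnj (z u) * z v * X' u v)" .
  qed
  from insert.IH[OF this] obtain V where V: "\<And>u v. u \<in> S \<Longrightarrow> v \<in> S \<Longrightarrow> X' u v = (\<Sum>k\<in>S. cnj (V k u) * V k v)"
    by blast
  \<comment> \<open>The row at s is that of X divided by the square root of d; the other rows are
    those found for the Schur complement, with 0 in the column of s.\<close>
  define W where "W k v = (if k = s then X s v / complex_of_real (sqrt d) else if v = s then 0 else V k v)" for k v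
  have dd: "complex_of_real (sqrt d) * complex_of_real (sqrt d) = complex_of_real d"
    using d(2) by (simp flip: of_real_mult)
  show ?case
  proof (intro exI ballI)
    fix u v assume uv: "u \<in> insert s S" "v \<in> insert s S"
    have Ws: "cnj (W s u) * W s v = cnj (X s u) * X s v / complex_of_real d"
      by (simp add: W_def flip: dd)
    have "(\<Sum>k\<in>insert s S. cnj (W k u) * W k v) = cnj (W s u) * W s v + (\<Sum>k\<in>S. cnj (W k u) * W k v)"
      using insert(1,2) by simp
    also have "(\<Sum>k\<in>S. cnj (W k u) * W k v) = (if u = s \<or> v = s then 0 else X' u v)"
    proof (cases "u = s \<or> v = s")
      case False
      then have "(\<Sum>k\<in>S. cnj (W k u) * W k v) = (\<Sum>k\<in>S. cnj (V k u) * V k v)"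
        using insert(2) by (intro sum.cong) (auto simp: W_def)
      then show ?thesis using False V uv by simp
    next
      case True
      then have "(\<Sum>k\<in>S. cnj (W k u) * W k v) = (\<Sum>k\<in>S. 0)"
        using insert(2) by (intro sum.cong) (auto simp: W_def)
      then show ?thesis using True by simp
    qed
    also have "cnj (W s u) * W s v + (if u = s \<or> v = s then 0 else X' u v) = X u v"
    proof -
      consider "u = s" "v = s" | "u = s" "v \<in> S" "v \<noteq> s" | "u \<in> S" "u \<noteq> s" "v = s" | "u \<in> S" "u \<noteq> s" "v \<in> S" "v \<noteq> s"
        using uv by blast
      then show ?thesis
      proof cases
        case 1
        then show ?thesis unfolding Ws by (cases "d = 0") (simp_all add: d)
      next
        case 2
        then show ?thesis unfolding Ws using zero[of v] by (cases "d = 0") (simp_all add: d)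
      next
        case 3
        then show ?thesis unfolding Ws using zero[of u] herm[of u] by (cases "d = 0") (simp_all add: d)
      next
        case 4
        then show ?thesis unfolding Ws by (simp add: X'_def)
      qed
    qed
    finally show "X u v = (\<Sum>k\<in>insert s S. cnj (W k u) * W k v)" by simp
  qed
qed auto

text \<open>This is the Schur product theorem. When X is decomposed as a sum over k of
  \<open>cnj (V k u) * V k v\<close>, the form of the entrywise product at z is the sum over k of
  the forms of Y at the vectors with coordinates \<open>z u * V k u\<close>.\<close>

lemma psd_on_schur:
  assumes S: "finite S" and X: "psd_on S X" and Y: "psd_on S Y"
  shows "psd_on S (\<lambda>u v. X u v * Y u v)"
  unfolding psd_on_def
proof
  fix z :: "'a \<Rightarrow> complex"
  obtain V where V: "\<And>u v. u \<in> S \<Longrightarrow> v \<in> S \<Longrightarrow> X u v = (\<Sum>k\<in>S. cnj (V k u) * V k v)"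
    using psd_on_decomp[OF S X] by blast
  have "(\<Sum>u\<in>S. \<Sum>v\<in>S. cnj (z u) * z v * (X u v * Y u v))
      = (\<Sum>u\<in>S. \<Sum>v\<in>S. \<Sum>k\<in>S. cnj (z u * V k u) * (z v * V k v) * Y u v)"
    by (intro sum.cong refl) (simp add: V sum_distrib_left sum_distrib_right mult_ac)
  also have "\<dots> = (\<Sum>u\<in>S. \<Sum>k\<in>S. \<Sum>v\<in>S. cnj (z u * V k u) * (z v * V k v) * Y u v)"
    by (rule sum.cong[OF refl], rule sum.swap)
  also have "\<dots> = (\<Sum>k\<in>S. \<Sum>u\<in>S. \<Sum>v\<in>S. cnj (z u * V k u) * (z v * V k v) * Y u v)"
    by (rule sum.swap)
  also have "0 \<le> \<dots>" by (intro sum_nonneg psd_onD[OF Y])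
  finally show "0 \<le> (\<Sum>u\<in>S. \<Sum>v\<in>S. cnj (z u) * z v * (X u v * Y u v))" .
qed

definition pos_fun :: "('a, 'm) star_alg_scheme \<Rightarrow> ('a \<Rightarrow> complex) \<Rightarrow> bool" where
  "pos_fun A \<phi> \<longleftrightarrow> (\<forall>x\<in>carrier A. \<forall>y\<in>carrier A. \<phi> (x \<oplus>\<^bsub>A\<^esub> y) = \<phi> x + \<phi> y)
     \<and> (\<forall>c. \<forall>x\<in>carrier A. \<phi> (c \<odot>\<^bsub>A\<^esub> x) = c * \<phi> x)
     \<and> (\<forall>x\<in>carrier A. 0 \<le> \<phi> (star A x \<otimes>\<^bsub>A\<^esub> x))"

text \<open>Positive functionals of arbitrary mass are kept apart from states because compressing a
  functional by an element, as in the construction of f tensor g, does not preserve the value 1 at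
  the unit.\<close>

lemma states_iff: "\<phi> \<in> states A \<longleftrightarrow> pos_fun A \<phi> \<and> \<phi> \<one>\<^bsub>A\<^esub> = 1"
  by (auto simp: states_def pos_fun_def)

locale positive_functional = star_algebra A for A :: "('a, 'm) star_alg_scheme" (structure) +
  fixes \<phi> :: "'a \<Rightarrow> complex"
  assumes pos: "pos_fun A \<phi>"
begin

lemma fun_add [simp]: "\<lbrakk>x \<in> carrier A; y \<in> carrier A\<rbrakk> \<Longrightarrow> \<phi> (x \<oplus> y) = \<phi> x + \<phi> y"
  and fun_smult [simp]: "x \<in> carrier A \<Longrightarrow> \<phi> (c \<odot> x) = c * \<phi> x"
  and fun_pos: "x \<in> carrier A \<Longrightarrow> 0 \<le> \<phi> (star A x \<otimes> x)"
  using pos by (auto simp: pos_fun_def)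

lemma fun_zero [simp]: "\<phi> \<zero> = 0"
  using fun_smult[of \<zero> 0] by simp

lemma fun_finsum: "f \<in> S \<rightarrow> carrier A \<Longrightarrow> \<phi> (\<Oplus>i\<in>S. f i) = (\<Sum>i\<in>S. \<phi> (f i))"
  by (induction S rule: infinite_finite_induct) (auto simp: finsum_insert Pi_def finsum_closed)

lemma psd_gram:
  assumes S: "finite S" and a: "\<And>u. u \<in> S \<Longrightarrow> a u \<in> carrier A"
  shows "psd_on S (\<lambda>u v. \<phi> (star A (a u) \<otimes> a v))"
  unfolding psd_on_def
proof
  fix z :: "'b \<Rightarrow> complex"
  define x where "x = (\<Oplus>u\<in>S. z u \<odot> a u)"
  have x: "x \<in> carrier A" using a by (auto simp: x_def intro!: finsum_closed)
  have "\<phi> (star A x \<otimes> x) = \<phi> (\<Oplus>u\<in>S. (cnj (z u) \<odot> star A (a u)) \<otimes> x)"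
  proof -
    have "star A x = (\<Oplus>u\<in>S. cnj (z u) \<odot> star A (a u))"
      unfolding x_def using a by (subst star_finsum) (auto intro!: finsum_cong')
    then show ?thesis using S x a by (simp add: finsum_ldistr Pi_def)
  qed
  also have "\<dots> = (\<Sum>u\<in>S. cnj (z u) * \<phi> (star A (a u) \<otimes> x))"
    using x a by (subst fun_finsum) auto
  also have "\<dots> = (\<Sum>u\<in>S. \<Sum>v\<in>S. cnj (z u) * z v * \<phi> (star A (a u) \<otimes> a v))"
  proof (rule sum.cong[OF refl])
    fix u assume u: "u \<in> S"
    have "\<phi> (star A (a u) \<otimes> x) = \<phi> (\<Oplus>v\<in>S. star A (a u) \<otimes> (z v \<odot> a v))"
      unfolding x_def using S a u by (simp add: finsum_rdistr Pi_def)
    also have "\<dots> = (\<Sum>v\<in>S. z v * \<phi> (star A (a u) \<otimes> a v))"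
      using a u by (subst fun_finsum) auto
    finally show "cnj (z u) * \<phi> (star A (a u) \<otimes> x) = (\<Sum>v\<in>S. cnj (z u) * z v * \<phi> (star A (a u) \<otimes> a v))"
      by (simp add: sum_distrib_left mult.assoc)
  qed
  finally show "0 \<le> (\<Sum>u\<in>S. \<Sum>v\<in>S. cnj (z u) * z v * \<phi> (star A (a u) \<otimes> a v))"
    using fun_pos[OF x] by simp
qed

text \<open>The norm of x applied to the cyclic vector in the GNS representation of
  \<open>\<phi>\<close>.\<close>

definition N :: "'a \<Rightarrow> real" where "N x = sqrt (Re (\<phi> (star A x \<otimes> x)))"

lemma N_nonneg [simp]: "x \<in> carrier A \<Longrightarrow> 0 \<le> N x"
  using fun_pos[of x] by (simp add: N_def less_eq_complex_def)

lemma N_sq: "x \<in> carrier A \<Longrightarrow> \<phi> (star A x \<otimes> x) = complex_of_real ((N x)\<^sup>2)"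
  using fun_pos[of x] by (simp add: N_def less_eq_complex_def complex_eq_iff)

lemma N_zero [simp]: "N \<zero> = 0"
  by (simp add: N_def)

lemma N_smult [simp]: "x \<in> carrier A \<Longrightarrow> N (c \<odot> x) = cmod c * N x"
proof -
  assume x: "x \<in> carrier A"
  have "\<phi> (star A (c \<odot> x) \<otimes> (c \<odot> x)) = complex_of_real ((cmod c)\<^sup>2 * (N x)\<^sup>2)"
    using x complex_norm_square[of c] by (simp add: N_sq mult_ac)
  then have "N (c \<odot> x) = sqrt ((cmod c)\<^sup>2 * (N x)\<^sup>2)" unfolding N_def[of "c \<odot> x"] by simp
  then show ?thesis using x by (simp add: real_sqrt_mult)
qed

lemma fun_hermitian: "\<lbrakk>x \<in> carrier A; y \<in> carrier A\<rbrakk> \<Longrightarrow> \<phi> (star A y \<otimes> x) = cnj (\<phi> (star A x \<otimes> y))"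
  using psd_on_hermitian[OF psd_gram[of "{x, y}" "\<lambda>x. x"], of x y] by auto

lemma cauchy_schwarz:
  assumes x: "x \<in> carrier A" and y: "y \<in> carrier A"
  shows "cmod (\<phi> (star A x \<otimes> y)) \<le> N x * N y"
proof -
  define h where "h = \<phi> (star A x \<otimes> y)"
  have q: "0 \<le> (t * cmod h)\<^sup>2 * (N x)\<^sup>2 - 2 * t * (cmod h)\<^sup>2 + (N y)\<^sup>2" for t
  proof -
    \<comment> \<open>Choosing a real multiple of h makes the cross terms real, so the form becomes
      a real quadratic polynomial in t.\<close>
    let ?c = "complex_of_real (- t) * h"
    have hh: "h * cnj h = complex_of_real ((cmod h)\<^sup>2)" by (rule complex_norm_square[symmetric])
    have "0 \<le> \<phi> (star A (?c \<odot> x \<oplus> y) \<otimes> (?c \<odot> x \<oplus> y))" using x y by (intro fun_pos) auto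
    also have "star A (?c \<odot> x \<oplus> y) \<otimes> (?c \<odot> x \<oplus> y) = ((cnj ?c * ?c) \<odot> (star A x \<otimes> x) \<oplus> cnj ?c \<odot> (star A x \<otimes> y))
        \<oplus> (?c \<odot> (star A y \<otimes> x) \<oplus> star A y \<otimes> y)"
      using x y by (simp add: l_distr r_distr smult_r_distr a_ac mult_ac)
    also have "\<phi> \<dots> = cnj ?c * ?c * complex_of_real ((N x)\<^sup>2) + cnj ?c * h + (?c * cnj h + complex_of_real ((N y)\<^sup>2))"
      using x y fun_hermitian[OF x y] by (simp add: N_sq h_def)
    also have "\<dots> = complex_of_real (t\<^sup>2) * (h * cnj h) * complex_of_real ((N x)\<^sup>2)
        - complex_of_real (2 * t) * (h * cnj h) + complex_of_real ((N y)\<^sup>2)"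
      by (simp add: power2_eq_square algebra_simps)
    also have "\<dots> = complex_of_real ((t * cmod h)\<^sup>2 * (N x)\<^sup>2 - 2 * t * (cmod h)\<^sup>2 + (N y)\<^sup>2)"
      unfolding hh by (simp add: power_mult_distrib)
    finally show ?thesis by (simp add: less_eq_complex_def)
  qed
  show ?thesis
  proof (cases "N x = 0")
    case True
    have "cmod h = 0"
    proof (rule ccontr)
      assume "cmod h \<noteq> 0"
      \<comment> \<open>For N x = 0 the polynomial is affine in t, and this t would give it the
        value -1.\<close>
      then show False using q[of "((N y)\<^sup>2 + 1) / (2 * (cmod h)\<^sup>2)"] True by simp
    qed
    then show ?thesis using True by (simp add: h_def)
  next
    case False
    then have pos: "0 < (N x)\<^sup>2" by simp
    \<comment> \<open>The value of the polynomial at its minimum t = 1 / (N x)^2.\<close>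
    have "(1 / (N x)\<^sup>2 * cmod h)\<^sup>2 * (N x)\<^sup>2 - 2 * (1 / (N x)\<^sup>2) * (cmod h)\<^sup>2 + (N y)\<^sup>2
        = (N y)\<^sup>2 - (cmod h)\<^sup>2 / (N x)\<^sup>2"
      using False by (simp add: power2_eq_square field_simps)
    then have "(cmod h)\<^sup>2 / (N x)\<^sup>2 \<le> (N y)\<^sup>2" using q[of "1 / (N x)\<^sup>2"] by linarith
    then have "(cmod h)\<^sup>2 \<le> (N x * N y)\<^sup>2"
      using pos by (simp add: pos_divide_le_eq power_mult_distrib mult.commute[of "(N x)\<^sup>2"])
    then show ?thesis unfolding h_def by (rule power2_le_imp_le) (use x y in simp)
  qed
qed

lemma N_triangle: "\<lbrakk>x \<in> carrier A; y \<in> carrier A\<rbrakk> \<Longrightarrow> N (x \<oplus> y) \<le> N x + N y"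
proof -
  assume x: "x \<in> carrier A" and y: "y \<in> carrier A"
  have "complex_of_real ((N (x \<oplus> y))\<^sup>2) = \<phi> (star A (x \<oplus> y) \<otimes> (x \<oplus> y))"
    by (rule N_sq[symmetric]) (use x y in auto)
  also have "star A (x \<oplus> y) \<otimes> (x \<oplus> y) = (star A x \<otimes> x \<oplus> star A x \<otimes> y) \<oplus> (star A y \<otimes> x \<oplus> star A y \<otimes> y)"
    using x y by (simp add: l_distr r_distr a_ac)
  also have "\<phi> \<dots> = complex_of_real ((N x)\<^sup>2 + 2 * Re (\<phi> (star A x \<otimes> y)) + (N y)\<^sup>2)"
  proof -
    have "\<phi> (star A x \<otimes> y) + \<phi> (star A y \<otimes> x) = complex_of_real (2 * Re (\<phi> (star A x \<otimes> y)))"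
      unfolding fun_hermitian[OF x y] by (rule complex_add_cnj)
    then show ?thesis using x y by (simp add: N_sq algebra_simps)
  qed
  finally have "(N (x \<oplus> y))\<^sup>2 = (N x)\<^sup>2 + 2 * Re (\<phi> (star A x \<otimes> y)) + (N y)\<^sup>2" using of_real_eq_iff by blast
  also have "\<dots> \<le> (N x + N y)\<^sup>2"
    using cauchy_schwarz[OF x y] complex_Re_le_cmod[of "\<phi> (star A x \<otimes> y)"] by (simp add: power2_sum)
  finally show ?thesis by (rule power2_le_imp_le) (use x y in simp)
qed

text \<open>For self-adjoint \<open>T\<close> the bound \<open>N (T\<^sup>n y) \<le> C m\<^sup>n\<close> along the powers of two improves itself to
  \<open>N (T y) \<le> m N y\<close>. As the hypothesis is stable under linear combinations in \<open>y\<close> (with varying \<open>C\<close>),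
  operator norms can be estimated on a spanning set of vectors.\<close>

lemma N_growth:
  assumes T: "T 0 \<in> carrier A" "star A (T 0) = T 0" "\<And>k. T (Suc k) = T k \<otimes> T k"
    and y: "y \<in> carrier A" and m: "0 \<le> m" and bound: "\<And>k. N (T k \<otimes> y) \<le> C * m ^ (2 ^ k)"
  shows "N (T 0 \<otimes> y) \<le> m * N y"
proof -
  have Tc: "T k \<in> carrier A \<and> star A (T k) = T k" for k
    by (induction k) (use T in auto)
  define t where "t k = N (T k \<otimes> y)" for k
  have t0: "0 \<le> t k" for k using Tc y by (simp add: t_def)
  \<comment> \<open>The Cauchy-Schwarz inequality, combined with \<open>T k\<close> being
    self-adjoint and having square \<open>T (Suc k)\<close>.\<close>
  have step: "(t k)\<^sup>2 \<le> N y * t (Suc k)" for k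
  proof -
    have "complex_of_real ((t k)\<^sup>2) = \<phi> (star A (T k \<otimes> y) \<otimes> (T k \<otimes> y))"
      unfolding t_def by (rule N_sq[symmetric]) (use Tc y in auto)
    also have "\<dots> = \<phi> (star A y \<otimes> (T (Suc k) \<otimes> y))" using Tc y by (simp add: T(3) m_assoc)
    finally have "(t k)\<^sup>2 = cmod (\<phi> (star A y \<otimes> (T (Suc k) \<otimes> y)))"
      by (metis abs_of_nonneg norm_of_real zero_le_power2)
    also have "\<dots> \<le> N y * t (Suc k)" unfolding t_def using Tc y by (intro cauchy_schwarz) auto
    finally show ?thesis .
  qed
  show ?thesis
  proof (cases "N y = 0")
    case True
    then show ?thesis using step[of 0] by (simp add: t_def)
  next
    case False
    then have Ny: "0 < N y" using y N_nonneg[of y] by linarith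
    define r where "r = t 0 / N y"
    have r0: "0 \<le> r" using t0 Ny by (simp add: r_def)
    have rk: "r ^ (2 ^ k) \<le> t k / N y" for k
    proof (induction k)
      case (Suc k)
      have "r ^ (2 ^ Suc k) = (r ^ (2 ^ k))\<^sup>2" by (simp flip: power_mult add: mult.commute)
      also have "\<dots> \<le> (t k / N y)\<^sup>2" using Suc r0 by (intro power_mono) auto
      also have "\<dots> \<le> t (Suc k) / N y" using step[of k] Ny by (simp add: power2_eq_square field_simps)
      finally show ?case .
    qed (simp add: r_def)
    have le: "r ^ (2 ^ k) \<le> C / N y * m ^ (2 ^ k)" for k
      using order.trans[OF rk[of k] divide_right_mono[OF bound[of k, folded t_def]]] Ny by simp
    have "r \<le> m"
    proof (rule ccontr)
      assume "\<not> r \<le> m"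
      then have rm: "m < r" by simp
      show False
      proof (cases "m = 0")
        case True
        then show False using le[of 0] rm by simp
      next
        case False
        then have m0: "0 < m" using m by simp
        then obtain n where n: "C / N y < (r / m) ^ n" using real_arch_pow[of "r / m" "C / N y"] rm by auto
        \<comment> \<open>The exponent found by the Archimedean property is enlarged to a power of
          two, where the hypothesis gives a bound.\<close>
        have "n \<le> 2 ^ n" by (simp add: less_imp_le)
        then have "(r / m) ^ n \<le> (r / m) ^ (2 ^ n)" using rm m0 by (intro power_increasing) auto
        also have "\<dots> \<le> C / N y" using le[of n] m0 by (simp add: power_divide field_simps)
        finally show False using n by simp
      qed
    qed
    then show ?thesis using Ny by (simp add: r_def t_def field_simps)
  qed
qed

end

text \<open>The supremum of the operator norms of x in the GNS representations of the functionals in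
  S, computed on the dense set of vectors y applied to the cyclic vector. The element 0 keeps the
  set nonempty when no such vector is nonzero.\<close>

definition gns_norm :: "('a, 'm) star_alg_scheme \<Rightarrow> ('a \<Rightarrow> complex) set \<Rightarrow> 'a \<Rightarrow> real" where
  "gns_norm A S x = Sup (insert 0 {positive_functional.N A \<phi> (x \<otimes>\<^bsub>A\<^esub> y) / positive_functional.N A \<phi> y | \<phi> y.
     \<phi> \<in> S \<and> y \<in> carrier A \<and> positive_functional.N A \<phi> y \<noteq> 0})"

text \<open>The assumption \<open>bounded\<close> says that x acts boundedly on the GNS vectors,
  uniformly over S; otherwise the supremum in \<open>gns_norm\<close> would say nothing.\<close>

locale gns_family = star_algebra A for A :: "('a, 'm) star_alg_scheme" (structure) +
  fixes S :: "('a \<Rightarrow> complex) set"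
  assumes S: "\<phi> \<in> S \<Longrightarrow> pos_fun A \<phi>"
    and bounded: "x \<in> carrier A \<Longrightarrow>
      \<exists>b. \<forall>\<phi>\<in>S. \<forall>y\<in>carrier A. positive_functional.N A \<phi> (x \<otimes> y) \<le> b * positive_functional.N A \<phi> y"
begin

lemma positive_functional: "\<phi> \<in> S \<Longrightarrow> positive_functional A \<phi>"
  by unfold_locales (rule S)

abbreviation "sn \<equiv> positive_functional.N A"
abbreviation "G \<equiv> gns_norm A S"

lemma N_le_G:
  assumes x: "x \<in> carrier A" and \<phi>: "\<phi> \<in> S" and y: "y \<in> carrier A"
  shows "sn \<phi> (x \<otimes> y) \<le> G x * sn \<phi> y"
proof -
  interpret positive_functional A \<phi> by (rule positive_functional[OF \<phi>])
  obtain b where b: "\<And>\<phi> y. \<phi> \<in> S \<Longrightarrow> y \<in> carrier A \<Longrightarrow> sn \<phi> (x \<otimes> y) \<le> b * sn \<phi> y"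
    using bounded[OF x] by blast
  show ?thesis
  proof (cases "sn \<phi> y = 0")
    case True
    then show ?thesis using b[OF \<phi> y] by simp
  next
    case False
    then have pos: "0 < sn \<phi> y" using N_nonneg[OF y] by linarith
    let ?T = "insert 0 {sn \<phi> (x \<otimes> y) / sn \<phi> y | \<phi> y. \<phi> \<in> S \<and> y \<in> carrier A \<and> sn \<phi> y \<noteq> 0}"
    have "bdd_above ?T"
    proof (rule bdd_aboveI[of _ "\<bar>b\<bar>"])
      fix r assume "r \<in> ?T"
      then show "r \<le> \<bar>b\<bar>"
      proof
        assume "r \<in> {sn \<phi> (x \<otimes> y) / sn \<phi> y | \<phi> y. \<phi> \<in> S \<and> y \<in> carrier A \<and> sn \<phi> y \<noteq> 0}"
        then obtain \<psi> z where z: "r = sn \<psi> (x \<otimes> z) / sn \<psi> z" "\<psi> \<in> S" "z \<in> carrier A" "sn \<psi> z \<noteq> 0" by blast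
        have "0 < sn \<psi> z" using positive_functional.N_nonneg[OF positive_functional[OF z(2)] z(3)] z(4) by linarith
        then have "r \<le> b" unfolding z(1) using b[OF z(2,3)] by (simp add: pos_divide_le_eq)
        then show ?thesis by linarith
      qed simp
    qed
    then have "sn \<phi> (x \<otimes> y) / sn \<phi> y \<le> G x"
      unfolding gns_norm_def by (rule cSup_upper[rotated]) (use False \<phi> y in blast)
    then show ?thesis using pos by (simp add: pos_divide_le_eq)
  qed
qed

lemma G_least:
  assumes x: "x \<in> carrier A" and b: "0 \<le> b" "\<And>\<phi> y. \<phi> \<in> S \<Longrightarrow> y \<in> carrier A \<Longrightarrow> sn \<phi> (x \<otimes> y) \<le> b * sn \<phi> y"
  shows "G x \<le> b"
  unfolding gns_norm_def
proof (rule cSup_least)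
  fix r assume "r \<in> insert 0 {sn \<phi> (x \<otimes> y) / sn \<phi> y | \<phi> y. \<phi> \<in> S \<and> y \<in> carrier A \<and> sn \<phi> y \<noteq> 0}"
  then show "r \<le> b"
  proof
    assume "r \<in> {sn \<phi> (x \<otimes> y) / sn \<phi> y | \<phi> y. \<phi> \<in> S \<and> y \<in> carrier A \<and> sn \<phi> y \<noteq> 0}"
    then obtain \<psi> z where z: "r = sn \<psi> (x \<otimes> z) / sn \<psi> z" "\<psi> \<in> S" "z \<in> carrier A" "sn \<psi> z \<noteq> 0" by blast
    have "0 < sn \<psi> z" using positive_functional.N_nonneg[OF positive_functional[OF z(2)] z(3)] z(4) by linarith
    then show ?thesis unfolding z(1) using b(2)[OF z(2,3)] by (simp add: pos_divide_le_eq)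
  qed (use b in simp)
qed simp

lemma G_nonneg: "x \<in> carrier A \<Longrightarrow> 0 \<le> G x"
proof -
  assume x: "x \<in> carrier A"
  show ?thesis
  proof (cases "\<exists>\<phi>\<in>S. \<exists>y\<in>carrier A. sn \<phi> y \<noteq> 0")
    case True
    then obtain \<phi> y where y: "\<phi> \<in> S" "y \<in> carrier A" "sn \<phi> y \<noteq> 0" by blast
    interpret positive_functional A \<phi> by (rule positive_functional[OF y(1)])
    have "0 \<le> G x * sn \<phi> y"
      by (rule order.trans[OF N_nonneg[OF m_closed[OF x y(2)]] N_le_G[OF x y(1,2)]])
    moreover have "0 < sn \<phi> y" using N_nonneg[OF y(2)] y(3) by linarith
    ultimately show ?thesis by (simp add: zero_le_mult_iff)
  next
    case False
    then have eq: "{sn \<phi> (x \<otimes> y) / sn \<phi> y | \<phi> y. \<phi> \<in> S \<and> y \<in> carrier A \<and> sn \<phi> y \<noteq> 0} = {}" by blast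
    show ?thesis unfolding gns_norm_def eq by simp
  qed
qed

lemma seminorm_G: "cstar_seminorm A G"
proof -
  \<comment> \<open>With z the adjoint of x applied to y, the square of the norm of z is the inner
    product of x z with y. Cauchy-Schwarz bounds it by the norms of x, z and y, and one factor
    cancels.\<close>
  have star: "G (star A x) \<le> G x" if x: "x \<in> carrier A" for x
  proof (rule G_least)
    fix \<phi> y assume \<phi>: "\<phi> \<in> S" and y: "y \<in> carrier A"
    interpret positive_functional A \<phi> by (rule positive_functional[OF \<phi>])
    let ?z = "star A x \<otimes> y"
    have "complex_of_real ((sn \<phi> ?z)\<^sup>2) = \<phi> (star A ?z \<otimes> ?z)"
      by (rule N_sq[symmetric]) (use x y in auto)
    also have "\<dots> = \<phi> (star A y \<otimes> (x \<otimes> ?z))" using x y by (simp add: m_assoc)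
    finally have "(sn \<phi> ?z)\<^sup>2 = cmod (\<phi> (star A y \<otimes> (x \<otimes> ?z)))"
      by (metis abs_of_nonneg norm_of_real zero_le_power2)
    also have "\<dots> \<le> sn \<phi> y * sn \<phi> (x \<otimes> ?z)" using x y by (intro cauchy_schwarz) auto
    also have "\<dots> \<le> sn \<phi> y * (G x * sn \<phi> ?z)" using x y by (intro mult_left_mono N_le_G \<phi>) auto
    finally have "sn \<phi> ?z * sn \<phi> ?z \<le> (G x * sn \<phi> y) * sn \<phi> ?z" by (simp add: power2_eq_square mult_ac)
    moreover have "0 \<le> G x * sn \<phi> y" "0 \<le> sn \<phi> ?z" using x y G_nonneg by auto
    ultimately show "sn \<phi> ?z \<le> G x * sn \<phi> y" by (cases "sn \<phi> ?z = 0") (auto simp: mult_le_cancel_right)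
  qed (use x G_nonneg in auto)
  have mult: "G (x \<otimes> y) \<le> G x * G y" if x: "x \<in> carrier A" and y: "y \<in> carrier A" for x y
  proof (rule G_least)
    fix \<phi> z assume \<phi>: "\<phi> \<in> S" and z: "z \<in> carrier A"
    have "sn \<phi> (x \<otimes> y \<otimes> z) \<le> G x * sn \<phi> (y \<otimes> z)" using x y z \<phi> by (simp add: m_assoc N_le_G)
    also have "\<dots> \<le> G x * (G y * sn \<phi> z)" using x y z \<phi> by (intro mult_left_mono N_le_G G_nonneg)
    finally show "sn \<phi> (x \<otimes> y \<otimes> z) \<le> G x * G y * sn \<phi> z" by simp
  qed (use x y G_nonneg in auto)
  have smult: "G (c \<odot> x) \<le> cmod c * G x" if x: "x \<in> carrier A" for c x
  proof (rule G_least)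
    fix \<phi> y assume \<phi>: "\<phi> \<in> S" and y: "y \<in> carrier A"
    interpret positive_functional A \<phi> by (rule positive_functional[OF \<phi>])
    show "sn \<phi> (c \<odot> x \<otimes> y) \<le> cmod c * G x * sn \<phi> y"
      using x y N_le_G[OF x \<phi> y] by (simp add: mult_left_mono mult.assoc)
  qed (use x G_nonneg in auto)
  show ?thesis
    unfolding cstar_seminorm_def
  proof (intro conjI ballI allI)
    fix x assume x: "x \<in> carrier A"
    show "0 \<le> G x" using G_nonneg[OF x] .
    show "G (c \<odot> x) = cmod c * G x" for c
    proof (cases "c = 0")
      case True
      then show ?thesis using smult[OF x, of c] x G_nonneg[of \<zero>] by simp
    next
      case False
      have "G x \<le> cmod (1 / c) * G (c \<odot> x)" using smult[of "c \<odot> x" "1 / c"] x False by simp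
      then have "cmod c * G x \<le> G (c \<odot> x)" using False by (simp add: norm_divide field_simps)
      then show ?thesis using smult[OF x, of c] by simp
    qed
    show "G (star A x \<otimes> x) = (G x)\<^sup>2"
    proof (rule antisym)
      have "G (star A x \<otimes> x) \<le> G (star A x) * G x" using x by (intro mult) auto
      also have "\<dots> \<le> G x * G x" using star[OF x] G_nonneg[OF x] by (rule mult_right_mono)
      finally show "G (star A x \<otimes> x) \<le> (G x)\<^sup>2" by (simp add: power2_eq_square)
      let ?m = "G (star A x \<otimes> x)"
      have m: "0 \<le> ?m" using x by (intro G_nonneg) auto
      have "G x \<le> sqrt ?m"
      proof (rule G_least[OF x])
        fix \<phi> y assume \<phi>: "\<phi> \<in> S" and y: "y \<in> carrier A"
        interpret positive_functional A \<phi> by (rule positive_functional[OF \<phi>])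
        have "complex_of_real ((sn \<phi> (x \<otimes> y))\<^sup>2) = \<phi> (star A (x \<otimes> y) \<otimes> (x \<otimes> y))"
          by (rule N_sq[symmetric]) (use x y in auto)
        also have "\<dots> = \<phi> (star A y \<otimes> (star A x \<otimes> x \<otimes> y))" using x y by (simp add: m_assoc)
        finally have "(sn \<phi> (x \<otimes> y))\<^sup>2 = cmod (\<phi> (star A y \<otimes> (star A x \<otimes> x \<otimes> y)))"
          by (metis abs_of_nonneg norm_of_real zero_le_power2)
        also have "\<dots> \<le> sn \<phi> y * sn \<phi> (star A x \<otimes> x \<otimes> y)" using x y by (intro cauchy_schwarz) auto
        also have "\<dots> \<le> sn \<phi> y * (?m * sn \<phi> y)" using x y by (intro mult_left_mono N_le_G \<phi>) auto
        also have "\<dots> = (sqrt ?m * sn \<phi> y)\<^sup>2" using m by (simp add: power_mult_distrib power2_eq_square)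
        finally show "sn \<phi> (x \<otimes> y) \<le> sqrt ?m * sn \<phi> y" by (rule power2_le_imp_le) (use m y in simp)
      qed (use m in simp)
      then have "(G x)\<^sup>2 \<le> (sqrt ?m)\<^sup>2" using G_nonneg[OF x] by (rule power_mono)
      then show "(G x)\<^sup>2 \<le> ?m" using m by simp
    qed
    fix y assume y: "y \<in> carrier A"
    show "G (x \<otimes> y) \<le> G x * G y" by (rule mult[OF x y])
    show "G (x \<oplus> y) \<le> G x + G y"
    proof (rule G_least)
      fix \<phi> z assume \<phi>: "\<phi> \<in> S" and z: "z \<in> carrier A"
      interpret positive_functional A \<phi> by (rule positive_functional[OF \<phi>])
      have "sn \<phi> ((x \<oplus> y) \<otimes> z) \<le> sn \<phi> (x \<otimes> z) + sn \<phi> (y \<otimes> z)"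
        using x y z N_triangle[of "x \<otimes> z" "y \<otimes> z"] by (simp add: l_distr)
      then show "sn \<phi> ((x \<oplus> y) \<otimes> z) \<le> (G x + G y) * sn \<phi> z"
        using N_le_G[OF x \<phi> z] N_le_G[OF y \<phi> z] by (simp add: distrib_right)
    qed (use x y G_nonneg in auto)
  qed
qed

end

section \<open>Minimal tensor products\<close>

text \<open>The monoid underlying \<open>pair_alg\<close>, named so that the results on
  \<open>monoid_star_alg\<close> apply to it.\<close>

definition pair_monoid ::
  "('a, 'm) star_alg_scheme \<Rightarrow> ('b, 'n) star_alg_scheme \<Rightarrow> ('a \<times> 'b) star_monoid" where
  "pair_monoid A B = \<lparr> carrier = carrier A \<times> carrier B,
     monoid.mult = (\<lambda>(a, b) (a', b'). (a \<otimes>\<^bsub>A\<^esub> a', b \<otimes>\<^bsub>B\<^esub> b')),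
     one = (\<one>\<^bsub>A\<^esub>, \<one>\<^bsub>B\<^esub>),
     inv_op = (\<lambda>(a, b). (star A a, star B b)) \<rparr>"

lemma pair_alg_eq: "pair_alg A B = monoid_star_alg (pair_monoid A B)"
  by (simp add: pair_alg_def pair_monoid_def)

lemma tensor_fun_eq: "tensor_fun \<phi> \<chi> x = lin (\<lambda>(a, b). \<phi> a * \<chi> b) x"
  by (simp add: tensor_fun_def lin_def case_prod_beta mult.assoc)

text \<open>The difference of t^2 and a* a has a square root once t exceeds the norm of a; t is
  chosen as that norm plus 1 because the bound for the square root is strict. This identity is what
  bounds the action of a on GNS vectors.\<close>

lemma (in cstar_algebra) scalar_minus_square:
  assumes a: "a \<in> carrier A"
  shows "\<exists>t k. 0 \<le> t \<and> k \<in> carrier A \<and> complex_of_real (t\<^sup>2) \<odot> \<one> = star A a \<otimes> a \<oplus> star A k \<otimes> k"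
proof -
  define t where "t = nrm A a + 1"
  have t: "0 < t" "nrm A a < t" using a by (simp_all add: t_def add_nonneg_pos)
  define b where "b = complex_of_real (1 / t) \<odot> a"
  have b: "b \<in> carrier A" using a by (simp add: b_def)
  have "nrm A b = nrm A a / t" using a t by (simp add: b_def norm_divide)
  then have "nrm A b < 1" using t by simp
  then have "nrm A (star A b \<otimes> b) < 1" using b p_nonneg[OF b] by (simp add: p_cstar power_less_one_iff)
  moreover have "star A b \<otimes> b \<in> carrier A" "star A (star A b \<otimes> b) = star A b \<otimes> b" using b by auto
  ultimately obtain k where k: "k \<in> carrier A" "star A k = k" "k \<otimes> k = \<one> \<ominus> star A b \<otimes> b"
    using sqrt_one_minus by metis
  let ?k = "complex_of_real t \<odot> k"
  have bb: "complex_of_real (t\<^sup>2) \<odot> (star A b \<otimes> b) = star A a \<otimes> a"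
    using a t by (simp add: b_def power2_eq_square)
  have "star A ?k \<otimes> ?k = complex_of_real (t\<^sup>2) \<odot> (k \<otimes> k)" using k(1,2) by (simp add: power2_eq_square)
  also have "\<dots> = complex_of_real (t\<^sup>2) \<odot> \<one> \<ominus> star A a \<otimes> a"
    unfolding k(3) bb[symmetric] by (rule smult_diff) (use b in auto)
  finally have "star A a \<otimes> a \<oplus> star A ?k \<otimes> ?k = complex_of_real (t\<^sup>2) \<odot> \<one> \<oplus> (star A a \<otimes> a \<oplus> \<ominus> (star A a \<otimes> a))"
    using a by (simp add: a_minus_def a_ac)
  then have "star A a \<otimes> a \<oplus> star A ?k \<otimes> ?k = complex_of_real (t\<^sup>2) \<odot> \<one>" using a by (simp add: r_neg)
  then show ?thesis using k(1) t by (intro exI[of _ t] exI[of _ ?k]) simp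
qed

lemma pos_fun_scale:
  assumes \<phi>: "pos_fun A \<phi>" and q: "0 \<le> q"
  shows "pos_fun A (\<lambda>a. complex_of_real q * \<phi> a)"
proof -
  have "0 \<le> complex_of_real q * z" if "0 \<le> z" for z
    using q that by (simp add: less_eq_complex_def)
  then show ?thesis using \<phi> unfolding pos_fun_def by (simp add: distrib_left mult.left_commute)
qed

lemma inv_monoid_pair:
  assumes "star_algebra A" "star_algebra B"
  shows "inv_monoid (pair_monoid A B)"
proof -
  interpret A: star_algebra A by fact
  interpret B: star_algebra B by fact
  have "Group.monoid (pair_monoid A B)"
    by (rule monoidI) (auto simp: pair_monoid_def A.m_assoc B.m_assoc)
  then show ?thesis
    by (rule inv_monoid.intro, unfold_locales) (auto simp: pair_monoid_def)
qed

locale tensor_pair = A: cstar_algebra A + B: cstar_algebra B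
  for A :: "'a cstar" and B :: "'b cstar"
begin

sublocale M: inv_monoid "pair_monoid A B"
  by (rule inv_monoid_pair[OF A.star_algebra_axioms B.star_algebra_axioms])

abbreviation "Pr \<equiv> pair_alg A B"
abbreviation "T \<equiv> min_tensor A B"
abbreviation "et \<equiv> elem_tensor A B"

sublocale Q: star_algebra Pr
  unfolding pair_alg_eq by (rule M.star_algebra_Q)

lemma pm_carrier: "carrier (pair_monoid A B) = carrier A \<times> carrier B"
  and pm_mult: "u \<otimes>\<^bsub>pair_monoid A B\<^esub> v = (fst u \<otimes>\<^bsub>A\<^esub> fst v, snd u \<otimes>\<^bsub>B\<^esub> snd v)"
  and pm_inv: "inv_op (pair_monoid A B) u = (star A (fst u), star B (snd u))"
  and pm_one: "\<one>\<^bsub>pair_monoid A B\<^esub> = (\<one>\<^bsub>A\<^esub>, \<one>\<^bsub>B\<^esub>)"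
  by (simp_all add: pair_monoid_def case_prod_beta)

lemma single_closed [simp, intro]: "\<lbrakk>a \<in> carrier A; b \<in> carrier B\<rbrakk> \<Longrightarrow> single (a, b) \<in> carrier Pr"
  unfolding pair_alg_eq by (rule M.single_closed) (simp add: pm_carrier)

lemma single_mult: "\<lbrakk>a \<in> carrier A; b \<in> carrier B; a' \<in> carrier A; b' \<in> carrier B\<rbrakk>
    \<Longrightarrow> single (a, b) \<otimes>\<^bsub>Pr\<^esub> single (a', b') = single (a \<otimes>\<^bsub>A\<^esub> a', b \<otimes>\<^bsub>B\<^esub> b')"
  unfolding pair_alg_eq by (subst M.single_mult) (auto simp: pm_carrier pm_mult)

lemma single_star: "\<lbrakk>a \<in> carrier A; b \<in> carrier B\<rbrakk> \<Longrightarrow> star Pr (single (a, b)) = single (star A a, star B b)"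
  unfolding pair_alg_eq by (subst M.single_star) (auto simp: pm_carrier pm_inv)

lemma one_eq: "\<one>\<^bsub>Pr\<^esub> = single (\<one>\<^bsub>A\<^esub>, \<one>\<^bsub>B\<^esub>)"
  unfolding pair_alg_eq M.Q_one pm_one ..

lemma Pr_supp: "\<lbrakk>x \<in> carrier Pr; x u \<noteq> 0\<rbrakk> \<Longrightarrow> fst u \<in> carrier A \<and> snd u \<in> carrier B"
  using M.Q_supp[of x u] unfolding pair_alg_eq pm_carrier by auto

lemma Pr_finite: "x \<in> carrier Pr \<Longrightarrow> finite (supp x)"
  unfolding pair_alg_eq by (rule M.Q_finite)

lemma Pr_induct [consumes 1, case_names zero add]:
  assumes "f \<in> carrier Pr" "P \<zero>\<^bsub>Pr\<^esub>"
    and "\<And>f c a b. \<lbrakk>f \<in> carrier Pr; P f; a \<in> carrier A; b \<in> carrier B\<rbrakk> \<Longrightarrow> P (f \<oplus>\<^bsub>Pr\<^esub> c \<odot>\<^bsub>Pr\<^esub> single (a, b))"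
  shows "P f"
  using M.Q_induct[of f P] assms unfolding pair_alg_eq pm_carrier by auto

lemma tf_star_mult:
  assumes w: "w \<in> carrier Pr" and y: "y \<in> carrier Pr"
  shows "tensor_fun \<phi> \<chi> (star Pr w \<otimes>\<^bsub>Pr\<^esub> y)
    = cnj (lin (\<lambda>u. cnj (lin (\<lambda>v. \<phi> (star A (fst u) \<otimes>\<^bsub>A\<^esub> fst v) * \<chi> (star B (snd u) \<otimes>\<^bsub>B\<^esub> snd v)) y)) w)"
  using w y unfolding pair_alg_eq tensor_fun_eq
  by (simp add: M.lin_mult M.lin_star M.Q_star_closed pm_mult pm_inv)

text \<open>The matrix coefficient of a tensor b between the vectors given by y and w. A formal pair
  (a, b) is not bilinear in a and b, but these coefficients are, and the four lemmas below record
  it.\<close>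

lemma tf_sandwich:
  assumes w: "w \<in> carrier Pr" and y: "y \<in> carrier Pr" and a: "a \<in> carrier A" and b: "b \<in> carrier B"
  shows "tensor_fun \<phi> \<chi> (star Pr w \<otimes>\<^bsub>Pr\<^esub> (single (a, b) \<otimes>\<^bsub>Pr\<^esub> y))
    = cnj (lin (\<lambda>u. cnj (lin (\<lambda>v. \<phi> (star A (fst u) \<otimes>\<^bsub>A\<^esub> (a \<otimes>\<^bsub>A\<^esub> fst v)) * \<chi> (star B (snd u) \<otimes>\<^bsub>B\<^esub> (b \<otimes>\<^bsub>B\<^esub> snd v))) y)) w)"
proof -
  have s: "single (a, b) \<in> carrier M.Q" using a b by (simp add: pm_carrier)
  have "lin \<psi> (single (a, b) \<otimes>\<^bsub>Pr\<^esub> y) = lin (\<lambda>v. \<psi> (a \<otimes>\<^bsub>A\<^esub> fst v, b \<otimes>\<^bsub>B\<^esub> snd v)) y" for \<psi>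
    using y s unfolding pair_alg_eq by (simp add: M.lin_mult pm_mult)
  then show ?thesis using a b w y by (simp add: tf_star_mult)
qed

lemma sandwich_add_left:
  assumes "w \<in> carrier Pr" "y \<in> carrier Pr" "a \<in> carrier A" "a' \<in> carrier A" "b \<in> carrier B" "pos_fun A \<phi>"
  shows "tensor_fun \<phi> \<chi> (star Pr w \<otimes>\<^bsub>Pr\<^esub> (single (a \<oplus>\<^bsub>A\<^esub> a', b) \<otimes>\<^bsub>Pr\<^esub> y))
    = tensor_fun \<phi> \<chi> (star Pr w \<otimes>\<^bsub>Pr\<^esub> (single (a, b) \<otimes>\<^bsub>Pr\<^esub> y)) + tensor_fun \<phi> \<chi> (star Pr w \<otimes>\<^bsub>Pr\<^esub> (single (a', b) \<otimes>\<^bsub>Pr\<^esub> y))"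
proof -
  interpret \<phi>: positive_functional A \<phi> by unfold_locales fact
  note sup = Pr_supp[OF assms(1)] Pr_supp[OF assms(2)]
  show ?thesis using assms(1-5)
    by (simp add: tf_sandwich flip: lin_fun_add complex_cnj_add)
      (intro lin_cong, simp, intro lin_cong, simp add: sup A.l_distr A.r_distr distrib_right)
qed

lemma sandwich_smult_left:
  assumes "w \<in> carrier Pr" "y \<in> carrier Pr" "a \<in> carrier A" "b \<in> carrier B" "pos_fun A \<phi>"
  shows "tensor_fun \<phi> \<chi> (star Pr w \<otimes>\<^bsub>Pr\<^esub> (single (c \<odot>\<^bsub>A\<^esub> a, b) \<otimes>\<^bsub>Pr\<^esub> y))
    = c * tensor_fun \<phi> \<chi> (star Pr w \<otimes>\<^bsub>Pr\<^esub> (single (a, b) \<otimes>\<^bsub>Pr\<^esub> y))"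
proof -
  interpret \<phi>: positive_functional A \<phi> by unfold_locales fact
  note sup = Pr_supp[OF assms(1)] Pr_supp[OF assms(2)]
  have "c * cnj (lin f w) = cnj (lin (\<lambda>u. cnj c * f u) w)" "c * lin f y = lin (\<lambda>u. c * f u) y" for f
    by (simp_all add: lin_fun_smult)
  then show ?thesis using assms(1-4)
    by (simp add: tf_sandwich flip: complex_cnj_mult)
      (intro lin_cong, simp, intro lin_cong, simp add: sup mult.assoc)
qed

lemma sandwich_add_right:
  assumes "w \<in> carrier Pr" "y \<in> carrier Pr" "a \<in> carrier A" "b \<in> carrier B" "b' \<in> carrier B" "pos_fun B \<chi>"
  shows "tensor_fun \<phi> \<chi> (star Pr w \<otimes>\<^bsub>Pr\<^esub> (single (a, b \<oplus>\<^bsub>B\<^esub> b') \<otimes>\<^bsub>Pr\<^esub> y))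
    = tensor_fun \<phi> \<chi> (star Pr w \<otimes>\<^bsub>Pr\<^esub> (single (a, b) \<otimes>\<^bsub>Pr\<^esub> y)) + tensor_fun \<phi> \<chi> (star Pr w \<otimes>\<^bsub>Pr\<^esub> (single (a, b') \<otimes>\<^bsub>Pr\<^esub> y))"
proof -
  interpret \<chi>: positive_functional B \<chi> by unfold_locales fact
  note sup = Pr_supp[OF assms(1)] Pr_supp[OF assms(2)]
  show ?thesis using assms(1-5)
    by (simp add: tf_sandwich flip: lin_fun_add complex_cnj_add)
      (intro lin_cong, simp, intro lin_cong, simp add: sup B.l_distr B.r_distr distrib_left)
qed

lemma sandwich_smult_right:
  assumes "w \<in> carrier Pr" "y \<in> carrier Pr" "a \<in> carrier A" "b \<in> carrier B" "pos_fun B \<chi>"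
  shows "tensor_fun \<phi> \<chi> (star Pr w \<otimes>\<^bsub>Pr\<^esub> (single (a, c \<odot>\<^bsub>B\<^esub> b) \<otimes>\<^bsub>Pr\<^esub> y))
    = c * tensor_fun \<phi> \<chi> (star Pr w \<otimes>\<^bsub>Pr\<^esub> (single (a, b) \<otimes>\<^bsub>Pr\<^esub> y))"
proof -
  interpret \<chi>: positive_functional B \<chi> by unfold_locales fact
  note sup = Pr_supp[OF assms(1)] Pr_supp[OF assms(2)]
  have "c * cnj (lin f w) = cnj (lin (\<lambda>u. cnj c * f u) w)" "c * lin f y = lin (\<lambda>u. c * f u) y" for f
    by (simp_all add: lin_fun_smult)
  then show ?thesis using assms(1-4)
    by (simp add: tf_sandwich flip: complex_cnj_mult)
      (intro lin_cong, simp, intro lin_cong, simp add: sup mult.left_commute)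
qed

text \<open>The value at z* z is a quadratic form whose matrix is the entrywise product of two Gram
  matrices, one for each functional, so the Schur product theorem gives positivity.\<close>

lemma pos_fun_tensor:
  assumes \<phi>: "pos_fun A \<phi>" and \<chi>: "pos_fun B \<chi>"
  shows "pos_fun Pr (tensor_fun \<phi> \<chi>)"
proof -
  interpret \<phi>: positive_functional A \<phi> by unfold_locales (rule \<phi>)
  interpret \<chi>: positive_functional B \<chi> by unfold_locales (rule \<chi>)
  have "0 \<le> tensor_fun \<phi> \<chi> (star Pr z \<otimes>\<^bsub>Pr\<^esub> z)" if z: "z \<in> carrier Pr" for z
  proof -
    note sup = Pr_supp[OF z]
    have "tensor_fun \<phi> \<chi> (star Pr z \<otimes>\<^bsub>Pr\<^esub> z) = (\<Sum>u\<in>supp z. \<Sum>v\<in>supp z. cnj (z u) * z v *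
        (\<phi> (star A (fst u) \<otimes>\<^bsub>A\<^esub> fst v) * \<chi> (star B (snd u) \<otimes>\<^bsub>B\<^esub> snd v)))"
      unfolding tf_star_mult[OF z z] lin_def by (simp add: cnj_sum sum_distrib_left mult.assoc)
    also have "0 \<le> \<dots>"
      by (intro psd_onD psd_on_schur \<phi>.psd_gram \<chi>.psd_gram Pr_finite z) (use sup in auto)
    finally show ?thesis .
  qed
  moreover have "tensor_fun \<phi> \<chi> (x \<oplus>\<^bsub>Pr\<^esub> y) = tensor_fun \<phi> \<chi> x + tensor_fun \<phi> \<chi> y"
    if "x \<in> carrier Pr" "y \<in> carrier Pr" for x y
    using that Pr_finite unfolding tensor_fun_eq pair_alg_eq M.Q_add by (intro lin_add) auto
  moreover have "tensor_fun \<phi> \<chi> (c \<odot>\<^bsub>Pr\<^esub> x) = c * tensor_fun \<phi> \<chi> x" for c x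
    unfolding tensor_fun_eq pair_alg_eq M.Q_smult by (rule lin_smult)
  ultimately show ?thesis by (simp add: pos_fun_def)
qed

abbreviation "S \<equiv> {tensor_fun \<phi> \<chi> | \<phi> \<chi>. \<phi> \<in> states A \<and> \<chi> \<in> states B}"

lemma S_pos: "\<rho> \<in> S \<Longrightarrow> pos_fun Pr \<rho>"
  using pos_fun_tensor by (auto simp: states_iff)

lemma S_positive_functional: "\<rho> \<in> S \<Longrightarrow> positive_functional Pr \<rho>"
  by unfold_locales (rule S_pos)

sublocale G: gns_family Pr S
proof
  show "\<And>\<rho>. \<rho> \<in> S \<Longrightarrow> pos_fun Pr \<rho>" by (rule S_pos)
  let ?N = "positive_functional.N Pr"
  fix x assume "x \<in> carrier Pr"
  then show "\<exists>b. \<forall>\<rho>\<in>S. \<forall>y\<in>carrier Pr. ?N \<rho> (x \<otimes>\<^bsub>Pr\<^esub> y) \<le> b * ?N \<rho> y"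
  proof (induction rule: Pr_induct)
    case zero
    have "?N \<rho> (\<zero>\<^bsub>Pr\<^esub> \<otimes>\<^bsub>Pr\<^esub> y) \<le> 0 * ?N \<rho> y" if "\<rho> \<in> S" "y \<in> carrier Pr" for \<rho> y
      using positive_functional.N_zero[OF S_positive_functional[OF that(1)]] that(2) by simp
    then show ?case by blast
  next
    case (add f c a b)
    have fc: "f \<in> carrier Pr" and ab: "a \<in> carrier A" "b \<in> carrier B" using add by auto
    obtain d where d: "\<And>\<rho> y. \<rho> \<in> S \<Longrightarrow> y \<in> carrier Pr \<Longrightarrow> ?N \<rho> (f \<otimes>\<^bsub>Pr\<^esub> y) \<le> d * ?N \<rho> y"
      using add.IH by blast
    obtain t k where k: "0 \<le> t" "k \<in> carrier A"
      "complex_of_real (t\<^sup>2) \<odot>\<^bsub>A\<^esub> \<one>\<^bsub>A\<^esub> = star A a \<otimes>\<^bsub>A\<^esub> a \<oplus>\<^bsub>A\<^esub> star A k \<otimes>\<^bsub>A\<^esub> k"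
      using A.scalar_minus_square[OF ab(1)] by blast
    obtain s l where l: "0 \<le> s" "l \<in> carrier B"
      "complex_of_real (s\<^sup>2) \<odot>\<^bsub>B\<^esub> \<one>\<^bsub>B\<^esub> = star B b \<otimes>\<^bsub>B\<^esub> b \<oplus>\<^bsub>B\<^esub> star B l \<otimes>\<^bsub>B\<^esub> l"
      using B.scalar_minus_square[OF ab(2)] by blast
    have "?N \<rho> ((f \<oplus>\<^bsub>Pr\<^esub> c \<odot>\<^bsub>Pr\<^esub> single (a, b)) \<otimes>\<^bsub>Pr\<^esub> y) \<le> (d + cmod c * (t * s)) * ?N \<rho> y"
      if \<rho>: "\<rho> \<in> S" and y: "y \<in> carrier Pr" for \<rho> y
    proof -
      interpret positive_functional Pr \<rho> by (rule S_positive_functional[OF \<rho>])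
      obtain \<phi> \<chi> where \<phi>\<chi>: "\<rho> = tensor_fun \<phi> \<chi>" "pos_fun A \<phi>" "pos_fun B \<chi>" using \<rho> by (auto simp: states_iff)
      \<comment> \<open>As a function of its two arguments, h is bilinear and nonnegative on
        products of squares. Writing t^2 as a sum of squares containing a* a, and s^2 likewise for
        b, bounds the value at a* a and b* b by t^2 s^2 times the value at the units, one variable
        at a time.\<close>
      define h where "h a b = tensor_fun \<phi> \<chi> (star Pr y \<otimes>\<^bsub>Pr\<^esub> (single (a, b) \<otimes>\<^bsub>Pr\<^esub> y))" for a b
      have hN: "h (star A a \<otimes>\<^bsub>A\<^esub> a) (star B b \<otimes>\<^bsub>B\<^esub> b) = complex_of_real ((N (single (a, b) \<otimes>\<^bsub>Pr\<^esub> y))\<^sup>2)"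
        if a: "a \<in> carrier A" and b: "b \<in> carrier B" for a b
      proof -
        have "star Pr (single (a, b) \<otimes>\<^bsub>Pr\<^esub> y) \<otimes>\<^bsub>Pr\<^esub> (single (a, b) \<otimes>\<^bsub>Pr\<^esub> y)
            = star Pr y \<otimes>\<^bsub>Pr\<^esub> ((star Pr (single (a, b)) \<otimes>\<^bsub>Pr\<^esub> single (a, b)) \<otimes>\<^bsub>Pr\<^esub> y)"
          using a b y by (simp add: Q.m_assoc)
        also have "star Pr (single (a, b)) \<otimes>\<^bsub>Pr\<^esub> single (a, b) = single (star A a \<otimes>\<^bsub>A\<^esub> a, star B b \<otimes>\<^bsub>B\<^esub> b)"
          using a b by (simp add: single_star single_mult)
        finally have "h (star A a \<otimes>\<^bsub>A\<^esub> a) (star B b \<otimes>\<^bsub>B\<^esub> b)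
            = \<rho> (star Pr (single (a, b) \<otimes>\<^bsub>Pr\<^esub> y) \<otimes>\<^bsub>Pr\<^esub> (single (a, b) \<otimes>\<^bsub>Pr\<^esub> y))"
          by (simp add: h_def \<phi>\<chi>(1))
        also have "\<dots> = complex_of_real ((N (single (a, b) \<otimes>\<^bsub>Pr\<^esub> y))\<^sup>2)" by (rule N_sq) (use a b y in auto)
        finally show ?thesis .
      qed
      have h1: "h \<one>\<^bsub>A\<^esub> (star B b \<otimes>\<^bsub>B\<^esub> b) = complex_of_real ((N (single (\<one>\<^bsub>A\<^esub>, b) \<otimes>\<^bsub>Pr\<^esub> y))\<^sup>2)" if "b \<in> carrier B" for b
        using hN[OF A.one_closed that] by simp
      have h11: "h \<one>\<^bsub>A\<^esub> \<one>\<^bsub>B\<^esub> = complex_of_real ((N y)\<^sup>2)"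
        using h1[of "\<one>\<^bsub>B\<^esub>"] y by (simp flip: one_eq)
      have "complex_of_real (t\<^sup>2) * h \<one>\<^bsub>A\<^esub> (star B b \<otimes>\<^bsub>B\<^esub> b)
          = h (complex_of_real (t\<^sup>2) \<odot>\<^bsub>A\<^esub> \<one>\<^bsub>A\<^esub>) (star B b \<otimes>\<^bsub>B\<^esub> b)"
        unfolding h_def by (rule sandwich_smult_left[symmetric]) (use y ab \<phi>\<chi> in auto)
      also have "\<dots> = h (star A a \<otimes>\<^bsub>A\<^esub> a) (star B b \<otimes>\<^bsub>B\<^esub> b) + h (star A k \<otimes>\<^bsub>A\<^esub> k) (star B b \<otimes>\<^bsub>B\<^esub> b)"
        unfolding k(3) h_def by (rule sandwich_add_left) (use y ab k \<phi>\<chi> in auto)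
      finally have "complex_of_real (t\<^sup>2 * (N (single (\<one>\<^bsub>A\<^esub>, b) \<otimes>\<^bsub>Pr\<^esub> y))\<^sup>2)
          = complex_of_real ((N (single (a, b) \<otimes>\<^bsub>Pr\<^esub> y))\<^sup>2 + (N (single (k, b) \<otimes>\<^bsub>Pr\<^esub> y))\<^sup>2)"
        unfolding hN[OF ab] hN[OF k(2) ab(2)] h1[OF ab(2)] of_real_mult of_real_add .
      then have 1: "t\<^sup>2 * (N (single (\<one>\<^bsub>A\<^esub>, b) \<otimes>\<^bsub>Pr\<^esub> y))\<^sup>2
          = (N (single (a, b) \<otimes>\<^bsub>Pr\<^esub> y))\<^sup>2 + (N (single (k, b) \<otimes>\<^bsub>Pr\<^esub> y))\<^sup>2"
        by (rule of_real_eq_iff[THEN iffD1])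
      have "complex_of_real (s\<^sup>2) * h \<one>\<^bsub>A\<^esub> \<one>\<^bsub>B\<^esub> = h \<one>\<^bsub>A\<^esub> (complex_of_real (s\<^sup>2) \<odot>\<^bsub>B\<^esub> \<one>\<^bsub>B\<^esub>)"
        unfolding h_def by (rule sandwich_smult_right[symmetric]) (use y ab \<phi>\<chi> in auto)
      also have "\<dots> = h \<one>\<^bsub>A\<^esub> (star B b \<otimes>\<^bsub>B\<^esub> b) + h \<one>\<^bsub>A\<^esub> (star B l \<otimes>\<^bsub>B\<^esub> l)"
        unfolding l(3) h_def by (rule sandwich_add_right) (use y ab l \<phi>\<chi> in auto)
      finally have "complex_of_real (s\<^sup>2 * (N y)\<^sup>2)
          = complex_of_real ((N (single (\<one>\<^bsub>A\<^esub>, b) \<otimes>\<^bsub>Pr\<^esub> y))\<^sup>2 + (N (single (\<one>\<^bsub>A\<^esub>, l) \<otimes>\<^bsub>Pr\<^esub> y))\<^sup>2)"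
        unfolding h11 h1[OF ab(2)] h1[OF l(2)] of_real_mult of_real_add .
      then have 2: "s\<^sup>2 * (N y)\<^sup>2 = (N (single (\<one>\<^bsub>A\<^esub>, b) \<otimes>\<^bsub>Pr\<^esub> y))\<^sup>2 + (N (single (\<one>\<^bsub>A\<^esub>, l) \<otimes>\<^bsub>Pr\<^esub> y))\<^sup>2"
        by (rule of_real_eq_iff[THEN iffD1])
      have "(N (single (a, b) \<otimes>\<^bsub>Pr\<^esub> y))\<^sup>2 \<le> t\<^sup>2 * (N (single (\<one>\<^bsub>A\<^esub>, b) \<otimes>\<^bsub>Pr\<^esub> y))\<^sup>2"
        using 1 by simp
      also have "\<dots> \<le> t\<^sup>2 * (s\<^sup>2 * (N y)\<^sup>2)" using 2 by (intro mult_left_mono) auto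
      also have "\<dots> = (t * s * N y)\<^sup>2" by (simp add: power_mult_distrib)
      finally have 3: "N (single (a, b) \<otimes>\<^bsub>Pr\<^esub> y) \<le> t * s * N y"
        by (rule power2_le_imp_le) (use k l y in simp)
      have "N ((f \<oplus>\<^bsub>Pr\<^esub> c \<odot>\<^bsub>Pr\<^esub> single (a, b)) \<otimes>\<^bsub>Pr\<^esub> y) \<le> N (f \<otimes>\<^bsub>Pr\<^esub> y) + cmod c * N (single (a, b) \<otimes>\<^bsub>Pr\<^esub> y)"
        using fc ab y N_triangle[of "f \<otimes>\<^bsub>Pr\<^esub> y" "c \<odot>\<^bsub>Pr\<^esub> (single (a, b) \<otimes>\<^bsub>Pr\<^esub> y)"] by (simp add: Q.l_distr)
      also have "\<dots> \<le> d * N y + cmod c * (t * s * N y)"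
        using d[OF \<rho> y] 3 by (intro add_mono mult_left_mono) auto
      finally show ?thesis by (simp add: algebra_simps)
    qed
    then show ?case by blast
  qed
qed

lemma spatial_norm_eq: "spatial_norm A B = gns_norm Pr S"
proof
  fix x
  let ?sq = "\<lambda>\<phi> \<chi> z. Re (tensor_fun \<phi> \<chi> (star Pr z \<otimes>\<^bsub>Pr\<^esub> z))"
  have N: "positive_functional.N Pr (tensor_fun \<phi> \<chi>) z = sqrt (?sq \<phi> \<chi> z)"
    if "\<phi> \<in> states A" "\<chi> \<in> states B" for \<phi> \<chi> z
    by (rule positive_functional.N_def[OF S_positive_functional]) (use that in blast)
  have "{sqrt (?sq \<phi> \<chi> (x \<otimes>\<^bsub>Pr\<^esub> y) / ?sq \<phi> \<chi> y) | \<phi> \<chi> y.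
        \<phi> \<in> states A \<and> \<chi> \<in> states B \<and> y \<in> carrier Pr \<and> ?sq \<phi> \<chi> y \<noteq> 0}
      = {positive_functional.N Pr \<rho> (x \<otimes>\<^bsub>Pr\<^esub> y) / positive_functional.N Pr \<rho> y | \<rho> y.
        \<rho> \<in> S \<and> y \<in> carrier Pr \<and> positive_functional.N Pr \<rho> y \<noteq> 0}" (is "?L = ?R")
  proof (intro equalityI subsetI)
    fix r assume "r \<in> ?L"
    then obtain \<phi> \<chi> y where r: "r = sqrt (?sq \<phi> \<chi> (x \<otimes>\<^bsub>Pr\<^esub> y) / ?sq \<phi> \<chi> y)" "\<phi> \<in> states A" "\<chi> \<in> states B"
      "y \<in> carrier Pr" "?sq \<phi> \<chi> y \<noteq> 0" by blast
    show "r \<in> ?R"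
      by (rule CollectI, intro exI[of _ "tensor_fun \<phi> \<chi>"] exI[of _ y])
        (use r N[OF r(2,3)] in \<open>auto simp: real_sqrt_divide\<close>)
  next
    fix r assume "r \<in> ?R"
    then obtain \<phi> \<chi> y where r: "r = positive_functional.N Pr (tensor_fun \<phi> \<chi>) (x \<otimes>\<^bsub>Pr\<^esub> y) / positive_functional.N Pr (tensor_fun \<phi> \<chi>) y"
      "\<phi> \<in> states A" "\<chi> \<in> states B" "y \<in> carrier Pr" "positive_functional.N Pr (tensor_fun \<phi> \<chi>) y \<noteq> 0" by blast
    show "r \<in> ?L"
      by (rule CollectI, intro exI[of _ \<phi>] exI[of _ \<chi>] exI[of _ y])
        (use r N[OF r(2,3)] in \<open>auto simp: real_sqrt_divide\<close>)
  qed
  then show "spatial_norm A B x = gns_norm Pr S x"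
    by (simp add: spatial_norm_def gns_norm_def Let_def)
qed

sublocale U: seminormed_star_algebra Pr "spatial_norm A B"
  unfolding spatial_norm_eq by unfold_locales (rule G.seminorm_G)

lemma cstar_algebra_T: "cstar_algebra T"
  unfolding min_tensor_def by (rule U.cstar_algebra_completion)

sublocale T: cstar_algebra T
  by (rule cstar_algebra_T)

sublocale toT: star_morphism Pr T "to_completion Pr (spatial_norm A B)"
  by unfold_locales (simp add: min_tensor_def U.star_hom_to_completion)

lemma et_eq: "et a b = to_completion Pr (spatial_norm A B) (single (a, b))"
  by (simp add: elem_tensor_def)

lemma et_closed [simp, intro]: "\<lbrakk>a \<in> carrier A; b \<in> carrier B\<rbrakk> \<Longrightarrow> et a b \<in> carrier T"
  by (simp add: et_eq)

lemma et_mult: "\<lbrakk>a \<in> carrier A; b \<in> carrier B; a' \<in> carrier A; b' \<in> carrier B\<rbrakk>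
    \<Longrightarrow> et a b \<otimes>\<^bsub>T\<^esub> et a' b' = et (a \<otimes>\<^bsub>A\<^esub> a') (b \<otimes>\<^bsub>B\<^esub> b')"
  by (simp add: et_eq single_mult flip: toT.map_mult)

lemma et_star: "\<lbrakk>a \<in> carrier A; b \<in> carrier B\<rbrakk> \<Longrightarrow> star T (et a b) = et (star A a) (star B b)"
  by (simp add: et_eq single_star flip: toT.map_star)

lemma et_one: "et \<one>\<^bsub>A\<^esub> \<one>\<^bsub>B\<^esub> = \<one>\<^bsub>T\<^esub>"
  by (simp add: et_eq flip: one_eq)

text \<open>If all matrix coefficients of x and x' agree, then every vector (x - x') y is orthogonal
  to itself, so the spatial norm of x - x' is 0. This turns bilinearity of the coefficients into
  bilinearity of \<open>elem_tensor\<close>.\<close>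

lemma to_T_eqI:
  assumes x: "x \<in> carrier Pr" and x': "x' \<in> carrier Pr"
    and eq: "\<And>\<phi> \<chi> w y. \<lbrakk>pos_fun A \<phi>; pos_fun B \<chi>; w \<in> carrier Pr; y \<in> carrier Pr\<rbrakk>
      \<Longrightarrow> tensor_fun \<phi> \<chi> (star Pr w \<otimes>\<^bsub>Pr\<^esub> (x \<otimes>\<^bsub>Pr\<^esub> y)) = tensor_fun \<phi> \<chi> (star Pr w \<otimes>\<^bsub>Pr\<^esub> (x' \<otimes>\<^bsub>Pr\<^esub> y))"
  shows "to_completion Pr (spatial_norm A B) x = to_completion Pr (spatial_norm A B) x'"
proof -
  let ?d = "x \<ominus>\<^bsub>Pr\<^esub> x'"
  have "gns_norm Pr S ?d \<le> 0"
  proof (rule G.G_least)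
    fix \<rho> y assume \<rho>: "\<rho> \<in> S" and y: "y \<in> carrier Pr"
    interpret positive_functional Pr \<rho> by (rule S_positive_functional[OF \<rho>])
    obtain \<phi> \<chi> where \<phi>\<chi>: "\<rho> = tensor_fun \<phi> \<chi>" "pos_fun A \<phi>" "pos_fun B \<chi>" using \<rho> by (auto simp: states_iff)
    let ?w = "?d \<otimes>\<^bsub>Pr\<^esub> y"
    have w: "?w \<in> carrier Pr" using x x' y by simp
    have "?w = x \<otimes>\<^bsub>Pr\<^esub> y \<oplus>\<^bsub>Pr\<^esub> (-1) \<odot>\<^bsub>Pr\<^esub> (x' \<otimes>\<^bsub>Pr\<^esub> y)"
      using x x' y by (simp add: Q.a_minus_eq Q.l_distr)
    then have "star Pr ?w \<otimes>\<^bsub>Pr\<^esub> ?w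
        = star Pr ?w \<otimes>\<^bsub>Pr\<^esub> (x \<otimes>\<^bsub>Pr\<^esub> y) \<oplus>\<^bsub>Pr\<^esub> (-1) \<odot>\<^bsub>Pr\<^esub> (star Pr ?w \<otimes>\<^bsub>Pr\<^esub> (x' \<otimes>\<^bsub>Pr\<^esub> y))"
      using x x' y w by (metis Q.m_closed Q.mult_smult Q.r_distr Q.smult_closed Q.star_closed)
    then have "\<rho> (star Pr ?w \<otimes>\<^bsub>Pr\<^esub> ?w) = \<rho> (star Pr ?w \<otimes>\<^bsub>Pr\<^esub> (x \<otimes>\<^bsub>Pr\<^esub> y)) - \<rho> (star Pr ?w \<otimes>\<^bsub>Pr\<^esub> (x' \<otimes>\<^bsub>Pr\<^esub> y))"
      using x x' y w by simp
    also have "\<dots> = 0" using eq[OF \<phi>\<chi>(2,3) w y] by (simp add: \<phi>\<chi>(1))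
    finally have "\<rho> (star Pr ?w \<otimes>\<^bsub>Pr\<^esub> ?w) = 0" .
    then show "G.sn \<rho> ?w \<le> 0 * G.sn \<rho> y" by (simp add: N_def)
  qed (use x x' in auto)
  moreover have dc: "?d \<in> carrier Pr" using x x' by simp
  have "nrm T (to_completion Pr (spatial_norm A B) ?d) = gns_norm Pr S ?d"
    unfolding min_tensor_def U.nrm_to_completion[OF dc] by (simp only: spatial_norm_eq)
  moreover have "0 \<le> nrm T (to_completion Pr (spatial_norm A B) ?d)"
    by (rule T.p_nonneg[OF toT.closed[OF dc]])
  ultimately have "nrm T (to_completion Pr (spatial_norm A B) ?d) = 0" by linarith
  then have "to_completion Pr (spatial_norm A B) ?d = \<zero>\<^bsub>T\<^esub>" by (rule T.nrm_eq_zero[OF toT.closed[OF dc]])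
  then show ?thesis unfolding toT.map_minus[OF x x'] using x x' by simp
qed

lemma tensor_fun_sandwich_add:
  "\<lbrakk>w \<in> carrier Pr; x \<in> carrier Pr; x' \<in> carrier Pr; y \<in> carrier Pr; pos_fun A \<phi>; pos_fun B \<chi>\<rbrakk>
    \<Longrightarrow> tensor_fun \<phi> \<chi> (star Pr w \<otimes>\<^bsub>Pr\<^esub> ((x \<oplus>\<^bsub>Pr\<^esub> x') \<otimes>\<^bsub>Pr\<^esub> y))
      = tensor_fun \<phi> \<chi> (star Pr w \<otimes>\<^bsub>Pr\<^esub> (x \<otimes>\<^bsub>Pr\<^esub> y)) + tensor_fun \<phi> \<chi> (star Pr w \<otimes>\<^bsub>Pr\<^esub> (x' \<otimes>\<^bsub>Pr\<^esub> y))"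
  using pos_fun_tensor[of \<phi> \<chi>] by (simp add: Q.l_distr Q.r_distr pos_fun_def)

lemma tensor_fun_smult: "tensor_fun \<phi> \<chi> (c \<odot>\<^bsub>Pr\<^esub> x) = c * tensor_fun \<phi> \<chi> x"
  unfolding tensor_fun_eq pair_alg_eq M.Q_smult by (rule lin_smult)

lemma et_add_left: "\<lbrakk>a \<in> carrier A; a' \<in> carrier A; b \<in> carrier B\<rbrakk> \<Longrightarrow> et (a \<oplus>\<^bsub>A\<^esub> a') b = et a b \<oplus>\<^bsub>T\<^esub> et a' b"
  unfolding et_eq by (subst toT.map_add[symmetric], simp, simp, rule to_T_eqI)
    (simp_all add: sandwich_add_left tensor_fun_sandwich_add)

lemma et_add_right: "\<lbrakk>a \<in> carrier A; b \<in> carrier B; b' \<in> carrier B\<rbrakk> \<Longrightarrow> et a (b \<oplus>\<^bsub>B\<^esub> b') = et a b \<oplus>\<^bsub>T\<^esub> et a b'"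
  unfolding et_eq by (subst toT.map_add[symmetric], simp, simp, rule to_T_eqI)
    (simp_all add: sandwich_add_right tensor_fun_sandwich_add)

lemma et_smult_left: "\<lbrakk>a \<in> carrier A; b \<in> carrier B\<rbrakk> \<Longrightarrow> et (c \<odot>\<^bsub>A\<^esub> a) b = c \<odot>\<^bsub>T\<^esub> et a b"
  unfolding et_eq by (subst toT.map_smult[symmetric], simp, rule to_T_eqI)
    (simp_all add: sandwich_smult_left tensor_fun_smult)

lemma et_smult_right: "\<lbrakk>a \<in> carrier A; b \<in> carrier B\<rbrakk> \<Longrightarrow> et a (c \<odot>\<^bsub>B\<^esub> b) = c \<odot>\<^bsub>T\<^esub> et a b"
  unfolding et_eq by (subst toT.map_smult[symmetric], simp, rule to_T_eqI)
    (simp_all add: sandwich_smult_right tensor_fun_smult)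

lemma et_zero_left [simp]: "b \<in> carrier B \<Longrightarrow> et \<zero>\<^bsub>A\<^esub> b = \<zero>\<^bsub>T\<^esub>"
  using et_smult_left[of "\<zero>\<^bsub>A\<^esub>" b 0] by simp

lemma star_hom_left: "star_hom A T (\<lambda>a. et a \<one>\<^bsub>B\<^esub>)"
  by (rule star_homI) (simp_all add: et_add_left et_mult et_one et_smult_left et_star)

lemma star_hom_right: "star_hom B T (\<lambda>b. et \<one>\<^bsub>A\<^esub> b)"
  by (rule star_homI) (simp_all add: et_add_right et_mult et_one et_smult_right et_star)

lemma T_hom_eqI:
  assumes D: "cstar_algebra D" and f: "star_hom T D f" and g: "star_hom T D g"
    and eq: "\<And>a b. \<lbrakk>a \<in> carrier A; b \<in> carrier B\<rbrakk> \<Longrightarrow> f (et a b) = g (et a b)" and x: "x \<in> carrier T"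
  shows "f x = g x"
proof (rule U.completion_hom_eqI[OF D f[unfolded min_tensor_def] g[unfolded min_tensor_def] _ x[unfolded min_tensor_def]])
  have D': "star_algebra D" using D by (simp add: cstar_algebra_def)
  fix z assume z: "z \<in> carrier Pr"
  show "f (to_completion Pr (spatial_norm A B) z) = g (to_completion Pr (spatial_norm A B) z)"
    by (rule M.Q_hom_eqI[OF D' star_hom_comp[OF toT.hom f, unfolded pair_alg_eq]
          star_hom_comp[OF toT.hom g, unfolded pair_alg_eq] _ z[unfolded pair_alg_eq], folded pair_alg_eq])
      (use eq in \<open>auto simp: pm_carrier et_eq\<close>)
qed

text \<open>The spatial norm ranges over states, so the functionals are first divided by their
  masses; in the resulting GNS representation the cyclic vector has norm 1 and z moves it by at most
  the spatial norm of z.\<close>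

lemma tensor_fun_le:
  assumes \<phi>: "pos_fun A \<phi>" and \<chi>: "pos_fun B \<chi>" and z: "z \<in> carrier Pr"
  shows "Re (tensor_fun \<phi> \<chi> (star Pr z \<otimes>\<^bsub>Pr\<^esub> z)) \<le> Re (\<phi> \<one>\<^bsub>A\<^esub>) * Re (\<chi> \<one>\<^bsub>B\<^esub>) * (spatial_norm A B z)\<^sup>2"
proof -
  interpret \<phi>: positive_functional A \<phi> by unfold_locales (rule \<phi>)
  interpret \<chi>: positive_functional B \<chi> by unfold_locales (rule \<chi>)
  define s r where "s = Re (\<phi> \<one>\<^bsub>A\<^esub>)" and "r = Re (\<chi> \<one>\<^bsub>B\<^esub>)"
  have s: "0 \<le> s" "\<phi> \<one>\<^bsub>A\<^esub> = complex_of_real s" using \<phi>.fun_pos[of "\<one>\<^bsub>A\<^esub>"]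
    by (simp_all add: s_def less_eq_complex_def complex_eq_iff)
  have r: "0 \<le> r" "\<chi> \<one>\<^bsub>B\<^esub> = complex_of_real r" using \<chi>.fun_pos[of "\<one>\<^bsub>B\<^esub>"]
    by (simp_all add: r_def less_eq_complex_def complex_eq_iff)
  have zz: "star Pr z \<otimes>\<^bsub>Pr\<^esub> z \<in> carrier Pr" using z by simp
  show ?thesis
  proof (cases "s = 0 \<or> r = 0")
    case True
    have "tensor_fun \<phi> \<chi> (star Pr z \<otimes>\<^bsub>Pr\<^esub> z) = 0"
    proof -
      \<comment> \<open>A positive functional of mass 0 vanishes by the Cauchy-Schwarz inequality,
        and then normalisation is impossible but the left-hand side is 0.\<close>
      have "\<phi> a * \<chi> b = 0" if a: "a \<in> carrier A" and b: "b \<in> carrier B" for a b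
      proof (cases "s = 0")
        case True
        then have "cmod (\<phi> a) \<le> 0" using \<phi>.cauchy_schwarz[of "\<one>\<^bsub>A\<^esub>" a] a s by (simp add: \<phi>.N_def)
        then show ?thesis by simp
      next
        case False
        then have "r = 0" using \<open>s = 0 \<or> r = 0\<close> by simp
        then have "cmod (\<chi> b) \<le> 0" using \<chi>.cauchy_schwarz[of "\<one>\<^bsub>B\<^esub>" b] b r by (simp add: \<chi>.N_def)
        then show ?thesis by simp
      qed
      then have "lin (\<lambda>(a, b). \<phi> a * \<chi> b) (star Pr z \<otimes>\<^bsub>Pr\<^esub> z) = lin (\<lambda>_. 0) (star Pr z \<otimes>\<^bsub>Pr\<^esub> z)"
        by (intro lin_cong) (use Pr_supp[OF zz] in \<open>auto simp: case_prod_beta\<close>)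
      then show ?thesis by (simp add: tensor_fun_eq lin_def)
    qed
    then show ?thesis using s(1) r(1) by (simp flip: s_def r_def)
  next
    case False
    then have sr: "0 < s" "0 < r" using s r by auto
    define \<phi>' \<chi>' where "\<phi>' a = complex_of_real (1 / s) * \<phi> a" and "\<chi>' b = complex_of_real (1 / r) * \<chi> b" for a b
    have "\<phi>' \<in> states A" unfolding states_iff \<phi>'_def
      using sr s pos_fun_scale[OF \<phi>, of "1 / s"] by simp
    moreover have "\<chi>' \<in> states B" unfolding states_iff \<chi>'_def
      using sr r pos_fun_scale[OF \<chi>, of "1 / r"] by simp
    ultimately have S: "tensor_fun \<phi>' \<chi>' \<in> S" by blast
    interpret positive_functional Pr "tensor_fun \<phi>' \<chi>'" by (rule S_positive_functional[OF S])
    have tf: "tensor_fun \<phi>' \<chi>' x = complex_of_real (1 / (s * r)) * tensor_fun \<phi> \<chi> x" for x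
      unfolding tensor_fun_eq lin_fun_smult[symmetric]
      by (intro lin_cong) (simp add: \<phi>'_def \<chi>'_def case_prod_beta)
    have "tensor_fun \<phi> \<chi> \<one>\<^bsub>Pr\<^esub> = complex_of_real (s * r)" by (simp add: one_eq tensor_fun_eq s r)
    then have N1: "N \<one>\<^bsub>Pr\<^esub> = 1" using sr by (simp add: N_def tf)
    have Nz: "N z \<le> spatial_norm A B z"
      using G.N_le_G[OF z S Q.one_closed] z by (simp add: N1 spatial_norm_eq)
    have "Re (tensor_fun \<phi> \<chi> (star Pr z \<otimes>\<^bsub>Pr\<^esub> z)) = s * r * Re (tensor_fun \<phi>' \<chi>' (star Pr z \<otimes>\<^bsub>Pr\<^esub> z))"
      using sr by (simp add: tf)
    also have "\<dots> = s * r * (N z)\<^sup>2" using N_sq[OF z] by simp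
    also have "\<dots> \<le> s * r * (spatial_norm A B z)\<^sup>2" using Nz z sr by (intro mult_left_mono power_mono) auto
    finally show ?thesis by (simp add: s_def r_def)
  qed
qed

end

text \<open>The point is that the map F of formal sums induced by f and g does not increase the
  spatial norm. On elementary vectors c tensor d this follows by pulling functionals back to A and
  B. On sums of such vectors it yields only some constant K depending on the vector, and
  \<open>N_growth\<close> then replaces K by 1.\<close>

lemma tensor_hom_ex:
  assumes A: "cstar_algebra A" and B: "cstar_algebra B" and C: "cstar_algebra C" and D: "cstar_algebra D"
    and f: "star_hom A C f" and g: "star_hom B D g"
  shows "\<exists>h. star_hom (min_tensor A B) (min_tensor C D) h
    \<and> (\<forall>a\<in>carrier A. \<forall>b\<in>carrier B. h (elem_tensor A B a b) = elem_tensor C D (f a) (g b))"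
proof -
  interpret AB: tensor_pair A B by (simp add: tensor_pair_def A B)
  interpret CD: tensor_pair C D by (simp add: tensor_pair_def C D)
  interpret f: star_morphism A C f by unfold_locales (rule f)
  interpret g: star_morphism B D g by unfold_locales (rule g)
  let ?p = "spatial_norm A B"
  have "\<exists>F. star_hom AB.M.Q CD.Pr F \<and> (\<forall>w\<in>carrier (pair_monoid A B). F (single w) = single (f (fst w), g (snd w)))"
    by (rule AB.M.Q_hom_ex[OF CD.Q.star_algebra_axioms])
      (auto simp: AB.pm_carrier AB.pm_mult AB.pm_inv AB.pm_one CD.single_mult CD.single_star CD.one_eq)
  then obtain F where F: "star_hom AB.Pr CD.Pr F"
    and Fs: "\<And>a b. \<lbrakk>a \<in> carrier A; b \<in> carrier B\<rbrakk> \<Longrightarrow> F (single (a, b)) = single (f a, g b)"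
    unfolding pair_alg_eq AB.pm_carrier by fastforce
  interpret F: star_morphism AB.Pr CD.Pr F by unfold_locales (rule F)
  have contr: "spatial_norm C D (F x) \<le> ?p x" if x: "x \<in> carrier AB.Pr" for x
    unfolding CD.spatial_norm_eq
  proof (rule CD.G.G_least)
    fix \<rho> y assume \<rho>: "\<rho> \<in> CD.S" and y: "y \<in> carrier CD.Pr"
    interpret positive_functional CD.Pr \<rho> by (rule CD.S_positive_functional[OF \<rho>])
    obtain \<phi> \<chi> where \<phi>\<chi>: "\<rho> = tensor_fun \<phi> \<chi>" "pos_fun C \<phi>" "pos_fun D \<chi>" using \<rho> by (auto simp: states_iff)
    interpret \<phi>: positive_functional C \<phi> by unfold_locales (rule \<phi>\<chi>)
    interpret \<chi>: positive_functional D \<chi> by unfold_locales (rule \<phi>\<chi>)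
    have vec: "\<exists>K. \<forall>z\<in>carrier AB.Pr. N (F z \<otimes>\<^bsub>CD.Pr\<^esub> single (c, d)) \<le> K * ?p z"
      if c: "c \<in> carrier C" and d: "d \<in> carrier D" for c d
    proof -
      \<comment> \<open>The functionals compressed by c and d and pulled back along f and g. The
        squared norm of F z applied to c tensor d is the value of their tensor product at z* z,
        which the spatial norm of A and B controls.\<close>
      define \<phi>c \<chi>d where "\<phi>c a = \<phi> (star C c \<otimes>\<^bsub>C\<^esub> (f a \<otimes>\<^bsub>C\<^esub> c))" and "\<chi>d b = \<chi> (star D d \<otimes>\<^bsub>D\<^esub> (g b \<otimes>\<^bsub>D\<^esub> d))" for a b
      have \<phi>c: "pos_fun A \<phi>c" unfolding pos_fun_def
      proof (intro conjI ballI allI)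
        fix a assume a: "a \<in> carrier A"
        show "\<phi>c (k \<odot>\<^bsub>A\<^esub> a) = k * \<phi>c a" for k using a c by (simp add: \<phi>c_def)
        have "\<phi>c (star A a \<otimes>\<^bsub>A\<^esub> a) = \<phi> (star C (f a \<otimes>\<^bsub>C\<^esub> c) \<otimes>\<^bsub>C\<^esub> (f a \<otimes>\<^bsub>C\<^esub> c))"
          using a c by (simp add: \<phi>c_def CD.A.m_assoc)
        then show "0 \<le> \<phi>c (star A a \<otimes>\<^bsub>A\<^esub> a)" using \<phi>.fun_pos[of "f a \<otimes>\<^bsub>C\<^esub> c"] a c by simp
        fix b assume b: "b \<in> carrier A"
        show "\<phi>c (a \<oplus>\<^bsub>A\<^esub> b) = \<phi>c a + \<phi>c b" using a b c by (simp add: \<phi>c_def CD.A.l_distr CD.A.r_distr)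
      qed
      have \<chi>d: "pos_fun B \<chi>d" unfolding pos_fun_def
      proof (intro conjI ballI allI)
        fix a assume a: "a \<in> carrier B"
        show "\<chi>d (k \<odot>\<^bsub>B\<^esub> a) = k * \<chi>d a" for k using a d by (simp add: \<chi>d_def)
        have "\<chi>d (star B a \<otimes>\<^bsub>B\<^esub> a) = \<chi> (star D (g a \<otimes>\<^bsub>D\<^esub> d) \<otimes>\<^bsub>D\<^esub> (g a \<otimes>\<^bsub>D\<^esub> d))"
          using a d by (simp add: \<chi>d_def CD.B.m_assoc)
        then show "0 \<le> \<chi>d (star B a \<otimes>\<^bsub>B\<^esub> a)" using \<chi>.fun_pos[of "g a \<otimes>\<^bsub>D\<^esub> d"] a d by simp
        fix b assume b: "b \<in> carrier B"
        show "\<chi>d (a \<oplus>\<^bsub>B\<^esub> b) = \<chi>d a + \<chi>d b" using a b d by (simp add: \<chi>d_def CD.B.l_distr CD.B.r_distr)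
      qed
      let ?e = "single (c, d)"
      have e: "?e \<in> carrier CD.Pr" using c d by simp
      interpret T: positive_functional AB.Pr "tensor_fun \<phi>c \<chi>d"
        by unfold_locales (rule AB.pos_fun_tensor[OF \<phi>c \<chi>d])
      have id: "\<rho> (star CD.Pr ?e \<otimes>\<^bsub>CD.Pr\<^esub> (F w \<otimes>\<^bsub>CD.Pr\<^esub> ?e)) = tensor_fun \<phi>c \<chi>d w" if "w \<in> carrier AB.Pr" for w
        using that
      proof (induction rule: AB.Pr_induct)
        case zero
        then show ?case using e by simp
      next
        case (add w k a b)
        have w: "w \<in> carrier AB.Pr" and a: "a \<in> carrier A" and b: "b \<in> carrier B" using add by auto
        have "\<rho> (star CD.Pr ?e \<otimes>\<^bsub>CD.Pr\<^esub> (single (f a, g b) \<otimes>\<^bsub>CD.Pr\<^esub> ?e)) = \<phi>c a * \<chi>d b"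
          using a b c d unfolding \<phi>\<chi>(1)
          by (simp add: CD.single_star CD.single_mult tensor_fun_eq \<phi>c_def \<chi>d_def)
        moreover have "tensor_fun \<phi>c \<chi>d (single (a, b)) = \<phi>c a * \<chi>d b" by (simp add: tensor_fun_eq)
        ultimately show ?case using w a b e add.IH
          by (simp add: Fs CD.Q.l_distr CD.Q.r_distr del: CD.Q.star_mult)
      qed
      define q where "q = Re (\<phi>c \<one>\<^bsub>A\<^esub>) * Re (\<chi>d \<one>\<^bsub>B\<^esub>)"
      have q: "0 \<le> q"
      proof -
        have "0 \<le> \<phi>c (star A \<one>\<^bsub>A\<^esub> \<otimes>\<^bsub>A\<^esub> \<one>\<^bsub>A\<^esub>)" "0 \<le> \<chi>d (star B \<one>\<^bsub>B\<^esub> \<otimes>\<^bsub>B\<^esub> \<one>\<^bsub>B\<^esub>)"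
          using \<phi>c \<chi>d unfolding pos_fun_def by blast+
        then show ?thesis by (simp add: q_def less_eq_complex_def)
      qed
      have "N (F z \<otimes>\<^bsub>CD.Pr\<^esub> ?e) \<le> sqrt q * ?p z" if z: "z \<in> carrier AB.Pr" for z
      proof (rule power2_le_imp_le)
        have "complex_of_real ((N (F z \<otimes>\<^bsub>CD.Pr\<^esub> ?e))\<^sup>2) = \<rho> (star CD.Pr (F z \<otimes>\<^bsub>CD.Pr\<^esub> ?e) \<otimes>\<^bsub>CD.Pr\<^esub> (F z \<otimes>\<^bsub>CD.Pr\<^esub> ?e))"
          by (rule N_sq[symmetric]) (use z e in auto)
        also have "\<dots> = \<rho> (star CD.Pr ?e \<otimes>\<^bsub>CD.Pr\<^esub> (F (star AB.Pr z \<otimes>\<^bsub>AB.Pr\<^esub> z) \<otimes>\<^bsub>CD.Pr\<^esub> ?e))"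
          using z e by (simp add: CD.Q.m_assoc)
        also have "\<dots> = tensor_fun \<phi>c \<chi>d (star AB.Pr z \<otimes>\<^bsub>AB.Pr\<^esub> z)" by (rule id) (use z in simp)
        finally have "(N (F z \<otimes>\<^bsub>CD.Pr\<^esub> ?e))\<^sup>2 = Re (tensor_fun \<phi>c \<chi>d (star AB.Pr z \<otimes>\<^bsub>AB.Pr\<^esub> z))"
          by (metis Re_complex_of_real)
        also have "\<dots> \<le> q * (?p z)\<^sup>2" unfolding q_def by (rule AB.tensor_fun_le[OF \<phi>c \<chi>d z])
        also have "\<dots> = (sqrt q * ?p z)\<^sup>2" using q by (simp add: power_mult_distrib)
        finally show "(N (F z \<otimes>\<^bsub>CD.Pr\<^esub> ?e))\<^sup>2 \<le> (sqrt q * ?p z)\<^sup>2" .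
      qed (use q z in simp)
      then show ?thesis by blast
    qed
    \<comment> \<open>The constant K depends on the expansion of y into elementary vectors, so
      contractivity cannot be read off yet.\<close>
    have ex: "\<exists>K. \<forall>z\<in>carrier AB.Pr. N (F z \<otimes>\<^bsub>CD.Pr\<^esub> y) \<le> K * ?p z"
      using y
    proof (induction rule: CD.Pr_induct)
      case zero
      have "\<forall>z\<in>carrier AB.Pr. N (F z \<otimes>\<^bsub>CD.Pr\<^esub> \<zero>\<^bsub>CD.Pr\<^esub>) \<le> 0 * ?p z" by simp
      then show ?case by blast
    next
      case (add y k c d)
      have yc: "y \<in> carrier CD.Pr" and c: "c \<in> carrier C" and d: "d \<in> carrier D" using add by auto
      obtain K where K: "\<And>z. z \<in> carrier AB.Pr \<Longrightarrow> N (F z \<otimes>\<^bsub>CD.Pr\<^esub> y) \<le> K * ?p z" using add.IH by blast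
      obtain L where L: "\<And>z. z \<in> carrier AB.Pr \<Longrightarrow> N (F z \<otimes>\<^bsub>CD.Pr\<^esub> single (c, d)) \<le> L * ?p z" using vec[OF c d] by blast
      have "N (F z \<otimes>\<^bsub>CD.Pr\<^esub> (y \<oplus>\<^bsub>CD.Pr\<^esub> k \<odot>\<^bsub>CD.Pr\<^esub> single (c, d))) \<le> (K + cmod k * L) * ?p z" if z: "z \<in> carrier AB.Pr" for z
      proof -
        have "N (F z \<otimes>\<^bsub>CD.Pr\<^esub> (y \<oplus>\<^bsub>CD.Pr\<^esub> k \<odot>\<^bsub>CD.Pr\<^esub> single (c, d)))
            \<le> N (F z \<otimes>\<^bsub>CD.Pr\<^esub> y) + cmod k * N (F z \<otimes>\<^bsub>CD.Pr\<^esub> single (c, d))"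
          using z yc c d N_triangle[of "F z \<otimes>\<^bsub>CD.Pr\<^esub> y" "k \<odot>\<^bsub>CD.Pr\<^esub> (F z \<otimes>\<^bsub>CD.Pr\<^esub> single (c, d))"] by (simp add: CD.Q.r_distr)
        also have "\<dots> \<le> K * ?p z + cmod k * (L * ?p z)" using K[OF z] L[OF z] by (intro add_mono mult_left_mono) auto
        finally show ?thesis by (simp add: algebra_simps)
      qed
      then show ?case by blast
    qed
    then obtain K where K: "\<And>z. z \<in> carrier AB.Pr \<Longrightarrow> N (F z \<otimes>\<^bsub>CD.Pr\<^esub> y) \<le> K * ?p z" by blast
    \<comment> \<open>\<open>t k\<close> is the power of x* x with exponent 2^k. The C*-identity
      makes its norm the corresponding power of the norm of x* x, which is the growth that
      \<open>N_growth\<close> asks for.\<close>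
    define t where "t = rec_nat (star AB.Pr x \<otimes>\<^bsub>AB.Pr\<^esub> x) (\<lambda>_ z. z \<otimes>\<^bsub>AB.Pr\<^esub> z)"
    have t0: "t 0 = star AB.Pr x \<otimes>\<^bsub>AB.Pr\<^esub> x" and tS: "t (Suc k) = t k \<otimes>\<^bsub>AB.Pr\<^esub> t k" for k by (simp_all add: t_def)
    have tc: "t k \<in> carrier AB.Pr \<and> star AB.Pr (t k) = t k" for k by (induction k) (use x in \<open>auto simp: t0 tS\<close>)
    have pt: "?p (t k) = ((?p x)\<^sup>2) ^ (2 ^ k)" for k
    proof (induction k)
      case 0
      then show ?case using x by (simp add: t0 AB.U.p_cstar)
    next
      case (Suc k)
      have "?p (t (Suc k)) = (?p (t k))\<^sup>2" using AB.U.p_cstar[of "t k"] tc by (simp add: tS)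
      then show ?case using Suc by (simp flip: power_mult add: mult.commute)
    qed
    have "N (F (t 0) \<otimes>\<^bsub>CD.Pr\<^esub> y) \<le> (?p x)\<^sup>2 * N y"
    proof (rule N_growth[where T = "\<lambda>k. F (t k)" and C = K])
      show "star CD.Pr (F (t 0)) = F (t 0)" using tc[of 0] by (metis F.map_star)
      show "N (F (t k) \<otimes>\<^bsub>CD.Pr\<^esub> y) \<le> K * ((?p x)\<^sup>2) ^ (2 ^ k)" for k using K[of "t k"] tc by (simp add: pt)
    qed (use tc y in \<open>auto simp: tS\<close>)
    then have le: "N (F (star AB.Pr x \<otimes>\<^bsub>AB.Pr\<^esub> x) \<otimes>\<^bsub>CD.Pr\<^esub> y) \<le> (?p x)\<^sup>2 * N y" by (simp only: t0)
    show "N (F x \<otimes>\<^bsub>CD.Pr\<^esub> y) \<le> ?p x * N y"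
    proof (rule power2_le_imp_le)
      have "complex_of_real ((N (F x \<otimes>\<^bsub>CD.Pr\<^esub> y))\<^sup>2) = \<rho> (star CD.Pr (F x \<otimes>\<^bsub>CD.Pr\<^esub> y) \<otimes>\<^bsub>CD.Pr\<^esub> (F x \<otimes>\<^bsub>CD.Pr\<^esub> y))"
        by (rule N_sq[symmetric]) (use x y in auto)
      also have "\<dots> = \<rho> (star CD.Pr y \<otimes>\<^bsub>CD.Pr\<^esub> (F (star AB.Pr x \<otimes>\<^bsub>AB.Pr\<^esub> x) \<otimes>\<^bsub>CD.Pr\<^esub> y))"
        using x y by (simp add: CD.Q.m_assoc)
      finally have "(N (F x \<otimes>\<^bsub>CD.Pr\<^esub> y))\<^sup>2 = cmod (\<rho> (star CD.Pr y \<otimes>\<^bsub>CD.Pr\<^esub> (F (star AB.Pr x \<otimes>\<^bsub>AB.Pr\<^esub> x) \<otimes>\<^bsub>CD.Pr\<^esub> y)))"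
        by (metis abs_of_nonneg norm_of_real zero_le_power2)
      also have "\<dots> \<le> N y * N (F (star AB.Pr x \<otimes>\<^bsub>AB.Pr\<^esub> x) \<otimes>\<^bsub>CD.Pr\<^esub> y)"
        by (rule cauchy_schwarz) (use x y in auto)
      also have "\<dots> \<le> N y * ((?p x)\<^sup>2 * N y)" using le y by (intro mult_left_mono) auto
      finally show "(N (F x \<otimes>\<^bsub>CD.Pr\<^esub> y))\<^sup>2 \<le> (?p x * N y)\<^sup>2" by (simp add: power_mult_distrib power2_eq_square mult_ac)
    qed (use x y in simp)
  qed (use x in simp_all)
  have "\<exists>h. star_hom AB.U.C (min_tensor C D) h \<and> (\<forall>x\<in>carrier AB.Pr. h (to_completion AB.Pr ?p x) = to_completion CD.Pr (spatial_norm C D) (F x))"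
  proof (rule AB.U.completion_extend[OF CD.cstar_algebra_T star_hom_comp[OF F CD.toT.hom]])
    fix x assume x: "x \<in> carrier AB.Pr"
    have "nrm (min_tensor C D) (to_completion CD.Pr (spatial_norm C D) (F x)) = spatial_norm C D (F x)"
      unfolding min_tensor_def by (rule CD.U.nrm_to_completion[OF F.closed[OF x]])
    then show "nrm (min_tensor C D) (to_completion CD.Pr (spatial_norm C D) (F x)) \<le> ?p x" using contr[OF x] by simp
  qed
  then obtain h where h: "star_hom (min_tensor A B) (min_tensor C D) h"
    "\<And>x. x \<in> carrier AB.Pr \<Longrightarrow> h (to_completion AB.Pr ?p x) = to_completion CD.Pr (spatial_norm C D) (F x)"
    unfolding min_tensor_def[of A B] by blast
  have "h (elem_tensor A B a b) = elem_tensor C D (f a) (g b)" if "a \<in> carrier A" "b \<in> carrier B" for a b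
    using h(2)[OF AB.single_closed[OF that]] Fs[OF that] by (simp add: elem_tensor_def)
  then show ?thesis using h(1) by blast
qed

lemma star_hom_restrict:
  assumes "star_algebra A" "star_hom A B f"
  shows "star_hom A B (restrict f (carrier A))"
  by (rule star_hom_cong[OF assms]) simp

lemma
  assumes A: "cstar_algebra A" and B: "cstar_algebra B" and C: "cstar_algebra C" and D: "cstar_algebra D"
    and f: "star_hom A C f" and g: "star_hom B D g"
  shows star_hom_tensor_hom: "star_hom (min_tensor A B) (min_tensor C D) (tensor_hom A B C D f g)"
    and tensor_hom_elem: "\<lbrakk>a \<in> carrier A; b \<in> carrier B\<rbrakk>
      \<Longrightarrow> tensor_hom A B C D f g (elem_tensor A B a b) = elem_tensor C D (f a) (g b)"
proof -
  interpret AB: tensor_pair A B by (simp add: tensor_pair_def A B)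
  interpret CD: tensor_pair C D by (simp add: tensor_pair_def C D)
  let ?P = "\<lambda>h. h \<in> extensional (carrier (min_tensor A B)) \<and> star_hom (min_tensor A B) (min_tensor C D) h
    \<and> (\<forall>a\<in>carrier A. \<forall>b\<in>carrier B. h (elem_tensor A B a b) = elem_tensor C D (f a) (g b))"
  obtain h where h: "star_hom (min_tensor A B) (min_tensor C D) h"
    "\<And>a b. \<lbrakk>a \<in> carrier A; b \<in> carrier B\<rbrakk> \<Longrightarrow> h (elem_tensor A B a b) = elem_tensor C D (f a) (g b)"
    using tensor_hom_ex[OF assms] by blast
  have "\<exists>!h. ?P h"
  proof (rule ex1I)
    show "?P (restrict h (carrier (min_tensor A B)))"
      using star_hom_restrict[OF AB.T.star_algebra_axioms h(1)] h(2) by simp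
    fix k assume k: "?P k"
    show "k = restrict h (carrier (min_tensor A B))"
    proof (rule extensionalityI[of _ "carrier (min_tensor A B)"])
      fix x assume x: "x \<in> carrier (min_tensor A B)"
      have "k x = h x"
        by (rule AB.T_hom_eqI[OF CD.cstar_algebra_T _ h(1) _ x]) (use k h(2) in auto)
      then show "k x = restrict h (carrier (min_tensor A B)) x" using x by simp
    qed (use k in auto)
  qed
  from theI'[OF this] have "?P (tensor_hom A B C D f g)" unfolding tensor_hom_def .
  then show "star_hom (min_tensor A B) (min_tensor C D) (tensor_hom A B C D f g)"
    and "\<lbrakk>a \<in> carrier A; b \<in> carrier B\<rbrakk>
      \<Longrightarrow> tensor_hom A B C D f g (elem_tensor A B a b) = elem_tensor C D (f a) (g b)" by auto
qed

section \<open>Matrices over a *-algebra\<close>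

definition smm :: "'l set \<Rightarrow> ('k \<Rightarrow> 'l \<Rightarrow> complex) \<Rightarrow> ('l \<Rightarrow> 'j \<Rightarrow> complex) \<Rightarrow> 'k \<Rightarrow> 'j \<Rightarrow> complex" where
  "smm L S T = (\<lambda>k j. \<Sum>l\<in>L. S k l * T l j)"

definition sid :: "'j set \<Rightarrow> 'j \<Rightarrow> 'j \<Rightarrow> complex" where
  "sid J = (\<lambda>p q. if p = q \<and> p \<in> J then 1 else 0)"

definition cadj :: "('k \<Rightarrow> 'j \<Rightarrow> complex) \<Rightarrow> 'j \<Rightarrow> 'k \<Rightarrow> complex" where
  "cadj T = (\<lambda>j k. cnj (T k j))"

text \<open>The entrywise conjugate transpose. It differs from the Hilbert space adjoint
  \<open>lstar\<close>, in which the Gram matrix takes part.\<close>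

definition madj :: "('a, 'm) star_alg_scheme \<Rightarrow> ('k \<Rightarrow> 'j \<Rightarrow> 'a) \<Rightarrow> 'j \<Rightarrow> 'k \<Rightarrow> 'a" where
  "madj D u = (\<lambda>j k. star D (u k j))"

lemma smm_assoc: "smm L (smm M S T) U = smm M S (smm L T U)"
  unfolding smm_def sum_distrib_left sum_distrib_right
  by (intro ext, subst sum.swap) (simp add: mult.assoc)

context star_algebra
begin

lemma finsum_swap:
  assumes "finite S" "finite T" "\<And>i j. \<lbrakk>i \<in> S; j \<in> T\<rbrakk> \<Longrightarrow> f i j \<in> carrier A"
  shows "(\<Oplus>i\<in>S. \<Oplus>j\<in>T. f i j) = (\<Oplus>j\<in>T. \<Oplus>i\<in>S. f i j)"
  using assms(1,3)
proof (induction S rule: finite_induct)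
  case empty
  then show ?case by (simp add: finsum_zero)
next
  case (insert s S)
  have "(\<Oplus>i\<in>insert s S. \<Oplus>j\<in>T. f i j) = (\<Oplus>j\<in>T. f s j) \<oplus> (\<Oplus>j\<in>T. \<Oplus>i\<in>S. f i j)"
    using insert by (subst finsum_insert) (auto intro!: finsum_closed)
  also have "\<dots> = (\<Oplus>j\<in>T. f s j \<oplus> (\<Oplus>i\<in>S. f i j))"
    using insert by (subst finsum_addf) (auto intro!: finsum_closed)
  also have "\<dots> = (\<Oplus>j\<in>T. \<Oplus>i\<in>insert s S. f i j)"
    using insert by (intro finsum_cong' refl) (auto simp: finsum_insert Pi_def intro!: finsum_closed)
  finally show ?case .
qed

lemma finsum_cartesian:
  assumes "finite S" "finite T" "\<And>i j. \<lbrakk>i \<in> S; j \<in> T\<rbrakk> \<Longrightarrow> f (i, j) \<in> carrier A"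
  shows "(\<Oplus>x\<in>S \<times> T. f x) = (\<Oplus>i\<in>S. \<Oplus>j\<in>T. f (i, j))"
  using assms(1,3)
proof (induction S rule: finite_induct)
  case (insert s S)
  have eq: "insert s S \<times> T = Pair s ` T \<union> S \<times> T" by auto
  have "(\<Oplus>x\<in>insert s S \<times> T. f x) = (\<Oplus>x\<in>Pair s ` T. f x) \<oplus> (\<Oplus>x\<in>S \<times> T. f x)"
    unfolding eq using insert assms(2) by (intro finsum_Un_disjoint) auto
  also have "(\<Oplus>x\<in>Pair s ` T. f x) = (\<Oplus>j\<in>T. f (s, j))"
    using insert by (intro finsum_reindex) (auto simp: inj_on_def)
  also have "(\<Oplus>x\<in>S \<times> T. f x) = (\<Oplus>i\<in>S. \<Oplus>j\<in>T. f (i, j))" using insert by simp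
  finally show ?case using insert by (simp add: finsum_insert Pi_def finsum_closed)
qed simp

lemma finsum_neutral: "(\<And>i. i \<in> S \<Longrightarrow> f i = \<zero>) \<Longrightarrow> (\<Oplus>i\<in>S. f i) = \<zero>"
  by (rule add.finprod_one_eqI)

lemma finsum_subset:
  assumes "finite S" "T \<subseteq> S" "\<And>i. i \<in> T \<Longrightarrow> f i \<in> carrier A" "\<And>i. i \<in> S - T \<Longrightarrow> f i = \<zero>"
  shows "(\<Oplus>i\<in>S. f i) = (\<Oplus>i\<in>T. f i)"
proof -
  have "f i \<in> carrier A" if "i \<in> S" for i using assms(3,4)[of i] that by (cases "i \<in> T") auto
  then show ?thesis using assms by (intro add.finprod_mono_neutral_cong_right) auto
qed

abbreviation "mm \<equiv> lmult A"
abbreviation "sc \<equiv> lscal A"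
abbreviation "ma \<equiv> madj A"

text \<open>The condition is on all indices, not only on those of the basis: matrices are extended
  by 0, so that matrix identities are equalities of functions and can be rewritten without side
  conditions on indices.\<close>

definition closed_mat :: "('k \<Rightarrow> 'j \<Rightarrow> 'a) \<Rightarrow> bool" where
  "closed_mat u \<longleftrightarrow> (\<forall>k j. u k j \<in> carrier A)"

lemma closed_matD [simp, intro]: "closed_mat u \<Longrightarrow> u k j \<in> carrier A"
  by (simp add: closed_mat_def)

lemma closed_mat_mm [simp, intro]: "\<lbrakk>closed_mat u; closed_mat v\<rbrakk> \<Longrightarrow> closed_mat (mm L u v)"
  by (auto simp: closed_mat_def lmult_def intro!: finsum_closed)

lemma closed_mat_sc [simp, intro]: "closed_mat (sc T)"
  by (simp add: closed_mat_def lscal_def)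

lemma closed_mat_ma [simp, intro]: "closed_mat u \<Longrightarrow> closed_mat (ma u)"
  by (simp add: closed_mat_def madj_def)

lemma closed_mat_ltensor [simp, intro]: "\<lbrakk>closed_mat u; closed_mat v\<rbrakk> \<Longrightarrow> closed_mat (ltensor A u v)"
  by (auto simp: closed_mat_def ltensor_def case_prod_beta)

lemma mm_assoc:
  assumes "finite L" "finite M" "closed_mat u" "closed_mat v" "closed_mat w"
  shows "mm L (mm M u v) w = mm M u (mm L v w)"
proof (intro ext)
  fix k j
  have "mm L (mm M u v) w k j = (\<Oplus>l\<in>L. \<Oplus>m\<in>M. u k m \<otimes> (v m l \<otimes> w l j))"
    using assms by (auto simp: lmult_def finsum_ldistr m_assoc intro!: finsum_cong' finsum_closed)
  also have "\<dots> = (\<Oplus>m\<in>M. \<Oplus>l\<in>L. u k m \<otimes> (v m l \<otimes> w l j))"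
    using assms by (intro finsum_swap) auto
  also have "\<dots> = mm M u (mm L v w) k j"
    using assms by (auto simp: lmult_def finsum_rdistr intro!: finsum_cong' finsum_closed)
  finally show "mm L (mm M u v) w k j = mm M u (mm L v w) k j" .
qed

lemma ma_mm: "\<lbrakk>closed_mat u; closed_mat v\<rbrakk> \<Longrightarrow> ma (mm L u v) = mm L (ma v) (ma u)"
  by (intro ext) (auto simp: madj_def lmult_def star_finsum intro!: finsum_cong')

lemma ma_sc: "ma (sc T) = sc (cadj T)"
  by (intro ext) (simp add: madj_def lscal_def cadj_def)

lemma sc_mm: "mm L (sc S) (sc T) = sc (smm L S T)"
  by (intro ext) (simp add: lmult_def lscal_def smm_def finsum_smult mult.commute)

lemma sc_mm_entry: "closed_mat u \<Longrightarrow> mm L (sc S) u k j = (\<Oplus>l\<in>L. S k l \<odot> u l j)"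
  by (auto simp: lmult_def lscal_def intro!: finsum_cong')

lemma mm_sc_entry: "closed_mat u \<Longrightarrow> mm L u (sc S) k j = (\<Oplus>l\<in>L. S l j \<odot> u k l)"
  by (auto simp: lmult_def lscal_def intro!: finsum_cong')

lemma mm_sid_left:
  assumes J: "finite J" and u: "closed_mat u" "\<And>p q. p \<notin> J \<Longrightarrow> u p q = \<zero>"
  shows "mm J (sc (sid J)) u = u"
proof (intro ext)
  fix p q
  show "mm J (sc (sid J)) u p q = u p q"
  proof (cases "p \<in> J")
    case True
    have "(\<Oplus>l\<in>J. sid J p l \<odot> u l q) = (\<Oplus>l\<in>{p}. sid J p l \<odot> u l q)"
      using J True u by (intro finsum_subset) (auto simp: sid_def)
    then show ?thesis using u True by (simp add: sc_mm_entry finsum_insert Pi_def) (simp add: sid_def)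
  next
    case False
    then show ?thesis using u by (simp add: sc_mm_entry sid_def)
  qed
qed

lemma mm_sid_right:
  assumes J: "finite J" and u: "closed_mat u" "\<And>p q. q \<notin> J \<Longrightarrow> u p q = \<zero>"
  shows "mm J u (sc (sid J)) = u"
proof (intro ext)
  fix p q
  show "mm J u (sc (sid J)) p q = u p q"
  proof (cases "q \<in> J")
    case True
    have "(\<Oplus>l\<in>J. sid J l q \<odot> u p l) = (\<Oplus>l\<in>{q}. sid J l q \<odot> u p l)"
      using J True u by (intro finsum_subset) (auto simp: sid_def)
    then show ?thesis using u True by (simp add: mm_sc_entry finsum_insert Pi_def) (simp add: sid_def)
  next
    case False
    then have "(\<Oplus>l\<in>J. sid J l q \<odot> u p l) = \<zero>" using u by (intro finsum_neutral) (auto simp: sid_def)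
    then show ?thesis using u False by (simp add: mm_sc_entry)
  qed
qed

lemma mm_zero_left: "\<lbrakk>closed_mat v; \<And>l. l \<in> L \<Longrightarrow> u k l = \<zero>\<rbrakk> \<Longrightarrow> mm L u v k j = \<zero>"
  by (auto simp: lmult_def intro!: finsum_neutral)

lemma mm_zero_right: "\<lbrakk>closed_mat u; \<And>l. l \<in> L \<Longrightarrow> v l j = \<zero>\<rbrakk> \<Longrightarrow> mm L u v k j = \<zero>"
  by (auto simp: lmult_def intro!: finsum_neutral)

lemma mm_subset:
  assumes "finite J" "L \<subseteq> J" "closed_mat u" "closed_mat v"
    and "\<And>l. l \<in> J - L \<Longrightarrow> u k l = \<zero> \<or> v l j = \<zero>"
  shows "mm J u v k j = mm L u v k j"
proof -
  have "u k l \<otimes> v l j = \<zero>" if "l \<in> J - L" for l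
    using assms(5)[OF that] assms(3,4) by (elim disjE) simp_all
  then show ?thesis unfolding lmult_def using assms(1-4) by (intro finsum_subset) auto
qed

text \<open>Moving u' past v is what needs the commutation. It holds when the two kinds of entries
  sit in different legs of a tensor product, as for the factors of a comultiplication.\<close>

lemma ltensor_mm:
  assumes J: "finite J" and c: "closed_mat u" "closed_mat v" "closed_mat u'" "closed_mat v'"
    and comm: "\<And>p q r s. v p q \<otimes> u' r s = u' r s \<otimes> v p q"
  shows "ltensor A (mm J u v) (mm J u' v') = mm (J \<times> J) (ltensor A u u') (ltensor A v v')"
proof (intro ext)
  fix x y :: "'b \<times> 'b"
  obtain p p' q q' where xy: "x = (p, p')" "y = (q, q')" by (cases x, cases y)
  have "ltensor A (mm J u v) (mm J u' v') x y = (\<Oplus>r\<in>J. u p r \<otimes> v r q) \<otimes> (\<Oplus>s\<in>J. u' p' s \<otimes> v' s q')"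
    by (simp add: ltensor_def xy lmult_def)
  also have "\<dots> = (\<Oplus>r\<in>J. (u p r \<otimes> v r q) \<otimes> (\<Oplus>s\<in>J. u' p' s \<otimes> v' s q'))"
    using J c by (intro finsum_ldistr finsum_closed) auto
  also have "\<dots> = (\<Oplus>r\<in>J. \<Oplus>s\<in>J. (u p r \<otimes> v r q) \<otimes> (u' p' s \<otimes> v' s q'))"
    using J c by (intro finsum_cong' refl finsum_rdistr Pi_I finsum_closed m_closed) auto
  also have "\<dots> = (\<Oplus>r\<in>J. \<Oplus>s\<in>J. (u p r \<otimes> u' p' s) \<otimes> (v r q \<otimes> v' s q'))"
  proof (intro finsum_cong' refl Pi_I finsum_closed)
    fix r s
    have "(u p r \<otimes> v r q) \<otimes> (u' p' s \<otimes> v' s q') = u p r \<otimes> ((v r q \<otimes> u' p' s) \<otimes> v' s q')"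
      using c by (simp add: m_assoc)
    also have "\<dots> = (u p r \<otimes> u' p' s) \<otimes> (v r q \<otimes> v' s q')"
      using c by (simp add: comm) (simp add: m_assoc)
    finally show "(u p r \<otimes> v r q) \<otimes> (u' p' s \<otimes> v' s q') = (u p r \<otimes> u' p' s) \<otimes> (v r q \<otimes> v' s q')" .
  qed (use c in auto)
  also have "\<dots> = mm (J \<times> J) (ltensor A u u') (ltensor A v v') x y"
    unfolding lmult_def using J c by (subst finsum_cartesian) (auto simp: ltensor_def xy)
  finally show "ltensor A (mm J u v) (mm J u' v') x y = mm (J \<times> J) (ltensor A u u') (ltensor A v v') x y" .
qed

end

section \<open>Unitaries with respect to a Gram matrix\<close>

definition stensor :: "('j \<Rightarrow> 'j \<Rightarrow> complex) \<Rightarrow> ('k \<Rightarrow> 'k \<Rightarrow> complex) \<Rightarrow> 'j \<times> 'k \<Rightarrow> 'j \<times> 'k \<Rightarrow> complex" where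
  "stensor S T = (\<lambda>(p, p') (q, q'). S p q * T p' q')"

text \<open>\<open>K\<close> is the matrix with entries \<open>K p q = \<langle>e\<^sub>q, e\<^sub>p\<rangle>\<close>, extended by 0. In terms of \<open>K\<close> and its
  inverse \<open>Ki\<close>, unitarity of \<open>u\<close> reads \<open>u\<^sup>* K u = K\<close> and \<open>u Ki u\<^sup>* = Ki\<close>, where \<open>u\<^sup>*\<close> is the entrywise
  conjugate transpose.\<close>

locale gram_data =
  fixes J :: "'j set" and K Ki :: "'j \<Rightarrow> 'j \<Rightarrow> complex"
  assumes fin [simp]: "finite J"
    and K0: "\<not> (p \<in> J \<and> q \<in> J) \<Longrightarrow> K p q = 0" and Ki0: "\<not> (p \<in> J \<and> q \<in> J) \<Longrightarrow> Ki p q = 0"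
    and KKi: "smm J K Ki = sid J" and KiK: "smm J Ki K = sid J"
    and psd_K: "psd_on J K" and psd_Ki: "psd_on J Ki"

definition gram_unitary ::
  "('a, 'm) star_alg_scheme \<Rightarrow> 'j set \<Rightarrow> ('j \<Rightarrow> 'j \<Rightarrow> complex) \<Rightarrow> ('j \<Rightarrow> 'j \<Rightarrow> complex) \<Rightarrow> ('j \<Rightarrow> 'j \<Rightarrow> 'a) \<Rightarrow> bool" where
  "gram_unitary D J K Ki u \<longleftrightarrow> (\<forall>p q. u p q \<in> carrier D) \<and> (\<forall>p q. \<not> (p \<in> J \<and> q \<in> J) \<longrightarrow> u p q = \<zero>\<^bsub>D\<^esub>)
     \<and> lmult D J (madj D u) (lmult D J (lscal D K) u) = lscal D K
     \<and> lmult D J u (lmult D J (lscal D Ki) (madj D u)) = lscal D Ki"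

locale gram_data_star = gram_data J K Ki + star_algebra D
  for J :: "'j set" and K Ki :: "'j \<Rightarrow> 'j \<Rightarrow> complex" and D :: "('a, 'm) star_alg_scheme" (structure)
begin

lemma gram_unitaryD:
  assumes "gram_unitary D J K Ki u"
  shows "closed_mat u" "\<And>p q. p \<notin> J \<Longrightarrow> u p q = \<zero>" "\<And>p q. q \<notin> J \<Longrightarrow> u p q = \<zero>"
    "mm J (ma u) (mm J (sc K) u) = sc K" "mm J u (mm J (sc Ki) (ma u)) = sc Ki"
  using assms by (auto simp: gram_unitary_def closed_mat_def)

lemma sc_K_Ki: "\<lbrakk>closed_mat u; \<And>p q. p \<notin> J \<Longrightarrow> u p q = \<zero>\<rbrakk> \<Longrightarrow> mm J (sc K) (mm J (sc Ki) u) = u"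
  by (subst mm_assoc[symmetric]) (simp_all add: sc_mm KKi mm_sid_left)

lemma gram_unitary_mm:
  assumes u: "gram_unitary D J K Ki u" and v: "gram_unitary D J K Ki v"
  shows "gram_unitary D J K Ki (mm J u v)"
proof -
  note U = gram_unitaryD[OF u] and V = gram_unitaryD[OF v]
  note c = U(1) V(1)
  have "mm J (ma (mm J u v)) (mm J (sc K) (mm J u v)) = mm J (ma v) (mm J (mm J (ma u) (mm J (sc K) u)) v)"
    using c by (simp add: ma_mm mm_assoc)
  then have 1: "mm J (ma (mm J u v)) (mm J (sc K) (mm J u v)) = sc K" by (simp add: U(4) V(4))
  have "mm J (mm J u v) (mm J (sc Ki) (ma (mm J u v))) = mm J u (mm J (mm J v (mm J (sc Ki) (ma v))) (ma u))"
    using c by (simp add: ma_mm mm_assoc)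
  then have 2: "mm J (mm J u v) (mm J (sc Ki) (ma (mm J u v))) = sc Ki" by (simp add: U(5) V(5))
  have "mm J u v p q = \<zero>" if "\<not> (p \<in> J \<and> q \<in> J)" for p q
    using that mm_zero_left[OF c(2), of J u p q] mm_zero_right[OF c(1), of J v q p] U(2) V(3) by blast
  then show ?thesis unfolding gram_unitary_def using 1 2 c by auto
qed

text \<open>The star reverses the factors of u_13 v_23, so the sums over the second leg can be made
  innermost. Unitarity of v collapses them to the scalar Ki q q', after which unitarity of u
  collapses the sums over the first leg.\<close>

lemma ltensor_Ki:
  assumes u: "gram_unitary D J K Ki u" and v: "gram_unitary D J K Ki v"
  shows "mm (J \<times> J) (ltensor D u v) (mm (J \<times> J) (sc (stensor Ki Ki)) (ma (ltensor D u v))) = sc (stensor Ki Ki)"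
proof (intro ext)
  fix x y :: "'j \<times> 'j"
  note U = gram_unitaryD[OF u] and V = gram_unitaryD[OF v]
  obtain p q p' q' where xy: "x = (p, q)" "y = (p', q')" by (cases x, cases y)
  have cu: "u k l \<in> carrier D" "v k l \<in> carrier D" for k l using U(1) V(1) by auto
  have V5: "(\<Oplus>q1\<in>J. v q q1 \<otimes> (\<Oplus>q2\<in>J. Ki q1 q2 \<odot> star D (v q' q2))) = Ki q q' \<odot> \<one>"
    using fun_cong[OF fun_cong[OF V(5)], of q q'] V(1)
    by (simp add: lmult_def[of D J v] sc_mm_entry) (simp add: lscal_def madj_def)
  have U5: "(\<Oplus>p1\<in>J. u p p1 \<otimes> (\<Oplus>p2\<in>J. Ki p1 p2 \<odot> star D (u p' p2))) = Ki p p' \<odot> \<one>"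
    using fun_cong[OF fun_cong[OF U(5)], of p p'] U(1)
    by (simp add: lmult_def[of D J u] sc_mm_entry) (simp add: lscal_def madj_def)
  have "mm (J \<times> J) (ltensor D u v) (mm (J \<times> J) (sc (stensor Ki Ki)) (ma (ltensor D u v))) x y
      = (\<Oplus>p1\<in>J. \<Oplus>q1\<in>J. (u p p1 \<otimes> v q q1) \<otimes>
          (\<Oplus>p2\<in>J. \<Oplus>q2\<in>J. (Ki p1 p2 * Ki q1 q2) \<odot> (star D (v q' q2) \<otimes> star D (u p' p2))))"
    unfolding lmult_def[of D "J \<times> J" "ltensor D u v"] sc_mm_entry[OF closed_mat_ma[OF closed_mat_ltensor[OF U(1) V(1)]]]
    using cu by (simp add: finsum_cartesian finsum_closed Pi_def stensor_def ltensor_def madj_def xy case_prod_beta)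
  also have "\<dots> = (\<Oplus>p1\<in>J. \<Oplus>q1\<in>J. \<Oplus>p2\<in>J. \<Oplus>q2\<in>J.
       Ki p1 p2 \<odot> (u p p1 \<otimes> (v q q1 \<otimes> (Ki q1 q2 \<odot> star D (v q' q2))) \<otimes> star D (u p' p2)))"
    using cu by (intro finsum_cong' refl)
      (auto simp: finsum_rdistr finsum_closed m_assoc mult.commute intro!: finsum_cong' finsum_closed)
  also have "\<dots> = (\<Oplus>p1\<in>J. \<Oplus>p2\<in>J. \<Oplus>q1\<in>J. \<Oplus>q2\<in>J.
       Ki p1 p2 \<odot> (u p p1 \<otimes> (v q q1 \<otimes> (Ki q1 q2 \<odot> star D (v q' q2))) \<otimes> star D (u p' p2)))"
    using cu by (intro finsum_cong' refl finsum_swap) (auto intro!: finsum_closed)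
  also have "\<dots> = (\<Oplus>p1\<in>J. \<Oplus>p2\<in>J. Ki p1 p2 \<odot> (u p p1 \<otimes>
       (\<Oplus>q1\<in>J. v q q1 \<otimes> (\<Oplus>q2\<in>J. Ki q1 q2 \<odot> star D (v q' q2))) \<otimes> star D (u p' p2)))"
    using cu by (intro finsum_cong' refl)
      (auto simp: finsum_rdistr finsum_ldistr smult_finsum finsum_closed Pi_def intro!: finsum_cong' finsum_closed)
  also have "\<dots> = (\<Oplus>p1\<in>J. \<Oplus>p2\<in>J. Ki q q' \<odot> (u p p1 \<otimes> (Ki p1 p2 \<odot> star D (u p' p2))))"
    unfolding V5 using cu by (intro finsum_cong' refl) (auto simp: mult.commute intro!: finsum_closed)
  also have "\<dots> = Ki q q' \<odot> (\<Oplus>p1\<in>J. u p p1 \<otimes> (\<Oplus>p2\<in>J. Ki p1 p2 \<odot> star D (u p' p2)))"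
    using cu by (auto simp: finsum_rdistr smult_finsum finsum_closed Pi_def intro!: finsum_cong' finsum_closed)
  also have "\<dots> = sc (stensor Ki Ki) x y"
    unfolding U5 by (simp add: xy lscal_def stensor_def mult.commute)
  finally show "mm (J \<times> J) (ltensor D u v) (mm (J \<times> J) (sc (stensor Ki Ki)) (ma (ltensor D u v))) x y
      = sc (stensor Ki Ki) x y" .
qed

text \<open>If \<open>m\<close> intertwines \<open>u \<otimes> v\<close> and \<open>w\<close>, so does its adjoint \<open>S\<close> in the other direction; hence \<open>m S\<close>
  commutes with \<open>w\<close>.\<close>

lemma mult_adjoint_commute:
  assumes u: "gram_unitary D J K Ki u" and v: "gram_unitary D J K Ki v" and w: "gram_unitary D J K Ki w"
    and m: "mm (J \<times> J) (sc m) (ltensor D u v) = mm J w (sc m)"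
    and S: "smm J (cadj m) K = smm (J \<times> J) (stensor K K) S"
    and S0: "\<And>t s. \<not> (t \<in> J \<times> J \<and> s \<in> J) \<Longrightarrow> S t s = 0"
  shows "mm J (sc (smm (J \<times> J) m S)) w = mm J w (sc (smm (J \<times> J) m S))"
proof -
  note W = gram_unitaryD[OF w]
  let ?uv = "ltensor D u v" and ?K2 = "stensor K K" and ?Ki2 = "stensor Ki Ki" and ?JJ = "J \<times> J"
  note cl = gram_unitaryD(1)[OF u] gram_unitaryD(1)[OF v] W(1)
  have cuv: "closed_mat ?uv" using cl by simp
  have fJJ: "finite ?JJ" by simp
  have m': "mm ?JJ (ma ?uv) (sc (cadj m)) = mm J (sc (cadj m)) (ma w)"
    using arg_cong[OF m, of ma] cuv cl by (simp add: ma_mm ma_sc)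
  \<comment> \<open>The chain computes (u tensor v)^* (K tensor K) S w = m^* w^* K w = m^* K = (K
    tensor K) S, where the first step uses the conjugate transpose of the intertwining
    relation.\<close>
  have "mm ?JJ (ma ?uv) (mm ?JJ (sc ?K2) (mm J (sc S) w)) = mm ?JJ (ma ?uv) (mm J (sc (smm ?JJ ?K2 S)) w)"
    using cl by (simp add: mm_assoc[symmetric] sc_mm fJJ)
  also have "\<dots> = mm ?JJ (ma ?uv) (mm J (sc (cadj m)) (mm J (sc K) w))"
    using cl by (simp add: mm_assoc[symmetric] sc_mm fJJ flip: S)
  also have "\<dots> = mm J (mm ?JJ (ma ?uv) (sc (cadj m))) (mm J (sc K) w)"
    using cl cuv by (simp add: mm_assoc fJJ)
  also have "\<dots> = mm J (sc (cadj m)) (mm J (ma w) (mm J (sc K) w))"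
    unfolding m' using cl by (simp add: mm_assoc)
  also have "\<dots> = sc (smm ?JJ ?K2 S)" unfolding W(4) by (simp add: sc_mm S)
  finally have 1: "mm ?JJ (ma ?uv) (mm ?JJ (sc ?K2) (mm J (sc S) w)) = sc (smm ?JJ ?K2 S)" .
  have Ki2K2: "smm ?JJ ?Ki2 ?K2 = sid ?JJ"
  proof (intro ext)
    fix x y :: "'j \<times> 'j"
    obtain p q p' q' where xy: "x = (p, q)" "y = (p', q')" by (cases x, cases y)
    have "smm ?JJ ?Ki2 ?K2 x y = smm J Ki K p p' * smm J Ki K q q'"
      by (simp add: smm_def stensor_def xy sum.cartesian_product sum_product case_prod_beta mult_ac)
    then show "smm ?JJ ?Ki2 ?K2 x y = sid ?JJ x y" unfolding KiK by (auto simp: sid_def xy)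
  qed
  have Ki2K2l: "mm ?JJ (sc ?Ki2) (mm ?JJ (sc ?K2) z) = z" if "closed_mat z" "\<And>p q. p \<notin> ?JJ \<Longrightarrow> z p q = \<zero>" for z :: "'j \<times> 'j \<Rightarrow> 'j \<Rightarrow> 'a"
    using that by (subst mm_assoc[symmetric]) (simp_all add: sc_mm Ki2K2 mm_sid_left fJJ)
  have z: "closed_mat (mm J (sc S) w)" "\<And>p q. p \<notin> ?JJ \<Longrightarrow> mm J (sc S) w p q = \<zero>"
    using cl S0 by (auto simp: sc_mm_entry intro!: finsum_neutral)
  have "sc S p q = \<zero>" if "p \<notin> ?JJ" for p q using S0[of p q] that by (simp add: lscal_def)
  then have KiKS: "mm ?JJ (sc ?Ki2) (mm ?JJ (sc ?K2) (sc S)) = sc S" by (intro Ki2K2l) auto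
  \<comment> \<open>Multiplying the identity just shown by u tensor v and the inverse Gram matrix on
    the left lets \<open>ltensor_Ki\<close> cancel, which leaves (u tensor v) S = S w.\<close>
  have "mm ?JJ ?uv (sc S) = mm ?JJ ?uv (mm ?JJ (sc ?Ki2) (sc (smm ?JJ ?K2 S)))"
    unfolding sc_mm[symmetric] KiKS ..
  also have "\<dots> = mm ?JJ (mm ?JJ ?uv (mm ?JJ (sc ?Ki2) (ma ?uv))) (mm ?JJ (sc ?K2) (mm J (sc S) w))"
    unfolding 1[symmetric] using cl cuv by (simp add: mm_assoc fJJ)
  also have "\<dots> = mm J (sc S) w" unfolding ltensor_Ki[OF u v] by (rule Ki2K2l[OF z])
  finally have 2: "mm ?JJ ?uv (sc S) = mm J (sc S) w" .
  have "mm J (sc (smm ?JJ m S)) w = mm ?JJ (sc m) (mm J (sc S) w)"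
    using cl by (simp add: mm_assoc fJJ flip: sc_mm)
  also have "\<dots> = mm ?JJ (mm ?JJ (sc m) ?uv) (sc S)" unfolding 2[symmetric] using cuv by (simp add: mm_assoc fJJ)
  also have "\<dots> = mm J w (sc (smm ?JJ m S))" unfolding m using cl by (simp add: mm_assoc fJJ sc_mm)
  finally show ?thesis .
qed

end

text \<open>In coordinates adapted to a decomposition K = V^* V the entries of u have real and
  imaginary parts whose squares sum to a scalar, so \<open>nrm_le_of_sum_squares\<close> bounds
  them. The bound b is chosen before D and u, which is the uniformity that
  \<open>presentation\<close> requires.\<close>

lemma (in gram_data) unitary_entries_bounded:
  "\<exists>b. \<forall>(D :: 'a cstar) u p q. cstar_algebra D \<longrightarrow> gram_unitary D J K Ki u \<longrightarrow> nrm D (u p q) \<le> b p q"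
proof -
  obtain V0 where V0: "\<And>u v. u \<in> J \<Longrightarrow> v \<in> J \<Longrightarrow> K u v = (\<Sum>k\<in>J. cnj (V0 k u) * V0 k v)"
    using psd_on_decomp[OF fin psd_K] by blast
  define V where "V k p = (if k \<in> J \<and> p \<in> J then V0 k p else 0)" for k p
  have VV: "smm J (cadj V) V = K"
  proof (intro ext)
    fix p q show "smm J (cadj V) V p q = K p q"
      using V0[of p q] K0[of p q] by (cases "p \<in> J \<and> q \<in> J") (auto simp: smm_def cadj_def V_def intro!: sum.neutral)
  qed
  have herm: "cadj Ki = Ki"
    using psd_on_hermitian[OF psd_Ki _ _ fin] Ki0 by (intro ext) (metis cadj_def complex_cnj_zero)
  \<comment> \<open>A left inverse of V.\<close>
  define W where "W = smm J Ki (cadj V)"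
  have cadj_smm: "cadj (smm J S T) = smm J (cadj T) (cadj S)" for S T :: "'j \<Rightarrow> 'j \<Rightarrow> complex"
    by (intro ext) (simp add: cadj_def smm_def mult.commute)
  have cc: "cadj (cadj V) = V" by (intro ext) (simp add: cadj_def)
  have WW: "smm J W (cadj W) = Ki"
  proof -
    have "smm J W (cadj W) = smm J Ki (smm J (smm J (cadj V) V) Ki)"
      by (simp add: W_def cadj_smm herm cc smm_assoc)
    also have "\<dots> = smm J Ki (sid J)" by (simp add: VV KKi)
    also have "\<dots> = Ki"
    proof (intro ext)
      fix p q
      have "(\<Sum>l\<in>J. Ki p l * sid J l q) = (\<Sum>l\<in>J. if l = q then Ki p q else 0)"
        by (intro sum.cong) (auto simp: sid_def)
      then show "smm J Ki (sid J) p q = Ki p q" using Ki0[of p q] by (simp add: smm_def)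
    qed
    finally show ?thesis .
  qed
  have WV: "smm J W V = sid J" by (simp add: W_def smm_assoc VV KiK)
  \<comment> \<open>The scalar matrices to which w^* w and w w^* evaluate for the transformed matrix
    w below. Their diagonals are nonnegative as values of the forms of K and Ki.\<close>
  define e1 e2 where "e1 = smm J (cadj W) (smm J K W)" and "e2 = smm J V (smm J Ki (cadj V))"
  have e: "0 \<le> e1 l l" "0 \<le> e2 l l" for l
  proof -
    have "e1 l l = (\<Sum>u\<in>J. \<Sum>v\<in>J. cnj (W u l) * W v l * K u v)"
      by (simp add: e1_def smm_def cadj_def sum_distrib_left mult_ac)
    then show "0 \<le> e1 l l" using psd_onD[OF psd_K, of "\<lambda>u. W u l"] by simp
    have "e2 l l = (\<Sum>u\<in>J. \<Sum>v\<in>J. cnj (cnj (V l u)) * cnj (V l v) * Ki u v)"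
      by (simp add: e2_def smm_def cadj_def sum_distrib_left mult_ac)
    then show "0 \<le> e2 l l" using psd_onD[OF psd_Ki, of "\<lambda>u. cnj (V l u)"] by simp
  qed
  \<comment> \<open>Half the sum of the two traces: the square sum of the self-adjoint elements h
    below is half the sum of all diagonal entries of w^* w and w w^*.\<close>
  define c where "c = Re ((\<Sum>l\<in>J. e1 l l) + (\<Sum>l\<in>J. e2 l l)) / 2"
  have "0 \<le> (\<Sum>l\<in>J. e1 l l) + (\<Sum>l\<in>J. e2 l l)" by (intro add_nonneg_nonneg sum_nonneg e)
  then have c: "0 \<le> c" "(\<Sum>l\<in>J. e1 l l) + (\<Sum>l\<in>J. e2 l l) = complex_of_real (2 * c)"
    by (auto simp: c_def less_eq_complex_def complex_eq_iff)
  define b where "b p q = (\<Sum>k\<in>J. cmod (W p k) * (\<Sum>l\<in>J. cmod (V l q) * (2 * sqrt c)))" for p q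
  have "nrm D (u p q) \<le> b p q" if D: "cstar_algebra D" and u: "gram_unitary D J K Ki u" for D :: "'a cstar" and u p q
  proof -
    interpret D: cstar_algebra D by (rule D)
    interpret gram_data_star J K Ki D by unfold_locales
    note U = gram_unitaryD[OF u]
    define w where "w = D.mm J (D.sc V) (D.mm J u (D.sc W))"
    have cw: "D.closed_mat w" using U(1) by (simp add: w_def)
    have wc [simp]: "w k l \<in> carrier D" for k l using cw by auto
    have maw: "D.ma w = D.mm J (D.sc (cadj W)) (D.mm J (D.ma u) (D.sc (cadj V)))"
      using U(1) by (simp add: w_def D.ma_mm D.ma_sc D.mm_assoc)
    have "D.mm J (D.ma w) w = D.mm J (D.sc (cadj W)) (D.mm J (D.mm J (D.ma u) (D.mm J (D.mm J (D.sc (cadj V)) (D.sc V)) u)) (D.sc W))"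
      unfolding maw unfolding w_def using U(1) by (simp add: D.mm_assoc)
    also have "\<dots> = D.sc e1" by (simp add: D.sc_mm VV U(4) e1_def)
    finally have e1: "D.mm J (D.ma w) w = D.sc e1" .
    have "D.mm J w (D.ma w) = D.mm J (D.sc V) (D.mm J (D.mm J u (D.mm J (D.mm J (D.sc W) (D.sc (cadj W))) (D.ma u))) (D.sc (cadj V)))"
      unfolding maw unfolding w_def using U(1) by (simp add: D.mm_assoc)
    also have "\<dots> = D.sc e2" by (simp add: D.sc_mm WW U(5) e2_def)
    finally have e2: "D.mm J w (D.ma w) = D.sc e2" .
    \<comment> \<open>The real part of an entry of w for s true, and minus its imaginary part for s
      false.\<close>
    define h where "h x = (case x of (k, l, s) \<Rightarrow>
        if s then (1/2) \<odot>\<^bsub>D\<^esub> (w k l \<oplus>\<^bsub>D\<^esub> star D (w k l)) else (\<i>/2) \<odot>\<^bsub>D\<^esub> (w k l \<ominus>\<^bsub>D\<^esub> star D (w k l)))" for x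
    have hc: "h x \<in> carrier D" for x by (simp add: h_def split: prod.split)
    have hs: "star D (h x) = h x" for x
      by (auto simp: h_def D.a_minus_eq D.smult_r_distr D.a_comm split: prod.split)
    have sq: "h (k, l, True) \<otimes>\<^bsub>D\<^esub> h (k, l, True) \<oplus>\<^bsub>D\<^esub> h (k, l, False) \<otimes>\<^bsub>D\<^esub> h (k, l, False)
        = (1/2) \<odot>\<^bsub>D\<^esub> (star D (w k l) \<otimes>\<^bsub>D\<^esub> w k l \<oplus>\<^bsub>D\<^esub> w k l \<otimes>\<^bsub>D\<^esub> star D (w k l))" for k l
    proof -
      let ?w = "w k l" and ?s = "star D (w k l)"
      have half: "(1/4) \<odot>\<^bsub>D\<^esub> z \<oplus>\<^bsub>D\<^esub> (1/4) \<odot>\<^bsub>D\<^esub> z = (1/2) \<odot>\<^bsub>D\<^esub> z" "(1/4) \<odot>\<^bsub>D\<^esub> z \<oplus>\<^bsub>D\<^esub> (- 1/4) \<odot>\<^bsub>D\<^esub> z = \<zero>\<^bsub>D\<^esub>" if "z \<in> carrier D" for z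
        using D.smult_l_distr[OF that, of "1/4" "1/4"] D.smult_l_distr[OF that, of "1/4" "-1/4"] that by simp_all
      have "h (k, l, True) \<otimes>\<^bsub>D\<^esub> h (k, l, True) \<oplus>\<^bsub>D\<^esub> h (k, l, False) \<otimes>\<^bsub>D\<^esub> h (k, l, False)
        = (((1/4) \<odot>\<^bsub>D\<^esub> (?w \<otimes>\<^bsub>D\<^esub> ?w) \<oplus>\<^bsub>D\<^esub> (-1/4) \<odot>\<^bsub>D\<^esub> (?w \<otimes>\<^bsub>D\<^esub> ?w)) \<oplus>\<^bsub>D\<^esub> ((1/4) \<odot>\<^bsub>D\<^esub> (?s \<otimes>\<^bsub>D\<^esub> ?s) \<oplus>\<^bsub>D\<^esub> (-1/4) \<odot>\<^bsub>D\<^esub> (?s \<otimes>\<^bsub>D\<^esub> ?s)))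
          \<oplus>\<^bsub>D\<^esub> (((1/4) \<odot>\<^bsub>D\<^esub> (?s \<otimes>\<^bsub>D\<^esub> ?w) \<oplus>\<^bsub>D\<^esub> (1/4) \<odot>\<^bsub>D\<^esub> (?s \<otimes>\<^bsub>D\<^esub> ?w)) \<oplus>\<^bsub>D\<^esub> ((1/4) \<odot>\<^bsub>D\<^esub> (?w \<otimes>\<^bsub>D\<^esub> ?s) \<oplus>\<^bsub>D\<^esub> (1/4) \<odot>\<^bsub>D\<^esub> (?w \<otimes>\<^bsub>D\<^esub> ?s)))"
        by (simp add: h_def D.a_minus_eq D.l_distr D.r_distr D.smult_r_distr D.a_ac)
      also have "\<dots> = (1/2) \<odot>\<^bsub>D\<^esub> (?s \<otimes>\<^bsub>D\<^esub> ?w \<oplus>\<^bsub>D\<^esub> ?w \<otimes>\<^bsub>D\<^esub> ?s)"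
        unfolding half[OF D.m_closed[OF wc wc]] half[OF D.m_closed[OF D.star_closed[OF wc] D.star_closed[OF wc]]]
          half[OF D.m_closed[OF D.star_closed[OF wc] wc]] half[OF D.m_closed[OF wc D.star_closed[OF wc]]]
        by (simp add: D.smult_r_distr)
      finally show ?thesis .
    qed
    have col: "(\<Oplus>\<^bsub>D\<^esub>k\<in>J. star D (w k l) \<otimes>\<^bsub>D\<^esub> w k l) = e1 l l \<odot>\<^bsub>D\<^esub> \<one>\<^bsub>D\<^esub>" for l
      using fun_cong[OF fun_cong[OF e1], of l l] by (simp add: lmult_def madj_def lscal_def)
    have row: "(\<Oplus>\<^bsub>D\<^esub>l\<in>J. w k l \<otimes>\<^bsub>D\<^esub> star D (w k l)) = e2 k k \<odot>\<^bsub>D\<^esub> \<one>\<^bsub>D\<^esub>" for k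
      using fun_cong[OF fun_cong[OF e2], of k k] by (simp add: lmult_def madj_def lscal_def)
    have fin3: "finite (J \<times> J \<times> (UNIV :: bool set))" by simp
    have "(\<Oplus>\<^bsub>D\<^esub>x\<in>J \<times> J \<times> UNIV. h x \<otimes>\<^bsub>D\<^esub> h x) = (\<Oplus>\<^bsub>D\<^esub>k\<in>J. \<Oplus>\<^bsub>D\<^esub>l\<in>J. \<Oplus>\<^bsub>D\<^esub>s\<in>UNIV. h (k, l, s) \<otimes>\<^bsub>D\<^esub> h (k, l, s))"
      using hc by (simp add: D.finsum_cartesian D.finsum_closed Pi_def)
    also have "\<dots> = (\<Oplus>\<^bsub>D\<^esub>k\<in>J. \<Oplus>\<^bsub>D\<^esub>l\<in>J. (1/2) \<odot>\<^bsub>D\<^esub> (star D (w k l) \<otimes>\<^bsub>D\<^esub> w k l) \<oplus>\<^bsub>D\<^esub> (1/2) \<odot>\<^bsub>D\<^esub> (w k l \<otimes>\<^bsub>D\<^esub> star D (w k l)))"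
    proof (intro D.finsum_cong' refl Pi_I D.finsum_closed)
      fix k l
      have "(\<Oplus>\<^bsub>D\<^esub>s\<in>UNIV. h (k, l, s) \<otimes>\<^bsub>D\<^esub> h (k, l, s)) = h (k, l, True) \<otimes>\<^bsub>D\<^esub> h (k, l, True) \<oplus>\<^bsub>D\<^esub> h (k, l, False) \<otimes>\<^bsub>D\<^esub> h (k, l, False)"
        unfolding UNIV_bool using hc by (simp add: D.finsum_insert Pi_def D.a_comm)
      then show "(\<Oplus>\<^bsub>D\<^esub>s\<in>UNIV. h (k, l, s) \<otimes>\<^bsub>D\<^esub> h (k, l, s))
          = (1/2) \<odot>\<^bsub>D\<^esub> (star D (w k l) \<otimes>\<^bsub>D\<^esub> w k l) \<oplus>\<^bsub>D\<^esub> (1/2) \<odot>\<^bsub>D\<^esub> (w k l \<otimes>\<^bsub>D\<^esub> star D (w k l))"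
        by (simp add: sq D.smult_r_distr)
    qed auto
    also have "\<dots> = (\<Oplus>\<^bsub>D\<^esub>k\<in>J. \<Oplus>\<^bsub>D\<^esub>l\<in>J. (1/2) \<odot>\<^bsub>D\<^esub> (star D (w k l) \<otimes>\<^bsub>D\<^esub> w k l))
        \<oplus>\<^bsub>D\<^esub> (\<Oplus>\<^bsub>D\<^esub>k\<in>J. \<Oplus>\<^bsub>D\<^esub>l\<in>J. (1/2) \<odot>\<^bsub>D\<^esub> (w k l \<otimes>\<^bsub>D\<^esub> star D (w k l)))"
      by (simp add: D.finsum_addf D.finsum_closed Pi_def)
    also have "(\<Oplus>\<^bsub>D\<^esub>k\<in>J. \<Oplus>\<^bsub>D\<^esub>l\<in>J. (1/2) \<odot>\<^bsub>D\<^esub> (star D (w k l) \<otimes>\<^bsub>D\<^esub> w k l)) = (1/2) \<odot>\<^bsub>D\<^esub> ((\<Sum>l\<in>J. e1 l l) \<odot>\<^bsub>D\<^esub> \<one>\<^bsub>D\<^esub>)"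
      by (subst D.finsum_swap) (simp_all add: D.smult_finsum[symmetric] Pi_def col D.finsum_closed D.finsum_smult del: D.smult_smult)
    also have "(\<Oplus>\<^bsub>D\<^esub>k\<in>J. \<Oplus>\<^bsub>D\<^esub>l\<in>J. (1/2) \<odot>\<^bsub>D\<^esub> (w k l \<otimes>\<^bsub>D\<^esub> star D (w k l))) = (1/2) \<odot>\<^bsub>D\<^esub> ((\<Sum>l\<in>J. e2 l l) \<odot>\<^bsub>D\<^esub> \<one>\<^bsub>D\<^esub>)"
      by (simp add: D.smult_finsum[symmetric] Pi_def row D.finsum_closed D.finsum_smult del: D.smult_smult)
    also have "(1/2) \<odot>\<^bsub>D\<^esub> ((\<Sum>l\<in>J. e1 l l) \<odot>\<^bsub>D\<^esub> \<one>\<^bsub>D\<^esub>) \<oplus>\<^bsub>D\<^esub> (1/2) \<odot>\<^bsub>D\<^esub> ((\<Sum>l\<in>J. e2 l l) \<odot>\<^bsub>D\<^esub> \<one>\<^bsub>D\<^esub>)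
        = (1/2) \<odot>\<^bsub>D\<^esub> (((\<Sum>l\<in>J. e1 l l) + (\<Sum>l\<in>J. e2 l l)) \<odot>\<^bsub>D\<^esub> \<one>\<^bsub>D\<^esub>)"
      by (simp only: D.smult_l_distr D.smult_r_distr D.one_closed D.smult_closed)
    also have "\<dots> = complex_of_real c \<odot>\<^bsub>D\<^esub> \<one>\<^bsub>D\<^esub>" unfolding c(2) by simp
    finally have sum: "(\<Oplus>\<^bsub>D\<^esub>x\<in>J \<times> J \<times> UNIV. h x \<otimes>\<^bsub>D\<^esub> h x) = complex_of_real c \<odot>\<^bsub>D\<^esub> \<one>\<^bsub>D\<^esub>" .
    have hn: "nrm D (h (k, l, s)) \<le> sqrt c" if "k \<in> J" "l \<in> J" for k l s
      using D.nrm_le_of_sum_squares[OF fin3 hc hs c(1) sum, of "(k, l, s)"] that by (intro real_le_rsqrt) auto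
    have wn: "nrm D (w k l) \<le> 2 * sqrt c" if kl: "k \<in> J" "l \<in> J" for k l
    proof -
      have "h (k, l, True) \<oplus>\<^bsub>D\<^esub> (-\<i>) \<odot>\<^bsub>D\<^esub> h (k, l, False)
          = ((1/2) \<odot>\<^bsub>D\<^esub> w k l \<oplus>\<^bsub>D\<^esub> (1/2) \<odot>\<^bsub>D\<^esub> w k l) \<oplus>\<^bsub>D\<^esub> ((1/2) \<odot>\<^bsub>D\<^esub> star D (w k l) \<oplus>\<^bsub>D\<^esub> (-1/2) \<odot>\<^bsub>D\<^esub> star D (w k l))"
        by (simp add: h_def D.a_minus_eq D.smult_r_distr D.a_ac)
      also have "\<dots> = w k l"
        using D.smult_l_distr[OF wc, of "1/2" "1/2" k l] D.smult_l_distr[OF D.star_closed[OF wc], of "1/2" "-1/2" k l] by simp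
      finally have "nrm D (w k l) \<le> nrm D (h (k, l, True)) + nrm D ((-\<i>) \<odot>\<^bsub>D\<^esub> h (k, l, False))"
        using D.p_triangle[OF hc[of "(k, l, True)"] D.smult_closed[OF hc[of "(k, l, False)"], of "-\<i>"]] by simp
      then show ?thesis using hn[OF kl, of True] hn[OF kl, of False] hc by simp
    qed
    have u_eq: "u = D.mm J (D.sc W) (D.mm J w (D.sc V))"
    proof -
      have "D.mm J (D.sc W) (D.mm J w (D.sc V)) = D.mm J (D.sc (sid J)) (D.mm J u (D.sc (sid J)))"
        unfolding WV[symmetric] D.sc_mm[symmetric] w_def using U(1) by (simp add: D.mm_assoc)
      also have "\<dots> = u" using U by (simp add: D.mm_sid_left D.mm_sid_right)
      finally show ?thesis by simp
    qed
    have "u p q = (\<Oplus>\<^bsub>D\<^esub>k\<in>J. W p k \<odot>\<^bsub>D\<^esub> (\<Oplus>\<^bsub>D\<^esub>l\<in>J. V l q \<odot>\<^bsub>D\<^esub> w k l))"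
      by (subst u_eq) (simp add: D.sc_mm_entry D.mm_sc_entry cw)
    also have "nrm D \<dots> \<le> (\<Sum>k\<in>J. nrm D (W p k \<odot>\<^bsub>D\<^esub> (\<Oplus>\<^bsub>D\<^esub>l\<in>J. V l q \<odot>\<^bsub>D\<^esub> w k l)))"
      by (intro D.p_finsum_le) (auto intro!: D.finsum_closed)
    also have "\<dots> \<le> b p q"
      unfolding b_def
    proof (rule sum_mono)
      fix k assume k: "k \<in> J"
      have "nrm D (\<Oplus>\<^bsub>D\<^esub>l\<in>J. V l q \<odot>\<^bsub>D\<^esub> w k l) \<le> (\<Sum>l\<in>J. nrm D (V l q \<odot>\<^bsub>D\<^esub> w k l))"
        by (intro D.p_finsum_le) auto
      also have "\<dots> \<le> (\<Sum>l\<in>J. cmod (V l q) * (2 * sqrt c))"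
        using wn[OF k] by (intro sum_mono) (simp add: mult_left_mono)
      finally have "cmod (W p k) * nrm D (\<Oplus>\<^bsub>D\<^esub>l\<in>J. V l q \<odot>\<^bsub>D\<^esub> w k l) \<le> cmod (W p k) * (\<Sum>l\<in>J. cmod (V l q) * (2 * sqrt c))"
        by (rule mult_left_mono) simp
      then show "nrm D (W p k \<odot>\<^bsub>D\<^esub> (\<Oplus>\<^bsub>D\<^esub>l\<in>J. V l q \<odot>\<^bsub>D\<^esub> w k l)) \<le> cmod (W p k) * (\<Sum>l\<in>J. cmod (V l q) * (2 * sqrt c))"
        by (simp add: D.finsum_closed)
    qed
    finally show ?thesis .
  qed
  then show ?thesis by blast
qed

section \<open>Adjoints and the Gram matrix of a finite-dimensional C*-algebra\<close>

lemma inner_h_apply_left: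
  "inner_h K (apply_h H T x) y = (\<Sum>j\<in>idx H. \<Sum>l\<in>idx K. x j * cnj (y l) * (\<Sum>k\<in>idx K. T k j * gram K k l))"
proof -
  have "inner_h K (apply_h H T x) y
      = (\<Sum>k\<in>idx K. \<Sum>l\<in>idx K. \<Sum>j\<in>idx H. x j * cnj (y l) * (T k j * gram K k l))"
    by (simp add: inner_h_def apply_h_def sum_distrib_left sum_distrib_right mult_ac)
  also have "\<dots> = (\<Sum>k\<in>idx K. \<Sum>j\<in>idx H. \<Sum>l\<in>idx K. x j * cnj (y l) * (T k j * gram K k l))"
    by (rule sum.cong[OF refl], rule sum.swap)
  also have "\<dots> = (\<Sum>j\<in>idx H. \<Sum>k\<in>idx K. \<Sum>l\<in>idx K. x j * cnj (y l) * (T k j * gram K k l))"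
    by (rule sum.swap)
  also have "\<dots> = (\<Sum>j\<in>idx H. \<Sum>l\<in>idx K. \<Sum>k\<in>idx K. x j * cnj (y l) * (T k j * gram K k l))"
    by (rule sum.cong[OF refl], rule sum.swap)
  finally show ?thesis by (simp add: sum_distrib_left)
qed

lemma inner_h_apply_right:
  "inner_h H x (apply_h K S y) = (\<Sum>j\<in>idx H. \<Sum>l\<in>idx K. x j * cnj (y l) * (\<Sum>m\<in>idx H. gram H j m * cnj (S m l)))"
proof -
  have "inner_h H x (apply_h K S y)
      = (\<Sum>j\<in>idx H. \<Sum>m\<in>idx H. \<Sum>l\<in>idx K. x j * cnj (y l) * (gram H j m * cnj (S m l)))"
    by (simp add: inner_h_def apply_h_def sum_distrib_left sum_distrib_right mult_ac cnj_sum)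
  also have "\<dots> = (\<Sum>j\<in>idx H. \<Sum>l\<in>idx K. \<Sum>m\<in>idx H. x j * cnj (y l) * (gram H j m * cnj (S m l)))"
    by (rule sum.cong[OF refl], rule sum.swap)
  finally show ?thesis by (simp add: sum_distrib_left)
qed

lemma sum_sum_delta:
  fixes F :: "'j \<Rightarrow> 'k \<Rightarrow> complex"
  assumes "finite A" "finite B" "a \<in> A" "b \<in> B"
  shows "(\<Sum>j\<in>A. \<Sum>l\<in>B. (if j = a then 1 else 0) * cnj (if l = b then 1 else 0) * F j l) = F a b"
proof -
  have "(\<Sum>j\<in>A. \<Sum>l\<in>B. (if j = a then 1 else 0) * cnj (if l = b then 1 else 0) * F j l)
      = (\<Sum>j\<in>A. if j = a then (\<Sum>l\<in>B. if l = b then F a b else 0) else 0)"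
    by (intro sum.cong refl) (auto intro!: sum.cong sum.neutral)
  also have "\<dots> = F a b" using assms by simp
  finally show ?thesis .
qed

text \<open>Invertibility of the Gram matrix of H, expressed by \<open>Gi\<close>, gives the
  uniqueness that the \<open>THE\<close> in \<open>adjoint_h\<close> needs; \<open>eq\<close> is the
  adjoint relation tested on basis vectors.\<close>

lemma adjoint_h_eqI:
  fixes H :: "'j fhilb" and K :: "'k fhilb"
  assumes fin: "finite (idx H)" "finite (idx K)"
    and inv: "\<And>p r. \<lbrakk>p \<in> idx H; r \<in> idx H\<rbrakk> \<Longrightarrow> (\<Sum>q\<in>idx H. Gi p q * gram H q r) = (if p = r then 1 else 0)"
    and S0: "\<And>j k. \<not> (j \<in> idx H \<and> k \<in> idx K) \<Longrightarrow> S j k = 0"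
    and eq: "\<And>j l. \<lbrakk>j \<in> idx H; l \<in> idx K\<rbrakk> \<Longrightarrow>
      (\<Sum>k\<in>idx K. T k j * gram K k l) = (\<Sum>m\<in>idx H. gram H j m * cnj (S m l))"
  shows "adjoint_h H K T = S"
  unfolding adjoint_h_def
proof (rule the_equality)
  show "(\<forall>j k. \<not> (j \<in> idx H \<and> k \<in> idx K) \<longrightarrow> S j k = 0)
     \<and> (\<forall>x y. inner_h K (apply_h H T x) y = inner_h H x (apply_h K S y))"
    using S0 by (auto simp: inner_h_apply_left inner_h_apply_right eq)
next
  fix S' assume S': "(\<forall>j k. \<not> (j \<in> idx H \<and> k \<in> idx K) \<longrightarrow> S' j k = 0)
     \<and> (\<forall>x y. inner_h K (apply_h H T x) y = inner_h H x (apply_h K S' y))"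
  have eq': "(\<Sum>m\<in>idx H. gram H j m * cnj (S' m l)) = (\<Sum>m\<in>idx H. gram H j m * cnj (S m l))"
    if j: "j \<in> idx H" and l: "l \<in> idx K" for j l
  proof -
    have "inner_h K (apply_h H T (\<lambda>i. if i = j then 1 else 0)) (\<lambda>i. if i = l then 1 else 0)
        = inner_h H (\<lambda>i. if i = j then 1 else 0) (apply_h K S' (\<lambda>i. if i = l then 1 else 0))"
      using S' by blast
    then show ?thesis unfolding inner_h_apply_left inner_h_apply_right sum_sum_delta[OF fin j l]
      by (simp add: eq[OF j l])
  qed
  show "S' = S"
  proof (intro ext)
    fix p l
    show "S' p l = S p l"
    proof (cases "p \<in> idx H \<and> l \<in> idx K")
      case True
      have rec: "cnj (U p l) = (\<Sum>j\<in>idx H. Gi p j * (\<Sum>m\<in>idx H. gram H j m * cnj (U m l)))" for U :: "'j \<Rightarrow> 'k \<Rightarrow> complex"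
      proof -
        have "(\<Sum>j\<in>idx H. Gi p j * (\<Sum>m\<in>idx H. gram H j m * cnj (U m l)))
            = (\<Sum>m\<in>idx H. (\<Sum>j\<in>idx H. Gi p j * gram H j m) * cnj (U m l))"
          unfolding sum_distrib_left sum_distrib_right by (subst sum.swap) (simp add: mult.assoc)
        also have "\<dots> = (\<Sum>m\<in>idx H. if p = m then cnj (U p l) else 0)"
          using True by (intro sum.cong refl) (simp add: inv)
        finally show ?thesis using True fin by simp
      qed
      have "cnj (S' p l) = cnj (S p l)" unfolding rec[of S'] rec[of S]
        using True by (intro sum.cong refl) (simp add: eq')
      then show ?thesis by simp
    qed (use S' S0 in metis)
  qed
qed

text \<open>\<open>faithful_state\<close> without the condition on the total trace, so that summands
  whose functional has not been normalised are covered too.\<close>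

definition fd_ok :: "fd_alg \<Rightarrow> bool" where
  "fd_ok B \<longleftrightarrow> finite (blocks B) \<and> (\<forall>\<alpha>\<in>blocks B. 0 < dims B \<alpha> \<and> pos_def (dims B \<alpha>) (dens B \<alpha>))"

section \<open>Positive definite matrices and their inverses\<close>

lemma pos_def_form:
  assumes Q: "Q \<in> carrier_mat n n"
  shows "(Q *\<^sub>v vec n z) \<bullet>c vec n z = (\<Sum>i<n. \<Sum>j<n. cnj (z i) * z j * Q $$ (i, j))"
proof -
  have "(Q *\<^sub>v vec n z) \<bullet>c vec n z = (\<Sum>i<n. (\<Sum>j<n. Q $$ (i, j) * z j) * cnj (z i))"
    using Q by (simp add: scalar_prod_def atLeast0LessThan)
  then show ?thesis by (simp add: sum_distrib_left sum_distrib_right mult_ac)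
qed

lemma pos_def_psd:
  assumes "pos_def n Q"
  shows "psd_on {..<n} (\<lambda>i j. Q $$ (i, j))"
  unfolding psd_on_def
proof
  fix z :: "nat \<Rightarrow> complex"
  have Q: "Q \<in> carrier_mat n n" using assms by (simp add: pos_def_def)
  show "0 \<le> (\<Sum>u<n. \<Sum>v<n. cnj (z u) * z v * Q $$ (u, v))"
  proof (cases "vec n z = 0\<^sub>v n")
    case True
    then have "z i = 0" if "i < n" for i using that by (metis index_vec index_zero_vec(1))
    then show ?thesis by (simp add: sum.neutral)
  next
    case False
    then have "0 < (Q *\<^sub>v vec n z) \<bullet>c vec n z" using assms by (simp add: pos_def_def)
    then show ?thesis unfolding pos_def_form[OF Q] by simp
  qed
qed

lemma
  assumes "pos_def n Q"
  shows mat_inv_closed: "mat_inv Q \<in> carrier_mat n n"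
    and mat_inv_right: "Q * mat_inv Q = 1\<^sub>m n" and mat_inv_left: "mat_inv Q * Q = 1\<^sub>m n"
proof -
  have Q: "Q \<in> carrier_mat n n" using assms by (simp add: pos_def_def)
  have "det Q \<noteq> 0"
  proof
    assume "det Q = 0"
    then obtain v where v: "v \<in> carrier_vec n" "v \<noteq> 0\<^sub>v n" "Q *\<^sub>v v = 0\<^sub>v n"
      using det_0_iff_vec_prod_zero[OF Q] by blast
    then have "0 < (0\<^sub>v n :: complex vec) \<bullet>c v" using assms by (metis pos_def_def)
    then show False using v by simp
  qed
  then have "Q \<in> Units (ring_mat TYPE(complex) n ())" by (rule det_non_zero_imp_unit[OF Q])
  then obtain R where R: "mat_inverse Q = Some R"
    using mat_inverse(1)[OF Q, where b = "()"] by (cases "mat_inverse Q") auto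
  from mat_inverse(2)[OF Q R] show "mat_inv Q \<in> carrier_mat n n" "Q * mat_inv Q = 1\<^sub>m n" "mat_inv Q * Q = 1\<^sub>m n"
    by (simp_all add: mat_inv_def R)
qed

lemma mat_mult_sum:
  "\<lbrakk>A \<in> carrier_mat n n; B \<in> carrier_mat n n; i < n; j < n\<rbrakk> \<Longrightarrow> (A * B) $$ (i, j) = (\<Sum>k<n. A $$ (i, k) * B $$ (k, j))"
  by (simp add: scalar_prod_def atLeast0LessThan)

text \<open>With w the image of v under the inverse of Q, the left side is the inner product of w
  with Q w.\<close>

lemma pos_def_inv_form:
  assumes Q: "pos_def n Q" and v: "v \<in> carrier_vec n"
  shows "(mat_inv Q *\<^sub>v v) \<bullet>c v = cnj ((Q *\<^sub>v (mat_inv Q *\<^sub>v v)) \<bullet>c (mat_inv Q *\<^sub>v v))"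
proof -
  have Qc: "Q \<in> carrier_mat n n" using Q by (simp add: pos_def_def)
  note Qi = mat_inv_closed[OF Q]
  let ?w = "mat_inv Q *\<^sub>v v"
  have w: "?w \<in> carrier_vec n" using Qi v by simp
  have "Q *\<^sub>v ?w = v" unfolding assoc_mult_mat_vec[OF Qc Qi v, symmetric] mat_inv_right[OF Q] using v by simp
  then have "cnj ((Q *\<^sub>v ?w) \<bullet>c ?w) = cnj (v \<bullet>c ?w)" by simp
  also have "\<dots> = u \<bullet>c v" if "u \<in> carrier_vec n" "?w = u" for u
    using v that by (simp add: scalar_prod_def cnj_sum mult.commute)
  finally show ?thesis using w by simp
qed

lemma pos_def_mat_inv:
  assumes Q: "pos_def n Q"
  shows "pos_def n (mat_inv Q)"
  unfolding pos_def_def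
proof (intro conjI ballI impI)
  show "mat_inv Q \<in> carrier_mat n n" by (rule mat_inv_closed[OF Q])
  have Qc: "Q \<in> carrier_mat n n" using Q by (simp add: pos_def_def)
  fix v :: "complex vec" assume v: "v \<in> carrier_vec n" "v \<noteq> 0\<^sub>v n"
  let ?w = "mat_inv Q *\<^sub>v v"
  have w: "?w \<in> carrier_vec n" using mat_inv_closed[OF Q] v by simp
  have Qw: "Q *\<^sub>v ?w = v"
    unfolding assoc_mult_mat_vec[OF Qc mat_inv_closed[OF Q] v(1), symmetric] mat_inv_right[OF Q] using v by simp
  have Q0: "Q *\<^sub>v 0\<^sub>v n = 0\<^sub>v n" using Qc by (intro eq_vecI) auto
  have "?w \<noteq> 0\<^sub>v n" using Qw Q0 v(2) by metis
  then have "0 < (Q *\<^sub>v ?w) \<bullet>c ?w" using Q w unfolding pos_def_def by blast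
  then show "0 < ?w \<bullet>c v" unfolding pos_def_inv_form[OF Q v(1)] by (simp add: less_complex_def)
qed

lemma pos_def_trace:
  assumes Q: "pos_def n Q" and n: "0 < n"
  shows "0 < mtrace Q"
proof -
  have Qc: "Q \<in> carrier_mat n n" using Q by (simp add: pos_def_def)
  have diag: "0 < Q $$ (i, i)" if i: "i < n" for i
  proof -
    let ?z = "\<lambda>j. if j = i then 1 else 0 :: complex"
    have "vec n ?z \<noteq> 0\<^sub>v n" using i by (metis (mono_tags, lifting) index_vec index_zero_vec(1) zero_neq_one)
    then have "0 < (Q *\<^sub>v vec n ?z) \<bullet>c vec n ?z" using Q by (simp add: pos_def_def)
    also have "\<dots> = (\<Sum>u<n. \<Sum>v<n. if u = i then (if v = i then Q $$ (i, i) else 0) else 0)"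
      unfolding pos_def_form[OF Qc] by (intro sum.cong refl) auto
    also have "\<dots> = (\<Sum>u<n. if u = i then (\<Sum>v<n. if v = i then Q $$ (i, i) else 0) else 0)"
      by (intro sum.cong refl) auto
    also have "\<dots> = Q $$ (i, i)" using i by simp
    finally show ?thesis .
  qed
  have "0 < (\<Sum>i<n. Re (Q $$ (i, i)))" using n diag by (intro sum_pos) (auto simp: less_complex_def)
  moreover have "(\<Sum>i<n. Im (Q $$ (i, i))) = 0" using diag by (intro sum.neutral) (auto simp: less_complex_def)
  ultimately show ?thesis using Qc by (simp add: mtrace_def less_complex_def)
qed

lemma mat_inv_smult:
  assumes Q: "pos_def n Q" and c: "c \<noteq> 0" and Q': "pos_def n (c \<cdot>\<^sub>m Q)"
  shows "mat_inv (c \<cdot>\<^sub>m Q) = (1 / c) \<cdot>\<^sub>m mat_inv Q"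
proof -
  have Qc: "Q \<in> carrier_mat n n" using Q by (simp add: pos_def_def)
  note Qi = mat_inv_closed[OF Q] and Qi' = mat_inv_closed[OF Q']
  have "mat_inv (c \<cdot>\<^sub>m Q) = mat_inv (c \<cdot>\<^sub>m Q) * ((c \<cdot>\<^sub>m Q) * ((1 / c) \<cdot>\<^sub>m mat_inv Q))"
  proof -
    have "(c \<cdot>\<^sub>m Q) * ((1 / c) \<cdot>\<^sub>m mat_inv Q) = (1 / c) \<cdot>\<^sub>m (c \<cdot>\<^sub>m (Q * mat_inv Q))"
      using Qc Qi by (simp add: mult_smult_assoc_mat[of Q n n] mult_smult_distrib[of "c \<cdot>\<^sub>m Q" n n])
    also have "\<dots> = 1\<^sub>m n" unfolding mat_inv_right[OF Q] using c by (intro eq_matI) auto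
    finally show ?thesis using Qi' by simp
  qed
  also have "\<dots> = (mat_inv (c \<cdot>\<^sub>m Q) * (c \<cdot>\<^sub>m Q)) * ((1 / c) \<cdot>\<^sub>m mat_inv Q)"
    using Qc Qi Qi' by (intro assoc_mult_mat[symmetric, of _ n n _ n _ n]) auto
  also have "\<dots> = (1 / c) \<cdot>\<^sub>m mat_inv Q" unfolding mat_inv_left[OF Q'] using Qi by simp
  finally show ?thesis .
qed

lemma pos_def_smult:
  assumes Q: "pos_def n Q" and c: "0 < c"
  shows "pos_def n (c \<cdot>\<^sub>m Q)"
  unfolding pos_def_def
proof (intro conjI ballI impI)
  have Qc: "Q \<in> carrier_mat n n" using Q by (simp add: pos_def_def)
  then show "c \<cdot>\<^sub>m Q \<in> carrier_mat n n" by simp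
  fix v :: "complex vec" assume v: "v \<in> carrier_vec n" "v \<noteq> 0\<^sub>v n"
  have "(c \<cdot>\<^sub>m Q *\<^sub>v v) \<bullet>c v = c * ((Q *\<^sub>v v) \<bullet>c v)"
    using Qc v by (simp add: scalar_prod_def sum_distrib_left sum_distrib_right mult_ac)
  moreover have "0 < (Q *\<^sub>v v) \<bullet>c v" using Q v by (simp add: pos_def_def)
  ultimately show "0 < (c \<cdot>\<^sub>m Q *\<^sub>v v) \<bullet>c v" using c by (auto simp: less_complex_def)
qed

section \<open>The structure matrices of B in the basis of matrix units\<close>

definition K_fd :: "fd_alg \<Rightarrow> fd_idx \<Rightarrow> fd_idx \<Rightarrow> complex" where
  "K_fd B = (\<lambda>(\<alpha>, i, j) (\<beta>, k, l). if (\<alpha>, i, j) \<in> fd_basis_idx B \<and> (\<beta>, k, l) \<in> fd_basis_idx B \<and> \<alpha> = \<beta> \<and> i = k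
     then dens B \<alpha> $$ (l, j) else 0)"

definition Ki_fd :: "fd_alg \<Rightarrow> fd_idx \<Rightarrow> fd_idx \<Rightarrow> complex" where
  "Ki_fd B = (\<lambda>(\<alpha>, i, j) (\<beta>, k, l). if (\<alpha>, i, j) \<in> fd_basis_idx B \<and> (\<beta>, k, l) \<in> fd_basis_idx B \<and> \<alpha> = \<beta> \<and> i = k
     then mat_inv (dens B \<alpha>) $$ (l, j) else 0)"

text \<open>The matrix \<open>fd_mult_map\<close> with value 0 outside the basis, as is needed for
  identities of matrices to hold as equalities of functions.\<close>

definition m_fd :: "fd_alg \<Rightarrow> fd_idx \<Rightarrow> fd_idx \<times> fd_idx \<Rightarrow> complex" where
  "m_fd B = (\<lambda>(\<gamma>, x, y) ((\<alpha>, i, k), (\<beta>, l, j)). if (\<gamma>, x, y) \<in> fd_basis_idx B \<and> (\<alpha>, i, k) \<in> fd_basis_idx B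
     \<and> (\<beta>, l, j) \<in> fd_basis_idx B \<and> \<alpha> = \<gamma> \<and> \<beta> = \<gamma> \<and> i = x \<and> k = l \<and> j = y then 1 else 0)"

text \<open>The adjoint of the multiplication: e_xy goes to the sum over k and l of (Q^-1)_lk e_xk
  tensor e_ly.\<close>

definition ms_fd :: "fd_alg \<Rightarrow> fd_idx \<times> fd_idx \<Rightarrow> fd_idx \<Rightarrow> complex" where
  "ms_fd B = (\<lambda>((\<alpha>, i, k), (\<beta>, l, j)) (\<gamma>, x, y). if (\<gamma>, x, y) \<in> fd_basis_idx B \<and> (\<alpha>, i, k) \<in> fd_basis_idx B
     \<and> (\<beta>, l, j) \<in> fd_basis_idx B \<and> \<alpha> = \<gamma> \<and> \<beta> = \<gamma> \<and> i = x \<and> j = y then mat_inv (dens B \<gamma>) $$ (l, k) else 0)"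

definition e_fd :: "fd_alg \<Rightarrow> fd_idx \<Rightarrow> unit \<Rightarrow> complex" where
  "e_fd B = (\<lambda>r _. if r \<in> fd_basis_idx B then fd_unit_map B r () else 0)"

lemma fd_basis_idx_Sigma: "fd_basis_idx B = (SIGMA \<alpha>:blocks B. {..<dims B \<alpha>} \<times> {..<dims B \<alpha>})"
  by (auto simp: fd_basis_idx_def)

lemma idx_fd_hilb [simp]: "idx (fd_hilb B) = fd_basis_idx B"
  by (simp add: fd_hilb_def)

lemma finite_fd_basis_idx: "finite (blocks B) \<Longrightarrow> finite (fd_basis_idx B)"
  unfolding fd_basis_idx_Sigma by auto

lemma fd_basis_entry: "\<lbrakk>i < dims B \<alpha>; j < dims B \<alpha>\<rbrakk> \<Longrightarrow> fd_basis B p \<alpha> $$ (i, j) = (if (\<alpha>, i, j) = p then 1 else 0)"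
  by (simp add: fd_basis_def)

lemma fd_basis_carrier: "fd_basis B p \<alpha> \<in> carrier_mat (dims B \<alpha>) (dims B \<alpha>)"
  by (simp add: fd_basis_def)

text \<open>The Gram matrix and its inverse preserve the summand and the row index of a matrix unit,
  so sums against them run over a single row.\<close>

lemma sum_fd_row:
  assumes f: "finite (blocks B)" and \<alpha>: "\<alpha> \<in> blocks B" "i < dims B \<alpha>"
    and 0: "\<And>\<beta> k l. \<lbrakk>(\<beta>, k, l) \<in> fd_basis_idx B; \<not> (\<beta> = \<alpha> \<and> k = i)\<rbrakk> \<Longrightarrow> F (\<beta>, k, l) = (0::complex)"
  shows "(\<Sum>p\<in>fd_basis_idx B. F p) = (\<Sum>c<dims B \<alpha>. F (\<alpha>, i, c))"
proof -
  have "(\<Sum>p\<in>fd_basis_idx B. F p) = (\<Sum>p\<in>(\<lambda>c. (\<alpha>, i, c)) ` {..<dims B \<alpha>}. F p)"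
  proof (rule sum.mono_neutral_right[OF finite_fd_basis_idx[OF f]])
    show "(\<lambda>c. (\<alpha>, i, c)) ` {..<dims B \<alpha>} \<subseteq> fd_basis_idx B" using \<alpha> by (auto simp: fd_basis_idx_def)
    show "\<forall>p\<in>fd_basis_idx B - (\<lambda>c. (\<alpha>, i, c)) ` {..<dims B \<alpha>}. F p = 0"
    proof
      fix p assume p: "p \<in> fd_basis_idx B - (\<lambda>c. (\<alpha>, i, c)) ` {..<dims B \<alpha>}"
      obtain \<beta> k l where [simp]: "p = (\<beta>, k, l)" by (cases p)
      show "F p = 0" using p 0[of \<beta> k l] by (auto simp: fd_basis_idx_def)
    qed
  qed
  also have "\<dots> = (\<Sum>c<dims B \<alpha>. F (\<alpha>, i, c))" by (subst sum.reindex) (auto simp: inj_on_def)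
  finally show ?thesis .
qed

text \<open>Within one summand the adjoint of e_kl times e_ij is e_lj if k = i and 0 otherwise, and
  Tr(Q e_lj) = Q_jl. The swapped arguments of \<open>K_fd\<close> make the inner product of x and y
  equal to y^* K x.\<close>

lemma gram_fd:
  assumes f: "finite (blocks B)" and Q: "\<And>\<alpha>. \<alpha> \<in> blocks B \<Longrightarrow> dens B \<alpha> \<in> carrier_mat (dims B \<alpha>) (dims B \<alpha>)"
    and p: "p \<in> fd_basis_idx B" and q: "q \<in> fd_basis_idx B"
  shows "gram (fd_hilb B) p q = K_fd B q p"
proof -
  obtain \<alpha> i j \<beta> k l where pq: "p = (\<alpha>, i, j)" "q = (\<beta>, k, l)" by (cases p, cases q)
  have tr: "mtrace (dens B \<gamma> * (mat_adjoint (fd_basis B q \<gamma>) * fd_basis B p \<gamma>))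
      = (\<Sum>a<dims B \<gamma>. \<Sum>b<dims B \<gamma>. \<Sum>c<dims B \<gamma>. if a = j \<and> b = l \<and> c = i \<and> c = k \<and> \<gamma> = \<alpha> \<and> \<gamma> = \<beta> then dens B \<gamma> $$ (a, b) else 0)"
    if \<gamma>: "\<gamma> \<in> blocks B" for \<gamma>
  proof -
    let ?n = "dims B \<gamma>" and ?X = "fd_basis B q \<gamma>" and ?Y = "fd_basis B p \<gamma>"
    have c: "?X \<in> carrier_mat ?n ?n" "?Y \<in> carrier_mat ?n ?n" "dens B \<gamma> \<in> carrier_mat ?n ?n"
      using Q \<gamma> fd_basis_carrier by auto
    have ad: "mat_adjoint ?X \<in> carrier_mat ?n ?n" using c by (simp add: mat_adjoint_def mat_of_rows_def)
    have ade: "mat_adjoint ?X $$ (b, c') = cnj (?X $$ (c', b))" if "b < ?n" "c' < ?n" for b c'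
      using that c by (simp add: mat_adjoint_def mat_of_rows_index)
    have "mtrace (dens B \<gamma> * (mat_adjoint ?X * ?Y)) = (\<Sum>a<?n. \<Sum>b<?n. \<Sum>c<?n. dens B \<gamma> $$ (a, b) * (cnj (?X $$ (c, b)) * ?Y $$ (c, a)))"
    proof -
      have d: "dim_row (dens B \<gamma> * (mat_adjoint ?X * ?Y)) = ?n" using c by simp
      show ?thesis unfolding mtrace_def d
      proof (rule sum.cong[OF refl])
        fix a assume a: "a \<in> {..<?n}"
        have "(dens B \<gamma> * (mat_adjoint ?X * ?Y)) $$ (a, a) = (\<Sum>b<?n. dens B \<gamma> $$ (a, b) * (mat_adjoint ?X * ?Y) $$ (b, a))"
          using a c ad by (intro mat_mult_sum) auto
        also have "\<dots> = (\<Sum>b<?n. dens B \<gamma> $$ (a, b) * (\<Sum>c<?n. mat_adjoint ?X $$ (b, c) * ?Y $$ (c, a)))"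
          using a c ad by (intro sum.cong refl, subst mat_mult_sum) auto
        also have "\<dots> = (\<Sum>b<?n. \<Sum>c<?n. dens B \<gamma> $$ (a, b) * (cnj (?X $$ (c, b)) * ?Y $$ (c, a)))"
          by (simp add: sum_distrib_left ade)
        finally show "(dens B \<gamma> * (mat_adjoint ?X * ?Y)) $$ (a, a) = (\<Sum>b<?n. \<Sum>c<?n. dens B \<gamma> $$ (a, b) * (cnj (?X $$ (c, b)) * ?Y $$ (c, a)))" .
      qed
    qed
    also have "\<dots> = (\<Sum>a<?n. \<Sum>b<?n. \<Sum>c<?n. if a = j \<and> b = l \<and> c = i \<and> c = k \<and> \<gamma> = \<alpha> \<and> \<gamma> = \<beta> then dens B \<gamma> $$ (a, b) else 0)"
      by (intro sum.cong refl) (auto simp: fd_basis_entry pq)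
    finally show ?thesis .
  qed
  have d3: "(\<Sum>a<n. \<Sum>b<n. \<Sum>c<n. if a = j \<and> b = l \<and> c = i \<and> c = k \<and> P then G a b else 0) = (if P \<and> i = k then G j l else (0::complex))"
    if "i < n" "j < n" "l < n" for n P and G :: "nat \<Rightarrow> nat \<Rightarrow> complex"
  proof -
    have c: "(\<Sum>c<n. if a = j \<and> b = l \<and> c = i \<and> c = k \<and> P then G a b else 0)
        = (if a = j then if b = l then if P \<and> i = k then G j l else 0 else 0 else 0)" for a b
    proof -
      have "(\<Sum>c<n. if a = j \<and> b = l \<and> c = i \<and> c = k \<and> P then G a b else 0)
          = (\<Sum>c<n. if c = i then (if a = j \<and> b = l \<and> P \<and> i = k then G j l else 0) else 0)"
        by (intro sum.cong refl) auto
      then show ?thesis using that by auto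
    qed
    have "(\<Sum>a<n. \<Sum>b<n. if a = j then if b = l then X else 0 else 0) = X" for X :: complex
    proof -
      have "(\<Sum>a<n. \<Sum>b<n. if a = j then if b = l then X else 0 else 0) = (\<Sum>a<n. if a = j then X else 0)"
        using that by (intro sum.cong refl) auto
      then show ?thesis using that by simp
    qed
    then show ?thesis unfolding c .
  qed
  have "gram (fd_hilb B) p q = (\<Sum>\<gamma>\<in>blocks B. mtrace (dens B \<gamma> * (mat_adjoint (fd_basis B q \<gamma>) * fd_basis B p \<gamma>)))"
    by (simp add: fd_hilb_def fd_state_def fd_mult_def fd_star_def)
  also have "\<dots> = (\<Sum>\<gamma>\<in>blocks B. if \<gamma> = \<alpha> then (if \<alpha> = \<beta> \<and> i = k then dens B \<alpha> $$ (j, l) else 0) else 0)"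
  proof (rule sum.cong[OF refl])
    fix \<gamma> assume \<gamma>: "\<gamma> \<in> blocks B"
    show "mtrace (dens B \<gamma> * (mat_adjoint (fd_basis B q \<gamma>) * fd_basis B p \<gamma>))
        = (if \<gamma> = \<alpha> then (if \<alpha> = \<beta> \<and> i = k then dens B \<alpha> $$ (j, l) else 0) else 0)"
    proof (cases "\<gamma> = \<alpha> \<and> \<gamma> = \<beta>")
      case True
      then show ?thesis unfolding tr[OF \<gamma>] using p q pq by (subst d3) (auto simp: fd_basis_idx_def)
    next
      case False
      then show ?thesis unfolding tr[OF \<gamma>] by (auto intro!: sum.neutral)
    qed
  qed
  also have "\<dots> = (if \<alpha> = \<beta> \<and> i = k then dens B \<alpha> $$ (j, l) else 0)"
    using f p pq by (simp add: fd_basis_idx_def)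
  also have "\<dots> = K_fd B q p" using p q by (auto simp: K_fd_def pq)
  finally show ?thesis .
qed

lemma fd_mult_map_eq:
  assumes "r \<in> fd_basis_idx B" "p \<in> fd_basis_idx B" "q \<in> fd_basis_idx B"
  shows "fd_mult_map B r (p, q) = m_fd B r (p, q)"
proof -
  obtain \<gamma> x y \<alpha> i k \<beta> l j where rpq: "r = (\<gamma>, x, y)" "p = (\<alpha>, i, k)" "q = (\<beta>, l, j)"
    by (cases r, cases p, cases q)
  have xy: "x < dims B \<gamma>" "y < dims B \<gamma>" using assms rpq by (auto simp: fd_basis_idx_def)
  have "fd_mult_map B r (p, q) = (fd_basis B p \<gamma> * fd_basis B q \<gamma>) $$ (x, y)"
    by (simp add: fd_mult_map_def fd_mult_def fd_coord_def rpq)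
  also have "\<dots> = (\<Sum>c<dims B \<gamma>. fd_basis B p \<gamma> $$ (x, c) * fd_basis B q \<gamma> $$ (c, y))"
    by (rule mat_mult_sum[OF fd_basis_carrier fd_basis_carrier xy])
  also have "\<dots> = (\<Sum>c<dims B \<gamma>. if c = k then (if \<gamma> = \<alpha> \<and> \<gamma> = \<beta> \<and> x = i \<and> k = l \<and> y = j then 1 else 0) else 0)"
    using xy by (intro sum.cong refl) (auto simp: fd_basis_entry rpq)
  also have "\<dots> = m_fd B r (p, q)" using assms by (auto simp: rpq m_fd_def fd_basis_idx_def)
  finally show ?thesis .
qed

locale fd =
  fixes B :: fd_alg
  assumes ok: "fd_ok B"
begin

abbreviation "J \<equiv> fd_basis_idx B"

lemma fin_blocks: "finite (blocks B)"
  and dims_pos: "\<alpha> \<in> blocks B \<Longrightarrow> 0 < dims B \<alpha>"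
  and pd: "\<alpha> \<in> blocks B \<Longrightarrow> pos_def (dims B \<alpha>) (dens B \<alpha>)"
  using ok by (auto simp: fd_ok_def)

lemma fin_J: "finite J"
  by (rule finite_fd_basis_idx[OF fin_blocks])

lemma dens_closed: "\<alpha> \<in> blocks B \<Longrightarrow> dens B \<alpha> \<in> carrier_mat (dims B \<alpha>) (dims B \<alpha>)"
  using pd by (simp add: pos_def_def)

lemma gram_eq: "\<lbrakk>p \<in> J; q \<in> J\<rbrakk> \<Longrightarrow> gram (fd_hilb B) p q = K_fd B q p"
  by (rule gram_fd[OF fin_blocks dens_closed])

lemma inv_sums:
  assumes \<alpha>: "\<alpha> \<in> blocks B" and ij: "i < dims B \<alpha>" "j < dims B \<alpha>"
  shows "(\<Sum>c<dims B \<alpha>. mat_inv (dens B \<alpha>) $$ (i, c) * dens B \<alpha> $$ (c, j)) = (if i = j then 1 else 0)"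
    and "(\<Sum>c<dims B \<alpha>. dens B \<alpha> $$ (i, c) * mat_inv (dens B \<alpha>) $$ (c, j)) = (if i = j then 1 else 0)"
  using mat_mult_sum[OF mat_inv_closed[OF pd[OF \<alpha>]] dens_closed[OF \<alpha>] ij]
    mat_mult_sum[OF dens_closed[OF \<alpha>] mat_inv_closed[OF pd[OF \<alpha>]] ij] ij
  by (simp_all add: mat_inv_left[OF pd[OF \<alpha>]] mat_inv_right[OF pd[OF \<alpha>]])

lemma psd_blocks:
  assumes Q: "\<And>\<alpha>. \<alpha> \<in> blocks B \<Longrightarrow> psd_on {..<dims B \<alpha>} (\<lambda>i j. Q \<alpha> $$ (i, j))"
    and X: "\<And>\<alpha> i j \<beta> k l. X (\<alpha>, i, j) (\<beta>, k, l) = (if (\<alpha>, i, j) \<in> J \<and> (\<beta>, k, l) \<in> J \<and> \<alpha> = \<beta> \<and> i = k then Q \<alpha> $$ (l, j) else 0)"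
  shows "psd_on J X"
  unfolding psd_on_def
proof
  fix z :: "fd_idx \<Rightarrow> complex"
  have "(\<Sum>u\<in>J. \<Sum>v\<in>J. cnj (z u) * z v * X u v)
      = (\<Sum>(\<alpha>, i, j)\<in>J. \<Sum>c<dims B \<alpha>. cnj (z (\<alpha>, i, j)) * z (\<alpha>, i, c) * Q \<alpha> $$ (c, j))"
  proof (intro sum.cong refl, clarify)
    fix \<alpha> i j assume u: "(\<alpha>, i, j) \<in> J"
    have "(\<Sum>v\<in>J. cnj (z (\<alpha>, i, j)) * z v * X (\<alpha>, i, j) v)
        = (\<Sum>c<dims B \<alpha>. cnj (z (\<alpha>, i, j)) * z (\<alpha>, i, c) * X (\<alpha>, i, j) (\<alpha>, i, c))"
      using u by (intro sum_fd_row[OF fin_blocks]) (auto simp: X fd_basis_idx_def)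
    also have "\<dots> = (\<Sum>c<dims B \<alpha>. cnj (z (\<alpha>, i, j)) * z (\<alpha>, i, c) * Q \<alpha> $$ (c, j))"
      using u by (intro sum.cong refl) (auto simp: X fd_basis_idx_def)
    finally show "(\<Sum>v\<in>J. cnj (z (\<alpha>, i, j)) * z v * X (\<alpha>, i, j) v)
        = (\<Sum>c<dims B \<alpha>. cnj (z (\<alpha>, i, j)) * z (\<alpha>, i, c) * Q \<alpha> $$ (c, j))" .
  qed
  also have "\<dots> = (\<Sum>\<alpha>\<in>blocks B. \<Sum>i<dims B \<alpha>. \<Sum>j<dims B \<alpha>. \<Sum>c<dims B \<alpha>. cnj (z (\<alpha>, i, j)) * z (\<alpha>, i, c) * Q \<alpha> $$ (c, j))"
  proof -
    let ?F = "\<lambda>p. \<Sum>c<dims B (fst p). cnj (z p) * z (fst p, fst (snd p), c) * Q (fst p) $$ (c, snd (snd p))"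
    have "(\<Sum>p\<in>J. ?F p) = (\<Sum>\<alpha>\<in>blocks B. \<Sum>q\<in>{..<dims B \<alpha>} \<times> {..<dims B \<alpha>}. ?F (\<alpha>, q))"
      unfolding fd_basis_idx_Sigma using sum.Sigma[OF fin_blocks, of "\<lambda>\<alpha>. {..<dims B \<alpha>} \<times> {..<dims B \<alpha>}" "\<lambda>\<alpha> q. ?F (\<alpha>, q)"]
      by (simp add: case_prod_beta)
    also have "\<dots> = (\<Sum>\<alpha>\<in>blocks B. \<Sum>i<dims B \<alpha>. \<Sum>j<dims B \<alpha>. ?F (\<alpha>, i, j))"
    proof (rule sum.cong[OF refl])
      fix \<alpha>
      show "(\<Sum>q\<in>{..<dims B \<alpha>} \<times> {..<dims B \<alpha>}. ?F (\<alpha>, q)) = (\<Sum>i<dims B \<alpha>. \<Sum>j<dims B \<alpha>. ?F (\<alpha>, i, j))"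
        unfolding sum.cartesian_product case_prod_unfold by simp
    qed
    finally show ?thesis by (simp add: case_prod_beta)
  qed
  \<comment> \<open>The blocks of X are transposes of Q, so the form at z is the form of Q at the
    complex conjugate of z.\<close>
  also have "\<dots> = (\<Sum>\<alpha>\<in>blocks B. \<Sum>i<dims B \<alpha>. \<Sum>c<dims B \<alpha>. \<Sum>j<dims B \<alpha>. cnj (cnj (z (\<alpha>, i, c))) * cnj (z (\<alpha>, i, j)) * Q \<alpha> $$ (c, j))"
    by (rule sum.cong[OF refl], rule sum.cong[OF refl], subst sum.swap) (simp add: mult_ac)
  also have "0 \<le> \<dots>" by (intro sum_nonneg psd_onD[OF Q])
  finally show "0 \<le> (\<Sum>u\<in>J. \<Sum>v\<in>J. cnj (z u) * z v * X u v)" .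
qed

lemma smm_K_row:
  assumes "(\<alpha>, i, j) \<in> J"
  shows "(\<Sum>l\<in>J. K_fd B (\<alpha>, i, j) l * F l) = (\<Sum>c<dims B \<alpha>. dens B \<alpha> $$ (c, j) * F (\<alpha>, i, c))"
    and "(\<Sum>l\<in>J. Ki_fd B (\<alpha>, i, j) l * F l) = (\<Sum>c<dims B \<alpha>. mat_inv (dens B \<alpha>) $$ (c, j) * F (\<alpha>, i, c))"
proof -
  have \<alpha>: "\<alpha> \<in> blocks B" "i < dims B \<alpha>" using assms by (auto simp: fd_basis_idx_def)
  have "(\<Sum>l\<in>J. K_fd B (\<alpha>, i, j) l * F l) = (\<Sum>c<dims B \<alpha>. K_fd B (\<alpha>, i, j) (\<alpha>, i, c) * F (\<alpha>, i, c))"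
    by (rule sum_fd_row[OF fin_blocks \<alpha>]) (auto simp: K_fd_def)
  then show "(\<Sum>l\<in>J. K_fd B (\<alpha>, i, j) l * F l) = (\<Sum>c<dims B \<alpha>. dens B \<alpha> $$ (c, j) * F (\<alpha>, i, c))"
    using assms by (auto simp: K_fd_def fd_basis_idx_def intro!: sum.cong)
  have "(\<Sum>l\<in>J. Ki_fd B (\<alpha>, i, j) l * F l) = (\<Sum>c<dims B \<alpha>. Ki_fd B (\<alpha>, i, j) (\<alpha>, i, c) * F (\<alpha>, i, c))"
    by (rule sum_fd_row[OF fin_blocks \<alpha>]) (auto simp: Ki_fd_def)
  then show "(\<Sum>l\<in>J. Ki_fd B (\<alpha>, i, j) l * F l) = (\<Sum>c<dims B \<alpha>. mat_inv (dens B \<alpha>) $$ (c, j) * F (\<alpha>, i, c))"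
    using assms by (auto simp: Ki_fd_def fd_basis_idx_def intro!: sum.cong)
qed

sublocale gram_data J "K_fd B" "Ki_fd B"
proof
  show "finite J" by (rule fin_J)
  show "\<And>p q. \<not> (p \<in> J \<and> q \<in> J) \<Longrightarrow> K_fd B p q = 0" "\<And>p q. \<not> (p \<in> J \<and> q \<in> J) \<Longrightarrow> Ki_fd B p q = 0"
    by (auto simp: K_fd_def Ki_fd_def split: prod.splits)
  show "psd_on J (K_fd B)"
    by (rule psd_blocks[where Q = "dens B"]) (use pd pos_def_psd in \<open>auto simp: K_fd_def\<close>)
  show "psd_on J (Ki_fd B)"
    by (rule psd_blocks[where Q = "\<lambda>\<alpha>. mat_inv (dens B \<alpha>)"])
      (use pd pos_def_psd pos_def_mat_inv in \<open>auto simp: Ki_fd_def\<close>)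
  show "smm J (K_fd B) (Ki_fd B) = sid J"
  proof (intro ext)
    fix p q :: fd_idx
    obtain \<alpha> i j \<beta> k l where pq: "p = (\<alpha>, i, j)" "q = (\<beta>, k, l)" by (cases p, cases q)
    show "smm J (K_fd B) (Ki_fd B) p q = sid J p q"
    proof (cases "p \<in> J")
      case True
      then have \<alpha>: "\<alpha> \<in> blocks B" "j < dims B \<alpha>" by (auto simp: pq fd_basis_idx_def)
      have "smm J (K_fd B) (Ki_fd B) p q = (\<Sum>c<dims B \<alpha>. dens B \<alpha> $$ (c, j) * Ki_fd B (\<alpha>, i, c) q)"
        using smm_K_row(1)[of \<alpha> i j "\<lambda>l. Ki_fd B l q"] True by (simp add: smm_def pq)
      also have "\<dots> = (if q \<in> J \<and> \<alpha> = \<beta> \<and> i = k then (\<Sum>c<dims B \<alpha>. mat_inv (dens B \<alpha>) $$ (l, c) * dens B \<alpha> $$ (c, j)) else 0)"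
        using True by (auto simp: Ki_fd_def pq fd_basis_idx_def mult.commute intro!: sum.cong)
      also have "\<dots> = sid J p q" using inv_sums(1)[OF \<alpha>(1) _ \<alpha>(2), of l] True by (auto simp: sid_def pq fd_basis_idx_def)
      finally show ?thesis .
    next
      case False
      then show ?thesis by (auto simp: smm_def sid_def K_fd_def pq intro!: sum.neutral split: prod.splits)
    qed
  qed
  show "smm J (Ki_fd B) (K_fd B) = sid J"
  proof (intro ext)
    fix p q :: fd_idx
    obtain \<alpha> i j \<beta> k l where pq: "p = (\<alpha>, i, j)" "q = (\<beta>, k, l)" by (cases p, cases q)
    show "smm J (Ki_fd B) (K_fd B) p q = sid J p q"
    proof (cases "p \<in> J")
      case True
      then have \<alpha>: "\<alpha> \<in> blocks B" "j < dims B \<alpha>" by (auto simp: pq fd_basis_idx_def)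
      have "smm J (Ki_fd B) (K_fd B) p q = (\<Sum>c<dims B \<alpha>. mat_inv (dens B \<alpha>) $$ (c, j) * K_fd B (\<alpha>, i, c) q)"
        using smm_K_row(2)[of \<alpha> i j "\<lambda>l. K_fd B l q"] True by (simp add: smm_def pq)
      also have "\<dots> = (if q \<in> J \<and> \<alpha> = \<beta> \<and> i = k then (\<Sum>c<dims B \<alpha>. dens B \<alpha> $$ (l, c) * mat_inv (dens B \<alpha>) $$ (c, j)) else 0)"
        using True by (auto simp: K_fd_def pq fd_basis_idx_def mult.commute intro!: sum.cong)
      also have "\<dots> = sid J p q" using inv_sums(2)[OF \<alpha>(1) _ \<alpha>(2), of l] True by (auto simp: sid_def pq fd_basis_idx_def)
      finally show ?thesis .
    next
      case False
      then show ?thesis by (auto simp: smm_def sid_def Ki_fd_def pq intro!: sum.neutral split: prod.splits)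
    qed
  qed
qed

lemma K_fd_herm: "cnj (K_fd B p q) = K_fd B q p"
  using psd_on_hermitian[OF psd_K, of p q] K0[of p q] K0[of q p] by (cases "p \<in> J \<and> q \<in> J") auto

lemma ms_fd_0: "\<not> (t \<in> J \<times> J \<and> s \<in> J) \<Longrightarrow> ms_fd B t s = 0"
  by (auto simp: ms_fd_def split: prod.splits)

text \<open>Expressed through the Gram matrix, S is the Hilbert space adjoint of m when m^* K = (K
  tensor K) S. In this form it is a hypothesis of \<open>mult_adjoint_commute\<close>.\<close>

lemma m_ms_adjoint: "smm J (cadj (m_fd B)) (K_fd B) = smm (J \<times> J) (stensor (K_fd B) (K_fd B)) (ms_fd B)"
proof (intro ext)
  fix t :: "fd_idx \<times> fd_idx" and s :: fd_idx
  obtain \<alpha> i k \<beta> l j \<gamma> x y where ts: "t = ((\<alpha>, i, k), (\<beta>, l, j))" "s = (\<gamma>, x, y)" by (cases t, cases s) auto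
  show "smm J (cadj (m_fd B)) (K_fd B) t s = smm (J \<times> J) (stensor (K_fd B) (K_fd B)) (ms_fd B) t s"
  proof (cases "t \<in> J \<times> J \<and> s \<in> J")
    case True
    then have ix: "\<alpha> \<in> blocks B" "i < dims B \<alpha>" "k < dims B \<alpha>" "\<beta> \<in> blocks B" "l < dims B \<beta>" "j < dims B \<beta>"
      "\<gamma> \<in> blocks B" "x < dims B \<gamma>" "y < dims B \<gamma>" by (auto simp: ts fd_basis_idx_def)
    have J: "(\<alpha>, i, k) \<in> J" "(\<beta>, l, j) \<in> J" "(\<gamma>, x, y) \<in> J" using True by (auto simp: ts)
    have "smm J (cadj (m_fd B)) (K_fd B) t s = (\<Sum>r\<in>J. if r = (\<alpha>, i, j) then (if \<alpha> = \<beta> \<and> k = l then K_fd B r s else 0) else 0)"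
      unfolding smm_def cadj_def by (intro sum.cong refl) (use J ix in \<open>auto simp: m_fd_def ts fd_basis_idx_def split: if_splits\<close>)
    also have "\<dots> = (if \<alpha> = \<beta> \<and> k = l \<and> \<alpha> = \<gamma> \<and> i = x then dens B \<alpha> $$ (y, j) else 0)"
      using fin_J ix by (auto simp: K_fd_def ts fd_basis_idx_def)
    finally have L: "smm J (cadj (m_fd B)) (K_fd B) t s = (if \<alpha> = \<beta> \<and> k = l \<and> \<alpha> = \<gamma> \<and> i = x then dens B \<alpha> $$ (y, j) else 0)" .
    have "smm (J \<times> J) (stensor (K_fd B) (K_fd B)) (ms_fd B) t s
        = (\<Sum>p\<in>J. K_fd B (\<alpha>, i, k) p * (\<Sum>q\<in>J. K_fd B (\<beta>, l, j) q * ms_fd B (p, q) s))"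
      by (simp add: smm_def stensor_def ts sum.cartesian_product sum_distrib_left case_prod_beta mult.assoc)
    also have "\<dots> = (\<Sum>a<dims B \<alpha>. dens B \<alpha> $$ (a, k) * (\<Sum>c<dims B \<beta>. dens B \<beta> $$ (c, j) * ms_fd B ((\<alpha>, i, a), (\<beta>, l, c)) s))"
      by (simp add: smm_K_row(1)[OF J(1)] smm_K_row(1)[OF J(2)])
    also have "\<dots> = (\<Sum>a<dims B \<alpha>. dens B \<alpha> $$ (a, k) *
        (\<Sum>c<dims B \<beta>. if c = y then (if \<alpha> = \<beta> \<and> \<alpha> = \<gamma> \<and> i = x then dens B \<alpha> $$ (y, j) * mat_inv (dens B \<alpha>) $$ (l, a) else 0) else 0))"
      by (intro sum.cong refl arg_cong2[where f = "(*)"]) (use ix in \<open>auto simp: ms_fd_def ts fd_basis_idx_def\<close>)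
    also have "\<dots> = (if \<alpha> = \<beta> \<and> \<alpha> = \<gamma> \<and> i = x then dens B \<alpha> $$ (y, j) * (\<Sum>a<dims B \<alpha>. mat_inv (dens B \<alpha>) $$ (l, a) * dens B \<alpha> $$ (a, k)) else 0)"
      using ix by (cases "\<alpha> = \<beta> \<and> \<alpha> = \<gamma> \<and> i = x") (auto simp: sum_distrib_left mult_ac intro!: sum.neutral)
    also have "\<dots> = (if \<alpha> = \<beta> \<and> k = l \<and> \<alpha> = \<gamma> \<and> i = x then dens B \<alpha> $$ (y, j) else 0)"
      using ix inv_sums(1)[of \<alpha> l k] by auto
    finally show ?thesis using L by simp
  next
    case False
    have "smm J (cadj (m_fd B)) (K_fd B) t s = 0"
      unfolding smm_def cadj_def by (rule sum.neutral) (use False in \<open>auto simp: m_fd_def K_fd_def ts\<close>)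
    moreover have "smm (J \<times> J) (stensor (K_fd B) (K_fd B)) (ms_fd B) t s = 0"
      unfolding smm_def stensor_def by (rule sum.neutral) (use False in \<open>auto simp: ms_fd_def K_fd_def ts\<close>)
    ultimately show ?thesis by simp
  qed
qed

text \<open>Applied to e_xy, m m^* gives the sum over k and l of (Q^-1)_lk e_xk e_ly. Only k = l
  contributes, and the trace of Q^-1 remains.\<close>

lemma m_ms: "smm (J \<times> J) (m_fd B) (ms_fd B) r s = (if r = s \<and> r \<in> J then mtrace (mat_inv (dens B (fst r))) else 0)"
proof -
  obtain \<gamma> x y where r: "r = (\<gamma>, x, y)" by (cases r)
  show ?thesis
  proof (cases "r \<in> J")
    case True
    then have ix: "\<gamma> \<in> blocks B" "x < dims B \<gamma>" "y < dims B \<gamma>" by (auto simp: r fd_basis_idx_def)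
    have "smm (J \<times> J) (m_fd B) (ms_fd B) r s = (\<Sum>p\<in>J. \<Sum>q\<in>J. m_fd B r (p, q) * ms_fd B (p, q) s)"
      by (simp add: smm_def sum.cartesian_product case_prod_beta)
    also have "\<dots> = (\<Sum>k<dims B \<gamma>. \<Sum>q\<in>J. m_fd B r ((\<gamma>, x, k), q) * ms_fd B ((\<gamma>, x, k), q) s)"
      by (rule sum_fd_row[OF fin_blocks ix(1,2)]) (auto simp: m_fd_def r intro!: sum.neutral)
    also have "\<dots> = (\<Sum>k<dims B \<gamma>. \<Sum>c<dims B \<gamma>. m_fd B r ((\<gamma>, x, k), (\<gamma>, k, c)) * ms_fd B ((\<gamma>, x, k), (\<gamma>, k, c)) s)"
      by (intro sum.cong refl sum_fd_row[OF fin_blocks ix(1)]) (auto simp: m_fd_def r)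
    also have "\<dots> = (\<Sum>k<dims B \<gamma>. \<Sum>c<dims B \<gamma>. if c = y then (if r = s then mat_inv (dens B \<gamma>) $$ (k, k) else 0) else 0)"
      using ix by (intro sum.cong refl) (auto simp: m_fd_def ms_fd_def r fd_basis_idx_def split: prod.splits)
    also have "\<dots> = (if r = s \<and> r \<in> J then mtrace (mat_inv (dens B (fst r))) else 0)"
      using ix True mat_inv_closed[OF pd[OF ix(1)]] by (auto simp: mtrace_def r)
    finally show ?thesis .
  next
    case False
    then show ?thesis unfolding smm_def by (auto simp: m_fd_def r intro!: sum.neutral split: prod.splits)
  qed
qed

lemma adjoint_fd_mult: "adjoint_h (tensor_h (fd_hilb B) (fd_hilb B)) (fd_hilb B) (fd_mult_map B) = ms_fd B"
\<comment> \<open>The arguments of \<open>Ki_fd\<close> are swapped because \<open>gram\<close> at p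
  and q is \<open>K_fd\<close> at q and p.\<close>
proof (rule adjoint_h_eqI[where Gi = "\<lambda>(p, q) (p', q'). Ki_fd B p' p * Ki_fd B q' q"])
  let ?H = "fd_hilb B"
  show "finite (idx (tensor_h ?H ?H))" "finite (idx ?H)" by (simp_all add: tensor_h_def fin_J)
  fix t r :: "fd_idx \<times> fd_idx" assume t: "t \<in> idx (tensor_h ?H ?H)" and r: "r \<in> idx (tensor_h ?H ?H)"
  obtain p q p' q' where tr: "t = (p, q)" "r = (p', q')" by (cases t, cases r)
  have in_J: "p \<in> J" "q \<in> J" "p' \<in> J" "q' \<in> J" using t r by (auto simp: tr tensor_h_def)
  have one: "(\<Sum>l\<in>J. Ki_fd B l p * gram ?H l p') = (if p = p' then 1 else 0)" if "p \<in> J" "p' \<in> J" for p p'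
  proof -
    have "(\<Sum>l\<in>J. Ki_fd B l p * gram ?H l p') = smm J (K_fd B) (Ki_fd B) p' p"
      unfolding smm_def using that by (intro sum.cong refl) (simp add: gram_eq)
    then show ?thesis using that by (auto simp: KKi sid_def)
  qed
  have "(\<Sum>s\<in>idx (tensor_h ?H ?H). (case t of (p, q) \<Rightarrow> \<lambda>(p', q'). Ki_fd B p' p * Ki_fd B q' q) s * gram (tensor_h ?H ?H) s r)
      = (\<Sum>l\<in>J. Ki_fd B l p * gram ?H l p') * (\<Sum>l\<in>J. Ki_fd B l q * gram ?H l q')"
    by (simp add: tensor_h_def tr sum_product sum.cartesian_product case_prod_beta mult_ac)
  then show "(\<Sum>s\<in>idx (tensor_h ?H ?H). (case t of (p, q) \<Rightarrow> \<lambda>(p', q'). Ki_fd B p' p * Ki_fd B q' q) s * gram (tensor_h ?H ?H) s r)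
      = (if t = r then 1 else 0)"
    using in_J by (simp add: one tr)
next
  let ?H = "fd_hilb B"
  fix t s assume "\<not> (t \<in> idx (tensor_h ?H ?H) \<and> s \<in> idx ?H)"
  then show "ms_fd B t s = 0" by (intro ms_fd_0) (simp add: tensor_h_def)
next
  let ?H = "fd_hilb B"
  fix t s assume t: "t \<in> idx (tensor_h ?H ?H)" and s: "s \<in> idx ?H"
  then have tJ: "t \<in> J \<times> J" "s \<in> J" by (simp_all add: tensor_h_def)
  obtain p q where tp: "t = (p, q)" by (cases t)
  have "(\<Sum>k\<in>idx ?H. fd_mult_map B k t * gram ?H k s) = (\<Sum>k\<in>J. m_fd B k t * cnj (K_fd B k s))"
    using tJ by (intro sum.cong) (auto simp: gram_eq K_fd_herm fd_mult_map_eq tp)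
  also have "\<dots> = cnj (smm J (cadj (m_fd B)) (K_fd B) t s)" by (simp add: smm_def cadj_def cnj_sum)
  also have "\<dots> = (\<Sum>u\<in>J \<times> J. cnj (stensor (K_fd B) (K_fd B) t u) * cnj (ms_fd B u s))"
    unfolding m_ms_adjoint by (simp add: smm_def cnj_sum)
  also have "\<dots> = (\<Sum>u\<in>idx (tensor_h ?H ?H). gram (tensor_h ?H ?H) t u * cnj (ms_fd B u s))"
    using tJ by (intro sum.cong) (auto simp: tensor_h_def stensor_def tp gram_eq K_fd_herm)
  finally show "(\<Sum>k\<in>idx ?H. fd_mult_map B k t * gram ?H k s) = (\<Sum>u\<in>idx (tensor_h ?H ?H). gram (tensor_h ?H ?H) t u * cnj (ms_fd B u s))" .
qed

lemma mult_coisometry: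
  assumes "\<And>\<alpha>. \<alpha> \<in> blocks B \<Longrightarrow> mtrace (mat_inv (dens B \<alpha>)) = z"
  shows "mult_coisometry_upto B z"
  unfolding mult_coisometry_upto_def Let_def adjoint_fd_mult
proof (intro ballI)
  fix r s assume r: "r \<in> idx (fd_hilb B)" and s: "s \<in> idx (fd_hilb B)"
  have "(\<Sum>t\<in>idx (tensor_h (fd_hilb B) (fd_hilb B)). fd_mult_map B r t * ms_fd B t s) = smm (J \<times> J) (m_fd B) (ms_fd B) r s"
    unfolding smm_def using r by (intro sum.cong) (auto simp: tensor_h_def fd_mult_map_eq)
  also have "\<dots> = (if r = s then z else 0)"
  proof -
    have "fst r \<in> blocks B" using r by (auto simp: fd_basis_idx_def)
    then show ?thesis using r assms[of "fst r"] unfolding m_ms by auto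
  qed
  finally show "(\<Sum>t\<in>idx (tensor_h (fd_hilb B) (fd_hilb B)). fd_mult_map B r t * ms_fd B t s) = (if r = s then z else 0)" .
qed

text \<open>The Hilbert space adjoint of T is Ki T^* K, and the conjugate transpose of E_pq is
  E_qp.\<close>

lemma adjoint_mat_unit:
  assumes p: "p \<in> J" and q: "q \<in> J"
  shows "adjoint_h (fd_hilb B) (fd_hilb B) (mat_unit_h p q) = (\<lambda>r s. Ki_fd B r q * K_fd B p s)"
proof (rule adjoint_h_eqI[where Gi = "\<lambda>p q. Ki_fd B q p"])
  let ?H = "fd_hilb B"
  show "finite (idx ?H)" by (simp add: fin_J)
  then show "finite (idx ?H)" .
  fix r s assume r: "r \<in> idx ?H" and s: "s \<in> idx ?H"
  have "(\<Sum>l\<in>idx ?H. Ki_fd B l r * gram ?H l s) = smm J (K_fd B) (Ki_fd B) s r"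
    unfolding smm_def using r s by (intro sum.cong) (auto simp: gram_eq)
  then show "(\<Sum>l\<in>idx ?H. Ki_fd B l r * gram ?H l s) = (if r = s then 1 else 0)" using r by (auto simp: KKi sid_def)
next
  let ?H = "fd_hilb B"
  fix r s assume "\<not> (r \<in> idx ?H \<and> s \<in> idx ?H)"
  then show "Ki_fd B r q * K_fd B p s = 0" using K0[of p s] Ki0[of r q] by auto
next
  let ?H = "fd_hilb B"
  fix j l assume j: "j \<in> idx ?H" and l: "l \<in> idx ?H"
  have "(\<Sum>k\<in>idx ?H. mat_unit_h p q k j * gram ?H k l) = (\<Sum>k\<in>J. if k = p then (if j = q then gram ?H p l else 0) else 0)"
    by (intro sum.cong) (auto simp: mat_unit_h_def)
  also have "\<dots> = (if j = q then K_fd B l p else 0)" using p l fin_J by (simp add: gram_eq)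
  also have "\<dots> = cnj (smm J (K_fd B) (Ki_fd B) j q * K_fd B p l)" using j q by (auto simp: KKi sid_def K_fd_herm)
  also have "\<dots> = (\<Sum>m\<in>idx ?H. gram ?H j m * cnj (Ki_fd B m q * K_fd B p l))"
    using j by (simp add: smm_def cnj_sum sum_distrib_right mult.assoc gram_eq K_fd_herm)
  finally show "(\<Sum>k\<in>idx ?H. mat_unit_h p q k j * gram ?H k l) = (\<Sum>m\<in>idx ?H. gram ?H j m * cnj (Ki_fd B m q * K_fd B p l))" .
qed

end

section \<open>The universal property of the free wreath product\<close>

text \<open>The matrix Ki c^* K is the Hilbert space adjoint of c, so the right-hand side is
  unitarity as \<open>unitary_rels\<close> expresses it. Multiplying by K from the left,
  respectively by Ki from the right, leads to the form in \<open>gram_unitary\<close>.\<close>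

lemma (in gram_data_star) gram_unitary_iff:
  assumes c: "closed_mat c" and 0: "\<And>p q. \<not> (p \<in> J \<and> q \<in> J) \<Longrightarrow> c p q = \<zero>"
  shows "gram_unitary D J K Ki c \<longleftrightarrow>
    mm J (mm J (mm J (sc Ki) (ma c)) (sc K)) c = sc (sid J) \<and> mm J c (mm J (mm J (sc Ki) (ma c)) (sc K)) = sc (sid J)"
    (is "_ \<longleftrightarrow> ?L = _ \<and> ?R = _")
proof -
  have ma0: "ma c p q = \<zero>" if "\<not> (p \<in> J \<and> q \<in> J)" for p q using 0[of q p] that by (auto simp: madj_def)
  let ?X = "mm J (ma c) (mm J (sc K) c)" and ?Y = "mm J c (mm J (sc Ki) (ma c))"
  have L: "?L = mm J (sc Ki) ?X" using c by (simp add: mm_assoc)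
  have R: "?R = mm J ?Y (sc K)" using c by (simp add: mm_assoc)
  have X0: "?X p q = \<zero>" if "p \<notin> J" for p q using c ma0 that by (intro mm_zero_left) auto
  have Y0: "?Y p q = \<zero>" if "q \<notin> J" for p q
  proof -
    have "mm J (sc Ki) (ma c) l q = \<zero>" for l using c ma0 that by (intro mm_zero_right) auto
    then show ?thesis by (rule mm_zero_right[OF c])
  qed
  have "sc K p q = \<zero>" if "q \<notin> J" for p q using K0 that by (simp add: lscal_def)
  then have KJ: "mm J (sc K) (sc (sid J)) = sc K" by (intro mm_sid_right) auto
  have "sc Ki p q = \<zero>" if "p \<notin> J" for p q using Ki0 that by (simp add: lscal_def)
  then have KiJ: "mm J (sc (sid J)) (sc Ki) = sc Ki" by (intro mm_sid_left) auto
  have 1: "?X = sc K \<longleftrightarrow> ?L = sc (sid J)"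
  proof
    assume "?X = sc K" then show "?L = sc (sid J)" unfolding L by (simp add: sc_mm KiK)
  next
    assume "?L = sc (sid J)"
    then have "mm J (sc K) (mm J (sc Ki) ?X) = mm J (sc K) (sc (sid J))" unfolding L by simp
    then show "?X = sc K" using sc_K_Ki[of ?X] X0 c KJ by simp
  qed
  have 2: "?Y = sc Ki \<longleftrightarrow> ?R = sc (sid J)"
  proof
    assume "?Y = sc Ki" then show "?R = sc (sid J)" unfolding R by (simp add: sc_mm KiK)
  next
    assume "?R = sc (sid J)"
    then have "mm J (mm J ?Y (sc K)) (sc Ki) = sc Ki" unfolding R by (simp add: KiJ)
    moreover have "mm J (mm J ?Y (sc K)) (sc Ki) = mm J ?Y (sc (sid J))" using c by (simp add: mm_assoc sc_mm KKi)
    moreover have "\<dots> = ?Y" using c Y0 by (intro mm_sid_right) auto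
    ultimately show "?Y = sc Ki" by simp
  qed
  have "gram_unitary D J K Ki c \<longleftrightarrow> ?X = sc K \<and> ?Y = sc Ki"
    using c 0 by (auto simp: gram_unitary_def closed_mat_def)
  then show ?thesis using 1 2 by simp
qed

lemma mat_eq_iff:
  assumes "\<And>r s. \<not> (r \<in> S \<and> s \<in> T) \<Longrightarrow> u r s = v r s"
  shows "(\<forall>r\<in>S. \<forall>s\<in>T. u r s = v r s) \<longleftrightarrow> u = v"
proof
  assume "\<forall>r\<in>S. \<forall>s\<in>T. u r s = v r s"
  then have "u r s = v r s" for r s using assms[of r s] by (cases "r \<in> S \<and> s \<in> T") blast+
  then show "u = v" by blast
qed simp

text \<open>A solution in D of the defining relations of the free wreath product, stated for
  matrices extended by 0. Homomorphisms from \<open>fw_alg\<close> into a C*-algebra correspond to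
  such solutions.\<close>

definition fw_family ::
  "('a, 'm) star_alg_scheme \<Rightarrow> ('g, 'n) monoid_scheme \<Rightarrow> fd_alg \<Rightarrow> ('g \<Rightarrow> fd_idx \<Rightarrow> fd_idx \<Rightarrow> 'a) \<Rightarrow> bool" where
  "fw_family D \<Gamma> B b \<longleftrightarrow>
     (\<forall>g\<in>carrier \<Gamma>. gram_unitary D (fd_basis_idx B) (K_fd B) (Ki_fd B) (b g))
     \<and> (\<forall>g\<in>carrier \<Gamma>. \<forall>h\<in>carrier \<Gamma>.
          lmult D (fd_basis_idx B \<times> fd_basis_idx B) (lscal D (m_fd B)) (ltensor D (b g) (b h))
          = lmult D (fd_basis_idx B) (b (g \<otimes>\<^bsub>\<Gamma>\<^esub> h)) (lscal D (m_fd B)))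
     \<and> lmult D (fd_basis_idx B) (b \<one>\<^bsub>\<Gamma>\<^esub>) (lscal D (e_fd B)) = lscal D (e_fd B)"

definition fw_ext :: "('a, 'm) star_alg_scheme \<Rightarrow> fd_alg \<Rightarrow> ('g \<Rightarrow> fd_idx \<Rightarrow> fd_idx \<Rightarrow> 'a) \<Rightarrow> 'g \<Rightarrow> fd_idx \<Rightarrow> fd_idx \<Rightarrow> 'a" where
  "fw_ext D B b = (\<lambda>g p q. if p \<in> fd_basis_idx B \<and> q \<in> fd_basis_idx B then b g p q else \<zero>\<^bsub>D\<^esub>)"

context star_morphism
begin

lemma map_lmult:
  assumes "\<And>l. l \<in> L \<Longrightarrow> u k l \<in> carrier A" "\<And>l. l \<in> L \<Longrightarrow> v l j \<in> carrier A"
    and "\<And>l. l \<in> L \<Longrightarrow> f (u k l) = u' k l" "\<And>l. l \<in> L \<Longrightarrow> f (v l j) = v' l j"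
  shows "f (lmult A L u v k j) = lmult B L u' v' k j"
proof -
  have "f (lmult A L u v k j) = (\<Oplus>\<^bsub>B\<^esub>l\<in>L. f (u k l \<otimes>\<^bsub>A\<^esub> v l j))"
    unfolding lmult_def by (rule map_finsum) (use assms in auto)
  also have "\<dots> = lmult B L u' v' k j" unfolding lmult_def
  proof (rule B.finsum_cong'[OF refl])
    fix l assume l: "l \<in> L"
    then show "f (u k l \<otimes>\<^bsub>A\<^esub> v l j) = u' k l \<otimes>\<^bsub>B\<^esub> v' l j" using assms by simp
  next
    show "(\<lambda>l. u' k l \<otimes>\<^bsub>B\<^esub> v' l j) \<in> L \<rightarrow> carrier B"
    proof
      fix l assume l: "l \<in> L"
      then have "u' k l \<in> carrier B" "v' l j \<in> carrier B" using assms closed by metis+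
      then show "u' k l \<otimes>\<^bsub>B\<^esub> v' l j \<in> carrier B" by simp
    qed
  qed
  finally show ?thesis .
qed

lemma map_lscal: "f (lscal A T k j) = lscal B T k j"
  by (simp add: lscal_def)

lemma map_coeff_diffs:
  assumes "\<And>k j. \<lbrakk>k \<in> K; j \<in> J\<rbrakk> \<Longrightarrow> u k j \<in> carrier A" "\<And>k j. \<lbrakk>k \<in> K; j \<in> J\<rbrakk> \<Longrightarrow> v k j \<in> carrier A"
  shows "(\<forall>r\<in>coeff_diffs A K J u v. f r = \<zero>\<^bsub>B\<^esub>) \<longleftrightarrow> (\<forall>k\<in>K. \<forall>j\<in>J. f (u k j) = f (v k j))"
proof -
  have "f (u k j \<ominus>\<^bsub>A\<^esub> v k j) = \<zero>\<^bsub>B\<^esub> \<longleftrightarrow> f (u k j) = f (v k j)" if "k \<in> K" "j \<in> J" for k j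
    using assms[OF that] by (simp add: B.diff_eq_zero_iff)
  then show ?thesis unfolding coeff_diffs_def by blast
qed

end

locale fw = fd B + \<Gamma>: Group.group \<Gamma>
  for B :: fd_alg and \<Gamma> :: "('g, 'm) monoid_scheme"
begin

abbreviation "X \<equiv> fw_gens \<Gamma> B"
abbreviation "R \<equiv> fw_rels \<Gamma> B"
abbreviation "P \<equiv> free_star_alg X"
abbreviation "a \<equiv> (\<lambda>g p q. gen (g, p, q))"
abbreviation "A \<equiv> fw_alg \<Gamma> B"

lemma a_closed: "\<lbrakk>g \<in> carrier \<Gamma>; p \<in> J; q \<in> J\<rbrakk> \<Longrightarrow> a g p q \<in> carrier P"
  by (rule gen_closed) (simp add: fw_gens_def)

lemma lstar_entry:
  assumes "r \<in> J" "s \<in> J"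
  shows "lstar P (fd_hilb B) u r s = (\<Oplus>\<^bsub>P\<^esub>pq\<in>J \<times> J. (Ki_fd B r (snd pq) * K_fd B (fst pq) s) \<odot>\<^bsub>P\<^esub> star P (u (fst pq) (snd pq)))
    \<or> (\<exists>p\<in>J. \<exists>q\<in>J. u p q \<notin> carrier P)"
proof -
  interpret P: star_algebra P by (rule star_algebra_free)
  show ?thesis
  proof (cases "\<forall>p\<in>J. \<forall>q\<in>J. u p q \<in> carrier P")
    case True
    then show ?thesis unfolding lstar_def
      by (intro disjI1) (auto simp: adjoint_mat_unit intro!: P.finsum_cong')
  qed blast
qed

lemma lstar_a:
  assumes g: "g \<in> carrier \<Gamma>" and rs: "r \<in> J" "s \<in> J"
  shows "lstar P (fd_hilb B) (a g) r s
    = (\<Oplus>\<^bsub>P\<^esub>pq\<in>J \<times> J. (Ki_fd B r (snd pq) * K_fd B (fst pq) s) \<odot>\<^bsub>P\<^esub> star P (a g (fst pq) (snd pq)))"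
  using lstar_entry[OF rs, of "a g"] a_closed[OF g] by blast

lemma lstar_closed:
  assumes g: "g \<in> carrier \<Gamma>" and rs: "r \<in> J" "s \<in> J"
  shows "lstar P (fd_hilb B) (a g) r s \<in> carrier P"
proof -
  interpret P: star_algebra P by (rule star_algebra_free)
  show ?thesis unfolding lstar_a[OF g rs] using a_closed[OF g] by (intro P.finsum_closed) auto
qed

lemma fw_rels_unfolded:
  "fw_rels \<Gamma> B = (\<Union>g\<in>carrier \<Gamma>. unitary_rels P (fd_hilb B) (a g))
     \<union> (\<Union>g\<in>carrier \<Gamma>. \<Union>h\<in>carrier \<Gamma>.
          hom_rels P (J \<times> J) J (ltensor P (a g) (a h)) (a (g \<otimes>\<^bsub>\<Gamma>\<^esub> h)) (fd_mult_map B))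
     \<union> hom_rels P {()} J (lone P) (a \<one>\<^bsub>\<Gamma>\<^esub>) (fd_unit_map B)"
  by (simp add: fw_rels_def Let_def)

lemma rel_terms_closed:
  assumes g: "g \<in> carrier \<Gamma>" and h: "h \<in> carrier \<Gamma>" and r: "r \<in> J"
  shows "s \<in> J \<Longrightarrow> lmult P J (lstar P (fd_hilb B) (a g)) (a g) r s \<in> carrier P"
    and "s \<in> J \<Longrightarrow> lmult P J (a g) (lstar P (fd_hilb B) (a g)) r s \<in> carrier P"
    and "t \<in> J \<times> J \<Longrightarrow> lmult P (J \<times> J) (lscal P (fd_mult_map B)) (ltensor P (a g) (a h)) r t \<in> carrier P"
    and "lmult P J (a g) (lscal P T) r t' \<in> carrier P"
    and "lmult P {()} (lscal P (fd_unit_map B)) (lone P) r () \<in> carrier P"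
    and "lone P r' s' \<in> carrier P"
proof -
  interpret P: star_algebra P by (rule star_algebra_free)
  note c = a_closed[OF g] a_closed[OF h] lstar_closed[OF g]
  show "s \<in> J \<Longrightarrow> lmult P J (lstar P (fd_hilb B) (a g)) (a g) r s \<in> carrier P"
    "s \<in> J \<Longrightarrow> lmult P J (a g) (lstar P (fd_hilb B) (a g)) r s \<in> carrier P"
    "t \<in> J \<times> J \<Longrightarrow> lmult P (J \<times> J) (lscal P (fd_mult_map B)) (ltensor P (a g) (a h)) r t \<in> carrier P"
    "lmult P J (a g) (lscal P T) r t' \<in> carrier P"
    "lmult P {()} (lscal P (fd_unit_map B)) (lone P) r () \<in> carrier P" "lone P r' s' \<in> carrier P"
    using c r by (auto simp: lmult_def ltensor_def lscal_def lone_def intro!: P.finsum_closed P.m_closed)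
qed

lemma rels_closed: "R \<subseteq> carrier P"
proof -
  interpret P: star_algebra P by (rule star_algebra_free)
  have cd: "coeff_diffs P K L u v \<subseteq> carrier P"
    if "\<And>k j. \<lbrakk>k \<in> K; j \<in> L\<rbrakk> \<Longrightarrow> u k j \<in> carrier P" "\<And>k j. \<lbrakk>k \<in> K; j \<in> L\<rbrakk> \<Longrightarrow> v k j \<in> carrier P"
    for K :: "'k set" and L :: "'l set" and u v
    using that by (auto simp: coeff_diffs_def)
  note c = rel_terms_closed
  show ?thesis unfolding fw_rels_unfolded
  proof (intro Un_least UN_least)
    fix g h assume g: "g \<in> carrier \<Gamma>" and h: "h \<in> carrier \<Gamma>"
    show "unitary_rels P (fd_hilb B) (a g) \<subseteq> carrier P"
      unfolding unitary_rels_def idx_fd_hilb by (intro Un_least cd c[OF g g])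
    show "hom_rels P (J \<times> J) J (ltensor P (a g) (a h)) (a (g \<otimes>\<^bsub>\<Gamma>\<^esub> h)) (fd_mult_map B) \<subseteq> carrier P"
      unfolding hom_rels_def using g h by (intro cd c(3)[OF g h] c(4)[of "g \<otimes>\<^bsub>\<Gamma>\<^esub> h" g]) auto
  next
    show "hom_rels P {()} J (lone P) (a \<one>\<^bsub>\<Gamma>\<^esub>) (fd_unit_map B) \<subseteq> carrier P"
      unfolding hom_rels_def by (intro cd) (auto intro: c(5)[OF \<Gamma>.one_closed \<Gamma>.one_closed] c(4)[OF \<Gamma>.one_closed \<Gamma>.one_closed])
  qed
qed

text \<open>This translates between relators in the free algebra and matrix identities in D.
  Relators concern only indices in the basis; outside it the extension by 0 makes both sides of each
  identity vanish, so the identities can be stated for whole functions.\<close>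

lemma fw_rels_hom:
  assumes D: "star_algebra D" and f: "star_hom P D f"
  shows "(\<forall>r\<in>R. f r = \<zero>\<^bsub>D\<^esub>) \<longleftrightarrow> fw_family D \<Gamma> B (fw_ext D B (\<lambda>g p q. f (gen (g, p, q))))"
proof -
  interpret D: star_algebra D by (rule D)
  interpret G: gram_data_star J "K_fd B" "Ki_fd B" D by unfold_locales
  interpret f: star_morphism P D f by (rule star_morphism.intro[OF star_algebra_free D]) (unfold_locales, rule f)
  define c where "c = fw_ext D B (\<lambda>g p q. f (gen (g, p, q)))"
  have fa: "f (a g p q) = c g p q" if "p \<in> J" "q \<in> J" for g p q using that by (simp add: c_def fw_ext_def)
  have cc: "D.closed_mat (c g)" if "g \<in> carrier \<Gamma>" for g
    using a_closed[OF that] by (auto simp: D.closed_mat_def c_def fw_ext_def)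
  have c0: "c g p q = \<zero>\<^bsub>D\<^esub>" if "\<not> (p \<in> J \<and> q \<in> J)" for g p q using that by (auto simp: c_def fw_ext_def)
  note tc = rel_terms_closed
  \<comment> \<open>The Hilbert space adjoint of c g, onto which f maps the coefficients of
    \<open>lstar\<close>.\<close>
  define us where "us g = D.mm J (D.mm J (D.sc (Ki_fd B)) (D.ma (c g))) (D.sc (K_fd B))" for g
  have usc: "D.closed_mat (us g)" if "g \<in> carrier \<Gamma>" for g using cc[OF that] by (simp add: us_def)
  have sck: "D.sc (K_fd B) p q = \<zero>\<^bsub>D\<^esub>" "D.sc (Ki_fd B) p q = \<zero>\<^bsub>D\<^esub>" if "\<not> (p \<in> J \<and> q \<in> J)" for p q
    using K0[OF that] Ki0[OF that] by (simp_all add: lscal_def)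
  have us0: "us g p q = \<zero>\<^bsub>D\<^esub>" if g: "g \<in> carrier \<Gamma>" and "\<not> (p \<in> J \<and> q \<in> J)" for g p q
  proof (cases "p \<in> J")
    case True
    then have "q \<notin> J" using that by blast
    then show ?thesis unfolding us_def using cc[OF g] by (intro D.mm_zero_right D.closed_mat_mm D.closed_mat_sc D.closed_mat_ma) (simp_all add: sck)
  next
    case False
    then have "D.mm J (D.sc (Ki_fd B)) (D.ma (c g)) p l = \<zero>\<^bsub>D\<^esub>" for l
      using cc[OF g] False by (intro D.mm_zero_left) (auto simp: sck)
    then show ?thesis unfolding us_def by (rule D.mm_zero_left[OF D.closed_mat_sc])
  qed
  have fstar: "f (lstar P (fd_hilb B) (a g) r s) = us g r s" if g: "g \<in> carrier \<Gamma>" and rs: "r \<in> J" "s \<in> J" for g r s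
  proof -
    have "f (lstar P (fd_hilb B) (a g) r s)
        = (\<Oplus>\<^bsub>D\<^esub>pq\<in>J \<times> J. f ((Ki_fd B r (snd pq) * K_fd B (fst pq) s) \<odot>\<^bsub>P\<^esub> star P (a g (fst pq) (snd pq))))"
      unfolding lstar_a[OF g rs] using a_closed[OF g] by (intro f.map_finsum) auto
    also have "\<dots> = (\<Oplus>\<^bsub>D\<^esub>pq\<in>J \<times> J. (Ki_fd B r (snd pq) * K_fd B (fst pq) s) \<odot>\<^bsub>D\<^esub> star D (c g (fst pq) (snd pq)))"
      using a_closed[OF g] cc[OF g] by (intro D.finsum_cong' refl) (auto simp: fa)
    also have "\<dots> = (\<Oplus>\<^bsub>D\<^esub>p\<in>J. \<Oplus>\<^bsub>D\<^esub>q\<in>J. (Ki_fd B r q * K_fd B p s) \<odot>\<^bsub>D\<^esub> star D (c g p q))"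
      using cc[OF g] by (subst D.finsum_cartesian) auto
    also have "\<dots> = (\<Oplus>\<^bsub>D\<^esub>p\<in>J. K_fd B p s \<odot>\<^bsub>D\<^esub> (\<Oplus>\<^bsub>D\<^esub>q\<in>J. Ki_fd B r q \<odot>\<^bsub>D\<^esub> star D (c g p q)))"
      using cc[OF g] by (intro D.finsum_cong' refl)
        (auto simp: D.smult_finsum mult.commute intro!: D.finsum_cong' D.finsum_closed)
    also have "\<dots> = us g r s" using cc[OF g]
      by (simp add: us_def D.mm_sc_entry D.sc_mm_entry) (simp add: madj_def)
    finally show ?thesis .
  qed
  have flone: "f (lone P r s) = D.sc (sid J) r s" if "r \<in> J" for r s :: fd_idx
    using that by (auto simp: lone_def lscal_def sid_def)
  have sidz: "D.sc (sid J) p q = \<zero>\<^bsub>D\<^esub>" if "\<not> (p \<in> J \<and> q \<in> J)" for p q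
    using that by (auto simp: lscal_def sid_def)
  have U: "(\<forall>r\<in>unitary_rels P (fd_hilb B) (a g). f r = \<zero>\<^bsub>D\<^esub>) \<longleftrightarrow> gram_unitary D J (K_fd B) (Ki_fd B) (c g)"
    if g: "g \<in> carrier \<Gamma>" for g
  proof -
    have z: "D.mm J (us g) (c g) p q = \<zero>\<^bsub>D\<^esub>" "D.mm J (c g) (us g) p q = \<zero>\<^bsub>D\<^esub>" if "\<not> (p \<in> J \<and> q \<in> J)" for p q
      using that D.mm_zero_left[OF cc[OF g], of J "us g" p q] D.mm_zero_right[OF usc[OF g], of J "c g" q p]
        D.mm_zero_left[OF usc[OF g], of J "c g" p q] D.mm_zero_right[OF cc[OF g], of J "us g" q p] us0[OF g] c0 by blast+
    have "(\<forall>r\<in>unitary_rels P (fd_hilb B) (a g). f r = \<zero>\<^bsub>D\<^esub>) \<longleftrightarrow>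
        (\<forall>r\<in>J. \<forall>s\<in>J. f (lmult P J (lstar P (fd_hilb B) (a g)) (a g) r s) = f (lone P r s))
        \<and> (\<forall>r\<in>J. \<forall>s\<in>J. f (lmult P J (a g) (lstar P (fd_hilb B) (a g)) r s) = f (lone P r s))"
      unfolding unitary_rels_def idx_fd_hilb ball_Un
      by (intro arg_cong2[where f = "(\<and>)"] f.map_coeff_diffs tc(1,2,6)[OF g g])
    also have "\<dots> \<longleftrightarrow> (\<forall>r\<in>J. \<forall>s\<in>J. D.mm J (us g) (c g) r s = D.sc (sid J) r s)
        \<and> (\<forall>r\<in>J. \<forall>s\<in>J. D.mm J (c g) (us g) r s = D.sc (sid J) r s)"
    proof -
      have "f (lmult P J (lstar P (fd_hilb B) (a g)) (a g) r s) = D.mm J (us g) (c g) r s"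
        "f (lmult P J (a g) (lstar P (fd_hilb B) (a g)) r s) = D.mm J (c g) (us g) r s" if "r \<in> J" "s \<in> J" for r s
        by (rule f.map_lmult; use that a_closed[OF g] lstar_closed[OF g] fa fstar[OF g] in blast)+
      then show ?thesis by (simp add: flone)
    qed
    also have "\<dots> \<longleftrightarrow> D.mm J (us g) (c g) = D.sc (sid J) \<and> D.mm J (c g) (us g) = D.sc (sid J)"
    proof (intro arg_cong2[where f = "(\<and>)"] mat_eq_iff)
      fix r s assume rs: "\<not> (r \<in> J \<and> s \<in> J)"
      show "D.mm J (us g) (c g) r s = D.sc (sid J) r s" "D.mm J (c g) (us g) r s = D.sc (sid J) r s"
        unfolding z(1)[OF rs] z(2)[OF rs] sidz[OF rs] by simp_all
    qed
    also have "\<dots> \<longleftrightarrow> gram_unitary D J (K_fd B) (Ki_fd B) (c g)"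
      unfolding us_def by (rule G.gram_unitary_iff[OF cc[OF g] c0, symmetric])
    finally show ?thesis .
  qed
  have m0: "m_fd B r t = 0" if "\<not> (r \<in> J \<and> t \<in> J \<times> J)" for r t using that by (auto simp: m_fd_def split: prod.splits)
  have M: "(\<forall>r\<in>hom_rels P (J \<times> J) J (ltensor P (a g) (a h)) (a (g \<otimes>\<^bsub>\<Gamma>\<^esub> h)) (fd_mult_map B). f r = \<zero>\<^bsub>D\<^esub>)
      \<longleftrightarrow> D.mm (J \<times> J) (D.sc (m_fd B)) (ltensor D (c g) (c h)) = D.mm J (c (g \<otimes>\<^bsub>\<Gamma>\<^esub> h)) (D.sc (m_fd B))"
    if g: "g \<in> carrier \<Gamma>" and h: "h \<in> carrier \<Gamma>" for g h
  proof -
    have gh: "g \<otimes>\<^bsub>\<Gamma>\<^esub> h \<in> carrier \<Gamma>" using g h by simp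
    note cl = cc[OF g] cc[OF h] cc[OF gh]
    have lt0: "ltensor D (c g) (c h) x t = \<zero>\<^bsub>D\<^esub>" if "t \<notin> J \<times> J" for x t
      using that c0 cl by (cases x, cases t) (auto simp: ltensor_def)
    have z1: "D.mm (J \<times> J) (D.sc (m_fd B)) (ltensor D (c g) (c h)) r t = \<zero>\<^bsub>D\<^esub>" if "\<not> (r \<in> J \<and> t \<in> J \<times> J)" for r t
    proof (cases "r \<in> J")
      case True
      then show ?thesis using that cl by (intro D.mm_zero_right) (auto simp: lt0)
    next
      case False
      then have "D.sc (m_fd B) r l = \<zero>\<^bsub>D\<^esub>" for l using m0[of r l] by (simp add: lscal_def)
      then show ?thesis by (rule D.mm_zero_left[OF D.closed_mat_ltensor[OF cl(1,2)]])
    qed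
    have z2: "D.mm J (c (g \<otimes>\<^bsub>\<Gamma>\<^esub> h)) (D.sc (m_fd B)) r t = \<zero>\<^bsub>D\<^esub>" if "\<not> (r \<in> J \<and> t \<in> J \<times> J)" for r t
    proof (cases "r \<in> J")
      case True
      then have "D.sc (m_fd B) l t = \<zero>\<^bsub>D\<^esub>" for l using m0[of l t] that by (simp add: lscal_def)
      then show ?thesis by (rule D.mm_zero_right[OF cl(3)])
    next
      case False
      then show ?thesis using cl c0 by (intro D.mm_zero_left) auto
    qed
    have "(\<forall>r\<in>hom_rels P (J \<times> J) J (ltensor P (a g) (a h)) (a (g \<otimes>\<^bsub>\<Gamma>\<^esub> h)) (fd_mult_map B). f r = \<zero>\<^bsub>D\<^esub>)
      \<longleftrightarrow> (\<forall>r\<in>J. \<forall>t\<in>J \<times> J. f (lmult P (J \<times> J) (lscal P (fd_mult_map B)) (ltensor P (a g) (a h)) r t)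
          = f (lmult P J (a (g \<otimes>\<^bsub>\<Gamma>\<^esub> h)) (lscal P (fd_mult_map B)) r t))"
      unfolding hom_rels_def by (rule f.map_coeff_diffs) (auto intro: tc(3)[OF g h] tc(4)[OF gh g])
    also have "\<dots> \<longleftrightarrow> (\<forall>r\<in>J. \<forall>t\<in>J \<times> J. D.mm (J \<times> J) (D.sc (m_fd B)) (ltensor D (c g) (c h)) r t
          = D.mm J (c (g \<otimes>\<^bsub>\<Gamma>\<^esub> h)) (D.sc (m_fd B)) r t)"
    proof -
      have fm: "f (lscal P (fd_mult_map B) r t) = D.sc (m_fd B) r t" if "r \<in> J" "t \<in> J \<times> J" for r t
        using that by (auto simp: f.map_lscal lscal_def fd_mult_map_eq)
      have scP: "lscal P T r t \<in> carrier P" for T :: "'k \<Rightarrow> 'l \<Rightarrow> complex" and r t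
        by (simp add: lscal_def)
      have "f (lmult P (J \<times> J) (lscal P (fd_mult_map B)) (ltensor P (a g) (a h)) r t)
          = D.mm (J \<times> J) (D.sc (m_fd B)) (ltensor D (c g) (c h)) r t"
        if r: "r \<in> J" and t: "t \<in> J \<times> J" for r t
        by (rule f.map_lmult) (use r t a_closed[OF g] a_closed[OF h] in \<open>auto simp: ltensor_def fa fm scP\<close>)
      moreover have "f (lmult P J (a (g \<otimes>\<^bsub>\<Gamma>\<^esub> h)) (lscal P (fd_mult_map B)) r t)
          = D.mm J (c (g \<otimes>\<^bsub>\<Gamma>\<^esub> h)) (D.sc (m_fd B)) r t" if r: "r \<in> J" and t: "t \<in> J \<times> J" for r t
        by (rule f.map_lmult) (use r t a_closed[OF gh] in \<open>auto simp: fa fm scP\<close>)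
      ultimately show ?thesis by simp
    qed
    also have "\<dots> \<longleftrightarrow> D.mm (J \<times> J) (D.sc (m_fd B)) (ltensor D (c g) (c h)) = D.mm J (c (g \<otimes>\<^bsub>\<Gamma>\<^esub> h)) (D.sc (m_fd B))"
    proof (rule mat_eq_iff)
      fix r t assume rt: "\<not> (r \<in> J \<and> t \<in> J \<times> J)"
      show "D.mm (J \<times> J) (D.sc (m_fd B)) (ltensor D (c g) (c h)) r t = D.mm J (c (g \<otimes>\<^bsub>\<Gamma>\<^esub> h)) (D.sc (m_fd B)) r t"
        unfolding z1[OF rt] z2[OF rt] ..
    qed
    finally show ?thesis .
  qed
  have E: "(\<forall>r\<in>hom_rels P {()} J (lone P) (a \<one>\<^bsub>\<Gamma>\<^esub>) (fd_unit_map B). f r = \<zero>\<^bsub>D\<^esub>)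
      \<longleftrightarrow> D.mm J (c \<one>\<^bsub>\<Gamma>\<^esub>) (D.sc (e_fd B)) = D.sc (e_fd B)"
  proof -
    note cl = cc[OF \<Gamma>.one_closed]
    have fe: "f (lscal P (fd_unit_map B) r u) = D.sc (e_fd B) r u" if "r \<in> J" for r u
      using that by (simp add: f.map_lscal lscal_def e_fd_def)
    have scP: "lscal P T r t \<in> carrier P" for T :: "'k \<Rightarrow> 'l \<Rightarrow> complex" and r t
      by (simp add: lscal_def)
    have "(\<forall>r\<in>hom_rels P {()} J (lone P) (a \<one>\<^bsub>\<Gamma>\<^esub>) (fd_unit_map B). f r = \<zero>\<^bsub>D\<^esub>)
      \<longleftrightarrow> (\<forall>r\<in>J. \<forall>t\<in>{()}. f (lmult P {()} (lscal P (fd_unit_map B)) (lone P) r t)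
          = f (lmult P J (a \<one>\<^bsub>\<Gamma>\<^esub>) (lscal P (fd_unit_map B)) r t))"
      unfolding hom_rels_def
      by (rule f.map_coeff_diffs) (auto intro: tc(5)[OF \<Gamma>.one_closed \<Gamma>.one_closed] tc(4)[OF \<Gamma>.one_closed \<Gamma>.one_closed])
    also have "\<dots> \<longleftrightarrow> (\<forall>r\<in>J. D.sc (e_fd B) r () = D.mm J (c \<one>\<^bsub>\<Gamma>\<^esub>) (D.sc (e_fd B)) r ())"
    proof -
      have "lmult P {()} (lscal P (fd_unit_map B)) (lone P) r () = lscal P (fd_unit_map B) r ()" for r
        using f.A.mm_sc_entry[of "lscal P (fd_unit_map B)" "{()}" "sid {()}" r "()"]
        by (simp add: lmult_def lone_def lscal_def f.A.finsum_insert)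
      moreover have "f (lmult P J (a \<one>\<^bsub>\<Gamma>\<^esub>) (lscal P (fd_unit_map B)) r t) = D.mm J (c \<one>\<^bsub>\<Gamma>\<^esub>) (D.sc (e_fd B)) r t"
        if r: "r \<in> J" for r t
        by (rule f.map_lmult) (use r a_closed[OF \<Gamma>.one_closed] in \<open>auto simp: fa fe scP\<close>)
      ultimately show ?thesis by (simp add: fe)
    qed
    also have "\<dots> \<longleftrightarrow> D.mm J (c \<one>\<^bsub>\<Gamma>\<^esub>) (D.sc (e_fd B)) = D.sc (e_fd B)"
    proof
      assume eq: "\<forall>r\<in>J. D.sc (e_fd B) r () = D.mm J (c \<one>\<^bsub>\<Gamma>\<^esub>) (D.sc (e_fd B)) r ()"
      show "D.mm J (c \<one>\<^bsub>\<Gamma>\<^esub>) (D.sc (e_fd B)) = D.sc (e_fd B)"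
      proof (intro ext)
        fix r and u :: unit
        show "D.mm J (c \<one>\<^bsub>\<Gamma>\<^esub>) (D.sc (e_fd B)) r u = D.sc (e_fd B) r u"
        proof (cases "r \<in> J")
          case False
          then have "D.mm J (c \<one>\<^bsub>\<Gamma>\<^esub>) (D.sc (e_fd B)) r u = \<zero>\<^bsub>D\<^esub>" using cl c0 by (intro D.mm_zero_left) auto
          then show ?thesis using False by (simp add: lscal_def e_fd_def)
        qed (use eq in simp)
      qed
    qed simp
    finally show ?thesis .
  qed
  show ?thesis unfolding fw_family_def fw_rels_unfolded ball_Un ball_UN c_def[symmetric] using U M E by auto
qed

end

section \<open>The universal family of coefficients and the comultiplications\<close>

definition fw_co :: "('g, 'm) monoid_scheme \<Rightarrow> fd_alg \<Rightarrow> 'g \<Rightarrow> fd_idx \<Rightarrow> fd_idx \<Rightarrow> 'g fw_elem" where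
  "fw_co \<Gamma> B = fw_ext (fw_alg \<Gamma> B) B (fw_coeff \<Gamma> B)"

lemma fw_family_cong:
  fixes \<Gamma> :: "('g, 'm) monoid_scheme"
  assumes "Group.group \<Gamma>" "\<And>g. g \<in> carrier \<Gamma> \<Longrightarrow> b g = b' g" "fw_family D \<Gamma> B b"
  shows "fw_family D \<Gamma> B b'"
proof -
  interpret \<Gamma>: Group.group \<Gamma> by fact
  show ?thesis using assms(3) unfolding fw_family_def by (simp add: assms(2))
qed

lemma fw_familyD:
  assumes "fw_family D \<Gamma> B b"
  shows "g \<in> carrier \<Gamma> \<Longrightarrow> gram_unitary D (fd_basis_idx B) (K_fd B) (Ki_fd B) (b g)"
    and "\<lbrakk>g \<in> carrier \<Gamma>; h \<in> carrier \<Gamma>\<rbrakk> \<Longrightarrow>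
      lmult D (fd_basis_idx B \<times> fd_basis_idx B) (lscal D (m_fd B)) (ltensor D (b g) (b h))
      = lmult D (fd_basis_idx B) (b (g \<otimes>\<^bsub>\<Gamma>\<^esub> h)) (lscal D (m_fd B))"
    and "lmult D (fd_basis_idx B) (b \<one>\<^bsub>\<Gamma>\<^esub>) (lscal D (e_fd B)) = lscal D (e_fd B)"
  using assms unfolding fw_family_def by blast+

context star_morphism
begin

lemma map_mm:
  assumes "A.closed_mat u" "A.closed_mat v"
  shows "(\<lambda>k j. f (lmult A L u v k j)) = lmult B L (\<lambda>k j. f (u k j)) (\<lambda>k j. f (v k j))"
proof (intro ext)
  fix k j
  show "f (lmult A L u v k j) = lmult B L (\<lambda>k j. f (u k j)) (\<lambda>k j. f (v k j)) k j"
    by (rule map_lmult) (use assms in auto)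
qed

lemma map_sc: "(\<lambda>k j. f (lscal A T k j)) = lscal B T"
  by (intro ext) (rule map_lscal)

lemma map_ma: "A.closed_mat u \<Longrightarrow> (\<lambda>k j. f (madj A u k j)) = madj B (\<lambda>k j. f (u k j))"
  by (intro ext) (simp add: madj_def A.closed_mat_def)

lemma map_ltensor:
  assumes "A.closed_mat u" "A.closed_mat v"
  shows "(\<lambda>k j. f (ltensor A u v k j)) = ltensor B (\<lambda>k j. f (u k j)) (\<lambda>k j. f (v k j))"
  using assms by (intro ext) (auto simp: ltensor_def case_prod_beta)

lemma map_gram_unitary:
  assumes u: "gram_unitary A J K Ki u"
  shows "gram_unitary B J K Ki (\<lambda>p q. f (u p q))"
proof -
  let ?fu = "\<lambda>p q. f (u p q)"
  have c: "A.closed_mat u" using u unfolding gram_unitary_def A.closed_mat_def by blast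
  note cl = c A.closed_mat_ma[OF c] A.closed_mat_sc A.closed_mat_mm[OF A.closed_mat_sc c]
    A.closed_mat_mm[OF A.closed_mat_sc A.closed_mat_ma[OF c]]
  have eq: "lmult A J (madj A u) (lmult A J (lscal A K) u) = lscal A K" "lmult A J u (lmult A J (lscal A Ki) (madj A u)) = lscal A Ki"
    using u unfolding gram_unitary_def by blast+
  have "lmult B J (madj B ?fu) (lmult B J (lscal B K) ?fu) = (\<lambda>k j. f (lmult A J (madj A u) (lmult A J (lscal A K) u) k j))"
    by (subst map_mm[OF cl(2,4)], subst map_mm[OF cl(3,1)], subst map_ma[OF c], subst map_sc, rule refl)
  then have 1: "lmult B J (madj B ?fu) (lmult B J (lscal B K) ?fu) = lscal B K" by (simp only: eq map_sc)
  have "lmult B J ?fu (lmult B J (lscal B Ki) (madj B ?fu)) = (\<lambda>k j. f (lmult A J u (lmult A J (lscal A Ki) (madj A u)) k j))"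
    by (subst map_mm[OF cl(1,5)], subst map_mm[OF cl(3,2)], subst map_ma[OF c], subst map_sc, rule refl)
  then have 2: "lmult B J ?fu (lmult B J (lscal B Ki) (madj B ?fu)) = lscal B Ki" by (simp only: eq map_sc)
  have 3: "\<forall>p q. ?fu p q \<in> carrier B" using c by (intro allI closed) (rule A.closed_matD)
  have 4: "f (u p q) = \<zero>\<^bsub>B\<^esub>" if "\<not> (p \<in> J \<and> q \<in> J)" for p q
  proof -
    have "u p q = \<zero>\<^bsub>A\<^esub>" using u that unfolding gram_unitary_def by blast
    then show ?thesis by (simp only: map_zero)
  qed
  show ?thesis unfolding gram_unitary_def by (intro conjI allI impI 1 2 3[rule_format] 4)
qed

lemma map_fw_family:
  assumes b: "fw_family A \<Gamma> B' b" and \<Gamma>: "Group.group \<Gamma>"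
  shows "fw_family B \<Gamma> B' (\<lambda>g p q. f (b g p q))"
proof -
  interpret \<Gamma>: Group.group \<Gamma> by fact
  have c: "A.closed_mat (b g)" if "g \<in> carrier \<Gamma>" for g
    using fw_familyD(1)[OF b that] unfolding gram_unitary_def A.closed_mat_def by blast
  show ?thesis unfolding fw_family_def
  proof (intro conjI ballI)
    fix g h assume g: "g \<in> carrier \<Gamma>" and h: "h \<in> carrier \<Gamma>"
    show "gram_unitary B (fd_basis_idx B') (K_fd B') (Ki_fd B') (\<lambda>p q. f (b g p q))"
      by (rule map_gram_unitary[OF fw_familyD(1)[OF b g]])
    have "lmult A (fd_basis_idx B' \<times> fd_basis_idx B') (lscal A (m_fd B')) (ltensor A (b g) (b h))
        = lmult A (fd_basis_idx B') (b (g \<otimes>\<^bsub>\<Gamma>\<^esub> h)) (lscal A (m_fd B'))"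
      by (rule fw_familyD(2)[OF b g h])
    then have eq: "(\<lambda>k j. f (lmult A (fd_basis_idx B' \<times> fd_basis_idx B') (lscal A (m_fd B')) (ltensor A (b g) (b h)) k j))
        = (\<lambda>k j. f (lmult A (fd_basis_idx B') (b (g \<otimes>\<^bsub>\<Gamma>\<^esub> h)) (lscal A (m_fd B')) k j))" by (rule arg_cong)
    have gh: "g \<otimes>\<^bsub>\<Gamma>\<^esub> h \<in> carrier \<Gamma>" using g h by simp
    show "lmult B (fd_basis_idx B' \<times> fd_basis_idx B') (lscal B (m_fd B')) (ltensor B (\<lambda>p q. f (b g p q)) (\<lambda>p q. f (b h p q)))
        = lmult B (fd_basis_idx B') (\<lambda>p q. f (b (g \<otimes>\<^bsub>\<Gamma>\<^esub> h) p q)) (lscal B (m_fd B'))"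
      using eq unfolding map_mm[OF A.closed_mat_sc A.closed_mat_ltensor[OF c[OF g] c[OF h]]]
        map_mm[OF c[OF gh] A.closed_mat_sc] map_ltensor[OF c[OF g] c[OF h]] map_sc .
  next
    have "lmult A (fd_basis_idx B') (b \<one>\<^bsub>\<Gamma>\<^esub>) (lscal A (e_fd B')) = lscal A (e_fd B')"
      by (rule fw_familyD(3)[OF b])
    then have eq: "(\<lambda>k j. f (lmult A (fd_basis_idx B') (b \<one>\<^bsub>\<Gamma>\<^esub>) (lscal A (e_fd B')) k j)) = (\<lambda>k j. f (lscal A (e_fd B') k j))"
      by (rule arg_cong)
    show "lmult B (fd_basis_idx B') (\<lambda>p q. f (b \<one>\<^bsub>\<Gamma>\<^esub> p q)) (lscal B (e_fd B')) = lscal B (e_fd B')"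
      using eq unfolding map_mm[OF c[OF \<Gamma>.one_closed] A.closed_mat_sc] map_sc .
  qed
qed

end

context fw
begin

text \<open>The commutation hypothesis allows m to be moved first through b and then through b'.
  Applied to a(g)_12 and a(g)_13 the lemma gives the family that defines the
  comultiplication.\<close>

lemma fw_family_mm:
  assumes D: "star_algebra D" and b: "fw_family D \<Gamma> B b" and b': "fw_family D \<Gamma> B b'"
    and comm: "\<And>g h p q r s. \<lbrakk>g \<in> carrier \<Gamma>; h \<in> carrier \<Gamma>\<rbrakk> \<Longrightarrow> b' g p q \<otimes>\<^bsub>D\<^esub> b h r s = b h r s \<otimes>\<^bsub>D\<^esub> b' g p q"
  shows "fw_family D \<Gamma> B (\<lambda>g. lmult D J (b g) (b' g))"
proof -
  interpret D: star_algebra D by (rule D)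
  interpret G: gram_data_star J "K_fd B" "Ki_fd B" D by unfold_locales
  have c: "D.closed_mat (b g)" "D.closed_mat (b' g)" if "g \<in> carrier \<Gamma>" for g
    using fw_familyD(1)[OF b that] fw_familyD(1)[OF b' that] unfolding gram_unitary_def D.closed_mat_def by blast+
  show ?thesis unfolding fw_family_def
  proof (intro conjI ballI)
    fix g h assume g: "g \<in> carrier \<Gamma>" and h: "h \<in> carrier \<Gamma>"
    then have gh: "g \<otimes>\<^bsub>\<Gamma>\<^esub> h \<in> carrier \<Gamma>" by simp
    show "gram_unitary D J (K_fd B) (Ki_fd B) (D.mm J (b g) (b' g))"
      by (rule G.gram_unitary_mm[OF fw_familyD(1)[OF b g] fw_familyD(1)[OF b' g]])
    note cl = c[OF g] c[OF h] c[OF gh]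
    have m: "D.mm (J \<times> J) (D.sc (m_fd B)) (ltensor D (b g) (b h)) = D.mm J (b (g \<otimes>\<^bsub>\<Gamma>\<^esub> h)) (D.sc (m_fd B))"
      "D.mm (J \<times> J) (D.sc (m_fd B)) (ltensor D (b' g) (b' h)) = D.mm J (b' (g \<otimes>\<^bsub>\<Gamma>\<^esub> h)) (D.sc (m_fd B))"
      by (rule fw_familyD(2)[OF b g h] fw_familyD(2)[OF b' g h])+
    have "D.mm (J \<times> J) (D.sc (m_fd B)) (ltensor D (D.mm J (b g) (b' g)) (D.mm J (b h) (b' h)))
        = D.mm (J \<times> J) (D.sc (m_fd B)) (D.mm (J \<times> J) (ltensor D (b g) (b h)) (ltensor D (b' g) (b' h)))"
      using cl comm[OF g h] by (subst D.ltensor_mm) auto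
    also have "\<dots> = D.mm (J \<times> J) (D.mm (J \<times> J) (D.sc (m_fd B)) (ltensor D (b g) (b h))) (ltensor D (b' g) (b' h))"
      using cl by (subst D.mm_assoc) auto
    also have "\<dots> = D.mm J (b (g \<otimes>\<^bsub>\<Gamma>\<^esub> h)) (D.mm (J \<times> J) (D.sc (m_fd B)) (ltensor D (b' g) (b' h)))"
      unfolding m(1) using cl by (subst D.mm_assoc) auto
    also have "\<dots> = D.mm J (D.mm J (b (g \<otimes>\<^bsub>\<Gamma>\<^esub> h)) (b' (g \<otimes>\<^bsub>\<Gamma>\<^esub> h))) (D.sc (m_fd B))"
      unfolding m(2) using cl by (subst D.mm_assoc) auto
    finally show "D.mm (J \<times> J) (D.sc (m_fd B)) (ltensor D (D.mm J (b g) (b' g)) (D.mm J (b h) (b' h)))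
        = D.mm J (D.mm J (b (g \<otimes>\<^bsub>\<Gamma>\<^esub> h)) (b' (g \<otimes>\<^bsub>\<Gamma>\<^esub> h))) (D.sc (m_fd B))" .
  next
    have e: "D.mm J (b \<one>\<^bsub>\<Gamma>\<^esub>) (D.sc (e_fd B)) = D.sc (e_fd B)" "D.mm J (b' \<one>\<^bsub>\<Gamma>\<^esub>) (D.sc (e_fd B)) = D.sc (e_fd B)"
      by (rule fw_familyD(3)[OF b] fw_familyD(3)[OF b'])+
    show "D.mm J (D.mm J (b \<one>\<^bsub>\<Gamma>\<^esub>) (b' \<one>\<^bsub>\<Gamma>\<^esub>)) (D.sc (e_fd B)) = D.sc (e_fd B)"
      using c[OF \<Gamma>.one_closed] by (subst D.mm_assoc) (auto simp: e)
  qed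
qed

sublocale pres: presentation X R
proof
  show "R \<subseteq> carrier P" by (rule rels_closed)
  fix x assume "x \<in> X"
  then obtain g p q where x: "x = (g, p, q)" "g \<in> carrier \<Gamma>" "p \<in> J" "q \<in> J" by (auto simp: fw_gens_def)
  \<comment> \<open>The completions of P for the various seminorms s all have this type, so one
    bound b serves for all of them.\<close>
  obtain b where b: "\<And>(D :: 'g fw_elem cstar) u p q. cstar_algebra D \<Longrightarrow> gram_unitary D J (K_fd B) (Ki_fd B) u \<Longrightarrow> nrm D (u p q) \<le> b p q"
    using unitary_entries_bounded by blast
  have "s (gen x) \<le> b p q" if s: "cstar_seminorm P s" and 0: "\<forall>r\<in>R. s r = 0" for s
  proof -
    interpret s: seminormed_star_algebra P s
      by (rule seminormed_star_algebra.intro[OF star_algebra_free]) (unfold_locales, rule s)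
    \<comment> \<open>In the completion for s alone the relators become 0, so the generators form
      unitary matrices there and the uniform bound applies to their norms, which are the values of
      s.\<close>
    interpret C: cstar_algebra s.C by (rule s.cstar_algebra_completion)
    have "to_completion P s r = \<zero>\<^bsub>s.C\<^esub>" if r: "r \<in> R" for r
    proof (rule C.nrm_eq_zero)
      have "r \<in> carrier P" using rels_closed r by blast
      then show "to_completion P s r \<in> carrier s.C" "nrm s.C (to_completion P s r) = 0"
        using 0 r by (auto simp: s.nrm_to_completion)
    qed
    then have "fw_family s.C \<Gamma> B (fw_ext s.C B (\<lambda>g p q. to_completion P s (gen (g, p, q))))"
      using fw_rels_hom[OF C.star_algebra_axioms s.star_hom_to_completion] by blast
    then have "nrm s.C (fw_ext s.C B (\<lambda>g p q. to_completion P s (gen (g, p, q))) g p q) \<le> b p q"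
      by (rule b[OF C.cstar_algebra_axioms fw_familyD(1)[OF _ x(2)]])
    then show ?thesis using x a_closed[OF x(2-4)] by (simp add: fw_ext_def)
  qed
  then show "\<exists>b. \<forall>s. cstar_seminorm P s \<longrightarrow> (\<forall>r\<in>R. s r = 0) \<longrightarrow> s (gen x) \<le> b" by blast
qed

lemma cstar_algebra_fw: "cstar_algebra A"
  unfolding fw_alg_def by (rule pres.cstar_algebra_univ)

lemma fw_family_co: "fw_family A \<Gamma> B (fw_co \<Gamma> B)"
proof -
  interpret A: cstar_algebra A by (rule cstar_algebra_fw)
  have eq: "fw_co \<Gamma> B = fw_ext A B (\<lambda>g p q. to_completion P pres.u (gen (g, p, q)))"
    by (intro ext) (simp add: fw_co_def fw_ext_def fw_coeff_def univ_gen_def)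
  have "star_hom P A (to_completion P pres.u)" unfolding fw_alg_def by (rule pres.star_hom_to_univ)
  from fw_rels_hom[OF A.star_algebra_axioms this] show ?thesis unfolding eq
    using pres.to_univ_rel by (simp add: fw_alg_def)
qed

lemma fw_hom_ex:
  assumes D: "cstar_algebra D" and b: "fw_family D \<Gamma> B b"
  shows "\<exists>F. star_hom A D F \<and> (\<forall>g\<in>carrier \<Gamma>. \<forall>p q. F (fw_co \<Gamma> B g p q) = b g p q)"
proof -
  interpret D: cstar_algebra D by (rule D)
  interpret A: cstar_algebra A by (rule cstar_algebra_fw)
  have bc: "b g p q \<in> carrier D" and b0: "\<not> (p \<in> J \<and> q \<in> J) \<Longrightarrow> b g p q = \<zero>\<^bsub>D\<^esub>" if "g \<in> carrier \<Gamma>" for g p q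
    using fw_familyD(1)[OF b that] unfolding gram_unitary_def by blast+
  have "\<exists>F. star_hom (univ_cstar X R) D F \<and> (\<forall>x\<in>X. F (univ_gen X R x) = (\<lambda>(g, p, q). b g p q) x)"
  proof (rule pres.univ_hom_ex[OF D])
    show "(\<lambda>(g, p, q). b g p q) x \<in> carrier D" if "x \<in> X" for x using that bc by (auto simp: fw_gens_def)
    fix f r assume f: "star_hom P D f" and fx: "\<And>x. x \<in> X \<Longrightarrow> f (gen x) = (\<lambda>(g, p, q). b g p q) x" and r: "r \<in> R"
    have "b g = fw_ext D B (\<lambda>g p q. f (gen (g, p, q))) g" if "g \<in> carrier \<Gamma>" for g
      using b0[OF that] fx that by (intro ext) (auto simp: fw_ext_def fw_gens_def)
    then have "fw_family D \<Gamma> B (fw_ext D B (\<lambda>g p q. f (gen (g, p, q))))"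
      by (rule fw_family_cong[OF \<Gamma>.group_axioms _ b])
    then show "f r = \<zero>\<^bsub>D\<^esub>" using fw_rels_hom[OF D.star_algebra_axioms f] r by blast
  qed
  then obtain F where F: "star_hom A D F" "\<And>x. x \<in> X \<Longrightarrow> F (univ_gen X R x) = (\<lambda>(g, p, q). b g p q) x"
    unfolding fw_alg_def by blast
  interpret F: star_morphism A D F by (rule star_morphism.intro[OF A.star_algebra_axioms D.star_algebra_axioms]) (unfold_locales, rule F)
  have "F (fw_co \<Gamma> B g p q) = b g p q" if "g \<in> carrier \<Gamma>" for g p q
    using F(2)[of "(g, p, q)"] b0[OF that, of p q] that by (simp add: fw_co_def fw_ext_def fw_coeff_def fw_gens_def)
  then show ?thesis using F(1) by blast
qed

lemma fw_hom_eqI: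
  assumes D: "cstar_algebra D" and F: "star_hom A D F" and G: "star_hom A D G"
    and eq: "\<And>g p q. \<lbrakk>g \<in> carrier \<Gamma>; p \<in> J; q \<in> J\<rbrakk> \<Longrightarrow> F (fw_co \<Gamma> B g p q) = G (fw_co \<Gamma> B g p q)"
    and x: "x \<in> carrier A"
  shows "F x = G x"
  by (rule pres.univ_hom_eqI[OF D F[unfolded fw_alg_def] G[unfolded fw_alg_def] _ x[unfolded fw_alg_def]])
    (use eq in \<open>auto simp: fw_gens_def fw_co_def fw_ext_def fw_coeff_def\<close>)

lemma co_closed: "g \<in> carrier \<Gamma> \<Longrightarrow> fw_co \<Gamma> B g p q \<in> carrier A"
  using fw_familyD(1)[OF fw_family_co] unfolding gram_unitary_def by blast

lemma co_zero: "\<not> (p \<in> J \<and> q \<in> J) \<Longrightarrow> fw_co \<Gamma> B g p q = \<zero>\<^bsub>A\<^esub>"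
  by (auto simp: fw_co_def fw_ext_def)

lemma
  shows star_hom_fw_comult: "star_hom A (min_tensor A A) (fw_comult \<Gamma> B)"
    and fw_comult_co: "\<lbrakk>g \<in> carrier \<Gamma>; p \<in> J; q \<in> J\<rbrakk> \<Longrightarrow> fw_comult \<Gamma> B (fw_co \<Gamma> B g p q)
      = (\<Oplus>\<^bsub>min_tensor A A\<^esub>r\<in>J. elem_tensor A A (fw_co \<Gamma> B g p r) (fw_co \<Gamma> B g r q))"
proof -
  note cA = cstar_algebra_fw
  interpret A: cstar_algebra A by (rule cA)
  interpret T: tensor_pair A A by (simp add: tensor_pair_def cA)
  let ?T = "min_tensor A A" and ?et = "elem_tensor A A" and ?a = "fw_co \<Gamma> B"
  interpret l: star_morphism A ?T "\<lambda>x. ?et x \<one>\<^bsub>A\<^esub>"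
    by (rule star_morphism.intro[OF A.star_algebra_axioms T.T.star_algebra_axioms]) (unfold_locales, rule T.star_hom_left)
  interpret r: star_morphism A ?T "\<lambda>x. ?et \<one>\<^bsub>A\<^esub> x"
    by (rule star_morphism.intro[OF A.star_algebra_axioms T.T.star_algebra_axioms]) (unfold_locales, rule T.star_hom_right)
  \<comment> \<open>The coefficients of a(g)_12 a(g)_13; entries of the two factors commute since
    they sit in different legs.\<close>
  define c where "c g = lmult ?T J (\<lambda>p q. ?et (?a g p q) \<one>\<^bsub>A\<^esub>) (\<lambda>p q. ?et \<one>\<^bsub>A\<^esub> (?a g p q))" for g
  have "fw_family ?T \<Gamma> B c" unfolding c_def
    by (rule fw_family_mm[OF T.T.star_algebra_axioms l.map_fw_family[OF fw_family_co \<Gamma>.group_axioms] r.map_fw_family[OF fw_family_co \<Gamma>.group_axioms]])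
      (simp add: T.et_mult co_closed)
  from fw_hom_ex[OF T.cstar_algebra_T this] obtain F
    where F: "star_hom A ?T F" "\<And>g p q. g \<in> carrier \<Gamma> \<Longrightarrow> F (?a g p q) = c g p q" by blast
  have ceq: "c g p q = (\<Oplus>\<^bsub>?T\<^esub>r\<in>J. ?et (?a g p r) (?a g r q))" if "g \<in> carrier \<Gamma>" for g p q
    unfolding c_def lmult_def using co_closed[OF that] by (intro T.T.finsum_cong' refl) (auto simp: T.et_mult)
  have co: "?a g p q = fw_coeff \<Gamma> B g p q" if "p \<in> J" "q \<in> J" for g p q
    using that by (simp add: fw_co_def fw_ext_def)
  let ?Q = "\<lambda>\<Delta>. \<Delta> \<in> extensional (carrier A) \<and> star_hom A ?T \<Delta> \<and> (\<forall>g\<in>carrier \<Gamma>. \<forall>p\<in>J. \<forall>q\<in>J.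
     \<Delta> (fw_coeff \<Gamma> B g p q) = (\<Oplus>\<^bsub>?T\<^esub>r\<in>J. ?et (fw_coeff \<Gamma> B g p r) (fw_coeff \<Gamma> B g r q)))"
  have sum_co: "(\<Oplus>\<^bsub>?T\<^esub>r\<in>J. ?et (fw_coeff \<Gamma> B g p r) (fw_coeff \<Gamma> B g r q)) = (\<Oplus>\<^bsub>?T\<^esub>r\<in>J. ?et (?a g p r) (?a g r q))"
    if "g \<in> carrier \<Gamma>" "p \<in> J" "q \<in> J" for g p q
    using co_closed[OF that(1)] that by (intro T.T.finsum_cong' refl) (auto simp: co[symmetric])
  have Q: "?Q (restrict F (carrier A))"
  proof (intro conjI ballI)
    show "star_hom A ?T (restrict F (carrier A))" by (rule star_hom_restrict[OF A.star_algebra_axioms F(1)])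
    fix g p q assume gpq: "g \<in> carrier \<Gamma>" "p \<in> J" "q \<in> J"
    have "restrict F (carrier A) (?a g p q) = (\<Oplus>\<^bsub>?T\<^esub>r\<in>J. ?et (?a g p r) (?a g r q))"
      using F(2)[OF gpq(1)] ceq[OF gpq(1)] co_closed[OF gpq(1)] by simp
    then show "restrict F (carrier A) (fw_coeff \<Gamma> B g p q) = (\<Oplus>\<^bsub>?T\<^esub>r\<in>J. ?et (fw_coeff \<Gamma> B g p r) (fw_coeff \<Gamma> B g r q))"
      unfolding sum_co[OF gpq] co[OF gpq(2,3)] .
  qed simp
  have uniq: "\<Delta> = \<Delta>'" if \<Delta>: "?Q \<Delta>" and \<Delta>': "?Q \<Delta>'" for \<Delta> \<Delta>'
  proof (rule extensionalityI[of _ "carrier A"])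
    fix x assume x: "x \<in> carrier A"
    show "\<Delta> x = \<Delta>' x"
      by (rule fw_hom_eqI[OF T.cstar_algebra_T _ _ _ x]) (use \<Delta> \<Delta>' in \<open>simp_all add: co\<close>)
  qed (use \<Delta> \<Delta>' in blast)+
  have "?Q (fw_comult \<Gamma> B)" unfolding fw_comult_def Let_def
    by (rule theI[where P = ?Q, OF Q]) (rule uniq[OF _ Q])
  then show "star_hom A ?T (fw_comult \<Gamma> B)"
    and "\<lbrakk>g \<in> carrier \<Gamma>; p \<in> J; q \<in> J\<rbrakk> \<Longrightarrow> fw_comult \<Gamma> B (?a g p q) = (\<Oplus>\<^bsub>?T\<^esub>r\<in>J. ?et (?a g p r) (?a g r q))"
    using sum_co[of g p q] by (simp_all add: co)
qed

end

lemma
  assumes A: "\<And>i. i \<in> I \<Longrightarrow> cstar_algebra (cqg_alg (G i))"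
    and \<Delta>: "\<And>i. i \<in> I \<Longrightarrow> star_hom (cqg_alg (G i)) (min_tensor (cqg_alg (G i)) (cqg_alg (G i))) (comult (G i))"
  defines "F \<equiv> free_prod I (\<lambda>i. cqg_alg (G i))" and "\<iota> \<equiv> free_prod_incl I (\<lambda>i. cqg_alg (G i))"
  shows star_hom_free_prod_comult: "star_hom F (min_tensor F F) (free_prod_comult I G)"
    and free_prod_comult_incl: "\<lbrakk>i \<in> I; a \<in> carrier (cqg_alg (G i))\<rbrakk> \<Longrightarrow>
      free_prod_comult I G (\<iota> i a) = tensor_hom (cqg_alg (G i)) (cqg_alg (G i)) F F (\<iota> i) (\<iota> i) (comult (G i) a)"
proof -
  let ?A = "\<lambda>i. cqg_alg (G i)"
  interpret fp: free_product I ?A by (rule free_product.intro) (rule A)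
  have cF: "cstar_algebra F" unfolding F_def by (rule fp.cstar_algebra_free_prod)
  interpret F: cstar_algebra F by (rule cF)
  interpret T: tensor_pair F F by (simp add: tensor_pair_def cF)
  have \<iota>: "star_hom (?A i) F (\<iota> i)" if "i \<in> I" for i unfolding F_def \<iota>_def by (rule fp.star_hom_incl[OF that])
  let ?h = "\<lambda>i a. tensor_hom (?A i) (?A i) F F (\<iota> i) (\<iota> i) (comult (G i) a)"
  have h: "star_hom (?A i) (min_tensor F F) (?h i)" if i: "i \<in> I" for i
    by (rule star_hom_comp[OF \<Delta>[OF i] star_hom_tensor_hom[OF A[OF i] A[OF i] cF cF \<iota>[OF i] \<iota>[OF i]]])
  obtain H where H: "star_hom F (min_tensor F F) H" "\<And>i a. \<lbrakk>i \<in> I; a \<in> carrier (?A i)\<rbrakk> \<Longrightarrow> H (\<iota> i a) = ?h i a"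
    using fp.free_prod_hom_ex[OF T.cstar_algebra_T, of ?h] h unfolding F_def \<iota>_def by blast
  let ?Q = "\<lambda>\<Delta>. \<Delta> \<in> extensional (carrier F) \<and> star_hom F (min_tensor F F) \<Delta>
       \<and> (\<forall>i\<in>I. \<forall>a\<in>carrier (?A i). \<Delta> (\<iota> i a) = ?h i a)"
  have incl: "\<iota> i a \<in> carrier F" if "i \<in> I" "a \<in> carrier (?A i)" for i a
    using \<iota>[OF that(1)] that(2) by (auto simp: star_hom_def dest: ring_hom_closed)
  have Q: "?Q (restrict H (carrier F))"
    using H star_hom_restrict[OF F.star_algebra_axioms H(1)] incl by simp
  have uniq: "\<Delta> = \<Delta>'" if \<Delta>: "?Q \<Delta>" and \<Delta>': "?Q \<Delta>'" for \<Delta> \<Delta>'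
  proof (rule extensionalityI[of _ "carrier F"])
    fix x assume x: "x \<in> carrier F"
    show "\<Delta> x = \<Delta>' x"
      by (rule fp.free_prod_hom_eqI[OF T.cstar_algebra_T, folded F_def, OF _ _ _ x])
        (use \<Delta> \<Delta>' in \<open>simp_all add: \<iota>_def\<close>)
  qed (use \<Delta> \<Delta>' in blast)+
  have "?Q (free_prod_comult I G)" unfolding free_prod_comult_def Let_def F_def[symmetric] \<iota>_def[symmetric]
    by (rule theI[where P = ?Q, OF Q]) (rule uniq[OF _ Q])
  then show "star_hom F (min_tensor F F) (free_prod_comult I G)"
    and "\<lbrakk>i \<in> I; a \<in> carrier (?A i)\<rbrakk> \<Longrightarrow> free_prod_comult I G (\<iota> i a) = ?h i a" by simp_all
qed

section \<open>Decomposition along the blocks\<close>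

lemma (in star_algebra) mm_restrict:
  assumes M: "finite M" "L \<subseteq> M" and c: "closed_mat u" "closed_mat v"
    and 0: "\<And>l. l \<in> M - L \<Longrightarrow> u k l = \<zero> \<or> v l j = \<zero>"
    and u': "\<And>l. l \<in> L \<Longrightarrow> u' k l = s \<odot> u k l" and v': "\<And>l. l \<in> L \<Longrightarrow> v' l j = t \<odot> v l j"
  shows "mm L u' v' k j = (s * t) \<odot> mm M u v k j"
proof -
  have "mm L u' v' k j = (\<Oplus>l\<in>L. (s * t) \<odot> (u k l \<otimes> v l j))"
    unfolding lmult_def using c by (intro finsum_cong' refl) (auto simp: u' v' mult.commute)
  also have "\<dots> = (s * t) \<odot> mm L u v k j" unfolding lmult_def using c by (subst smult_finsum) auto
  also have "mm L u v k j = mm M u v k j" using mm_subset[OF M c 0] by simp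
  finally show ?thesis .
qed

text \<open>For the unit of the group and g, \<open>mult_adjoint_commute\<close> says that the
  diagonal matrix with entries t_r = Tr(Q^-1), taken in the summand of r, commutes with b(g). At the
  entry (r, s) this reads t_r x = t_s x, and t_r - t_s is invertible.\<close>

lemma (in fw) family_diag:
  assumes D: "star_algebra D" and b: "fw_family D \<Gamma> B b" and g: "g \<in> carrier \<Gamma>" and rs: "r \<in> J" "s \<in> J"
    and ne: "mtrace (mat_inv (dens B (fst r))) \<noteq> mtrace (mat_inv (dens B (fst s)))"
  shows "b g r s = \<zero>\<^bsub>D\<^esub>"
proof -
  interpret D: star_algebra D by (rule D)
  interpret G: gram_data_star J "K_fd B" "Ki_fd B" D by unfold_locales
  let ?t = "\<lambda>r :: fd_idx. mtrace (mat_inv (dens B (fst r)))"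
  let ?M = "smm (J \<times> J) (m_fd B) (ms_fd B)"
  have U: "gram_unitary D J (K_fd B) (Ki_fd B) (b h)" if "h \<in> carrier \<Gamma>" for h by (rule fw_familyD(1)[OF b that])
  note c = G.gram_unitaryD(1)[OF U[OF g]]
  have "D.mm (J \<times> J) (D.sc (m_fd B)) (ltensor D (b \<one>\<^bsub>\<Gamma>\<^esub>) (b g)) = D.mm J (b g) (D.sc (m_fd B))"
    using fw_familyD(2)[OF b \<Gamma>.one_closed g] \<Gamma>.l_one[OF g] by simp
  from G.mult_adjoint_commute[OF U[OF \<Gamma>.one_closed] U[OF g] U[OF g] this m_ms_adjoint ms_fd_0]
  have comm: "D.mm J (D.sc ?M) (b g) r s = D.mm J (b g) (D.sc ?M) r s" by simp
  have "D.mm J (D.sc ?M) (b g) r s = (\<Oplus>\<^bsub>D\<^esub>l\<in>J. ?M r l \<odot>\<^bsub>D\<^esub> b g l s)" by (rule D.sc_mm_entry[OF c])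
  also have "\<dots> = (\<Oplus>\<^bsub>D\<^esub>l\<in>{r}. ?M r l \<odot>\<^bsub>D\<^esub> b g l s)"
    using rs c by (intro D.finsum_subset) (auto simp: m_ms)
  also have "\<dots> = ?t r \<odot>\<^bsub>D\<^esub> b g r s" using rs c by (simp add: D.finsum_insert Pi_def m_ms)
  finally have 1: "D.mm J (D.sc ?M) (b g) r s = ?t r \<odot>\<^bsub>D\<^esub> b g r s" .
  have "D.mm J (b g) (D.sc ?M) r s = (\<Oplus>\<^bsub>D\<^esub>l\<in>J. ?M l s \<odot>\<^bsub>D\<^esub> b g r l)" by (rule D.mm_sc_entry[OF c])
  also have "\<dots> = (\<Oplus>\<^bsub>D\<^esub>l\<in>{s}. ?M l s \<odot>\<^bsub>D\<^esub> b g r l)"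
    using rs c by (intro D.finsum_subset) (auto simp: m_ms)
  also have "\<dots> = ?t s \<odot>\<^bsub>D\<^esub> b g r s" using rs c by (simp add: D.finsum_insert Pi_def m_ms)
  finally have 2: "?t r \<odot>\<^bsub>D\<^esub> b g r s = ?t s \<odot>\<^bsub>D\<^esub> b g r s" using 1 comm by simp
  have x: "b g r s \<in> carrier D" using c by simp
  have "(?t r - ?t s) \<odot>\<^bsub>D\<^esub> b g r s = ?t r \<odot>\<^bsub>D\<^esub> b g r s \<oplus>\<^bsub>D\<^esub> (- ?t s) \<odot>\<^bsub>D\<^esub> b g r s"
    using D.smult_l_distr[OF x, of "?t r" "- ?t s"] by simp
  also have "\<dots> = (?t s - ?t s) \<odot>\<^bsub>D\<^esub> b g r s"
    unfolding 2 using D.smult_l_distr[OF x, of "?t s" "- ?t s"] by simp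
  also have "\<dots> = \<zero>\<^bsub>D\<^esub>" using x by simp
  finally have "(1 / (?t r - ?t s)) \<odot>\<^bsub>D\<^esub> ((?t r - ?t s) \<odot>\<^bsub>D\<^esub> b g r s) = \<zero>\<^bsub>D\<^esub>" by simp
  then show ?thesis using ne x by simp
qed

text \<open>A sum B' of some of the summands of B, its densities rescaled by a common factor; in the
  application c is the reciprocal of the mass of the functional on these summands. The Gram matrix
  then scales by c and its inverse by 1 / c.\<close>

locale fw_sub = fw B \<Gamma> + B': fw B' \<Gamma>
  for B B' :: fd_alg and \<Gamma> :: "('g, 'm) monoid_scheme" +
  fixes c :: complex
  assumes sub: "blocks B' \<subseteq> blocks B" and dims_eq: "dims B' = dims B"
    and dens_eq: "\<alpha> \<in> blocks B' \<Longrightarrow> dens B' \<alpha> = c \<cdot>\<^sub>m dens B \<alpha>" and c0: "c \<noteq> 0"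
begin

abbreviation "J' \<equiv> fd_basis_idx B'"

lemma J'_eq: "J' = {p \<in> J. fst p \<in> blocks B'}"
  using sub by (auto simp: fd_basis_idx_def dims_eq)

lemma J'_sub: "J' \<subseteq> J"
  by (auto simp: J'_eq)

lemma dens_inv_eq:
  assumes "\<alpha> \<in> blocks B'"
  shows "mat_inv (dens B' \<alpha>) = (1 / c) \<cdot>\<^sub>m mat_inv (dens B \<alpha>)"
  using mat_inv_smult[OF pd c0] B'.pd[OF assms] assms sub by (auto simp: dens_eq dims_eq)

lemma rows:
  assumes p: "p \<in> J'"
  shows K_row: "K_fd B' p q = c * K_fd B p q" and Ki_row: "Ki_fd B' p q = (1 / c) * Ki_fd B p q"
    and m_row: "m_fd B' p t = m_fd B p t" and e_row: "e_fd B' p x = e_fd B p x"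
    and K_off: "q \<notin> J' \<Longrightarrow> K_fd B p q = 0" and Ki_off: "q \<notin> J' \<Longrightarrow> Ki_fd B p q = 0"
    and m_off: "t \<notin> J' \<times> J' \<Longrightarrow> m_fd B p t = 0"
proof -
  obtain \<alpha> i j where pp: "p = (\<alpha>, i, j)" by (cases p)
  obtain \<beta> k l where qq: "q = (\<beta>, k, l)" by (cases q)
  obtain \<beta>1 k1 l1 \<beta>2 k2 l2 where tt: "t = ((\<beta>1, k1, l1), (\<beta>2, k2, l2))" by (cases t) auto
  have \<alpha>: "\<alpha> \<in> blocks B'" "\<alpha> \<in> blocks B" using p sub by (auto simp: pp fd_basis_idx_def)
  have pJ: "p \<in> J" using p J'_sub by blast
  note Q = dens_closed[OF \<alpha>(2)] and Qi = mat_inv_closed[OF pd[OF \<alpha>(2)]]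
  have pm: "(\<alpha>, i, j) \<in> J'" "(\<alpha>, i, j) \<in> J" using p pJ by (simp_all add: pp)
  have j: "j < dims B \<alpha>" using pm(2) by (simp add: fd_basis_idx_def)
  have qm: "(\<alpha>, k, l) \<in> J' \<longleftrightarrow> (\<alpha>, k, l) \<in> J" for k l using \<alpha> by (simp add: J'_eq)
  have l: "l < dims B \<alpha>" if "(\<alpha>, k, l) \<in> J" for k l using that by (simp add: fd_basis_idx_def)
  show "K_fd B' p q = c * K_fd B p q"
  proof (cases "\<beta> = \<alpha>")
    case True
    then show ?thesis using pm Q j l[of k l] by (simp add: K_fd_def pp qq dens_eq[OF \<alpha>(1)] qm)
  next
    case False
    then have "K_fd B p q = 0" "K_fd B' p q = 0" by (simp_all add: K_fd_def pp qq)
    then show ?thesis by simp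
  qed
  show "Ki_fd B' p q = (1 / c) * Ki_fd B p q"
  proof (cases "\<beta> = \<alpha>")
    case True
    then show ?thesis using pm Qi j l[of k l] by (simp add: Ki_fd_def pp qq dens_inv_eq[OF \<alpha>(1)] qm)
  next
    case False
    then have "Ki_fd B p q = 0" "Ki_fd B' p q = 0" by (simp_all add: Ki_fd_def pp qq)
    then show ?thesis by simp
  qed
  show "m_fd B' p t = m_fd B p t"
  proof (cases "\<beta>1 = \<alpha> \<and> \<beta>2 = \<alpha>")
    case True
    then show ?thesis using pm by (simp add: m_fd_def pp tt qm)
  next
    case False
    then have "m_fd B p t = 0" "m_fd B' p t = 0" unfolding m_fd_def pp tt by auto
    then show ?thesis by simp
  qed
  show "e_fd B' p x = e_fd B p x"
    using p pJ by (simp add: e_fd_def fd_unit_map_def fd_one_def dims_eq)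
  show "K_fd B p q = 0" if "q \<notin> J'"
  proof (cases "\<beta> = \<alpha>")
    case True
    then show ?thesis using that by (simp add: K_fd_def pp qq qm)
  qed (simp add: K_fd_def pp qq)
  show "Ki_fd B p q = 0" if "q \<notin> J'"
  proof (cases "\<beta> = \<alpha>")
    case True
    then show ?thesis using that by (simp add: Ki_fd_def pp qq qm)
  qed (simp add: Ki_fd_def pp qq)
  show "m_fd B p t = 0" if "t \<notin> J' \<times> J'"
  proof (cases "\<beta>1 = \<alpha> \<and> \<beta>2 = \<alpha>")
    case True
    then show ?thesis using that by (auto simp: m_fd_def pp tt qm)
  next
    case False
    then show ?thesis unfolding m_fd_def pp tt by auto
  qed
qed

end

section \<open>Restricting families to a summand and gluing them from the summands\<close>

lemma (in star_algebra) mm_scalar_left_restrict: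
  assumes M: "finite M" "L \<subseteq> M" and v: "closed_mat v"
    and T: "\<And>l. l \<in> L \<Longrightarrow> T' k l = T k l" "\<And>l. l \<notin> L \<Longrightarrow> T k l = 0" and v': "\<And>l. l \<in> L \<Longrightarrow> v' l j = v l j"
  shows "mm L (sc T') v' k j = mm M (sc T) v k j"
proof -
  have "mm L (sc T') v' k j = mm L (sc T) v k j"
    unfolding lmult_def lscal_def using v by (intro finsum_cong' refl) (auto simp: T(1) v')
  also have "\<dots> = mm M (sc T) v k j"
    by (rule mm_subset[OF M closed_mat_sc v, symmetric]) (simp add: lscal_def T(2))
  finally show ?thesis .
qed

lemma (in star_algebra) mm_scalar_right_restrict:
  assumes M: "finite M" "L \<subseteq> M" and u: "closed_mat u" "\<And>l. l \<notin> L \<Longrightarrow> u k l = \<zero>"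
    and u': "\<And>l. l \<in> L \<Longrightarrow> u' k l = u k l" and T: "\<And>l. l \<in> L \<Longrightarrow> T' l j = T l j"
  shows "mm L u' (sc T') k j = mm M u (sc T) k j"
proof -
  have "mm L u' (sc T') k j = mm L u (sc T) k j"
    unfolding lmult_def lscal_def using u by (intro finsum_cong' refl) (auto simp: T u')
  also have "\<dots> = mm M u (sc T) k j"
    using u by (intro mm_subset[OF M, symmetric]) auto
  finally show ?thesis .
qed

text \<open>The Gram matrix occurs once in each product, so a single factor c appears. The lemma is
  applied to K with the factor c and to the inverse of K with the factor 1 / c.\<close>

lemma (in star_algebra) gram_rows:
  assumes M: "finite M" "L \<subseteq> M" and u: "closed_mat u" and p: "p \<in> L"
    and row: "\<And>l q. l \<in> L \<Longrightarrow> u' l q = u l q" "\<And>l q. l \<in> L \<Longrightarrow> u' q l = u q l"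
    and off: "\<And>l q. \<lbrakk>l \<in> L; q \<notin> L\<rbrakk> \<Longrightarrow> u l q = \<zero>" "\<And>l q. \<lbrakk>l \<in> L; q \<notin> L\<rbrakk> \<Longrightarrow> u q l = \<zero>"
    and K: "\<And>l q. l \<in> L \<Longrightarrow> K' l q = c * K l q" "\<And>l q. \<lbrakk>l \<in> L; q \<notin> L\<rbrakk> \<Longrightarrow> K l q = 0"
  shows "mm L (ma u') (mm L (sc K') u') p q = c \<odot> mm M (ma u) (mm M (sc K) u) p q"
    and "mm L u' (mm L (sc K') (ma u')) p q = c \<odot> mm M u (mm M (sc K) (ma u)) p q"
proof -
  note c1 = closed_mat_ma[OF u] closed_mat_mm[OF closed_mat_sc u] closed_mat_mm[OF closed_mat_sc closed_mat_ma[OF u]]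
  have uc: "u k j \<in> carrier A" for k j using u by (rule closed_matD)
  have in1: "mm L (sc K') u' l q = (c * 1) \<odot> mm M (sc K) u l q" if l: "l \<in> L" for l
    by (rule mm_restrict[OF M closed_mat_sc u]) (use l uc in \<open>auto simp: lscal_def K row\<close>)
  have in2: "mm L (sc K') (ma u') l q = (c * 1) \<odot> mm M (sc K) (ma u) l q" if l: "l \<in> L" for l
    by (rule mm_restrict[OF M closed_mat_sc c1(1)]) (use l uc in \<open>auto simp: lscal_def K row madj_def\<close>)
  have "mm L (ma u') (mm L (sc K') u') p q = (1 * c) \<odot> mm M (ma u) (mm M (sc K) u) p q"
    by (rule mm_restrict[OF M c1(1,2)]) (use p uc in1 in \<open>auto simp: madj_def row off\<close>)
  then show "mm L (ma u') (mm L (sc K') u') p q = c \<odot> mm M (ma u) (mm M (sc K) u) p q" by simp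
  have "mm L u' (mm L (sc K') (ma u')) p q = (1 * c) \<odot> mm M u (mm M (sc K) (ma u)) p q"
    by (rule mm_restrict[OF M u c1(3)]) (use p uc in2 in \<open>auto simp: row off\<close>)
  then show "mm L u' (mm L (sc K') (ma u')) p q = c \<odot> mm M u (mm M (sc K) (ma u)) p q" by simp
qed

lemma K_fd_zero: "p \<notin> fd_basis_idx B \<Longrightarrow> K_fd B p q = 0"
  and Ki_fd_zero: "p \<notin> fd_basis_idx B \<Longrightarrow> Ki_fd B p q = 0"
  by (auto simp: K_fd_def Ki_fd_def split: prod.splits)

text \<open>Here b belongs to B and b' to a summand B'. As b' vanishes outside the basis of B',
  agreement on all rows and columns through this basis makes b block diagonal with b' as one
  block.\<close>

definition compatible ::
  "('g, 'm) monoid_scheme \<Rightarrow> fd_alg \<Rightarrow> ('a, 'z) star_alg_scheme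
    \<Rightarrow> ('g \<Rightarrow> fd_idx \<Rightarrow> fd_idx \<Rightarrow> 'a) \<Rightarrow> ('g \<Rightarrow> fd_idx \<Rightarrow> fd_idx \<Rightarrow> 'a) \<Rightarrow> bool" where
  "compatible \<Gamma> B' D b b' \<longleftrightarrow> star_algebra D \<and> (\<forall>g\<in>carrier \<Gamma>. \<forall>p q. b g p q \<in> carrier D \<and> b' g p q \<in> carrier D
     \<and> (\<not> (p \<in> (fd_basis_idx B') \<and> q \<in> (fd_basis_idx B')) \<longrightarrow> b' g p q = \<zero>\<^bsub>D\<^esub>) \<and> (p \<in> (fd_basis_idx B') \<or> q \<in> (fd_basis_idx B') \<longrightarrow> b g p q = b' g p q))"

lemma compatibleD:
  assumes "compatible \<Gamma> B' D b b'"
  shows "star_algebra D" and "g \<in> carrier \<Gamma> \<Longrightarrow> b g p q \<in> carrier D" and "g \<in> carrier \<Gamma> \<Longrightarrow> b' g p q \<in> carrier D"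
    and "\<lbrakk>g \<in> carrier \<Gamma>; \<not> (p \<in> (fd_basis_idx B') \<and> q \<in> (fd_basis_idx B'))\<rbrakk> \<Longrightarrow> b' g p q = \<zero>\<^bsub>D\<^esub>"
    and "\<lbrakk>g \<in> carrier \<Gamma>; p \<in> (fd_basis_idx B') \<or> q \<in> (fd_basis_idx B')\<rbrakk> \<Longrightarrow> b g p q = b' g p q"
proof -
  note c = assms[unfolded compatible_def]
  show "star_algebra D" using c by (rule conjunct1)
  note c' = conjunct2[OF c, rule_format]
  show "g \<in> carrier \<Gamma> \<Longrightarrow> b g p q \<in> carrier D" using c'[of g p q] by simp
  show "g \<in> carrier \<Gamma> \<Longrightarrow> b' g p q \<in> carrier D" using c'[of g p q] by simp
  show "\<lbrakk>g \<in> carrier \<Gamma>; \<not> (p \<in> (fd_basis_idx B') \<and> q \<in> (fd_basis_idx B'))\<rbrakk> \<Longrightarrow> b' g p q = \<zero>\<^bsub>D\<^esub>" using c'[of g p q] by simp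
  show "\<lbrakk>g \<in> carrier \<Gamma>; p \<in> (fd_basis_idx B') \<or> q \<in> (fd_basis_idx B')\<rbrakk> \<Longrightarrow> b g p q = b' g p q" using c'[of g p q] by simp
qed

text \<open>Block diagonality collapses the sums over the basis of B to sums over that of B', so in
  a row through B' the relations for B and for B' agree up to the scaling of the Gram matrix. This
  serves restriction and gluing alike.\<close>

lemma compat_rows:
  assumes comp: "compatible \<Gamma> B' D b b'"
    and fs: "fw_sub B B' \<Gamma> c" and g: "g \<in> carrier \<Gamma>" and h: "h \<in> carrier \<Gamma>" and p: "p \<in> (fd_basis_idx B')"
  shows "lmult D (fd_basis_idx B') (madj D (b' g)) (lmult D (fd_basis_idx B') (lscal D (K_fd B')) (b' g)) p q
      = c \<odot>\<^bsub>D\<^esub> lmult D (fd_basis_idx B) (madj D (b g)) (lmult D (fd_basis_idx B) (lscal D (K_fd B)) (b g)) p q"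
    and "lmult D (fd_basis_idx B') (b' g) (lmult D (fd_basis_idx B') (lscal D (Ki_fd B')) (madj D (b' g))) p q
      = (1 / c) \<odot>\<^bsub>D\<^esub> lmult D (fd_basis_idx B) (b g) (lmult D (fd_basis_idx B) (lscal D (Ki_fd B)) (madj D (b g))) p q"
    and "lmult D ((fd_basis_idx B') \<times> (fd_basis_idx B')) (lscal D (m_fd B')) (ltensor D (b' g) (b' h)) p t
      = lmult D ((fd_basis_idx B) \<times> (fd_basis_idx B)) (lscal D (m_fd B)) (ltensor D (b g) (b h)) p t"
    and "lmult D (fd_basis_idx B') (b' g) (lscal D (m_fd B')) p t = lmult D (fd_basis_idx B) (b g) (lscal D (m_fd B)) p t"
    and "lmult D (fd_basis_idx B') (b' g) (lscal D (e_fd B')) p x = lmult D (fd_basis_idx B) (b g) (lscal D (e_fd B)) p x"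
proof -
  note D = compatibleD(1)[OF comp] and closed = compatibleD(2)[OF comp] and zero' = compatibleD(4)[OF comp]
    and compat = compatibleD(5)[OF comp]
  interpret D: star_algebra D by (rule D)
  have fin: "finite (fd_basis_idx B)" using fs by (auto simp: fw_sub_def fw_def fd_def fd_ok_def intro: finite_fd_basis_idx)
  note sub = fw_sub.J'_sub[OF fs]
  note K = fw_sub.K_row[OF fs] fw_sub.K_off[OF fs] and Ki = fw_sub.Ki_row[OF fs] fw_sub.Ki_off[OF fs]
  have cl: "D.closed_mat (b g)" "D.closed_mat (b h)"
    unfolding D.closed_mat_def using closed[OF g] closed[OF h] by blast+
  have row: "b' g l q = b g l q" "b' g q l = b g q l" "b' h l q = b h l q" if "l \<in> fd_basis_idx B'" for l q
    by (rule compat[OF g disjI1[OF that], symmetric] compat[OF g disjI2[OF that], symmetric]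
      compat[OF h disjI1[OF that], symmetric])+
  have off: "b g l q = \<zero>\<^bsub>D\<^esub>" "b g q l = \<zero>\<^bsub>D\<^esub>" if "l \<in> fd_basis_idx B'" "q \<notin> fd_basis_idx B'" for l q
    unfolding compat[OF g disjI1[OF that(1)]] compat[OF g disjI2[OF that(1)]] using that(2) by (simp_all add: zero'[OF g])
  show "lmult D (fd_basis_idx B') (madj D (b' g)) (lmult D (fd_basis_idx B') (lscal D (K_fd B')) (b' g)) p q
      = c \<odot>\<^bsub>D\<^esub> lmult D (fd_basis_idx B) (madj D (b g)) (lmult D (fd_basis_idx B) (lscal D (K_fd B)) (b g)) p q"
    by (rule D.gram_rows(1)[OF fin sub cl(1) p row(1,2) off K])
  show "lmult D (fd_basis_idx B') (b' g) (lmult D (fd_basis_idx B') (lscal D (Ki_fd B')) (madj D (b' g))) p q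
      = (1 / c) \<odot>\<^bsub>D\<^esub> lmult D (fd_basis_idx B) (b g) (lmult D (fd_basis_idx B) (lscal D (Ki_fd B)) (madj D (b g))) p q"
    by (rule D.gram_rows(2)[OF fin sub cl(1) p row(1,2) off Ki])
  have lt: "ltensor D (b' g) (b' h) l t = ltensor D (b g) (b h) l t" if "l \<in> fd_basis_idx B' \<times> fd_basis_idx B'" for l
    using that by (cases l, cases t) (auto simp: ltensor_def row)
  show "lmult D (fd_basis_idx B' \<times> fd_basis_idx B') (lscal D (m_fd B')) (ltensor D (b' g) (b' h)) p t
      = lmult D (fd_basis_idx B \<times> fd_basis_idx B) (lscal D (m_fd B)) (ltensor D (b g) (b h)) p t"
    by (rule D.mm_scalar_left_restrict[OF finite_cartesian_product[OF fin fin] Sigma_mono[OF sub sub] D.closed_mat_ltensor[OF cl]])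
      (blast intro: fw_sub.m_row[OF fs p] fw_sub.m_off[OF fs p] lt)+
  show "lmult D (fd_basis_idx B') (b' g) (lscal D (m_fd B')) p t = lmult D (fd_basis_idx B) (b g) (lscal D (m_fd B)) p t"
    by (rule D.mm_scalar_right_restrict[OF fin sub cl(1)]) (blast intro: off(1)[OF p] row(1)[OF p] fw_sub.m_row[OF fs])+
  show "lmult D (fd_basis_idx B') (b' g) (lscal D (e_fd B')) p x = lmult D (fd_basis_idx B) (b g) (lscal D (e_fd B)) p x"
    by (rule D.mm_scalar_right_restrict[OF fin sub cl(1)]) (blast intro: off(1)[OF p] row(1)[OF p] fw_sub.e_row[OF fs])+
qed

lemma family_restrict:
  assumes comp: "compatible \<Gamma> B' D b b'"
    and fs: "fw_sub B B' \<Gamma> c" and b: "fw_family D \<Gamma> B b"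
  shows "fw_family D \<Gamma> B' b'"
proof -
  note D = compatibleD(1)[OF comp] and closed = compatibleD(2)[OF comp] and closed' = compatibleD(3)[OF comp]
    and zero' = compatibleD(4)[OF comp] and compat = compatibleD(5)[OF comp]
  interpret D: star_algebra D by (rule D)
  have "group \<Gamma>" using fs by (simp add: fw_sub_def fw_def)
  then interpret \<Gamma>: Group.group \<Gamma> .
  have cl': "D.closed_mat (b' g)" if "g \<in> carrier \<Gamma>" for g unfolding D.closed_mat_def using closed'[OF that] by blast
  have z: "b' g p l = \<zero>\<^bsub>D\<^esub>" "D.ma (b' g) p l = \<zero>\<^bsub>D\<^esub>" if "g \<in> carrier \<Gamma>" "p \<notin> (fd_basis_idx B')" for g p l
    using zero'[OF that(1), of p l] zero'[OF that(1), of l p] that(2) by (simp_all add: madj_def)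
  show ?thesis unfolding fw_family_def gram_unitary_def
  proof (intro conjI ballI allI impI ext)
    fix g h p q t assume g: "g \<in> carrier \<Gamma>" and h: "h \<in> carrier \<Gamma>"
    have gh: "g \<otimes>\<^bsub>\<Gamma>\<^esub> h \<in> carrier \<Gamma>" using g h by simp
    show "b' g p q \<in> carrier D" by (rule closed'[OF g])
    show "D.mm (fd_basis_idx B') (D.ma (b' g)) (D.mm (fd_basis_idx B') (D.sc (K_fd B')) (b' g)) p q = D.sc (K_fd B') p q"
    proof (cases "p \<in> (fd_basis_idx B')")
      case True
      have "D.mm (fd_basis_idx B) (D.ma (b g)) (D.mm (fd_basis_idx B) (D.sc (K_fd B)) (b g)) = D.sc (K_fd B)"
        using fw_familyD(1)[OF b g] unfolding gram_unitary_def by blast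
      then show ?thesis unfolding compat_rows(1)[OF comp fs g g True] by (simp add: lscal_def fw_sub.K_row[OF fs True])
    next
      case False
      then have "D.mm (fd_basis_idx B') (D.ma (b' g)) (D.mm (fd_basis_idx B') (D.sc (K_fd B')) (b' g)) p q = \<zero>\<^bsub>D\<^esub>"
        using cl'[OF g] z(2)[OF g] by (intro D.mm_zero_left D.closed_mat_mm D.closed_mat_sc) auto
      then show ?thesis using False K_fd_zero[of p B' q] by (simp add: lscal_def)
    qed
    show "D.mm (fd_basis_idx B') (b' g) (D.mm (fd_basis_idx B') (D.sc (Ki_fd B')) (D.ma (b' g))) p q = D.sc (Ki_fd B') p q"
    proof (cases "p \<in> (fd_basis_idx B')")
      case True
      have "D.mm (fd_basis_idx B) (b g) (D.mm (fd_basis_idx B) (D.sc (Ki_fd B)) (D.ma (b g))) = D.sc (Ki_fd B)"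
        using fw_familyD(1)[OF b g] unfolding gram_unitary_def by blast
      then show ?thesis unfolding compat_rows(2)[OF comp fs g g True] by (simp add: lscal_def fw_sub.Ki_row[OF fs True])
    next
      case False
      then have "D.mm (fd_basis_idx B') (b' g) (D.mm (fd_basis_idx B') (D.sc (Ki_fd B')) (D.ma (b' g))) p q = \<zero>\<^bsub>D\<^esub>"
        using cl'[OF g] z(1)[OF g] by (intro D.mm_zero_left D.closed_mat_mm D.closed_mat_sc D.closed_mat_ma) auto
      then show ?thesis using False Ki_fd_zero[of p B' q] by (simp add: lscal_def)
    qed
    show "D.mm ((fd_basis_idx B') \<times> (fd_basis_idx B')) (D.sc (m_fd B')) (ltensor D (b' g) (b' h)) p t = D.mm (fd_basis_idx B') (b' (g \<otimes>\<^bsub>\<Gamma>\<^esub> h)) (D.sc (m_fd B')) p t"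
    proof (cases "p \<in> (fd_basis_idx B')")
      case True
      have "D.mm ((fd_basis_idx B) \<times> (fd_basis_idx B)) (D.sc (m_fd B)) (ltensor D (b g) (b h)) = D.mm (fd_basis_idx B) (b (g \<otimes>\<^bsub>\<Gamma>\<^esub> h)) (D.sc (m_fd B))"
        by (rule fw_familyD(2)[OF b g h])
      then show ?thesis unfolding compat_rows(3)[OF comp fs g h True] compat_rows(4)[OF comp fs gh g True] by simp
    next
      case False
      then have "m_fd B' p l = 0" for l by (auto simp: m_fd_def split: prod.splits)
      then have "D.mm ((fd_basis_idx B') \<times> (fd_basis_idx B')) (D.sc (m_fd B')) (ltensor D (b' g) (b' h)) p t = \<zero>\<^bsub>D\<^esub>"
        using cl'[OF g] cl'[OF h] by (intro D.mm_zero_left D.closed_mat_ltensor) (simp_all add: lscal_def)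
      moreover have "D.mm (fd_basis_idx B') (b' (g \<otimes>\<^bsub>\<Gamma>\<^esub> h)) (D.sc (m_fd B')) p t = \<zero>\<^bsub>D\<^esub>"
        using False z(1)[OF gh] by (intro D.mm_zero_left D.closed_mat_sc) auto
      ultimately show ?thesis by simp
    qed
  next
    fix g p q assume "g \<in> carrier \<Gamma>" "\<not> (p \<in> (fd_basis_idx B') \<and> q \<in> (fd_basis_idx B'))"
    then show "b' g p q = \<zero>\<^bsub>D\<^esub>" by (rule zero')
  next
    fix p and x :: unit
    show "D.mm (fd_basis_idx B') (b' \<one>\<^bsub>\<Gamma>\<^esub>) (D.sc (e_fd B')) p x = D.sc (e_fd B') p x"
    proof (cases "p \<in> (fd_basis_idx B')")
      case True
      have "D.mm (fd_basis_idx B) (b \<one>\<^bsub>\<Gamma>\<^esub>) (D.sc (e_fd B)) = D.sc (e_fd B)" by (rule fw_familyD(3)[OF b])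
      then show ?thesis unfolding compat_rows(5)[OF comp fs \<Gamma>.one_closed \<Gamma>.one_closed True] by (simp add: lscal_def fw_sub.e_row[OF fs True])
    next
      case False
      then have "D.mm (fd_basis_idx B') (b' \<one>\<^bsub>\<Gamma>\<^esub>) (D.sc (e_fd B')) p x = \<zero>\<^bsub>D\<^esub>"
        using z(1)[OF \<Gamma>.one_closed] by (intro D.mm_zero_left D.closed_mat_sc) auto
      then show ?thesis using False by (simp add: lscal_def e_fd_def)
    qed
  qed
qed

text \<open>The identities of \<open>compat_rows\<close> read in the other direction, with the
  nonzero factors c and 1 / c cancelled.\<close>

lemma family_rows:
  assumes comp: "compatible \<Gamma> B' D b b'"
    and fs: "fw_sub B B' \<Gamma> c" and b': "fw_family D \<Gamma> B' b'" and g: "g \<in> carrier \<Gamma>" and h: "h \<in> carrier \<Gamma>" and p: "p \<in> (fd_basis_idx B')"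
  shows "lmult D (fd_basis_idx B) (madj D (b g)) (lmult D (fd_basis_idx B) (lscal D (K_fd B)) (b g)) p q = lscal D (K_fd B) p q"
    and "lmult D (fd_basis_idx B) (b g) (lmult D (fd_basis_idx B) (lscal D (Ki_fd B)) (madj D (b g))) p q = lscal D (Ki_fd B) p q"
    and "lmult D ((fd_basis_idx B) \<times> (fd_basis_idx B)) (lscal D (m_fd B)) (ltensor D (b g) (b h)) p t = lmult D (fd_basis_idx B) (b (g \<otimes>\<^bsub>\<Gamma>\<^esub> h)) (lscal D (m_fd B)) p t"
    and "lmult D (fd_basis_idx B) (b \<one>\<^bsub>\<Gamma>\<^esub>) (lscal D (e_fd B)) p x = lscal D (e_fd B) p x"
proof -
  note D = compatibleD(1)[OF comp] and closed = compatibleD(2)[OF comp] and closed' = compatibleD(3)[OF comp]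
    and zero' = compatibleD(4)[OF comp] and compat = compatibleD(5)[OF comp]
  interpret D: star_algebra D by (rule D)
  have "group \<Gamma>" using fs by (simp add: fw_sub_def fw_def)
  then interpret \<Gamma>: Group.group \<Gamma> .
  have c0: "c \<noteq> 0" using fs by (simp add: fw_sub_def fw_sub_axioms_def)
  have cl: "D.closed_mat (b g)" unfolding D.closed_mat_def using closed[OF g] by blast
  have cancel: "y = z" if "s \<odot>\<^bsub>D\<^esub> y = s \<odot>\<^bsub>D\<^esub> z" "s \<noteq> 0" "y \<in> carrier D" "z \<in> carrier D" for s y z
  proof -
    have "y = (1 / s) \<odot>\<^bsub>D\<^esub> (s \<odot>\<^bsub>D\<^esub> y)" using that(2,3) by simp
    also have "\<dots> = (1 / s) \<odot>\<^bsub>D\<^esub> (s \<odot>\<^bsub>D\<^esub> z)" by (simp only: that(1))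
    also have "\<dots> = z" using that(2,4) by simp
    finally show ?thesis .
  qed
  have gh: "g \<otimes>\<^bsub>\<Gamma>\<^esub> h \<in> carrier \<Gamma>" using g h by simp
  have U: "D.mm (fd_basis_idx B') (D.ma (b' g)) (D.mm (fd_basis_idx B') (D.sc (K_fd B')) (b' g)) = D.sc (K_fd B')"
    "D.mm (fd_basis_idx B') (b' g) (D.mm (fd_basis_idx B') (D.sc (Ki_fd B')) (D.ma (b' g))) = D.sc (Ki_fd B')"
    "D.mm ((fd_basis_idx B') \<times> (fd_basis_idx B')) (D.sc (m_fd B')) (ltensor D (b' g) (b' h)) = D.mm (fd_basis_idx B') (b' (g \<otimes>\<^bsub>\<Gamma>\<^esub> h)) (D.sc (m_fd B'))"
    "D.mm (fd_basis_idx B') (b' \<one>\<^bsub>\<Gamma>\<^esub>) (D.sc (e_fd B')) = D.sc (e_fd B')"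
    using fw_familyD(1)[OF b' g] fw_familyD(2)[OF b' g h] fw_familyD(3)[OF b'] unfolding gram_unitary_def by blast+
  have "c \<odot>\<^bsub>D\<^esub> D.mm (fd_basis_idx B) (D.ma (b g)) (D.mm (fd_basis_idx B) (D.sc (K_fd B)) (b g)) p q = c \<odot>\<^bsub>D\<^esub> D.sc (K_fd B) p q"
    unfolding compat_rows(1)[OF comp fs g g p, symmetric] U by (simp add: lscal_def fw_sub.K_row[OF fs p])
  then show "D.mm (fd_basis_idx B) (D.ma (b g)) (D.mm (fd_basis_idx B) (D.sc (K_fd B)) (b g)) p q = D.sc (K_fd B) p q"
    by (rule cancel) (use c0 cl in auto)
  have "(1 / c) \<odot>\<^bsub>D\<^esub> D.mm (fd_basis_idx B) (b g) (D.mm (fd_basis_idx B) (D.sc (Ki_fd B)) (D.ma (b g))) p q = (1 / c) \<odot>\<^bsub>D\<^esub> D.sc (Ki_fd B) p q"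
    unfolding compat_rows(2)[OF comp fs g g p, symmetric] U by (simp add: lscal_def fw_sub.Ki_row[OF fs p])
  then show "D.mm (fd_basis_idx B) (b g) (D.mm (fd_basis_idx B) (D.sc (Ki_fd B)) (D.ma (b g))) p q = D.sc (Ki_fd B) p q"
    by (rule cancel) (use c0 cl in auto)
  show "D.mm ((fd_basis_idx B) \<times> (fd_basis_idx B)) (D.sc (m_fd B)) (ltensor D (b g) (b h)) p t = D.mm (fd_basis_idx B) (b (g \<otimes>\<^bsub>\<Gamma>\<^esub> h)) (D.sc (m_fd B)) p t"
    unfolding compat_rows(3)[OF comp fs g h p, symmetric] compat_rows(4)[OF comp fs gh g p, symmetric] U ..
  show "D.mm (fd_basis_idx B) (b \<one>\<^bsub>\<Gamma>\<^esub>) (D.sc (e_fd B)) p x = D.sc (e_fd B) p x"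
    unfolding compat_rows(5)[OF comp fs \<Gamma>.one_closed g p, symmetric] U by (simp add: lscal_def fw_sub.e_row[OF fs p])
qed

text \<open>Relations can be checked one row at a time, so each row of a glued family may be
  referred to the summand that contains its index.\<close>

lemma fw_family_rowsI:
  fixes \<Gamma> :: "('g, 'm) monoid_scheme"
  assumes D: "star_algebra D" and \<Gamma>: "group \<Gamma>"
    and gc: "\<And>g p q. g \<in> carrier \<Gamma> \<Longrightarrow> b g p q \<in> carrier D"
    and z: "\<And>g p q. \<lbrakk>g \<in> carrier \<Gamma>; \<not> (p \<in> (fd_basis_idx B) \<and> q \<in> (fd_basis_idx B))\<rbrakk> \<Longrightarrow> b g p q = \<zero>\<^bsub>D\<^esub>"
    and rows: "\<And>g h p q. \<lbrakk>g \<in> carrier \<Gamma>; h \<in> carrier \<Gamma>; p \<in> (fd_basis_idx B)\<rbrakk> \<Longrightarrow>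
        lmult D (fd_basis_idx B) (madj D (b g)) (lmult D (fd_basis_idx B) (lscal D (K_fd B)) (b g)) p q = lscal D (K_fd B) p q"
      "\<And>g h p q. \<lbrakk>g \<in> carrier \<Gamma>; h \<in> carrier \<Gamma>; p \<in> (fd_basis_idx B)\<rbrakk> \<Longrightarrow>
        lmult D (fd_basis_idx B) (b g) (lmult D (fd_basis_idx B) (lscal D (Ki_fd B)) (madj D (b g))) p q = lscal D (Ki_fd B) p q"
      "\<And>g h p t. \<lbrakk>g \<in> carrier \<Gamma>; h \<in> carrier \<Gamma>; p \<in> (fd_basis_idx B)\<rbrakk> \<Longrightarrow>
        lmult D ((fd_basis_idx B) \<times> (fd_basis_idx B)) (lscal D (m_fd B)) (ltensor D (b g) (b h)) p t = lmult D (fd_basis_idx B) (b (g \<otimes>\<^bsub>\<Gamma>\<^esub> h)) (lscal D (m_fd B)) p t"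
      "\<And>g h p x. \<lbrakk>g \<in> carrier \<Gamma>; h \<in> carrier \<Gamma>; p \<in> (fd_basis_idx B)\<rbrakk> \<Longrightarrow>
        lmult D (fd_basis_idx B) (b \<one>\<^bsub>\<Gamma>\<^esub>) (lscal D (e_fd B)) p x = lscal D (e_fd B) p x"
  shows "fw_family D \<Gamma> B b"
proof -
  interpret D: star_algebra D by (rule D)
  interpret \<Gamma>: Group.group \<Gamma> by (rule \<Gamma>)
  have cl: "D.closed_mat (b g)" if "g \<in> carrier \<Gamma>" for g unfolding D.closed_mat_def using gc[OF that] by blast
  have z1: "b g p l = \<zero>\<^bsub>D\<^esub>" "D.ma (b g) p l = \<zero>\<^bsub>D\<^esub>" if "p \<notin> (fd_basis_idx B)" "g \<in> carrier \<Gamma>" for g p l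
    using z[OF that(2), of p l] z[OF that(2), of l p] that(1) by (simp_all add: madj_def)
  show ?thesis unfolding fw_family_def gram_unitary_def
  proof (intro conjI ballI allI impI ext)
    fix g h p q t assume g: "g \<in> carrier \<Gamma>" and h: "h \<in> carrier \<Gamma>"
    have gh: "g \<otimes>\<^bsub>\<Gamma>\<^esub> h \<in> carrier \<Gamma>" using g h by simp
    show "b g p q \<in> carrier D" by (rule gc[OF g])
    show "D.mm (fd_basis_idx B) (D.ma (b g)) (D.mm (fd_basis_idx B) (D.sc (K_fd B)) (b g)) p q = D.sc (K_fd B) p q"
    proof (cases "p \<in> (fd_basis_idx B)")
      case True
      show ?thesis by (rule rows(1)[OF g g True])
    next
      case False
      then have "D.mm (fd_basis_idx B) (D.ma (b g)) (D.mm (fd_basis_idx B) (D.sc (K_fd B)) (b g)) p q = \<zero>\<^bsub>D\<^esub>"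
        using cl[OF g] z1(2)[OF _ g] by (intro D.mm_zero_left D.closed_mat_mm D.closed_mat_sc) auto
      then show ?thesis using K_fd_zero[OF False, of q] by (simp add: lscal_def)
    qed
    show "D.mm (fd_basis_idx B) (b g) (D.mm (fd_basis_idx B) (D.sc (Ki_fd B)) (D.ma (b g))) p q = D.sc (Ki_fd B) p q"
    proof (cases "p \<in> (fd_basis_idx B)")
      case True
      show ?thesis by (rule rows(2)[OF g g True])
    next
      case False
      then have "D.mm (fd_basis_idx B) (b g) (D.mm (fd_basis_idx B) (D.sc (Ki_fd B)) (D.ma (b g))) p q = \<zero>\<^bsub>D\<^esub>"
        using cl[OF g] z1(1)[OF _ g] by (intro D.mm_zero_left D.closed_mat_mm D.closed_mat_sc D.closed_mat_ma) auto
      then show ?thesis using Ki_fd_zero[OF False, of q] by (simp add: lscal_def)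
    qed
    show "D.mm ((fd_basis_idx B) \<times> (fd_basis_idx B)) (D.sc (m_fd B)) (ltensor D (b g) (b h)) p t = D.mm (fd_basis_idx B) (b (g \<otimes>\<^bsub>\<Gamma>\<^esub> h)) (D.sc (m_fd B)) p t"
    proof (cases "p \<in> (fd_basis_idx B)")
      case True
      show ?thesis by (rule rows(3)[OF g h True])
    next
      case False
      then have "m_fd B p l = 0" for l by (auto simp: m_fd_def split: prod.splits)
      then have "D.mm ((fd_basis_idx B) \<times> (fd_basis_idx B)) (D.sc (m_fd B)) (ltensor D (b g) (b h)) p t = \<zero>\<^bsub>D\<^esub>"
        using cl[OF g] cl[OF h] by (intro D.mm_zero_left D.closed_mat_ltensor) (simp_all add: lscal_def)
      moreover have "D.mm (fd_basis_idx B) (b (g \<otimes>\<^bsub>\<Gamma>\<^esub> h)) (D.sc (m_fd B)) p t = \<zero>\<^bsub>D\<^esub>"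
        using z1(1)[OF False gh] by (intro D.mm_zero_left D.closed_mat_sc) auto
      ultimately show ?thesis by simp
    qed
  next
    fix g p q assume "g \<in> carrier \<Gamma>" "\<not> (p \<in> (fd_basis_idx B) \<and> q \<in> (fd_basis_idx B))"
    then show "b g p q = \<zero>\<^bsub>D\<^esub>" by (rule z)
  next
    fix p and x :: unit
    show "D.mm (fd_basis_idx B) (b \<one>\<^bsub>\<Gamma>\<^esub>) (D.sc (e_fd B)) p x = D.sc (e_fd B) p x"
    proof (cases "p \<in> (fd_basis_idx B)")
      case True
      show ?thesis by (rule rows(4)[OF \<Gamma>.one_closed \<Gamma>.one_closed True])
    next
      case False
      then have "D.mm (fd_basis_idx B) (b \<one>\<^bsub>\<Gamma>\<^esub>) (D.sc (e_fd B)) p x = \<zero>\<^bsub>D\<^esub>"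
        using z1(1)[OF _ \<Gamma>.one_closed] by (intro D.mm_zero_left D.closed_mat_sc) auto
      then show ?thesis using False by (simp add: lscal_def e_fd_def)
    qed
  qed
qed

section \<open>The isomorphism for a decomposition into sums of summands with different
  traces\<close>

locale fw_decomp = fw B \<Gamma> for B :: fd_alg and \<Gamma> :: "('g, 'm) monoid_scheme" +
  fixes I :: "nat set" and B' :: "nat \<Rightarrow> fd_alg" and c :: "nat \<Rightarrow> complex"
  assumes fw_sub: "i \<in> I \<Longrightarrow> fw_sub B (B' i) \<Gamma> (c i)"
    and cover: "\<alpha> \<in> blocks B \<Longrightarrow> \<exists>i\<in>I. \<alpha> \<in> blocks (B' i)"
    and separate: "\<lbrakk>i \<in> I; j \<in> I; \<alpha> \<in> blocks (B' i); \<beta> \<in> blocks (B' j); i \<noteq> j\<rbrakk>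
      \<Longrightarrow> mtrace (mat_inv (dens B \<alpha>)) \<noteq> mtrace (mat_inv (dens B \<beta>))"
begin

abbreviation "Ai i \<equiv> fw_alg \<Gamma> (B' i)"
abbreviation "Ji i \<equiv> fd_basis_idx (B' i)"
abbreviation "coi i \<equiv> fw_co \<Gamma> (B' i)"
abbreviation "F \<equiv> free_prod I Ai"
abbreviation "\<iota> \<equiv> free_prod_incl I Ai"

lemma fwi: "i \<in> I \<Longrightarrow> fw (B' i) \<Gamma>"
  using fw_sub by (simp add: fw_sub_def)

lemma cstar_Ai: "i \<in> I \<Longrightarrow> cstar_algebra (Ai i)"
  by (rule fw.cstar_algebra_fw[OF fwi])

sublocale fp: free_product I Ai
  by (rule free_product.intro) (rule cstar_Ai)

lemma Ji_sub: "i \<in> I \<Longrightarrow> Ji i \<subseteq> J"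
  by (rule fw_sub.J'_sub[OF fw_sub])

lemma Ji_disjoint: "\<lbrakk>i \<in> I; j \<in> I; p \<in> Ji i; p \<in> Ji j\<rbrakk> \<Longrightarrow> i = j"
proof (rule ccontr)
  assume ij: "i \<in> I" "j \<in> I" "p \<in> Ji i" "p \<in> Ji j" "i \<noteq> j"
  then have "fst p \<in> blocks (B' i)" "fst p \<in> blocks (B' j)" by (auto simp: fd_basis_idx_def)
  then show False using separate[OF ij(1,2) _ _ ij(5)] by blast
qed

lemma Ji_cover:
  assumes "p \<in> J"
  obtains i where "i \<in> I" "p \<in> Ji i"
proof -
  have "fst p \<in> blocks B" using assms by (auto simp: fd_basis_idx_def)
  then obtain i where i: "i \<in> I" "fst p \<in> blocks (B' i)" using cover by blast
  then have "p \<in> Ji i" unfolding fw_sub.J'_eq[OF fw_sub[OF i(1)]] using assms by blast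
  then show thesis by (rule that[OF i(1)])
qed

text \<open>The block diagonal family with blocks \<open>b i\<close>: the row index selects the
  block, and \<open>b i\<close>, being extended by 0, supplies the zeros outside it.\<close>

definition glue :: "('a, 'z) star_alg_scheme \<Rightarrow> (nat \<Rightarrow> 'g \<Rightarrow> fd_idx \<Rightarrow> fd_idx \<Rightarrow> 'a) \<Rightarrow> 'g \<Rightarrow> fd_idx \<Rightarrow> fd_idx \<Rightarrow> 'a" where
  "glue D b g p q = (if p \<in> J then b (THE i. i \<in> I \<and> p \<in> Ji i) g p q else \<zero>\<^bsub>D\<^esub>)"

lemma glue_row: "\<lbrakk>i \<in> I; p \<in> Ji i\<rbrakk> \<Longrightarrow> glue D b g p q = b i g p q"
proof -
  assume i: "i \<in> I" and p: "p \<in> Ji i"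
  then have "(THE i. i \<in> I \<and> p \<in> Ji i) = i" using Ji_disjoint by (intro the_equality) blast+
  then show ?thesis using Ji_sub[OF i] p by (auto simp: glue_def)
qed

lemma fw_family_glue:
  assumes D: "star_algebra D" and b: "\<And>i. i \<in> I \<Longrightarrow> fw_family D \<Gamma> (B' i) (b i)"
  shows "fw_family D \<Gamma> B (glue D b)"
proof -
  interpret D: star_algebra D by (rule D)
  have bc: "b i g p q \<in> carrier D" and b0: "\<not> (p \<in> Ji i \<and> q \<in> Ji i) \<Longrightarrow> b i g p q = \<zero>\<^bsub>D\<^esub>"
    if "i \<in> I" "g \<in> carrier \<Gamma>" for i g p q
    using fw_familyD(1)[OF b[OF that(1)] that(2)] unfolding gram_unitary_def by blast+
  have gc: "glue D b g p q \<in> carrier D" if g: "g \<in> carrier \<Gamma>" for g p q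
  proof (cases "p \<in> J")
    case True
    then obtain i where i: "i \<in> I" "p \<in> Ji i" by (rule Ji_cover)
    show ?thesis unfolding glue_row[OF i] by (rule bc[OF i(1) g])
  qed (simp add: glue_def)
  have comp: "glue D b g p q = b i g p q" if i: "i \<in> I" and g: "g \<in> carrier \<Gamma>" and pq: "p \<in> Ji i \<or> q \<in> Ji i" for i g p q
  proof (cases "p \<in> Ji i")
    case True
    then show ?thesis by (rule glue_row[OF i])
  next
    case False
    then have q: "q \<in> Ji i" using pq by blast
    show ?thesis
    proof (cases "p \<in> J")
      case True
      then obtain j where j: "j \<in> I" "p \<in> Ji j" by (rule Ji_cover)
      then have "q \<notin> Ji j" using Ji_disjoint[OF i j(1) q] False by blast
      then show ?thesis unfolding glue_row[OF j] using b0[OF j(1) g, of p q] b0[OF i g, of p q] False by simp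
    next
      case p: False
      then show ?thesis using b0[OF i g, of p q] False by (simp add: glue_def)
    qed
  qed
  have cp: "compatible \<Gamma> (B' i) D (glue D b) (b i)" if i: "i \<in> I" for i
    unfolding compatible_def by (intro conjI ballI allI impI D gc bc[OF i] b0[OF i] comp[OF i]) assumption+
  note rows = family_rows[OF cp fw_sub b]
  have z2: "glue D b g l p = \<zero>\<^bsub>D\<^esub>" if p: "p \<notin> J" and g: "g \<in> carrier \<Gamma>" for g p l
  proof (cases "l \<in> J")
    case True
    then obtain i where i: "i \<in> I" "l \<in> Ji i" by (rule Ji_cover)
    have "\<not> (l \<in> Ji i \<and> p \<in> Ji i)" using p Ji_sub[OF i(1)] by blast
    then show ?thesis unfolding glue_row[OF i] by (rule b0[OF i(1) g])
  qed (simp add: glue_def)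
  show ?thesis
  proof (rule fw_family_rowsI[OF D \<Gamma>.group_axioms gc])
    fix g p q assume "g \<in> carrier \<Gamma>" "\<not> (p \<in> J \<and> q \<in> J)"
    then show "glue D b g p q = \<zero>\<^bsub>D\<^esub>" using z2[of q g p] by (cases "p \<in> J") (auto simp: glue_def)
  next
    fix g h p q t x assume g: "g \<in> carrier \<Gamma>" and h: "h \<in> carrier \<Gamma>" and "p \<in> J"
    then obtain i where i: "i \<in> I" "p \<in> Ji i" using Ji_cover by blast
    note r = rows[OF i(1) i(1) i(1) g h i(2)]
    show "D.mm J (D.ma (glue D b g)) (D.mm J (D.sc (K_fd B)) (glue D b g)) p q = D.sc (K_fd B) p q"
      "D.mm J (glue D b g) (D.mm J (D.sc (Ki_fd B)) (D.ma (glue D b g))) p q = D.sc (Ki_fd B) p q"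
      "D.mm (J \<times> J) (D.sc (m_fd B)) (ltensor D (glue D b g) (glue D b h)) p t = D.mm J (glue D b (g \<otimes>\<^bsub>\<Gamma>\<^esub> h)) (D.sc (m_fd B)) p t"
      "D.mm J (glue D b \<one>\<^bsub>\<Gamma>\<^esub>) (D.sc (e_fd B)) p x = D.sc (e_fd B) p x"
      by (rule r)+
  qed
qed

definition res :: "nat \<Rightarrow> 'g \<Rightarrow> fd_idx \<Rightarrow> fd_idx \<Rightarrow> 'g fw_elem" where
  "res i g p q = (if p \<in> Ji i \<and> q \<in> Ji i then fw_co \<Gamma> B g p q else \<zero>\<^bsub>A\<^esub>)"

text \<open>The two indices lie in different parts of the decomposition, where the traces of Q^-1
  differ, so \<open>family_diag\<close> applies to the universal family; if one of them is no basis
  index, the entry is 0 by the extension.\<close>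

lemma co_off:
  assumes i: "i \<in> I" and g: "g \<in> carrier \<Gamma>" and pq: "(p \<in> Ji i) \<noteq> (q \<in> Ji i)"
  shows "fw_co \<Gamma> B g p q = \<zero>\<^bsub>A\<^esub>"
proof (cases "p \<in> J \<and> q \<in> J")
  case True
  interpret A: cstar_algebra A by (rule cstar_algebra_fw)
  obtain j where j: "j \<in> I" "p \<in> Ji j" using True Ji_cover by blast
  obtain k where k: "k \<in> I" "q \<in> Ji k" using True Ji_cover by blast
  have "j \<noteq> k" using pq i j k Ji_disjoint by metis
  then have "mtrace (mat_inv (dens B (fst p))) \<noteq> mtrace (mat_inv (dens B (fst q)))"
    using separate[OF j(1) k(1), of "fst p" "fst q"] j(2) k(2) by (auto simp: fd_basis_idx_def)
  then show ?thesis using family_diag[OF A.star_algebra_axioms fw_family_co g] True by blast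
qed (rule co_zero)

lemma fw_family_res: "i \<in> I \<Longrightarrow> fw_family A \<Gamma> (B' i) (res i)"
proof -
  assume i: "i \<in> I"
  interpret A: cstar_algebra A by (rule cstar_algebra_fw)
  show ?thesis
    by (rule family_restrict[OF _ fw_sub[OF i] fw_family_co], unfold compatible_def)
      (use co_off[OF i] co_closed A.star_algebra_axioms in \<open>auto simp: res_def\<close>)
qed

lemma cqg_iso_decomp: "\<exists>\<Phi>. cqg_iso (free_wreath \<Gamma> B) (cqg_free_prod I (\<lambda>i. free_wreath \<Gamma> (B' i))) \<Phi>"
proof -
  note cA = cstar_algebra_fw and cF = fp.cstar_algebra_free_prod
  interpret A: cstar_algebra A by (rule cA)
  interpret F: cstar_algebra F by (rule cF)
  have coi: "fw_family F \<Gamma> (B' i) (\<lambda>g p q. \<iota> i (coi i g p q))" if i: "i \<in> I" for i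
  proof -
    interpret Ai: cstar_algebra "Ai i" by (rule cstar_Ai[OF i])
    interpret h: star_morphism "Ai i" F "\<iota> i"
      by (rule star_morphism.intro[OF Ai.star_algebra_axioms F.star_algebra_axioms]) (unfold_locales, rule fp.star_hom_incl[OF i])
    show ?thesis by (rule h.map_fw_family[OF fw.fw_family_co[OF fwi[OF i]] \<Gamma>.group_axioms])
  qed
  let ?f = "glue F (\<lambda>i g p q. \<iota> i (coi i g p q))"
  obtain \<Phi> where \<Phi>: "star_hom A F \<Phi>" "\<And>g p q. g \<in> carrier \<Gamma> \<Longrightarrow> \<Phi> (fw_co \<Gamma> B g p q) = ?f g p q"
    using fw_hom_ex[OF cF fw_family_glue[OF F.star_algebra_axioms coi]] by blast
  \<comment> \<open>Choosing one homomorphism for every i gives a function of i, as the universal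
    property of the free product expects.\<close>
  define \<psi> where "\<psi> i = (SOME h. star_hom (Ai i) A h \<and> (\<forall>g\<in>carrier \<Gamma>. \<forall>p q. h (coi i g p q) = res i g p q))" for i
  have \<psi>0: "star_hom (Ai i) A (\<psi> i) \<and> (\<forall>g\<in>carrier \<Gamma>. \<forall>p q. \<psi> i (coi i g p q) = res i g p q)" if "i \<in> I" for i
    unfolding \<psi>_def by (rule someI_ex[OF fw.fw_hom_ex[OF fwi[OF that] cA fw_family_res[OF that]]])
  have \<psi>: "i \<in> I \<Longrightarrow> star_hom (Ai i) A (\<psi> i)" "\<lbrakk>i \<in> I; g \<in> carrier \<Gamma>\<rbrakk> \<Longrightarrow> \<psi> i (coi i g p q) = res i g p q" for i g p q
    using \<psi>0 by blast+
  obtain \<Psi> where \<Psi>: "star_hom F A \<Psi>" "\<And>i a. \<lbrakk>i \<in> I; a \<in> carrier (Ai i)\<rbrakk> \<Longrightarrow> \<Psi> (\<iota> i a) = \<psi> i a"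
    using fp.free_prod_hom_ex[OF cA \<psi>(1)] by blast
  have coi_closed: "coi i g p q \<in> carrier (Ai i)" if "i \<in> I" "g \<in> carrier \<Gamma>" for i g p q
    by (rule fw.co_closed[OF fwi[OF that(1)] that(2)])
  have \<Phi>_co: "\<Phi> (fw_co \<Gamma> B g p q) = \<iota> i (coi i g p q)" if "g \<in> carrier \<Gamma>" "i \<in> I" "p \<in> Ji i" for g i p q
    using \<Phi>(2)[OF that(1)] glue_row[OF that(2,3)] by simp
  have id_hom: "star_hom C C (\<lambda>x. x)" if "star_algebra C" for C :: "'x cstar"
  proof -
    interpret star_algebra C by (rule that)
    show ?thesis by (rule star_homI) simp_all
  qed
  have inv1: "\<Psi> (\<Phi> x) = x" if x: "x \<in> carrier A" for x
  proof (rule fw_hom_eqI[OF cA star_hom_comp[OF \<Phi>(1) \<Psi>(1)] id_hom[OF A.star_algebra_axioms] _ x])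
    fix g p q assume g: "g \<in> carrier \<Gamma>" and p: "p \<in> J" and q: "q \<in> J"
    from p obtain i where i: "i \<in> I" "p \<in> Ji i" by (rule Ji_cover)
    have "\<Psi> (\<Phi> (fw_co \<Gamma> B g p q)) = res i g p q"
      by (simp add: \<Phi>_co[OF g i] \<Psi>(2)[OF i(1) coi_closed[OF i(1) g]] \<psi>(2)[OF i(1) g])
    also have "\<dots> = fw_co \<Gamma> B g p q" using i(2) co_off[OF i(1) g, of p q] by (simp add: res_def)
    finally show "\<Psi> (\<Phi> (fw_co \<Gamma> B g p q)) = fw_co \<Gamma> B g p q" .
  qed
  have inv2: "\<Phi> (\<Psi> y) = y" if y: "y \<in> carrier F" for y
  proof (rule fp.free_prod_hom_eqI[OF cF star_hom_comp[OF \<Psi>(1) \<Phi>(1)] id_hom[OF F.star_algebra_axioms] _ y])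
    fix i a assume i: "i \<in> I" and a: "a \<in> carrier (Ai i)"
    have "\<Phi> (\<psi> i a) = \<iota> i a"
    proof (rule fw.fw_hom_eqI[OF fwi[OF i] cF star_hom_comp[OF \<psi>(1)[OF i] \<Phi>(1)] fp.star_hom_incl[OF i] _ a])
      fix g p q assume g: "g \<in> carrier \<Gamma>" and p: "p \<in> Ji i" and q: "q \<in> Ji i"
      show "\<Phi> (\<psi> i (coi i g p q)) = \<iota> i (coi i g p q)"
        using \<Phi>_co[OF g i p, of q] p q by (simp add: \<psi>(2)[OF i g] res_def)
    qed
    then show "\<Phi> (\<Psi> (\<iota> i a)) = \<iota> i a" by (simp add: \<Psi>(2)[OF i a])
  qed
  interpret \<Phi>: star_morphism A F \<Phi>
    by (rule star_morphism.intro[OF A.star_algebra_axioms F.star_algebra_axioms]) (unfold_locales, rule \<Phi>(1))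
  interpret \<Psi>: star_morphism F A \<Psi>
    by (rule star_morphism.intro[OF F.star_algebra_axioms A.star_algebra_axioms]) (unfold_locales, rule \<Psi>(1))
  have iso: "star_iso A F \<Phi>" unfolding star_iso_def
  proof (intro conjI ballI)
    show "star_hom A F \<Phi>" by (rule \<Phi>(1))
    show "bij_betw \<Phi> (carrier A) (carrier F)"
      by (rule bij_betw_byWitness[of _ \<Psi>]) (use inv1 inv2 in auto)
    fix x assume x: "x \<in> carrier A"
    show "nrm F (\<Phi> x) = nrm A x"
      using star_hom_contractive[OF cA cF \<Phi>(1) x] star_hom_contractive[OF cF cA \<Psi>(1) \<Phi>.closed[OF x]] inv1[OF x] by simp
  qed
  let ?G = "\<lambda>i. free_wreath \<Gamma> (B' i)" and ?TF = "min_tensor F F"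
  have G: "cqg_alg (?G i) = Ai i" "comult (?G i) = fw_comult \<Gamma> (B' i)" for i by (simp_all add: free_wreath_def)
  have G': "cstar_algebra (cqg_alg (?G i))" "star_hom (cqg_alg (?G i)) (min_tensor (cqg_alg (?G i)) (cqg_alg (?G i))) (comult (?G i))"
    if "i \<in> I" for i
    unfolding G by (rule cstar_Ai[OF that], rule fw.star_hom_fw_comult[OF fwi[OF that]])
  note fpc = star_hom_free_prod_comult[of I ?G, OF G', unfolded G] free_prod_comult_incl[of I ?G, OF G', unfolded G]
  interpret TA: tensor_pair A A by (simp add: tensor_pair_def cA)
  interpret TF: tensor_pair F F by (simp add: tensor_pair_def cF)
  let ?fpc = "free_prod_comult I ?G" and ?th = "tensor_hom A A F F \<Phi> \<Phi>"
  note th = star_hom_tensor_hom[OF cA cA cF cF \<Phi>(1) \<Phi>(1)] tensor_hom_elem[OF cA cA cF cF \<Phi>(1) \<Phi>(1)]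
  have hl: "star_hom A ?TF (\<lambda>x. ?fpc (\<Phi> x))" by (rule star_hom_comp[OF \<Phi>(1) fpc(1)])
  have hr: "star_hom A ?TF (\<lambda>x. ?th (fw_comult \<Gamma> B x))" by (rule star_hom_comp[OF star_hom_fw_comult th(1)])
  interpret hl: star_morphism A ?TF "\<lambda>x. ?fpc (\<Phi> x)"
    by (rule star_morphism.intro[OF A.star_algebra_axioms TF.T.star_algebra_axioms]) (unfold_locales, rule hl)
  interpret hr: star_morphism A ?TF "\<lambda>x. ?th (fw_comult \<Gamma> B x)"
    by (rule star_morphism.intro[OF A.star_algebra_axioms TF.T.star_algebra_axioms]) (unfold_locales, rule hr)
  interpret th: star_morphism "min_tensor A A" ?TF ?th
    by (rule star_morphism.intro[OF TA.T.star_algebra_axioms TF.T.star_algebra_axioms]) (unfold_locales, rule th(1))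
  have comult: "?fpc (\<Phi> x) = ?th (fw_comult \<Gamma> B x)" if x: "x \<in> carrier A" for x
  proof (rule fw_hom_eqI[OF TF.cstar_algebra_T hl hr _ x])
    fix g p q assume g: "g \<in> carrier \<Gamma>" and p: "p \<in> J" and q: "q \<in> J"
    from p obtain i where i: "i \<in> I" "p \<in> Ji i" by (rule Ji_cover)
    interpret Ai: cstar_algebra "Ai i" by (rule cstar_Ai[OF i(1)])
    interpret TAi: tensor_pair "Ai i" "Ai i" by (simp add: tensor_pair_def cstar_Ai[OF i(1)])
    note \<iota> = fp.star_hom_incl[OF i(1)]
    interpret \<iota>: star_morphism "Ai i" F "\<iota> i"
      by (rule star_morphism.intro[OF Ai.star_algebra_axioms F.star_algebra_axioms]) (unfold_locales, rule \<iota>)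
    note thi = star_hom_tensor_hom[OF cstar_Ai[OF i(1)] cstar_Ai[OF i(1)] cF cF \<iota> \<iota>]
      tensor_hom_elem[OF cstar_Ai[OF i(1)] cstar_Ai[OF i(1)] cF cF \<iota> \<iota>]
    interpret thi: star_morphism "min_tensor (Ai i) (Ai i)" ?TF "tensor_hom (Ai i) (Ai i) F F (\<iota> i) (\<iota> i)"
      by (rule star_morphism.intro[OF TAi.T.star_algebra_axioms TF.T.star_algebra_axioms]) (unfold_locales, rule thi(1))
    show "?fpc (\<Phi> (fw_co \<Gamma> B g p q)) = ?th (fw_comult \<Gamma> B (fw_co \<Gamma> B g p q))"
    proof (cases "q \<in> Ji i")
      case False
      then have "fw_co \<Gamma> B g p q = \<zero>\<^bsub>A\<^esub>" using co_off[OF i(1) g] i(2) by blast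
      then show ?thesis using hl.map_zero hr.map_zero by simp
    next
      case True
      note cl = co_closed[OF g] and cli = coi_closed[OF i(1) g]
      have "?fpc (\<Phi> (fw_co \<Gamma> B g p q)) = tensor_hom (Ai i) (Ai i) F F (\<iota> i) (\<iota> i) (fw_comult \<Gamma> (B' i) (coi i g p q))"
        unfolding \<Phi>_co[OF g i] by (rule fpc(2)[OF _ _ i(1) cli])
      also have "\<dots> = (\<Oplus>\<^bsub>?TF\<^esub>r\<in>Ji i. tensor_hom (Ai i) (Ai i) F F (\<iota> i) (\<iota> i)
          (elem_tensor (Ai i) (Ai i) (coi i g p r) (coi i g r q)))"
        unfolding fw.fw_comult_co[OF fwi[OF i(1)] g i(2) True] using cli by (intro thi.map_finsum) auto
      also have "\<dots> = (\<Oplus>\<^bsub>?TF\<^esub>r\<in>Ji i. elem_tensor F F (\<Phi> (fw_co \<Gamma> B g p r)) (\<Phi> (fw_co \<Gamma> B g r q)))"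
        using cl cli by (intro TF.T.finsum_cong' refl) (auto simp: thi(2) \<Phi>_co[OF g i] \<Phi>_co[OF g i(1)])
      \<comment> \<open>The comultiplication of the summand sums over its own basis, that of B over
        the whole basis. The additional terms vanish because a(g)_pr = 0 for r outside the summand
        of p.\<close>
      also have "\<dots> = (\<Oplus>\<^bsub>?TF\<^esub>r\<in>J. elem_tensor F F (\<Phi> (fw_co \<Gamma> B g p r)) (\<Phi> (fw_co \<Gamma> B g r q)))"
      proof (rule TF.T.finsum_subset[symmetric, OF fin Ji_sub[OF i(1)]])
        fix r assume "r \<in> J - Ji i"
        then have "fw_co \<Gamma> B g p r = \<zero>\<^bsub>A\<^esub>" using co_off[OF i(1) g] i(2) by blast
        then show "elem_tensor F F (\<Phi> (fw_co \<Gamma> B g p r)) (\<Phi> (fw_co \<Gamma> B g r q)) = \<zero>\<^bsub>?TF\<^esub>"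
          using cl by (simp add: TF.et_zero_left)
      qed (use cl in auto)
      also have "\<dots> = (\<Oplus>\<^bsub>?TF\<^esub>r\<in>J. ?th (elem_tensor A A (fw_co \<Gamma> B g p r) (fw_co \<Gamma> B g r q)))"
        using cl by (intro TF.T.finsum_cong' refl) (auto simp: th(2))
      also have "\<dots> = ?th (fw_comult \<Gamma> B (fw_co \<Gamma> B g p q))"
        unfolding fw_comult_co[OF g p q] using cl by (intro th.map_finsum[symmetric]) auto
      finally show ?thesis .
    qed
  qed
  have "cqg_iso (free_wreath \<Gamma> B) (cqg_free_prod I ?G) \<Phi>"
    unfolding cqg_iso_def Let_def using iso comult by (simp add: cqg_free_prod_def free_wreath_def)
  then show ?thesis by blast
qed

end

section \<open>Application to the decomposition by the values of Tr(Q^-1)\<close>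

lemma mtrace_smult: "mtrace (z \<cdot>\<^sub>m M) = z * mtrace M" if "M \<in> carrier_mat n n"
  using that by (simp add: mtrace_def sum_distrib_left)

lemma fd_state_one:
  assumes "\<And>\<alpha>. \<alpha> \<in> blocks B \<Longrightarrow> pos_def (dims B \<alpha>) (dens B \<alpha>)"
  shows "fd_state B (fd_one B) = (\<Sum>\<alpha>\<in>blocks B. mtrace (dens B \<alpha>))"
  unfolding fd_state_def fd_one_def
proof (intro sum.cong refl arg_cong[where f = mtrace])
  fix \<alpha> assume "\<alpha> \<in> blocks B"
  then have "dens B \<alpha> \<in> carrier_mat (dims B \<alpha>) (dims B \<alpha>)" using assms by (simp add: pos_def_def)
  then show "dens B \<alpha> * 1\<^sub>m (dims B \<alpha>) = dens B \<alpha>" by (rule right_mult_one_mat)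
qed

text \<open>The bijection \<open>\<delta>\<close> enumerates the distinct values of Tr(Q^-1). The
  claims on a single summand separate two readings of the constant: m m^* is Tr(Q^-1) for the
  restricted functional as it stands, and Tr(Q) Tr(Q^-1) once the functional is normalised.\<close>

theorem proposition2p12:
  fixes \<Gamma> :: "('g, 'm) monoid_scheme"
    and B :: fd_alg and c d :: nat and \<delta> :: "nat \<Rightarrow> real"
  assumes "group \<Gamma>"
    and "faithful_state B" and "blocks B = {1..c}"
    and "bij_betw (\<lambda>i. complex_of_real (\<delta> i)) {1..d}
           ((\<lambda>\<alpha>. mtrace (mat_inv (dens B \<alpha>))) ` {1..c})"
  defines "B' \<equiv> \<lambda>i. normalize_state (restrict_blocks B
             {\<alpha> \<in> {1..c}. mtrace (mat_inv (dens B \<alpha>)) = complex_of_real (\<delta> i)})"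
  shows "(\<forall>\<alpha>\<in>{1..c}.
            mult_coisometry_upto (restrict_blocks B {\<alpha>}) (mtrace (mat_inv (dens B \<alpha>)))
            \<and> delta_form (normalize_state (restrict_blocks B {\<alpha>}))
                (mtrace (dens B \<alpha>) * mtrace (mat_inv (dens B \<alpha>))))
         \<and> (\<exists>\<Phi>. cqg_iso (free_wreath \<Gamma> B)
                 (cqg_free_prod {1..d} (\<lambda>i. free_wreath \<Gamma> (B' i))) \<Phi>)"
proof (intro conjI ballI)
  have dp: "0 < dims B \<alpha>" and pd: "pos_def (dims B \<alpha>) (dens B \<alpha>)" if "\<alpha> \<in> {1..c}" for \<alpha>
    using assms(2,3) that by (auto simp: faithful_state_def)
  let ?S = "\<lambda>T. fd_state (restrict_blocks B T) (fd_one (restrict_blocks B T))"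
  have S: "?S T = (\<Sum>\<alpha>\<in>T. mtrace (dens B \<alpha>))" if "T \<subseteq> {1..c}" for T
  proof -
    have "pos_def (dims (restrict_blocks B T) \<alpha>) (dens (restrict_blocks B T) \<alpha>)" if "\<alpha> \<in> blocks (restrict_blocks B T)" for \<alpha>
      using that pd[of \<alpha>] \<open>T \<subseteq> {1..c}\<close> by (auto simp: restrict_blocks_def)
    from fd_state_one[OF this] show ?thesis by (simp add: restrict_blocks_def)
  qed
  have S_pos: "0 < ?S T" if "T \<subseteq> {1..c}" "T \<noteq> {}" for T
    unfolding S[OF that(1)]
  proof (rule sum_pos)
    show "finite T" by (rule finite_subset[OF that(1)]) simp
    show "T \<noteq> {}" by (rule that(2))
    fix \<alpha> assume "\<alpha> \<in> T"
    then have \<alpha>: "\<alpha> \<in> {1..c}" by (rule subsetD[OF that(1)])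
    show "0 < mtrace (dens B \<alpha>)" by (rule pos_def_trace[OF pd[OF \<alpha>] dp[OF \<alpha>]])
  qed
  have N: "blocks (normalize_state (restrict_blocks B T)) = T" "dims (normalize_state (restrict_blocks B T)) = dims B"
    "dens (normalize_state (restrict_blocks B T)) \<alpha> = (1 / ?S T) \<cdot>\<^sub>m dens B \<alpha>" for T \<alpha>
    by (simp_all add: normalize_state_def restrict_blocks_def)
  have inv_pos: "0 < 1 / z" if "0 < z" for z :: complex
    using that by (auto simp: less_complex_def Re_divide Im_divide complex_eq_iff)
  have Npd: "pos_def (dims B \<alpha>) ((1 / ?S T) \<cdot>\<^sub>m dens B \<alpha>)" if "T \<subseteq> {1..c}" "\<alpha> \<in> T" for T \<alpha>
    by (rule pos_def_smult[OF pd[OF subsetD[OF that]] inv_pos[OF S_pos[OF that(1)]]]) (use that(2) in blast)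
  have Nok: "fd_ok (normalize_state (restrict_blocks B T))" if "T \<subseteq> {1..c}" for T
    unfolding fd_ok_def N
  proof (intro conjI ballI)
    show "finite T" by (rule finite_subset[OF that]) simp
    fix \<alpha> assume \<alpha>: "\<alpha> \<in> T"
    then show "0 < dims B \<alpha>" by (rule dp[OF subsetD[OF that]])
    show "pos_def (dims B \<alpha>) ((1 / ?S T) \<cdot>\<^sub>m dens B \<alpha>)" by (rule Npd[OF that \<alpha>])
  qed
  {
    fix \<alpha> assume \<alpha>: "\<alpha> \<in> {1..c}"
    have "fd_ok (restrict_blocks B {\<alpha>})" using dp[OF \<alpha>] pd[OF \<alpha>] by (simp add: fd_ok_def restrict_blocks_def)
    then show "mult_coisometry_upto (restrict_blocks B {\<alpha>}) (mtrace (mat_inv (dens B \<alpha>)))"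
      by (intro fd.mult_coisometry fd.intro) (simp_all add: restrict_blocks_def)
    let ?N = "normalize_state (restrict_blocks B {\<alpha>})" and ?Q = "dens B \<alpha>"
    have Q: "?Q \<in> carrier_mat (dims B \<alpha>) (dims B \<alpha>)" using pd[OF \<alpha>] by (simp add: pos_def_def)
    have t: "0 < mtrace ?Q" by (rule pos_def_trace[OF pd[OF \<alpha>] dp[OF \<alpha>]])
    have S\<alpha>: "?S {\<alpha>} = mtrace ?Q" using S[of "{\<alpha>}"] \<alpha> by simp
    have ok: "fd_ok ?N" using Nok[of "{\<alpha>}"] \<alpha> by simp
    have pdN: "pos_def (dims B \<alpha>) ((1 / mtrace ?Q) \<cdot>\<^sub>m ?Q)" using Npd[of "{\<alpha>}" \<alpha>] \<alpha> by (simp add: S\<alpha>)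
    have "(\<Sum>\<beta>\<in>blocks ?N. mtrace (dens ?N \<beta>)) = 1"
      unfolding N using t by (simp add: S\<alpha> mtrace_smult[OF Q])
    then have f: "faithful_state ?N" using ok by (simp add: faithful_state_def fd_ok_def)
    \<comment> \<open>Normalising divides Q by its trace, which multiplies the inverse of Q by that
      trace.\<close>
    have inv: "mtrace (mat_inv ((1 / mtrace ?Q) \<cdot>\<^sub>m ?Q)) = mtrace ?Q * mtrace (mat_inv ?Q)"
      using t by (subst mat_inv_smult[OF pd[OF \<alpha>] _ pdN]) (auto simp: mtrace_smult[OF mat_inv_closed[OF pd[OF \<alpha>]]])
    have "0 < mtrace ?Q * mtrace (mat_inv ?Q)"
      using t pos_def_trace[OF pos_def_mat_inv[OF pd[OF \<alpha>]] dp[OF \<alpha>]] by (auto simp: less_complex_def)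
    moreover have "mult_coisometry_upto ?N (mtrace ?Q * mtrace (mat_inv ?Q))"
    proof (rule fd.mult_coisometry[OF fd.intro[OF ok]])
      fix \<beta> assume "\<beta> \<in> blocks ?N"
      then have "\<beta> = \<alpha>" by (simp add: N)
      then show "mtrace (mat_inv (dens ?N \<beta>)) = mtrace ?Q * mtrace (mat_inv ?Q)" by (simp add: N S\<alpha> inv)
    qed
    ultimately show "delta_form ?N (mtrace ?Q * mtrace (mat_inv ?Q))" using f by (simp add: delta_form_def)
  }
  let ?T = "\<lambda>i. {\<alpha> \<in> {1..c}. mtrace (mat_inv (dens B \<alpha>)) = complex_of_real (\<delta> i)}"
  have "fd_ok B" using assms(2) by (simp add: fd_ok_def faithful_state_def)
  then have fw: "fw B \<Gamma>" by (rule fw.intro[OF fd.intro assms(1)])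
  have "fw_decomp B \<Gamma> {1..d} B' (\<lambda>i. 1 / ?S (?T i))"
  proof (rule fw_decomp.intro[OF fw], rule fw_decomp_axioms.intro)
    fix i assume i: "i \<in> {1..d}"
    have "complex_of_real (\<delta> i) \<in> (\<lambda>\<alpha>. mtrace (mat_inv (dens B \<alpha>))) ` {1..c}"
      using bij_betwE[OF assms(4)] i by blast
    then obtain \<alpha> where "\<alpha> \<in> {1..c}" "complex_of_real (\<delta> i) = mtrace (mat_inv (dens B \<alpha>))" by blast
    \<comment> \<open>Every value \<open>\<delta> i\<close> is attained, so the corresponding
      summand is nonzero and the functional has positive mass on it; the normalising factor is
      therefore the reciprocal of a positive number.\<close>
    then have ne: "?T i \<noteq> {}" by (metis (mono_tags, lifting) empty_iff mem_Collect_eq)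
    have sub: "?T i \<subseteq> {1..c}" by blast
    show "fw_sub B (B' i) \<Gamma> (1 / ?S (?T i))"
    proof (rule fw_sub.intro[OF fw])
      show "fw (B' i) \<Gamma>" unfolding B'_def by (rule fw.intro[OF fd.intro[OF Nok[OF sub]] assms(1)])
      show "fw_sub_axioms B (B' i) (1 / ?S (?T i))"
      proof (rule fw_sub_axioms.intro)
        show "blocks (B' i) \<subseteq> blocks B" unfolding B'_def N assms(3) by (rule sub)
        show "dims (B' i) = dims B" unfolding B'_def N ..
        show "dens (B' i) \<alpha> = (1 / ?S (?T i)) \<cdot>\<^sub>m dens B \<alpha>" for \<alpha> unfolding B'_def N ..
        show "1 / ?S (?T i) \<noteq> 0" by (rule not_sym[OF less_imp_neq[OF inv_pos[OF S_pos[OF sub ne]]]])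
      qed
    qed
  next
    fix \<alpha> assume \<alpha>: "\<alpha> \<in> blocks B"
    then have \<alpha>': "\<alpha> \<in> {1..c}" by (simp only: assms(3))
    then have "mtrace (mat_inv (dens B \<alpha>)) \<in> (\<lambda>i. complex_of_real (\<delta> i)) ` {1..d}"
      unfolding bij_betw_imp_surj_on[OF assms(4)] by blast
    then obtain i where i: "i \<in> {1..d}" "mtrace (mat_inv (dens B \<alpha>)) = complex_of_real (\<delta> i)" by blast
    then have "\<alpha> \<in> ?T i" using \<alpha>' by blast
    then have "\<alpha> \<in> blocks (B' i)" unfolding B'_def N .
    then show "\<exists>i\<in>{1..d}. \<alpha> \<in> blocks (B' i)" using i(1) by blast
  next
    fix i j \<alpha> \<beta> assume ij: "i \<in> {1..d}" "j \<in> {1..d}" and \<alpha>\<beta>: "\<alpha> \<in> blocks (B' i)" "\<beta> \<in> blocks (B' j)" and ne: "i \<noteq> j"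
    have "\<alpha> \<in> ?T i" "\<beta> \<in> ?T j" using \<alpha>\<beta> unfolding B'_def N .
    then have "mtrace (mat_inv (dens B \<alpha>)) = complex_of_real (\<delta> i)" "mtrace (mat_inv (dens B \<beta>)) = complex_of_real (\<delta> j)"
      by blast+
    moreover have "complex_of_real (\<delta> i) \<noteq> complex_of_real (\<delta> j)"
      using inj_onD[OF bij_betw_imp_inj_on[OF assms(4)], of i j] ij ne by blast
    ultimately show "mtrace (mat_inv (dens B \<alpha>)) \<noteq> mtrace (mat_inv (dens B \<beta>))" by simp
  qed
  then show "\<exists>\<Phi>. cqg_iso (free_wreath \<Gamma> B) (cqg_free_prod {1..d} (\<lambda>i. free_wreath \<Gamma> (B' i))) \<Phi>"
    by (rule fw_decomp.cqg_iso_decomp)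
qed

end
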